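(* Let $S_{\mu,\nu}(w)$ be the Lommel function. For $\alpha,\beta>0$ with $\alpha\beta=1$, and $s\in\mathbb{C}$ with $-1<\operatorname{Re}s<1$, \begin{align*} &\sqrt\alpha\int_0^{\infty}S_{s/2,s/2}(2\pi\alpha t)\left(\varphi(t,s)-\frac{\zeta(s)}{2\pi}t^{s/2-1}\right)dt\\ &=\sqrt\beta\int_0^{\infty}S_{s/2,s/2}(2\pi\beta t)\left(\varphi(t,s)-\frac{\zeta(s)}{2\pi}t^{s/2-1}\right)dt\\ &=\frac{2^{s/2-2}\pi^{-\frac52}}{\Gamma\left(\frac{1-s}{2}\right)}\int_0^{\infty}\Gamma\left(\frac{s-1+it}{4}\right)\Gamma\left(\frac{s-1-it}{4}\right)\Gamma\left(\frac{-s+1+it}{4}\right)\Gamma\left(\frac{-s+1-it}{4}\right)\\ &\qquad\times\Xi\left(\frac{t-is}{2}\right)\Xi\left(\frac{t+is}{2}\right)\frac{\cos\left(\frac12t\log\alpha\right)}{t^2+(s+1)^2}\,dt. \end{align*}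
   Context: $\sigma_s(n)=\sum_{d\mid n}d^s$; $\zeta$ is the Riemann zeta function; $\xi(s)=\frac12s(s-1)\pi^{-s/2}\Gamma(\frac12s)\zeta(s)$ and $\Xi(t)=\xi(\frac12+it)$. For $x>0$, $$\varphi(x,s):=2\sum_{n=1}^{\infty}\sigma_{-s}(n)n^{\frac12s}\left(e^{\pi is/4}K_s\left(4\pi e^{\pi i/4}\sqrt{nx}\right)+e^{-\pi is/4}K_s\left(4\pi e^{-\pi i/4}\sqrt{nx}\right)\right),$$ with $K_\nu$ the modified Bessel function of the second kind. The Lommel function is $$S_{\mu,\nu}(w)=s_{\mu,\nu}(w)+\frac{2^{\mu-1}\Gamma\left(\frac{\mu-\nu+1}{2}\right)\Gamma\left(\frac{\mu+\nu+1}{2}\right)}{\sin(\nu\pi)}\left\{\cos\left(\tfrac12(\mu-\nu)\pi\right)J_{-\nu}(w)-\cos\left(\tfrac12(\mu+\nu)\pi\right)J_\nu(w)\right\}$$ for $\nu\notin\mathbb{Z}$, and $$S_{\mu,\nu}(w)=s_{\mu,\nu}(w)+2^{\mu-1}\Gamma\left(\tfrac{\mu-\nu+1}{2}\right)\Gamma\left(\tfrac{\mu+\nu+1}{2}\right)\left\{\sin\left(\tfrac12(\mu-\nu)\pi\right)J_\nu(w)-\cos\left(\tfrac12(\mu-\nu)\pi\right)Y_\nu(w)\right\}$$ for $\nu\in\mathbb{Z}$, where $$s_{\mu,\nu}(w)=\frac{w^{\mu+1}}{(\mu-\nu+1)(\mu+\nu+1)}\,{}_1F_2\left(1;\tfrac{\mu-\nu+3}{2},\tfrac{\mu+\nu+3}{2};-\tfrac14w^2\right),$$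 ${}_1F_2(a;b,c;z)=\sum_{k\ge0}\frac{(a)_k}{(b)_k(c)_k}\frac{z^k}{k!}$, and $J_\nu,Y_\nu$ are the Bessel functions of the first and second kind. *)

theory Defs
  imports "HOL-Complex_Analysis.Complex_Analysis"
begin

text \<open>
  All complex powers are principal (\<open>powr\<close>). In the arguments used below the bases are
  positive reals or have argument \<open>\<plusminus>\<pi>/4\<close>, so the branch cut is never met.
\<close>

definition divisor_sigma :: "complex \<Rightarrow> nat \<Rightarrow> complex" where
  "divisor_sigma s n = (\<Sum>d | d dvd n. of_nat d powr s)"

text \<open>
  The analytic continuation of the Dirichlet series to the plane punctured at \<open>1\<close>. It exists by
  Riemann and is unique off \<open>1\<close> by the identity theorem; the value at the pole \<open>1\<close> is unspecified.
\<close>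

definition riemann_zeta :: "complex \<Rightarrow> complex" where
  "riemann_zeta = (SOME f. f holomorphic_on (- {1}) \<and>
     (\<forall>s. Re s > 1 \<longrightarrow> (\<lambda>n. of_nat (Suc n) powr (- s)) sums f s))"

text \<open>
  The displayed formula has removable singularities at \<open>0\<close>, \<open>1\<close> and the negative even integers,
  which are not filled in here. For \<open>\<bar>Re s\<bar> < 1\<close> and real \<open>t\<close>, the arguments
  \<open>1/2 + \<i> (t \<plusminus> \<i> s)/2\<close> have real part strictly between \<open>0\<close> and \<open>1\<close>.
\<close>

definition riemann_xi :: "complex \<Rightarrow> complex" where
  "riemann_xi s = 1 / 2 * s * (s - 1) * of_real pi powr (- s / 2) * Gamma (s / 2) * riemann_zeta s"

definition riemann_Xi :: "complex \<Rightarrow> complex" where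
  "riemann_Xi t = riemann_xi (1 / 2 + \<i> * t)"

text \<open>
  Here \<open>rGamma\<close> is the entire function \<open>1/\<Gamma>\<close>, so the two series below are the standard ones for
  every order, including negative integers.
\<close>

definition bessel_J :: "complex \<Rightarrow> complex \<Rightarrow> complex" where
  "bessel_J \<nu> z = (z / 2) powr \<nu> *
     (\<Sum>k. (- 1) ^ k * (z\<^sup>2 / 4) ^ k * rGamma (\<nu> + of_nat k + 1) / fact k)"

definition bessel_I :: "complex \<Rightarrow> complex \<Rightarrow> complex" where
  "bessel_I \<nu> z = (z / 2) powr \<nu> *
     (\<Sum>k. (z\<^sup>2 / 4) ^ k * rGamma (\<nu> + of_nat k + 1) / fact k)"

text \<open>For integer order, \<open>Y\<close> and \<open>K\<close> are the limits in the order of the generic formulas.\<close>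

definition bessel_Y_generic :: "complex \<Rightarrow> complex \<Rightarrow> complex" where
  "bessel_Y_generic \<nu> z =
     (bessel_J \<nu> z * cos (\<nu> * of_real pi) - bessel_J (- \<nu>) z) / sin (\<nu> * of_real pi)"

definition bessel_Y :: "complex \<Rightarrow> complex \<Rightarrow> complex" where
  "bessel_Y \<nu> z =
     (if \<nu> \<in> \<int> then Lim (at \<nu>) (\<lambda>\<mu>. bessel_Y_generic \<mu> z) else bessel_Y_generic \<nu> z)"

definition bessel_K_generic :: "complex \<Rightarrow> complex \<Rightarrow> complex" where
  "bessel_K_generic \<nu> z =
     of_real pi / 2 * (bessel_I (- \<nu>) z - bessel_I \<nu> z) / sin (\<nu> * of_real pi)"

definition bessel_K :: "complex \<Rightarrow> complex \<Rightarrow> complex" where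
  "bessel_K \<nu> z =
     (if \<nu> \<in> \<int> then Lim (at \<nu>) (\<lambda>\<mu>. bessel_K_generic \<mu> z) else bessel_K_generic \<nu> z)"

definition hyp_1F2 :: "complex \<Rightarrow> complex \<Rightarrow> complex \<Rightarrow> complex \<Rightarrow> complex" where
  "hyp_1F2 a b c z =
     (\<Sum>k. pochhammer a k / (pochhammer b k * pochhammer c k) * (z ^ k / fact k))"

definition lommel_s :: "complex \<Rightarrow> complex \<Rightarrow> complex \<Rightarrow> complex" where
  "lommel_s \<mu> \<nu> w =
     w powr (\<mu> + 1) / ((\<mu> - \<nu> + 1) * (\<mu> + \<nu> + 1)) *
     hyp_1F2 1 ((\<mu> - \<nu> + 3) / 2) ((\<mu> + \<nu> + 3) / 2) (- (w\<^sup>2 / 4))"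

definition lommel_S :: "complex \<Rightarrow> complex \<Rightarrow> complex \<Rightarrow> complex" where
  "lommel_S \<mu> \<nu> w =
     (if \<nu> \<in> \<int> then
        lommel_s \<mu> \<nu> w +
        2 powr (\<mu> - 1) * Gamma ((\<mu> - \<nu> + 1) / 2) * Gamma ((\<mu> + \<nu> + 1) / 2) *
        (sin ((\<mu> - \<nu>) * of_real pi / 2) * bessel_J \<nu> w
         - cos ((\<mu> - \<nu>) * of_real pi / 2) * bessel_Y \<nu> w)
      else
        lommel_s \<mu> \<nu> w +
        2 powr (\<mu> - 1) * Gamma ((\<mu> - \<nu> + 1) / 2) * Gamma ((\<mu> + \<nu> + 1) / 2) / sin (\<nu> * of_real pi) *
        (cos ((\<mu> - \<nu>) * of_real pi / 2) * bessel_J (- \<nu>) w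
         - cos ((\<mu> + \<nu>) * of_real pi / 2) * bessel_J \<nu> w))"

definition phi_term :: "real \<Rightarrow> complex \<Rightarrow> nat \<Rightarrow> complex" where
  "phi_term x s n =
     divisor_sigma (- s) n * of_nat n powr (s / 2) *
     (exp (of_real pi * \<i> * s / 4)
        * bessel_K s (4 * of_real pi * exp (of_real pi * \<i> / 4) * of_real (sqrt (real n * x)))
      + exp (- (of_real pi * \<i> * s / 4))
        * bessel_K s (4 * of_real pi * exp (- (of_real pi * \<i> / 4)) * of_real (sqrt (real n * x))))"

definition phi :: "real \<Rightarrow> complex \<Rightarrow> complex" where
  "phi x s = 2 * (\<Sum>n. phi_term x s (Suc n))"

definition lommel_integrand :: "complex \<Rightarrow> real \<Rightarrow> real \<Rightarrow> complex" where
  "lommel_integrand s \<alpha> t =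
     lommel_S (s / 2) (s / 2) (of_real (2 * pi * \<alpha> * t)) *
     (phi t s - riemann_zeta s / (2 * of_real pi) * of_real t powr (s / 2 - 1))"

definition Xi_integrand :: "complex \<Rightarrow> real \<Rightarrow> real \<Rightarrow> complex" where
  "Xi_integrand s \<alpha> t =
     Gamma ((s - 1 + \<i> * of_real t) / 4) * Gamma ((s - 1 - \<i> * of_real t) / 4) *
     Gamma ((- s + 1 + \<i> * of_real t) / 4) * Gamma ((- s + 1 - \<i> * of_real t) / 4) *
     riemann_Xi ((of_real t - \<i> * s) / 2) * riemann_Xi ((of_real t + \<i> * s) / 2) *
     (of_real (cos (1 / 2 * t * ln \<alpha>)) / ((of_real t)\<^sup>2 + (s + 1)\<^sup>2))"

end

theory Submission imports Defs begin

text \<open>Both factors of the integrand on \<open>(0, \<infinity>)\<close> have explicit Mellin representations. Inserting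
  the Mellin-Barnes integral of \<open>K\<^sub>s\<close> into the series \<open>\<phi>(t, s)\<close> and summing gives, on \<open>Re w = 2\<close>, a
  Mellin-Barnes integral with integrand \<open>(2\<pi>) powr (- w - s/2) \<Gamma>(w + s/2) \<zeta>(w + s/2) \<zeta>(1 - w + s/2) t powr (- w)\<close>.
  Moving the line to \<open>Re w = 1/2\<close> crosses only the pole at \<open>w = 1 - s/2\<close>, whose residue is the subtracted term.
  The Mellin-Barnes integral of \<open>S_{\<nu>,\<nu>}\<close> turns into a Laplace type integral, from which its Mellin transform on
  \<open>Re w = 1/2\<close> is read off. By Fubini the integral over \<open>t\<close> becomes the integral of the product of the two
  transforms over the critical line; reflection, duplication and the functional equation of \<open>\<zeta>\<close> identify that
  product with the \<open>\<Xi>\<close>-product times \<open>\<alpha> powr (i\<tau> - 1/2)\<close>. The \<open>\<Xi>\<close>-product is even in \<open>\<tau>\<close>, so only the cosine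
  survives, which is invariant under \<open>\<alpha> \<mapsto> 1/\<alpha>\<close>.\<close>

subsection \<open>Vertical line integrals and bounds for the Gamma function\<close>

text \<open>Everything rests on exponential decay along vertical lines. \<open>Gamma\<close> is
  bounded with any rate below pi/2: with the full rate on \<open>Re z = 1/2\<close> by reflection,
  elsewhere by recurrence and monotonicity. A product of two factors therefore beats the growth with
  rate pi/2 that the arguments of \<open>K\<close> on the rays of angle pi/4 and -pi/4 cause; the
  rates 3*pi/8, 3*pi/4, pi/4 and pi/8 are shares of that margin. The Laplace integral avoids Mellin
  inversion: the transform of the Lommel function can be computed by Fubini with absolute
  convergence. For \<open>|Re s| < 1\<close> the only integer order that occurs is 0. There
  \<open>K\<close> and \<open>Y\<close> are defined as limits whose existence has to be shown;
  dominated convergence in the Mellin-Barnes integrals supplies it. The functional equation comes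
  from the kernels \<open>exp (- (2 * pi * u * x))\<close> and \<open>1 / (x^2 + u^2)\<close>. For
  both, the defect between integral and sum over u is the same function up to a factor pi / x, so
  one Mellin transform yields zeta at z and at 1 - z.\<close>

lemma borel_measurable_of_real_powr [measurable]:
  fixes f :: "'a \<Rightarrow> real" and g :: "'a \<Rightarrow> complex"
  assumes [measurable]: "f \<in> borel_measurable M" "g \<in> borel_measurable M"
  shows "(\<lambda>x. of_real (f x) powr g x) \<in> borel_measurable M"
proof -
  \<comment> \<open>The principal logarithm written out on the real axis, with imaginary part pi on
    the negative half, reduces measurability to that of \<open>exp\<close> and
    \<open>ln\<close>.\<close>
  have *: "of_real a powr z =
      (if a = 0 then 0 else exp (z * (of_real (ln \<bar>a\<bar>) + \<i> * of_real (if a < 0 then pi else 0))))"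
    for a z
    using Ln_of_real[of "- a"] Ln_minus[of "of_real (- a)"]
    by (auto simp: powr_def Ln_of_real mult.commute)
  show ?thesis
    unfolding * by measurable
qed

lemma integrable_exp_abs:
  fixes d :: real
  assumes "d > 0"
  shows "integrable lborel (\<lambda>t. exp (- d * \<bar>t\<bar>))"
proof -
  have m: "(\<lambda>t. indicator {0<..} t *\<^sub>R (complex_of_real t powr (1 - 1) / of_real (exp (d * t)))) \<in> borel_measurable lborel"
    by measurable
  have "(\<lambda>t. complex_of_real t powr (1 - 1) / of_real (exp (d * t))) absolutely_integrable_on {0<..}"
    by (rule absolutely_integrable_Gamma_integral) (use assms in auto)
  hence "set_integrable lborel {0<..} (\<lambda>t. complex_of_real t powr (1 - 1) / of_real (exp (d * t)))"
    unfolding set_integrable_def using integrable_completion[OF m] by blast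
  hence i: "integrable lborel (\<lambda>t. norm (indicator {0<..} t *\<^sub>R (complex_of_real t powr (1 - 1) / of_real (exp (d * t)))))"
    unfolding set_integrable_def by (rule integrable_norm)
  from lborel_integrable_real_affine[OF i, of "-1" 0]
  have i2: "integrable lborel (\<lambda>t. norm (indicator {0<..} (-t) *\<^sub>R (complex_of_real (-t) powr (1 - 1) / of_real (exp (d * (-t))))))"
    by simp
  \<comment> \<open>Both half-line integrands vanish at 0, where the target has the value 1; the
    indicator of the singleton closes this gap.\<close>
  have "integrable lborel (\<lambda>t::real. indicator {0} t :: real)"
    by (intro integrable_real_indicator) auto
  from Bochner_Integration.integrable_add[OF Bochner_Integration.integrable_add[OF i i2] this]
  show ?thesis
    by (rule Bochner_Integration.integrable_bound)
       (auto simp: indicator_def norm_divide norm_mult divide_simps exp_minus)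
qed

lemma integrable_of_exp_bound:
  fixes f :: "real \<Rightarrow> complex"
  assumes f: "continuous_on UNIV f" and d: "d > 0"
    and bound: "\<And>t. \<bar>t\<bar> \<ge> Y \<Longrightarrow> norm (f t) \<le> C * exp (- d * \<bar>t\<bar>)"
  shows "integrable lborel f"
proof -
  have "bounded (f ` {- \<bar>Y\<bar>..\<bar>Y\<bar>})"
    by (intro compact_imp_bounded compact_continuous_image continuous_on_subset[OF f]) auto
  then obtain B where B: "\<And>t. t \<in> {- \<bar>Y\<bar>..\<bar>Y\<bar>} \<Longrightarrow> norm (f t) \<le> B"
    unfolding bounded_iff by blast
  have B0: "B \<ge> 0" using B[of 0] norm_ge_zero[of "f 0"] by (simp del: norm_ge_zero)
  have C0: "C \<ge> 0" using bound[of "\<bar>Y\<bar>"] norm_ge_zero[of "f \<bar>Y\<bar>"]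
    by (smt (verit) exp_gt_zero zero_le_mult_iff)
  \<comment> \<open>The factor \<open>exp (d * \<bar>Y\<bar>)\<close> makes the bounded middle part
    fit under the same exponential.\<close>
  define K where "K = max C (B * exp (d * \<bar>Y\<bar>))"
  have "norm (f t) \<le> K * exp (- d * \<bar>t\<bar>)" for t
  proof (cases "\<bar>t\<bar> \<ge> \<bar>Y\<bar>")
    case True
    hence "norm (f t) \<le> C * exp (- d * \<bar>t\<bar>)" by (intro bound) auto
    also have "\<dots> \<le> K * exp (- d * \<bar>t\<bar>)" unfolding K_def by (intro mult_right_mono) auto
    finally show ?thesis .
  next
    case False
    hence "norm (f t) \<le> B" by (intro B) auto
    also have "B \<le> B * exp (d * \<bar>Y\<bar> - d * \<bar>t\<bar>)"
      using False B0 d by (simp add: mult_le_cancel_left1 not_less)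
    also have "\<dots> = B * exp (d * \<bar>Y\<bar>) * exp (- d * \<bar>t\<bar>)" by (simp flip: exp_add)
    also have "\<dots> \<le> K * exp (- d * \<bar>t\<bar>)" unfolding K_def by (intro mult_right_mono) auto
    finally show ?thesis .
  qed
  moreover have "K \<ge> 0" unfolding K_def using C0 by simp
  ultimately show ?thesis
    by (intro Bochner_Integration.integrable_bound[OF integrable_mult_right[OF integrable_exp_abs[OF d], of K]])
       (use f in \<open>auto intro!: borel_measurable_continuous_onI\<close>)
qed

text \<open>Fubini and Tonelli for set integrals. The iterated integral of the norm in one order is
  the only analytic input, and the integrability of both iterated integrals comes with the exchange.
  Every interchange of two integrals below goes through it, and several integrability facts are read
  off from it instead of being estimated.\<close>

lemma set_integrals_swap:
  fixes f :: "real \<Rightarrow> real \<Rightarrow> complex"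
  assumes [measurable]: "case_prod f \<in> borel_measurable (lborel \<Otimes>\<^sub>M lborel)"
    and [measurable]: "A \<in> sets borel" "B \<in> sets borel"
    and i1: "\<And>x. x \<in> A \<Longrightarrow> set_integrable lborel B (f x)"
    and i2: "set_integrable lborel A (\<lambda>x. LINT y:B|lborel. norm (f x y))"
  shows "set_integrable lborel A (\<lambda>x. LINT y:B|lborel. f x y)"
    and "set_integrable lborel B (\<lambda>y. LINT x:A|lborel. f x y)"
    and "(LINT x:A|lborel. LINT y:B|lborel. f x y) = (LINT y:B|lborel. LINT x:A|lborel. f x y)"
proof -
  define g where "g = (\<lambda>x y. indicator A x *\<^sub>R indicator B y *\<^sub>R f x y)"
  have gm: "case_prod g \<in> borel_measurable (lborel \<Otimes>\<^sub>M lborel)"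
  proof -
    have [measurable]: "(\<lambda>p. f (fst p) (snd p)) \<in> borel_measurable (lborel \<Otimes>\<^sub>M lborel)"
      using assms(1) by (simp add: case_prod_beta')
    show ?thesis unfolding g_def case_prod_beta' by measurable
  qed
  have G: "integrable (lborel \<Otimes>\<^sub>M lborel) (case_prod g)"
  proof (rule lborel_pair.Fubini_integrable[OF gm])
    have "(\<lambda>x. \<integral>y. norm (case_prod g (x, y)) \<partial>lborel) =
        (\<lambda>x. indicator A x *\<^sub>R (LINT y:B|lborel. norm (f x y)))"
      by (auto simp: g_def set_lebesgue_integral_def fun_eq_iff indicator_def)
    thus "integrable lborel (\<lambda>x. \<integral>y. norm (case_prod g (x, y)) \<partial>lborel)"
      using i2 by (simp add: set_integrable_def)
    show "AE x in lborel. integrable lborel (\<lambda>y. case_prod g (x, y))"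
      using i1 by (auto simp: g_def set_integrable_def indicator_def)
  qed
  have e1: "(\<integral>y. g x y \<partial>lborel) = indicator A x *\<^sub>R (LINT y:B|lborel. f x y)" for x
    by (auto simp: g_def set_lebesgue_integral_def indicator_def)
  have e2: "(\<integral>x. g x y \<partial>lborel) = indicator B y *\<^sub>R (LINT x:A|lborel. f x y)" for y
    unfolding g_def set_lebesgue_integral_def
    by (auto simp: indicator_def scaleR_left_commute)
  show "set_integrable lborel A (\<lambda>x. LINT y:B|lborel. f x y)"
    using lborel_pair.integrable_fst[OF G] unfolding e1 set_integrable_def .
  show "set_integrable lborel B (\<lambda>y. LINT x:A|lborel. f x y)"
    using lborel_pair.integrable_snd[OF G] unfolding e2 set_integrable_def .
  show "(LINT x:A|lborel. LINT y:B|lborel. f x y) = (LINT y:B|lborel. LINT x:A|lborel. f x y)"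
    using lborel_pair.integral_fst[OF G] lborel_pair.integral_snd[OF G]
    unfolding e1 e2 set_lebesgue_integral_def[symmetric] by simp
qed

lemma integral_UNIV_as_set_integral:
  "(LINT x:UNIV|M. f x) = (\<integral>x. f x \<partial>M)" "set_integrable M UNIV f \<longleftrightarrow> integrable M f"
  by (simp_all add: set_lebesgue_integral_def set_integrable_def)

section \<open>Exponential bounds for the Gamma function in the right half-plane\<close>

lemma nonpos_Ints_Re: "Re z > 0 \<Longrightarrow> z \<notin> \<int>\<^sub>\<le>\<^sub>0"
  by (auto elim!: nonpos_Ints_cases)

text \<open>For fixed \<open>\<tau>\<close>, the Euler product of \<open>\<bar>\<Gamma>(\<sigma> + i\<tau>)\<bar> / \<Gamma>(\<sigma>)\<close> has factors increasing in \<open>\<sigma>\<close>.\<close>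

lemma norm_Gamma_ratio_mono:
  fixes \<sigma> \<rho> \<tau> :: real
  assumes "0 < \<sigma>" "\<sigma> \<le> \<rho>"
  shows "norm (Gamma (Complex \<sigma> \<tau>)) / Gamma \<sigma> \<le> norm (Gamma (Complex \<rho> \<tau>)) / Gamma \<rho>"
proof (rule LIMSEQ_le)
  have *: "(\<lambda>n. norm (Gamma_series (Complex r \<tau>) n) / Gamma_series r n)
      \<longlonglongrightarrow> norm (Gamma (Complex r \<tau>)) / Gamma r" if "r > 0" for r
    using Gamma_real_pos[OF that] by (intro tendsto_intros) auto
  show "(\<lambda>n. norm (Gamma_series (Complex \<sigma> \<tau>) n) / Gamma_series \<sigma> n)
      \<longlonglongrightarrow> norm (Gamma (Complex \<sigma> \<tau>)) / Gamma \<sigma>"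
    "(\<lambda>n. norm (Gamma_series (Complex \<rho> \<tau>) n) / Gamma_series \<rho> n)
      \<longlonglongrightarrow> norm (Gamma (Complex \<rho> \<tau>)) / Gamma \<rho>"
    using assms by (auto intro!: *)
  have eq: "norm (Gamma_series (Complex r \<tau>) n) / Gamma_series r n =
     (\<Prod>k\<le>n. (r + k) / norm (Complex r \<tau> + of_nat k))" if "r > 0" "n > 0" for r n
  proof -
    have p: "pochhammer z (n + 1) = (\<Prod>k\<le>n. z + of_nat k)" for z :: "'a::comm_semiring_1"
      by (simp add: pochhammer_prod atLeast0LessThan lessThan_Suc_atMost)
    have "norm (exp (Complex r \<tau> * of_real (ln (real n)))) = exp (r * ln (real n))"
      by simp
    moreover have "of_real (ln (of_nat n)) = complex_of_real (ln (real n))" by simp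
    ultimately show ?thesis
      using that unfolding Gamma_series_def p
      by (simp add: norm_divide norm_mult prod_norm prod_dividef)
  qed
  have "(\<sigma> + k) / norm (Complex \<sigma> \<tau> + of_nat k) \<le> (\<rho> + k) / norm (Complex \<rho> \<tau> + of_nat k)" for k :: nat
  proof -
    have n: "norm (Complex r \<tau> + of_nat k) = sqrt ((r + k)^2 + \<tau>^2)" for r :: real
      by (simp add: cmod_def)
    have pos: "(r + k)^2 + \<tau>^2 > 0" if "r > 0" for r :: real
      using that by (simp add: add_pos_nonneg)
    have "((\<sigma> + k) * sqrt ((\<rho> + k)^2 + \<tau>^2))\<^sup>2 \<le> ((\<rho> + k) * sqrt ((\<sigma> + k)^2 + \<tau>^2))\<^sup>2"
    proof -
      have "(\<sigma> + k)\<^sup>2 \<le> (\<rho> + k)\<^sup>2" using assms by (intro power_mono) auto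
      hence "(\<sigma> + k)\<^sup>2 * \<tau>\<^sup>2 \<le> (\<rho> + k)\<^sup>2 * \<tau>\<^sup>2" by (rule mult_right_mono) simp
      thus ?thesis unfolding power_mult_distrib by (simp add: algebra_simps)
    qed
    hence "(\<sigma> + k) * sqrt ((\<rho> + k)^2 + \<tau>^2) \<le> (\<rho> + k) * sqrt ((\<sigma> + k)^2 + \<tau>^2)"
      by (rule power2_le_imp_le) (use assms in auto)
    thus ?thesis unfolding n using pos[of \<sigma>] pos[of \<rho>] assms
      by (simp add: divide_simps mult.commute)
  qed
  hence "norm (Gamma_series (Complex \<sigma> \<tau>) n) / Gamma_series \<sigma> n \<le>
      norm (Gamma_series (Complex \<rho> \<tau>) n) / Gamma_series \<rho> n" if "n > 0" for n
    using that assms unfolding eq[OF assms(1) that] eq[OF less_le_trans[OF assms] that]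
    by (intro prod_mono) auto
  thus "\<exists>N. \<forall>n\<ge>N. norm (Gamma_series (Complex \<sigma> \<tau>) n) / Gamma_series \<sigma> n \<le>
      norm (Gamma_series (Complex \<rho> \<tau>) n) / Gamma_series \<rho> n"
    by (intro exI[of _ 1]) auto
qed

lemma norm_Gamma_half_bound: "norm (Gamma (Complex (1/2) t)) \<le> sqrt (2 * pi) * exp (- pi / 2 * \<bar>t\<bar>)"
proof -
  let ?z = "Complex (1/2) t"
  have "1 - ?z = cnj ?z" by (simp add: complex_eq_iff)
  hence "Gamma ?z * cnj (Gamma ?z) = of_real pi / sin (of_real pi * ?z)"
    using Gamma_reflection_complex[of ?z] cnj_Gamma[of ?z] by simp
  moreover have "sin (of_real pi * ?z) = of_real (cosh (pi * t))"
  proof -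
    have "of_real pi * ?z = of_real (pi/2) + \<i> * of_real (pi * t)" by (simp add: complex_eq_iff)
    hence s: "sin (of_real pi * ?z) = cos (\<i> * of_real (pi * t))"
      by (simp add: sin_add sin_of_real cos_of_real)
    have "exp (of_real pi * of_real t) = complex_of_real (exp (pi * t))"
      by (simp only: exp_of_real of_real_mult[symmetric])
    hence "cos (\<i> * of_real (pi * t)) = of_real (cosh (pi * t))"
      by (simp add: cos_i_times cosh_def scaleR_conv_of_real exp_minus field_simps)
    thus ?thesis by (simp only: s)
  qed
  ultimately have "complex_of_real ((norm (Gamma ?z))\<^sup>2) = of_real (pi / cosh (pi * t))"
    by (simp only: complex_norm_square of_real_divide)
  hence "(norm (Gamma ?z))\<^sup>2 = pi / cosh (pi * t)" using of_real_eq_iff by blast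
  also have "\<dots> \<le> 2 * pi * exp (- pi * \<bar>t\<bar>)"
  proof -
    have "exp (pi * \<bar>t\<bar>) \<le> 2 * cosh (pi * t)"
      by (cases "t \<ge> 0") (auto simp: cosh_def)
    moreover have "cosh (pi * t) > 0" by (rule cosh_real_pos)
    ultimately show ?thesis by (simp add: divide_simps exp_minus)
  qed
  also have "\<dots> = (sqrt (2 * pi) * exp (- pi / 2 * \<bar>t\<bar>))\<^sup>2"
    by (simp add: power_mult_distrib flip: exp_double)
  finally show ?thesis by (rule power2_le_imp_le) auto
qed

lemma power_div_fact_le_exp:
  fixes x :: real
  assumes "x \<ge> 0"
  shows "x ^ n / fact n \<le> exp x"
proof -
  have "x ^ n / fact n = (\<Sum>k\<in>{n}. x ^ k / fact k)" by simp
  also have "\<dots> \<le> (\<Sum>k. x ^ k / fact k)"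
    using exp_converges[of x] assms
    by (intro sum_le_suminf) (auto simp: sums_iff divide_inverse mult.commute)
  also have "\<dots> = exp x"
    using exp_converges[of x] by (auto simp: sums_iff divide_inverse mult.commute)
  finally show ?thesis .
qed

lemma norm_Gamma_exp_bound:
  fixes a b \<delta> :: real
  assumes "0 < a" "\<delta> < pi / 2"
  obtains C where "C > 0" "\<And>z. a \<le> Re z \<Longrightarrow> Re z \<le> b \<Longrightarrow> norm (Gamma z) \<le> C * exp (- \<delta> * \<bar>Im z\<bar>)"
proof -
  obtain N :: nat where N: "b \<le> real N + 1/2" using real_arch_simple[of "b - 1/2"] by (auto simp: algebra_simps)
  define \<rho> where "\<rho> = real N + 1/2"
  \<comment> \<open>The rate given away; it pays for the power of order N through one term of the
    exponential series.\<close>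
  define \<eta> where "\<eta> = pi / 2 - \<delta>"
  have \<eta>: "\<eta> > 0" using assms by (simp add: \<eta>_def)
  define D where "D = sqrt (2 * pi) * (fact N * exp (\<eta> * \<rho>) / \<eta> ^ N)"
  have D0: "D > 0" unfolding D_def using \<eta> by simp
  have G\<rho>: "norm (Gamma (Complex \<rho> t)) \<le> D * exp (- \<delta> * \<bar>t\<bar>)" for t
  proof -
    have "Gamma (Complex (1/2) t + of_nat n) = pochhammer (Complex (1/2) t) n * Gamma (Complex (1/2) t)" for n
    proof (induction n)
      case (Suc n)
      have "Gamma (Complex (1/2) t + of_nat n + 1) = (Complex (1/2) t + of_nat n) * Gamma (Complex (1/2) t + of_nat n)"
        by (intro Gamma_plus1 nonpos_Ints_Re) auto
      with Suc.IH show ?case by (simp add: pochhammer_rec' algebra_simps)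
    qed simp
    moreover have "Complex \<rho> t = Complex (1/2) t + of_nat N" by (simp add: \<rho>_def complex_eq_iff)
    ultimately have "norm (Gamma (Complex \<rho> t)) = norm (pochhammer (Complex (1/2) t) N) * norm (Gamma (Complex (1/2) t))"
      by (simp only: norm_mult)
    also have "\<dots> \<le> (\<rho> + \<bar>t\<bar>) ^ N * (sqrt (2 * pi) * exp (- pi / 2 * \<bar>t\<bar>))"
    proof (intro mult_mono norm_Gamma_half_bound)
      have "norm (pochhammer (Complex (1/2) t) N) = (\<Prod>i<N. norm (Complex (1/2) t + of_nat i))"
        by (simp add: pochhammer_prod prod_norm atLeast0LessThan)
      also have "\<dots> \<le> (\<Prod>i<N. \<rho> + \<bar>t\<bar>)"
      proof (intro prod_mono conjI)
        fix i assume "i \<in> {..<N}"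
        have "norm (Complex (1/2) t + of_nat i) \<le> \<bar>1/2 + real i\<bar> + \<bar>t\<bar>"
          using cmod_le[of "Complex (1/2) t + of_nat i"] by simp
        also have "\<dots> \<le> \<rho> + \<bar>t\<bar>" using \<open>i \<in> {..<N}\<close> by (simp add: \<rho>_def)
        finally show "norm (Complex (1/2) t + of_nat i) \<le> \<rho> + \<bar>t\<bar>" .
      qed auto
      also have "\<dots> = (\<rho> + \<bar>t\<bar>) ^ N" by simp
      finally show "norm (pochhammer (Complex (1/2) t) N) \<le> (\<rho> + \<bar>t\<bar>) ^ N" .
    qed (auto simp: \<rho>_def)
    also have "\<dots> \<le> (fact N * exp (\<eta> * (\<rho> + \<bar>t\<bar>)) / \<eta> ^ N) * (sqrt (2 * pi) * exp (- pi / 2 * \<bar>t\<bar>))"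
    proof (intro mult_right_mono)
      have "(\<eta> * (\<rho> + \<bar>t\<bar>)) ^ N / fact N \<le> exp (\<eta> * (\<rho> + \<bar>t\<bar>))"
        using \<eta> by (intro power_div_fact_le_exp) (auto simp: \<rho>_def)
      thus "(\<rho> + \<bar>t\<bar>) ^ N \<le> fact N * exp (\<eta> * (\<rho> + \<bar>t\<bar>)) / \<eta> ^ N"
        using \<eta> by (simp only: power_mult_distrib) (simp add: field_simps)
    qed auto
    also have "\<dots> = D * (exp (\<eta> * \<bar>t\<bar>) * exp (- pi / 2 * \<bar>t\<bar>))"
      by (simp add: D_def algebra_simps exp_add)
    also have "exp (\<eta> * \<bar>t\<bar>) * exp (- pi / 2 * \<bar>t\<bar>) = exp (- \<delta> * \<bar>t\<bar>)"
      unfolding exp_add[symmetric] by (simp add: \<eta>_def algebra_simps)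
    finally show ?thesis .
  qed
  have "continuous_on {a..b} (Gamma :: real \<Rightarrow> real)"
    using assms by (intro continuous_intros) (auto elim!: nonpos_Ints_cases)
  hence "bounded (Gamma ` {a..b} :: real set)"
    by (intro compact_imp_bounded compact_continuous_image) auto
  then obtain B where "\<forall>x\<in>{a..b}. norm (Gamma x) \<le> B"
    unfolding bounded_iff by auto
  hence B: "\<And>x. x \<in> {a..b} \<Longrightarrow> norm (Gamma x) \<le> B" by blast
  have G0: "Gamma \<rho> > 0" by (intro Gamma_real_pos) (simp add: \<rho>_def)
  show ?thesis
  proof (rule that[of "(\<bar>B\<bar> + 1) / Gamma \<rho> * D"])
    fix z :: complex assume z: "a \<le> Re z" "Re z \<le> b"
    have g0: "Gamma (Re z) > 0" using z assms by (intro Gamma_real_pos) auto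
    have "norm (Gamma z) / Gamma (Re z) \<le> norm (Gamma (Complex \<rho> (Im z))) / Gamma \<rho>"
      using norm_Gamma_ratio_mono[of "Re z" \<rho> "Im z"] z assms N by (simp add: \<rho>_def)
    hence "norm (Gamma z) \<le> Gamma (Re z) * (norm (Gamma (Complex \<rho> (Im z))) / Gamma \<rho>)"
      using g0 by (simp only: pos_divide_le_eq mult.commute)
    also have "\<dots> \<le> (\<bar>B\<bar> + 1) * (D * exp (- \<delta> * \<bar>Im z\<bar>) / Gamma \<rho>)"
      using B[of "Re z"] z g0 G0 D0 G\<rho>[of "Im z"]
      by (intro mult_mono divide_right_mono) auto
    finally show "norm (Gamma z) \<le> (\<bar>B\<bar> + 1) / Gamma \<rho> * D * exp (- \<delta> * \<bar>Im z\<bar>)" by simp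
  qed (use G0 D0 in auto)
qed

section \<open>Shifting vertical lines of integration and summing residues\<close>

lemma vertical_integral_tendsto:
  fixes f :: "real \<Rightarrow> complex"
  assumes "integrable lborel f"
  shows "((\<lambda>T. integral {-T..T} f) \<longlongrightarrow> (\<integral>t. f t \<partial>lborel)) at_top"
proof -
  have [measurable]: "f \<in> borel_measurable borel" using assms by auto
  have "((\<lambda>T. \<integral>t. indicator {-T..T} t *\<^sub>R f t \<partial>lborel) \<longlongrightarrow> (\<integral>t. f t \<partial>lborel)) at_top"
  proof (rule integral_dominated_convergence_at_top[where w = "\<lambda>t. norm (f t)"])
    show "AE t in lborel. ((\<lambda>T. indicator {-T..T} t *\<^sub>R f t) \<longlongrightarrow> f t) at_top"
    proof (intro AE_I2 tendsto_eventually)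
      fix t
      show "eventually (\<lambda>T. indicator {-T..T} t *\<^sub>R f t = f t) at_top"
        using eventually_ge_at_top[of "\<bar>t\<bar>"] by eventually_elim (auto simp: indicator_def)
    qed
  qed (use assms in \<open>auto simp: indicator_def\<close>)
  moreover have "(\<integral>t. indicator {-T..T} t *\<^sub>R f t \<partial>lborel) = integral {-T..T} f" for T
  proof -
    have "set_integrable lborel {-T..T} f"
      unfolding set_integrable_def using assms by (intro integrable_mult_indicator) auto
    from set_borel_integral_eq_integral(2)[OF this] show ?thesis
      by (simp add: set_lebesgue_integral_def)
  qed
  ultimately show ?thesis by simp
qed

text \<open>Residue theorem on rectangles of height 2T whose horizontal sides vanish as T grows. The
  outer strip from a' to b' provides an open connected set around the closed rectangle, and decay is
  required only for |Im z| \<ge> Y because F may have poles below that height.\<close>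

lemma vertical_line_shift:
  fixes F :: "complex \<Rightarrow> complex"
  assumes ab: "a' < a" "a < b" "b < b'" and P: "finite P"
    and holo: "F holomorphic_on {z. a' < Re z \<and> Re z < b'} - P"
    and inside: "\<And>p. p \<in> P \<Longrightarrow> a < Re p \<and> Re p < b"
    and d: "d > 0"
    and bound: "\<And>z. a \<le> Re z \<Longrightarrow> Re z \<le> b \<Longrightarrow> \<bar>Im z\<bar> \<ge> Y \<Longrightarrow> norm (F z) \<le> C * exp (- d * \<bar>Im z\<bar>)"
  shows "integrable lborel (\<lambda>t. F (Complex a t))" (is ?th1)
    and "integrable lborel (\<lambda>t. F (Complex b t))" (is ?th2)
    and "(\<integral>t. F (Complex b t) \<partial>lborel) - (\<integral>t. F (Complex a t) \<partial>lborel) =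
      2 * of_real pi * (\<Sum>p\<in>P. residue F p)" (is ?th3)
proof -
  define S where "S = {z. a' < Re z \<and> Re z < b'}"
  have S: "open S" "convex S"
  proof -
    have "S = {z. a' < Re z} \<inter> {z. Re z < b'}" by (auto simp: S_def)
    thus "open S" "convex S"
      by (auto intro!: open_Int convex_Int open_halfspace_Re_gt open_halfspace_Re_lt
            convex_halfspace_Re_gt convex_halfspace_Re_lt)
  qed
  have cont: "continuous_on (S - P) F" using holo by (auto simp: S_def intro: holomorphic_on_imp_continuous_on)
  have line: "integrable lborel (\<lambda>t. F (Complex c t))" if "c = a \<or> c = b" for c
  proof (rule integrable_of_exp_bound[OF _ d])
    have "continuous_on UNIV (F \<circ> Complex c)"
    proof (rule continuous_on_compose)
      show "continuous_on UNIV (Complex c)" unfolding Complex_eq by (intro continuous_intros)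
      show "continuous_on (range (Complex c)) F"
        by (rule continuous_on_subset[OF cont]) (use that ab inside in \<open>force simp: S_def\<close>)
    qed
    thus "continuous_on UNIV (\<lambda>t. F (Complex c t))" by (simp add: o_def)
    show "norm (F (Complex c t)) \<le> C * exp (- d * \<bar>t\<bar>)" if "Y \<le> \<bar>t\<bar>" for t
      using bound[of "Complex c t"] that \<open>c = a \<or> c = b\<close> ab by auto
  qed
  show ?th1 ?th2 using line by auto
  obtain T0 where T0: "\<And>p. p \<in> P \<Longrightarrow> \<bar>Im p\<bar> \<le> T0"
  proof -
    have "bounded ((\<lambda>p. Im p) ` P)" using P by (intro finite_imp_bounded) auto
    thus ?thesis using that by (auto simp: bounded_iff)
  qed
  define H1 where "H1 = (\<lambda>T. contour_integral (linepath (Complex a (-T)) (Complex b (-T))) F)"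
  define H2 where "H2 = (\<lambda>T. contour_integral (linepath (Complex b T) (Complex a T)) F)"
  have rect: "H1 T + \<i> * integral {-T..T} (\<lambda>t. F (Complex b t)) + H2 T - \<i> * integral {-T..T} (\<lambda>t. F (Complex a t))
      = 2 * of_real pi * \<i> * (\<Sum>p\<in>P. residue F p)" if T: "T > max 0 T0" for T
  proof -
    let ?g = "rectpath (Complex a (-T)) (Complex b T)"
    have img: "path_image ?g \<subseteq> S - P"
    proof -
      have "path_image ?g \<subseteq> S"
        using path_image_rectpath_subset_cbox[of "Complex a (-T)" "Complex b T"] ab T
        by (force simp: S_def in_cbox_complex_iff)
      moreover have "path_image ?g \<inter> P = {}"
        using inside T0 T ab by (subst path_image_rectpath_cbox_minus_box) (force simp: in_box_complex_iff)+
      ultimately show ?thesis by auto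
    qed
    have "contour_integral ?g F = 2 * pi * \<i> * (\<Sum>p\<in>P. winding_number ?g p * residue F p)"
    proof (rule Residue_theorem[of S])
      show "\<forall>z. z \<notin> S \<longrightarrow> winding_number ?g z = 0"
        using ab T by (auto intro!: winding_number_rectpath_outside simp: S_def in_cbox_complex_iff)
    qed (use S P holo img in \<open>auto simp: S_def[symmetric] convex_connected\<close>)
    also have "(\<Sum>p\<in>P. winding_number ?g p * residue F p) = (\<Sum>p\<in>P. residue F p)"
    proof (intro sum.cong refl)
      fix p assume "p \<in> P"
      hence "winding_number ?g p = 1"
        using inside[of p] T0[of p] T by (intro winding_number_rectpath) (auto simp: in_box_complex_iff)
      thus "winding_number ?g p * residue F p = residue F p" by simp
    qed
    finally have 1: "contour_integral ?g F = 2 * of_real pi * \<i> * (\<Sum>p\<in>P. residue F p)" by simp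
    have ci: "F contour_integrable_on linepath u v" if "path_image (linepath u v) \<subseteq> path_image ?g" for u v
      using that img by (intro contour_integrable_continuous_linepath continuous_on_subset[OF cont]) auto
    have pi: "path_image ?g = path_image (linepath (Complex a (-T)) (Complex b (-T))) \<union>
        path_image (linepath (Complex b (-T)) (Complex b T)) \<union>
        path_image (linepath (Complex b T) (Complex a T)) \<union>
        path_image (linepath (Complex a T) (Complex a (-T)))"
      by (simp add: rectpath_def Let_def path_image_join Un_assoc)
    have i1: "F contour_integrable_on linepath (Complex a (-T)) (Complex b (-T))"
      and i2: "F contour_integrable_on linepath (Complex b (-T)) (Complex b T)"
      and i3: "F contour_integrable_on linepath (Complex b T) (Complex a T)"
      and i4: "F contour_integrable_on linepath (Complex a T) (Complex a (-T))"
      by (rule ci, unfold pi, blast)+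
    have "contour_integral ?g F = H1 T + (contour_integral (linepath (Complex b (-T)) (Complex b T)) F
       + (H2 T + contour_integral (linepath (Complex a T) (Complex a (-T))) F))"
      unfolding rectpath_def Let_def H1_def H2_def
      by (simp add: i1 i2 i3 i4 contour_integrable_join)
    also have "contour_integral (linepath (Complex b (-T)) (Complex b T)) F =
        \<i> * integral {-T..T} (\<lambda>t. F (Complex b t))"
      using T by (intro contour_integral_linepath_same_Re) auto
    also have "contour_integral (linepath (Complex a T) (Complex a (-T))) F =
       - contour_integral (linepath (Complex a (-T)) (Complex a T)) F"
      by (metis contour_integral_reversepath reversepath_linepath valid_path_linepath)
    also have "contour_integral (linepath (Complex a (-T)) (Complex a T)) F =
        \<i> * integral {-T..T} (\<lambda>t. F (Complex a t))"
      using T by (intro contour_integral_linepath_same_Re) auto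
    finally show ?thesis using 1 by (simp add: algebra_simps)
  qed
  \<comment> \<open>Stating the end points only through \<open>{Re (u T), Re (v T)} = {a, b}\<close>
    leaves orientation and height sign open, so that one argument serves the lower and the upper
    side.\<close>
  have hor: "(h \<longlongrightarrow> 0) at_top"
    if h: "\<And>T. h T = contour_integral (linepath (u T) (v T)) F"
      and uv: "\<And>T. \<bar>Im (u T)\<bar> = \<bar>T\<bar> \<and> Im (u T) = Im (v T) \<and> {Re (u T), Re (v T)} = {a, b}" for h u v
  proof (rule Lim_null_comparison)
    have C: "((\<lambda>T. \<bar>C\<bar> * exp (- d * T) * (b - a)) \<longlongrightarrow> \<bar>C\<bar> * 0 * (b - a)) at_top"
      using d by (intro tendsto_intros filterlim_compose[OF exp_at_bot]
        filterlim_tendsto_neg_mult_at_bot[OF tendsto_const] filterlim_ident) auto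
    thus "((\<lambda>T. \<bar>C\<bar> * exp (- d * T) * (b - a)) \<longlongrightarrow> 0) at_top" by simp
    show "\<forall>\<^sub>F T in at_top. norm (h T) \<le> \<bar>C\<bar> * exp (- d * T) * (b - a)"
      using eventually_gt_at_top[of "max 0 (max T0 Y)"]
    proof eventually_elim
      case (elim T)
      have seg: "a \<le> Re z \<and> Re z \<le> b \<and> \<bar>Im z\<bar> = T" if "z \<in> closed_segment (u T) (v T)" for z
      proof -
        from that uv[of T] have "z \<in> closed_segment (u T) (v T)" "Im (u T) = Im (v T)" by auto
        hence "Im z = Im (u T) \<and> Re z \<in> closed_segment (Re (u T)) (Re (v T))"
          by (simp add: closed_segment_same_Im)
        moreover have "closed_segment (Re (u T)) (Re (v T)) = {a..b}"
          using uv[of T] ab by (auto simp: closed_segment_eq_real_ivl doubleton_eq_iff)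
        ultimately show ?thesis using uv[of T] elim by auto
      qed
      have len: "norm (v T - u T) = b - a"
      proof -
        have "v T - u T = of_real (Re (v T) - Re (u T))" using uv[of T] by (simp add: complex_eq_iff)
        hence "norm (v T - u T) = \<bar>Re (v T) - Re (u T)\<bar>" by (simp only: norm_of_real real_norm_def)
        also have "\<dots> = b - a" using uv[of T] ab by (auto simp: doubleton_eq_iff)
        finally show ?thesis .
      qed
      have "F contour_integrable_on linepath (u T) (v T)"
      proof (intro contour_integrable_continuous_linepath continuous_on_subset[OF cont])
        show "closed_segment (u T) (v T) \<subseteq> S - P"
          using seg T0 elim ab by (fastforce simp: S_def)
      qed
      moreover have "norm (F z) \<le> \<bar>C\<bar> * exp (- d * T)" if "z \<in> closed_segment (u T) (v T)" for z
      proof -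
        have "norm (F z) \<le> C * exp (- d * T)" using seg[OF that] bound[of z] elim by auto
        also have "\<dots> \<le> \<bar>C\<bar> * exp (- d * T)" by (intro mult_right_mono) auto
        finally show ?thesis .
      qed
      ultimately have "norm (h T) \<le> \<bar>C\<bar> * exp (- d * T) * norm (v T - u T)"
        unfolding h by (intro contour_integral_bound_linepath) auto
      thus ?case by (simp add: len)
    qed
  qed
  have "((\<lambda>T. H1 T + \<i> * integral {-T..T} (\<lambda>t. F (Complex b t)) + H2 T - \<i> * integral {-T..T} (\<lambda>t. F (Complex a t)))
     \<longlongrightarrow> 0 + \<i> * (\<integral>t. F (Complex b t) \<partial>lborel) + 0 - \<i> * (\<integral>t. F (Complex a t) \<partial>lborel)) at_top"
    by (intro tendsto_intros vertical_integral_tendsto line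
          hor[of H1 "\<lambda>T. Complex a (-T)" "\<lambda>T. Complex b (-T)"]
          hor[of H2 "\<lambda>T. Complex b T" "\<lambda>T. Complex a T"]) (auto simp: H1_def H2_def)
  moreover have "((\<lambda>T. H1 T + \<i> * integral {-T..T} (\<lambda>t. F (Complex b t)) + H2 T - \<i> * integral {-T..T} (\<lambda>t. F (Complex a t)))
     \<longlongrightarrow> 2 * of_real pi * \<i> * (\<Sum>p\<in>P. residue F p)) at_top"
    using eventually_gt_at_top[of "max 0 T0"] by (intro tendsto_eventually) (auto elim!: eventually_mono simp: rect)
  ultimately have "0 + \<i> * (\<integral>t. F (Complex b t) \<partial>lborel) + 0 - \<i> * (\<integral>t. F (Complex a t) \<partial>lborel) =
     2 * of_real pi * \<i> * (\<Sum>p\<in>P. residue F p)"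
    by (rule tendsto_unique[rotated]) simp
  hence "\<i> * ((\<integral>t. F (Complex b t) \<partial>lborel) - (\<integral>t. F (Complex a t) \<partial>lborel)) =
     \<i> * (2 * of_real pi * (\<Sum>p\<in>P. residue F p))" by (simp add: algebra_simps)
  thus ?th3 by simp
qed

text \<open>The other singularities are finitely many, hence closed: removing them from S leaves an
  open set in which p is the only one, and the simple pole rule applies.\<close>

lemma residue_of_limit:
  assumes "open S" "p \<in> S" "F holomorphic_on S - P" "finite P" "((\<lambda>w. F w * (w - p)) \<longlongrightarrow> c) (at p)"
  shows "residue F p = c"
proof (rule residue_simple'[OF _ _ _ assms(5)])
  show "open (S - (P - {p}))" using assms by (intro open_Diff finite_imp_closed) auto
  show "p \<in> S - (P - {p})" using assms by auto
  show "F holomorphic_on S - (P - {p}) - {p}" by (rule holomorphic_on_subset[OF assms(3)]) auto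
qed

text \<open>In the applications the lines \<open>Re w = a n\<close> run off to the left between the
  poles. Inside each strip a constant depending on n is enough to shift the line; only on the left
  edge is an explicit bound required, since \<open>K n\<close> tending to 0 removes the remaining
  integral and leaves the residue series.\<close>

lemma line_integral_residue_series:
  fixes F :: "complex \<Rightarrow> complex" and P :: "nat \<Rightarrow> complex set"
  assumes "b < b'" "\<And>n. a' n < a n" "\<And>n. a n < b" "\<And>n. finite (P n)"
    and "\<And>n. F holomorphic_on {z. a' n < Re z \<and> Re z < b'} - P n"
    and "\<And>n p. p \<in> P n \<Longrightarrow> a n < Re p \<and> Re p < b"
    and d: "d > 0"
    and "\<And>n. \<exists>C. \<forall>z. a n \<le> Re z \<longrightarrow> Re z \<le> b \<longrightarrow> \<bar>Im z\<bar> \<ge> Y \<longrightarrow> norm (F z) \<le> C * exp (- d * \<bar>Im z\<bar>)"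
    and left: "\<And>n t. norm (F (Complex (a n) t)) \<le> K n * exp (- d * \<bar>t\<bar>)"
    and K: "K \<longlonglongrightarrow> 0"
  shows "integrable lborel (\<lambda>t. F (Complex b t)) \<and>
    (\<lambda>n. \<Sum>p\<in>P n. residue F p) \<longlonglongrightarrow> (\<integral>t. F (Complex b t) \<partial>lborel) / (2 * of_real pi)"
proof (intro conjI)
  have shift: "integrable lborel (\<lambda>t. F (Complex (a n) t)) \<and> integrable lborel (\<lambda>t. F (Complex b t)) \<and>
    (\<integral>t. F (Complex b t) \<partial>lborel) - (\<integral>t. F (Complex (a n) t) \<partial>lborel) =
      2 * of_real pi * (\<Sum>p\<in>P n. residue F p)" for n
  proof -
    obtain C where C: "\<And>z. a n \<le> Re z \<Longrightarrow> Re z \<le> b \<Longrightarrow> \<bar>Im z\<bar> \<ge> Y \<Longrightarrow> norm (F z) \<le> C * exp (- d * \<bar>Im z\<bar>)"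
      using assms(8) by metis
    show ?thesis
      using vertical_line_shift[OF assms(2,3,1,4,5,6) d C] by blast
  qed
  from shift show "integrable lborel (\<lambda>t. F (Complex b t))" by blast
  define E where "E = (\<integral>t. exp (- d * \<bar>t\<bar>) \<partial>lborel)"
  have "(\<lambda>n. \<integral>t. F (Complex (a n) t) \<partial>lborel) \<longlonglongrightarrow> 0"
  proof (rule Lim_null_comparison)
    show "(\<lambda>n. K n * E) \<longlonglongrightarrow> 0" using tendsto_mult_left_zero[OF K] .
    show "\<forall>\<^sub>F n in sequentially. norm (\<integral>t. F (Complex (a n) t) \<partial>lborel) \<le> K n * E"
    proof (intro always_eventually allI)
      fix n
      have "norm (\<integral>t. F (Complex (a n) t) \<partial>lborel) \<le> (\<integral>t. K n * exp (- d * \<bar>t\<bar>) \<partial>lborel)"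
        using integral_norm_bound shift[of n] left
        by (intro order_trans[OF integral_norm_bound] integral_mono integrable_norm integrable_mult_right integrable_exp_abs d) auto
      thus "norm (\<integral>t. F (Complex (a n) t) \<partial>lborel) \<le> K n * E" by (simp add: E_def)
    qed
  qed
  hence "(\<lambda>n. ((\<integral>t. F (Complex b t) \<partial>lborel) - (\<integral>t. F (Complex (a n) t) \<partial>lborel)) / (2 * of_real pi))
     \<longlonglongrightarrow> ((\<integral>t. F (Complex b t) \<partial>lborel) - 0) / (2 * of_real pi)"
    by (intro tendsto_intros) auto
  thus "(\<lambda>n. \<Sum>p\<in>P n. residue F p) \<longlonglongrightarrow> (\<integral>t. F (Complex b t) \<partial>lborel) / (2 * of_real pi)"
    using shift by simp
qed

section \<open>The Gamma function to the left of its first pole\<close>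

lemma Gamma_left_shift:
  fixes z :: complex
  assumes "z \<notin> \<int>\<^sub>\<le>\<^sub>0"
  shows "norm (Gamma z) = norm (Gamma (z + of_nat n)) / norm (pochhammer z n)"
proof -
  have "norm (pochhammer z n) = norm (Gamma (z + of_nat n)) / norm (Gamma z)"
    by (simp add: pochhammer_Gamma[OF assms] norm_divide)
  moreover have "Gamma (z + of_nat n) \<noteq> 0"
  proof -
    have "z = - of_nat (k + n)" if "z + of_nat n = - of_nat k" for k
      using that by (simp add: eq_diff_eq[symmetric])
    moreover have "- of_nat (k + n) \<in> (\<int>\<^sub>\<le>\<^sub>0 :: complex set)" for k by (rule minus_of_nat_in_nonpos_Ints)
    ultimately have "z + of_nat n \<notin> \<int>\<^sub>\<le>\<^sub>0" using assms by (metis nonpos_Ints_cases')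
    thus ?thesis by (simp add: Gamma_eq_zero_iff)
  qed
  moreover have "Gamma z \<noteq> 0" using assms by (simp add: Gamma_eq_zero_iff)
  ultimately show ?thesis by (auto simp: divide_simps mult.commute)
qed

lemma nonpos_Ints_Im: "Im z \<noteq> 0 \<Longrightarrow> z \<notin> \<int>\<^sub>\<le>\<^sub>0"
  by (auto elim!: nonpos_Ints_cases)

text \<open>At height at least 1 every factor of the Pochhammer symbol has modulus at least 1, so
  moving left costs nothing and the constant of the shifted strip carries over.\<close>

lemma norm_Gamma_exp_bound_strip:
  assumes "\<delta> < pi / 2"
  obtains C where "C > 0"
    "\<And>z. a \<le> Re z \<Longrightarrow> Re z \<le> b \<Longrightarrow> \<bar>Im z\<bar> \<ge> 1 \<Longrightarrow> norm (Gamma z) \<le> C * exp (- \<delta> * \<bar>Im z\<bar>)"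
proof -
  obtain n :: nat where n: "real n > - a" using reals_Archimedean2 by blast
  have "0 < a + n" using n by simp
  from norm_Gamma_exp_bound[OF this assms, of "b + n"] obtain C where C: "C > 0"
    "\<And>z. a + n \<le> Re z \<Longrightarrow> Re z \<le> b + n \<Longrightarrow> norm (Gamma z) \<le> C * exp (- \<delta> * \<bar>Im z\<bar>)" by blast
  show ?thesis
  proof (rule that[OF C(1)])
    fix z assume z: "a \<le> Re z" "Re z \<le> b" "\<bar>Im z\<bar> \<ge> 1"
    have "1 \<le> (\<Prod>i<n. norm (z + of_nat i))"
    proof (intro prod_ge_1)
      fix i
      have "\<bar>Im (z + of_nat i)\<bar> \<le> norm (z + of_nat i)" by (rule abs_Im_le_cmod)
      thus "1 \<le> norm (z + of_nat i)" using z by simp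
    qed
    hence p: "norm (pochhammer z n) \<ge> 1" by (simp add: pochhammer_prod prod_norm atLeast0LessThan)
    have "norm (Gamma z) = norm (Gamma (z + of_nat n)) / norm (pochhammer z n)"
      using z by (intro Gamma_left_shift nonpos_Ints_Im) auto
    also have "\<dots> \<le> norm (Gamma (z + of_nat n)) / 1"
      using p by (intro divide_left_mono) auto
    also have "\<dots> \<le> C * exp (- \<delta> * \<bar>Im (z + of_nat n)\<bar>)"
      using z C(2)[of "z + of_nat n"] by simp
    finally show "norm (Gamma z) \<le> C * exp (- \<delta> * \<bar>Im z\<bar>)" by simp
  qed
qed

text \<open>Each Pochhammer factor is bounded below by the modulus of its real part, which puts a
  factorial into the denominator. That factorial beats the geometric growth of the exponential
  factor when the line of integration moves to the left.\<close>

lemma norm_Gamma_left_line: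
  fixes z :: complex
  assumes x: "0 < x" "x < 1" and z: "Re z = x - real (Suc n)"
  shows "norm (Gamma z) \<le> norm (Gamma (z + of_nat (Suc n))) / ((1 - x) * fact n)"
proof -
  have nonpos: "z \<notin> \<int>\<^sub>\<le>\<^sub>0"
  proof
    assume "z \<in> \<int>\<^sub>\<le>\<^sub>0"
    then obtain k where "z = of_int k" by (auto elim!: nonpos_Ints_cases)
    hence "real_of_int (k + int (Suc n)) = x" using z by simp
    hence "0 < k + int (Suc n)" "k + int (Suc n) < 1" using x by linarith+
    thus False by linarith
  qed
  have "(1 - x) * fact n = (1 - x) * (\<Prod>i<n. real (Suc i))"
    by (simp add: fact_prod_Suc atLeast0LessThan)
  \<comment> \<open>The factor closest to 0 is kept as 1 - x; the others are larger than 1, 2, ...,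
    n.\<close>
  also have "\<dots> \<le> (1 - x) * (\<Prod>i<n. real (Suc (Suc i)) - x)"
    using x by (intro mult_left_mono prod_mono) auto
  also have "\<dots> = (\<Prod>i<Suc n. real (Suc i) - x)" by (subst prod.lessThan_Suc_shift) simp
  also have "\<dots> = (\<Prod>i<Suc n. real (Suc (n - i)) - x)"
    by (subst prod.nat_diff_reindex[symmetric]) (intro prod.cong, auto)
  also have "\<dots> \<le> (\<Prod>i<Suc n. norm (z + of_nat i))"
  proof (intro prod_mono conjI)
    fix i assume i: "i \<in> {..<Suc n}"
    hence "0 \<le> real (Suc (n - i)) - x" using x by simp
    thus "0 \<le> real (Suc (n - i)) - x" .
    have "real (Suc (n - i)) - x = - Re (z + of_nat i)" using i z by (simp add: of_nat_diff)
    also have "\<dots> \<le> norm (z + of_nat i)" using abs_Re_le_cmod[of "z + of_nat i"] by linarith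
    finally show "real (Suc (n - i)) - x \<le> norm (z + of_nat i)" .
  qed
  also have "\<dots> = norm (pochhammer z (Suc n))" by (simp add: pochhammer_prod prod_norm atLeast0LessThan)
  finally have p: "(1 - x) * fact n \<le> norm (pochhammer z (Suc n))" .
  have "norm (Gamma z) = norm (Gamma (z + of_nat (Suc n))) / norm (pochhammer z (Suc n))"
    by (rule Gamma_left_shift[OF nonpos])
  also have "\<dots> \<le> norm (Gamma (z + of_nat (Suc n))) / ((1 - x) * fact n)"
    using p x by (intro divide_left_mono mult_pos_pos) (auto intro!: less_le_trans[OF _ p] mult_pos_pos simp del: zero_less_norm_iff)
  finally show ?thesis .
qed

lemma power_div_fact_tendsto_0: "(\<lambda>n. C * A ^ Suc n / fact n :: real) \<longlonglongrightarrow> 0"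
proof -
  have "(\<lambda>n. C * A * (inverse (fact n) * A ^ n)) \<longlonglongrightarrow> C * A * 0"
    using summable_LIMSEQ_zero[OF summable_exp[of A]] by (intro tendsto_intros) (simp add: mult.commute)
  thus ?thesis by (simp add: field_simps)
qed

lemma Gamma_pole_limit:
  "((\<lambda>w. Gamma (w + \<mu>) * (w - (- \<mu> - of_nat k))) \<longlongrightarrow> (-1) ^ k / fact k) (at (- \<mu> - of_nat k :: complex))"
proof -
  have "filterlim (\<lambda>w. w + \<mu>) (at (- of_nat k)) (at (- \<mu> - of_nat k))"
  proof (rule filterlim_atI)
    have "eventually (\<lambda>w. w \<noteq> - \<mu> - of_nat k) (at (- \<mu> - of_nat k))"
      by (simp add: eventually_at_filter)
    thus "eventually (\<lambda>w. w + \<mu> \<noteq> - of_nat k) (at (- \<mu> - of_nat k))"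
      by eventually_elim (metis add_diff_cancel_right' diff_conv_add_uminus add.commute)
  qed (auto intro!: tendsto_eq_intros)
  from filterlim_compose[OF Gamma_residues[of k] this] show ?thesis
    by (simp add: algebra_simps)
qed

lemma nonpos_Ints_add_cases:
  assumes "w + \<mu> \<in> \<int>\<^sub>\<le>\<^sub>0" "Re (w + \<mu>) > - real (Suc n)"
  obtains k where "k \<le> n" "w = - \<mu> - of_nat k"
proof -
  from assms(1) obtain k where k: "w + \<mu> = - of_nat k" by (auto elim!: nonpos_Ints_cases')
  with assms(2) have "real k < real (Suc n)" by simp
  with k that[of k] show ?thesis by (auto simp: algebra_simps eq_neg_iff_add_eq_0)
qed

text \<open>The Cahen-Mellin integral: the residues (-y)^k / k! at w = -k add up to exp (-y). It
  later evaluates the line integral that remains when the Lommel function is rewritten as a Laplace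
  integral.\<close>

theorem exp_Mellin_Barnes:
  fixes b y :: real
  assumes b: "b > 0" and y: "y > 0"
  shows "integrable lborel (\<lambda>t. Gamma (Complex b t) * of_real y powr (- Complex b t))"
    and "(\<integral>t. Gamma (Complex b t) * of_real y powr (- Complex b t) \<partial>lborel) = 2 * of_real pi * exp (- of_real y)"
proof -
  define F where "F = (\<lambda>w. Gamma w * complex_of_real y powr (- w))"
  define P where "P = (\<lambda>n. (\<lambda>k. - of_nat k :: complex) ` {..n})"
  \<comment> \<open>Halfway between the poles -n and -n - 1, in the form x - (n + 1) that
    \<open>norm_Gamma_left_line\<close> expects.\<close>
  define a where "a = (\<lambda>n. 1/2 - real (Suc n))"
  have y': "complex_of_real y \<noteq> 0" using y by simp
  have ny: "norm (complex_of_real y powr (- w)) = y powr (- Re w)" for w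
    using y by (simp add: norm_powr_real_powr)
  obtain C0 where C0: "C0 > 0" "\<And>z. 1/2 \<le> Re z \<Longrightarrow> Re z \<le> 1/2 \<Longrightarrow> norm (Gamma z) \<le> C0 * exp (- 1 * \<bar>Im z\<bar>)"
    using norm_Gamma_exp_bound[of "1/2" 1 "1/2"] pi_gt3 by auto
  have holo: "F holomorphic_on {z. - 1/2 - real (Suc n) < Re z \<and> Re z < b + 1} - P (Suc n)" for n
  proof -
    have "w \<notin> \<int>\<^sub>\<le>\<^sub>0" if w: "w \<in> {z. - 1/2 - real (Suc n) < Re z \<and> Re z < b + 1} - P (Suc n)" for w
    proof
      assume "w \<in> \<int>\<^sub>\<le>\<^sub>0"
      hence "w + 0 \<in> \<int>\<^sub>\<le>\<^sub>0" by simp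
      from nonpos_Ints_add_cases[OF this, of "Suc n"] w show False by (auto simp: P_def)
    qed
    thus ?thesis unfolding F_def using y'
      by (intro holomorphic_on_mult holomorphic_Gamma holomorphic_intros) auto
  qed
  note holo' = holomorphic_on_subset[OF holo]
  have main: "integrable lborel (\<lambda>t. F (Complex b t)) \<and>
    (\<lambda>n. \<Sum>p\<in>P n. residue F p) \<longlonglongrightarrow> (\<integral>t. F (Complex b t) \<partial>lborel) / (2 * of_real pi)"
  proof (rule line_integral_residue_series[where P = P and b' = "b + 1" and a = a and a' = "\<lambda>n. a n - 1/4" and Y = 1 and d = 1
       and K = "\<lambda>n. 2 * C0 * y powr (-1/2) * y ^ Suc n / fact n"])
    fix n
    show "F holomorphic_on {z. a n - 1/4 < Re z \<and> Re z < b + 1} - P n"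
    proof (rule holo')
      show "{z. a n - 1 / 4 < Re z \<and> Re z < b + 1} - P n
        \<subseteq> {z. - 1 / 2 - real (Suc n) < Re z \<and> Re z < b + 1} - P (Suc n)"
        by (auto simp: a_def P_def atMost_Suc)
    qed
    show "\<exists>C. \<forall>z. a n \<le> Re z \<longrightarrow> Re z \<le> b \<longrightarrow> \<bar>Im z\<bar> \<ge> 1 \<longrightarrow> norm (F z) \<le> C * exp (- 1 * \<bar>Im z\<bar>)"
    proof -
      obtain C where C: "C > 0" "\<And>z. a n \<le> Re z \<Longrightarrow> Re z \<le> b \<Longrightarrow> \<bar>Im z\<bar> \<ge> 1 \<Longrightarrow> norm (Gamma z) \<le> C * exp (- 1 * \<bar>Im z\<bar>)"
        using norm_Gamma_exp_bound_strip[of 1 "a n" b] pi_gt3 by auto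
      define D where "D = exp ((\<bar>a n\<bar> + b) * \<bar>ln y\<bar>)"
      have "norm (F z) \<le> C * D * exp (- 1 * \<bar>Im z\<bar>)" if "a n \<le> Re z" "Re z \<le> b" "\<bar>Im z\<bar> \<ge> 1" for z
      proof -
        have "- Re z * ln y \<le> \<bar>- Re z * ln y\<bar>" by simp
        also have "\<dots> = \<bar>Re z\<bar> * \<bar>ln y\<bar>" by (simp add: abs_mult)
        also have "\<dots> \<le> (\<bar>a n\<bar> + b) * \<bar>ln y\<bar>" using that b by (intro mult_right_mono) auto
        finally have "y powr (- Re z) \<le> D" using y by (simp add: powr_def D_def)
        hence "norm (F z) \<le> (C * exp (- 1 * \<bar>Im z\<bar>)) * D"
          unfolding F_def norm_mult ny using C that by (intro mult_mono) auto
        thus ?thesis by (simp add: mult_ac)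
      qed
      thus ?thesis by blast
    qed
    fix t
    have "norm (Gamma (Complex (a n) t)) \<le> norm (Gamma (Complex (a n) t + of_nat (Suc n))) / ((1 - 1/2) * fact n)"
      by (intro norm_Gamma_left_line) (auto simp: a_def)
    also have "norm (Gamma (Complex (a n) t + of_nat (Suc n))) \<le> C0 * exp (- 1 * \<bar>t\<bar>)"
      using C0(2)[of "Complex (a n) t + of_nat (Suc n)"] by (simp add: a_def)
    finally have "norm (F (Complex (a n) t)) \<le> C0 * exp (- 1 * \<bar>t\<bar>) / ((1 - 1/2) * fact n) * y powr (- a n)"
      unfolding F_def norm_mult ny by (intro mult_mono) (use C0(1) in \<open>auto simp: divide_right_mono\<close>)
    also have "y powr (- a n) = y powr (-1/2) * y ^ Suc n"
    proof -
      have "- a n = - 1/2 + real (Suc n)" by (simp add: a_def)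
      thus ?thesis using y by (simp only: powr_add powr_realpow)
    qed
    finally show "norm (F (Complex (a n) t)) \<le> 2 * C0 * y powr (-1/2) * y ^ Suc n / fact n * exp (- 1 * \<bar>t\<bar>)"
      by (simp add: mult_ac)
  qed (use b power_div_fact_tendsto_0 in \<open>auto simp: a_def P_def\<close>)
  have res: "residue F (- of_nat k) = (- of_real y) ^ k / fact k" for k
  proof -
    have "residue F (- of_nat k) = (-1) ^ k / fact k * complex_of_real y powr (- (- of_nat k))"
    proof (rule residue_of_limit[OF _ _ holo[of k]])
      have "((\<lambda>w. Gamma w * (w + of_nat k) * complex_of_real y powr (- w))
         \<longlongrightarrow> (-1) ^ k / fact k * complex_of_real y powr (- (- of_nat k))) (at (- of_nat k))"
        using y by (intro tendsto_mult[OF Gamma_residues] tendsto_intros) auto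
      thus "((\<lambda>w. F w * (w - (- of_nat k))) \<longlongrightarrow> (-1) ^ k / fact k * complex_of_real y powr (- (- of_nat k))) (at (- of_nat k))"
        by (simp add: F_def mult_ac)
      have "{z. - 1/2 - real (Suc k) < Re z \<and> Re z < b + 1} = {z. - 1/2 - real (Suc k) < Re z} \<inter> {z. Re z < b + 1}" by auto
      thus "open {z. - 1/2 - real (Suc k) < Re z \<and> Re z < b + 1}"
        by (auto intro!: open_Int open_halfspace_Re_gt open_halfspace_Re_lt)
    qed (use b in \<open>auto simp: P_def\<close>)
    also have "complex_of_real y powr (- (- of_nat k)) = of_real y ^ k"
      using y' by (simp add: powr_nat)
    finally show ?thesis by (simp add: power_minus[of "of_real y"])
  qed
  have "(\<Sum>p\<in>P n. residue F p) = (\<Sum>k\<le>n. (- of_real y) ^ k / fact k)" for n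
    unfolding P_def by (subst sum.reindex) (auto simp: inj_on_def res)
  with main have "(\<lambda>n. \<Sum>k\<le>n. (- of_real y) ^ k / fact k) \<longlonglongrightarrow> (\<integral>t. F (Complex b t) \<partial>lborel) / (2 * of_real pi)"
    by simp
  moreover have "(\<lambda>n. \<Sum>k\<le>n. (- complex_of_real y) ^ k / fact k) \<longlonglongrightarrow> exp (- of_real y)"
    using exp_converges[of "- complex_of_real y"] by (simp add: sums_def_le scaleR_conv_of_real field_simps)
  ultimately have "(\<integral>t. F (Complex b t) \<partial>lborel) / (2 * of_real pi) = exp (- of_real y)"
    by (rule LIMSEQ_unique)
  thus "(\<integral>t. Gamma (Complex b t) * of_real y powr (- Complex b t) \<partial>lborel) = 2 * of_real pi * exp (- of_real y)"
    by (simp add: F_def field_simps)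
  show "integrable lborel (\<lambda>t. Gamma (Complex b t) * of_real y powr (- Complex b t))"
    using main by (simp add: F_def)
qed

subsection \<open>Mellin-Barnes integral for the modified Bessel function\<close>

lemma norm_exp_neg_mult_le:
  assumes "\<bar>Re w\<bar> \<le> R"
  shows "norm (exp (- w * L)) \<le> exp (R * \<bar>Re L\<bar>) * exp (\<bar>Im L\<bar> * \<bar>Im w\<bar>)"
proof -
  have "- (Re w * Re L) \<le> \<bar>Re w\<bar> * \<bar>Re L\<bar>" by (metis abs_ge_minus_self abs_mult)
  also have "\<dots> \<le> R * \<bar>Re L\<bar>" using assms by (intro mult_right_mono) auto
  finally have "- (Re w * Re L) \<le> R * \<bar>Re L\<bar>" .
  moreover have "Im w * Im L \<le> \<bar>Im L\<bar> * \<bar>Im w\<bar>" by (metis abs_ge_self abs_mult mult.commute)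
  ultimately show ?thesis by (simp flip: exp_add)
qed

text \<open>Rate 3*pi/8 per factor, hence 3*pi/4 for the pair: an arbitrary choice below pi that
  leaves a margin of pi/4 over the growth with rate pi/2 of \<open>exp (- w * L)\<close> for |Im L|
  \<le> pi/2. The condition on Im w keeps both arguments at height at least 1.\<close>

lemma Gamma_pair_exp_bound_strip:
  obtains C where "C > 0" "\<And>w. a \<le> Re w \<Longrightarrow> Re w \<le> b \<Longrightarrow> \<bar>Im w\<bar> \<ge> 1 + \<bar>Im \<mu>\<bar> \<Longrightarrow>
    norm (Gamma (w + \<mu>) * Gamma (w - \<mu>)) \<le> C * exp (- (3 * pi / 4) * \<bar>Im w\<bar>)"
proof -
  obtain C where C: "C > 0" "\<And>z. a - \<bar>Re \<mu>\<bar> \<le> Re z \<Longrightarrow> Re z \<le> b + \<bar>Re \<mu>\<bar> \<Longrightarrow> \<bar>Im z\<bar> \<ge> 1 \<Longrightarrow>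
      norm (Gamma z) \<le> C * exp (- (3 * pi / 8) * \<bar>Im z\<bar>)"
    using norm_Gamma_exp_bound_strip[of "3 * pi / 8" "a - \<bar>Re \<mu>\<bar>" "b + \<bar>Re \<mu>\<bar>"] by auto
  define D where "D = C * exp (3 * pi / 8 * \<bar>Im \<mu>\<bar>)"
  have *: "norm (Gamma (w + \<mu>')) \<le> D * exp (- (3 * pi / 8) * \<bar>Im w\<bar>)"
    if "a \<le> Re w" "Re w \<le> b" "\<bar>Im w\<bar> \<ge> 1 + \<bar>Im \<mu>\<bar>" "\<mu>' = \<mu> \<or> \<mu>' = - \<mu>" for w \<mu>'
  proof -
    have "norm (Gamma (w + \<mu>')) \<le> C * exp (- (3 * pi / 8) * \<bar>Im (w + \<mu>')\<bar>)"
      using that by (intro C(2)) auto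
    also have "\<dots> \<le> C * exp (3 * pi / 8 * \<bar>Im \<mu>\<bar> + (- (3 * pi / 8) * \<bar>Im w\<bar>))"
    proof -
      have "\<bar>Im w\<bar> - \<bar>Im \<mu>\<bar> \<le> \<bar>Im (w + \<mu>')\<bar>" using that(4) by auto
      hence "3 * pi / 8 * (\<bar>Im w\<bar> - \<bar>Im \<mu>\<bar>) \<le> 3 * pi / 8 * \<bar>Im (w + \<mu>')\<bar>"
        by (intro mult_left_mono) auto
      thus ?thesis using C(1) by (simp add: algebra_simps)
    qed
    finally show ?thesis by (simp only: D_def exp_add mult.assoc)
  qed
  show ?thesis
  proof (rule that[of "D * D"])
    show "D * D > 0" using C(1) by (simp add: D_def)
    fix w assume w: "a \<le> Re w" "Re w \<le> b" "\<bar>Im w\<bar> \<ge> 1 + \<bar>Im \<mu>\<bar>"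
    have "norm (Gamma (w + \<mu>) * Gamma (w - \<mu>)) \<le>
      (D * exp (- (3 * pi / 8) * \<bar>Im w\<bar>)) * (D * exp (- (3 * pi / 8) * \<bar>Im w\<bar>))"
      unfolding norm_mult using *[OF w, of \<mu>] *[OF w, of "- \<mu>"] C(1)
      by (intro mult_mono) (auto simp: D_def)
    also have "\<dots> = D * D * exp (- (3 * pi / 4) * \<bar>Im w\<bar>)" by (simp add: mult_ac flip: exp_add)
    finally show "norm (Gamma (w + \<mu>) * Gamma (w - \<mu>)) \<le> D * D * exp (- (3 * pi / 4) * \<bar>Im w\<bar>)" .
  qed
qed

text \<open>Uniformity in \<open>\<mu>\<close> allows the passage to the excluded orders by dominated convergence.\<close>

lemma Gamma_pair_exp_bound_line:
  assumes "\<delta> < c" "0 \<le> M"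
  obtains C where "C > 0" "\<And>\<mu> t. \<bar>Re \<mu>\<bar> \<le> \<delta> \<Longrightarrow> \<bar>Im \<mu>\<bar> \<le> M \<Longrightarrow>
    norm (Gamma (Complex c t + \<mu>) * Gamma (Complex c t - \<mu>)) \<le> C * exp (- (3 * pi / 4) * \<bar>t\<bar>)"
proof -
  obtain C where C: "C > 0" "\<And>z. c - \<delta> \<le> Re z \<Longrightarrow> Re z \<le> c + \<delta> \<Longrightarrow>
      norm (Gamma z) \<le> C * exp (- (3 * pi / 8) * \<bar>Im z\<bar>)"
    using norm_Gamma_exp_bound[of "c - \<delta>" "3 * pi / 8" "c + \<delta>"] assms by auto
  define D where "D = C * exp (3 * pi / 8 * M)"
  have *: "norm (Gamma (Complex c t + \<mu>)) \<le> D * exp (- (3 * pi / 8) * \<bar>t\<bar>)"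
    if "\<bar>Re \<mu>\<bar> \<le> \<delta>" "\<bar>Im \<mu>\<bar> \<le> M" for \<mu> t
  proof -
    have "norm (Gamma (Complex c t + \<mu>)) \<le> C * exp (- (3 * pi / 8) * \<bar>Im (Complex c t + \<mu>)\<bar>)"
      using that by (intro C(2)) auto
    also have "\<dots> \<le> C * exp (3 * pi / 8 * M + (- (3 * pi / 8) * \<bar>t\<bar>))"
    proof -
      have "\<bar>t\<bar> - M \<le> \<bar>Im (Complex c t + \<mu>)\<bar>" using that by auto
      hence "3 * pi / 8 * (\<bar>t\<bar> - M) \<le> 3 * pi / 8 * \<bar>Im (Complex c t + \<mu>)\<bar>"
        by (intro mult_left_mono) auto
      thus ?thesis using C(1) by (simp add: algebra_simps)
    qed
    finally show ?thesis by (simp only: D_def exp_add mult.assoc)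
  qed
  show ?thesis
  proof (rule that[of "D * D"])
    show "D * D > 0" using C(1) by (simp add: D_def)
    fix \<mu> t assume w: "\<bar>Re \<mu>\<bar> \<le> \<delta>" "\<bar>Im \<mu>\<bar> \<le> M"
    have "norm (Gamma (Complex c t + \<mu>) * Gamma (Complex c t - \<mu>)) \<le>
      (D * exp (- (3 * pi / 8) * \<bar>t\<bar>)) * (D * exp (- (3 * pi / 8) * \<bar>t\<bar>))"
      unfolding norm_mult using *[OF w, of t] *[of "- \<mu>" t] w C(1)
      by (intro mult_mono) (auto simp: D_def)
    also have "\<dots> = D * D * exp (- (3 * pi / 4) * \<bar>t\<bar>)" by (simp add: mult_ac flip: exp_add)
    finally show "norm (Gamma (Complex c t + \<mu>) * Gamma (Complex c t - \<mu>)) \<le> D * D * exp (- (3 * pi / 4) * \<bar>t\<bar>)" .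
  qed
qed

text \<open>|Re \<mu>| < c \<le> 1/2 places c + Re \<mu> and c - Re \<mu> strictly between 0 and 1,
  so each factor gains a factorial; one of the two is enough. The value c = 1/2 serves
  \<open>K\<close>, c = 1/4 the Lommel function.\<close>

lemma Gamma_pair_left_line:
  assumes \<mu>: "\<bar>Re \<mu>\<bar> < c" "c \<le> 1/2"
  obtains C where "C > 0" "\<And>n t.
    norm (Gamma (Complex (c - real (Suc n)) t + \<mu>) * Gamma (Complex (c - real (Suc n)) t - \<mu>))
      \<le> C / fact n * exp (- (3 * pi / 4) * \<bar>t\<bar>)"
proof -
  obtain C where C: "C > 0" "\<And>t. norm (Gamma (Complex c t + \<mu>) * Gamma (Complex c t - \<mu>)) \<le> C * exp (- (3 * pi / 4) * \<bar>t\<bar>)"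
    using Gamma_pair_exp_bound_line[OF \<mu>(1) abs_ge_zero[of "Im \<mu>"]] by (metis order_refl)
  define k where "k = (1 - (c + Re \<mu>)) * (1 - (c - Re \<mu>))"
  have k: "k > 0" unfolding k_def using \<mu> by (intro mult_pos_pos) auto
  show ?thesis
  proof (rule that[of "C / k"])
    show "C / k > 0" using C k by simp
    fix n t
    let ?z = "Complex (c - real (Suc n)) t"
    have z: "?z + \<mu> + of_nat (Suc n) = Complex c t + \<mu>" "?z - \<mu> + of_nat (Suc n) = Complex c t - \<mu>"
      by (auto simp: complex_eq_iff)
    have "norm (Gamma (?z + \<mu>)) \<le> norm (Gamma (?z + \<mu> + of_nat (Suc n))) / ((1 - (c + Re \<mu>)) * fact n)"
      using \<mu> by (intro norm_Gamma_left_line) auto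
    moreover have "norm (Gamma (?z - \<mu>)) \<le> norm (Gamma (?z - \<mu> + of_nat (Suc n))) / ((1 - (c - Re \<mu>)) * fact n)"
      using \<mu> by (intro norm_Gamma_left_line) auto
    ultimately have "norm (Gamma (?z + \<mu>) * Gamma (?z - \<mu>)) \<le>
       norm (Gamma (Complex c t + \<mu>)) / ((1 - (c + Re \<mu>)) * fact n) * (norm (Gamma (Complex c t - \<mu>)) / ((1 - (c - Re \<mu>)) * fact n))"
      unfolding norm_mult z using \<mu> by (intro mult_mono divide_nonneg_nonneg) auto
    also have "\<dots> = norm (Gamma (Complex c t + \<mu>) * Gamma (Complex c t - \<mu>)) / (k * fact n * fact n)"
      by (simp add: k_def norm_mult)
    also have "\<dots> \<le> (C * exp (- (3 * pi / 4) * \<bar>t\<bar>)) / (k * fact n * 1)"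
      using k C by (intro frac_le mult_left_mono) (auto simp: fact_ge_1)
    finally show "norm (Gamma (?z + \<mu>) * Gamma (?z - \<mu>)) \<le> C / k / fact n * exp (- (3 * pi / 4) * \<bar>t\<bar>)" by simp
  qed
qed

text \<open>Ratio test. From the index N on, the recurrence makes |rGamma| nonincreasing along the
  series and |x| / (n + 1) is at most 1/2. No order is exceptional, since \<open>rGamma\<close> is
  entire.\<close>

lemma summable_bessel:
  fixes x \<nu> :: complex
  shows "summable (\<lambda>k. x ^ k * rGamma (\<nu> + of_nat k + 1) / fact k)"
proof -
  obtain N :: nat where N: "real N \<ge> 2 * norm x + norm \<nu> + 1" using real_arch_simple by blast
  show ?thesis
  proof (rule summable_ratio_test[of "1/2" N])
    fix n assume n: "n \<ge> N"
    have eq: "(\<nu> + of_nat n + 1) * rGamma (\<nu> + of_nat (Suc n) + 1) = rGamma (\<nu> + of_nat n + 1)"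
      using rGamma_plus1[of "\<nu> + of_nat n + 1"] by (simp add: add_ac)
    have "real n + 1 - norm \<nu> \<le> norm (\<nu> + of_nat n + 1)"
      using norm_triangle_ineq4[of "\<nu> + of_nat n + 1" \<nu>] norm_of_nat[of "Suc n", where 'a = complex]
      by (simp add: add_ac)
    hence ge1: "1 \<le> norm (\<nu> + of_nat n + 1)" using n N norm_ge_zero[of x] by linarith
    have "norm (rGamma (\<nu> + of_nat (Suc n) + 1)) * 1 \<le> norm (rGamma (\<nu> + of_nat (Suc n) + 1)) * norm (\<nu> + of_nat n + 1)"
      by (intro mult_left_mono ge1) auto
    also have "\<dots> = norm (rGamma (\<nu> + of_nat n + 1))" unfolding eq[symmetric] norm_mult by simp
    finally have r: "norm (rGamma (\<nu> + of_nat (Suc n) + 1)) \<le> norm (rGamma (\<nu> + of_nat n + 1))" by simp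
    have "2 * norm x \<le> real (Suc n)" using n N norm_ge_zero[of \<nu>] by linarith
    hence "norm x / real (Suc n) \<le> 1/2" by (simp add: field_simps)
    hence "(norm x / real (Suc n)) * (norm x ^ n * norm (rGamma (\<nu> + of_nat (Suc n) + 1)) / fact n)
        \<le> 1/2 * (norm x ^ n * norm (rGamma (\<nu> + of_nat n + 1)) / fact n)"
      by (intro mult_mono divide_right_mono mult_left_mono r) auto
    also have "(norm x / real (Suc n)) * (norm x ^ n * norm (rGamma (\<nu> + of_nat (Suc n) + 1)) / fact n)
        = norm (x ^ Suc n * rGamma (\<nu> + of_nat (Suc n) + 1) / fact (Suc n))"
      by (simp only: norm_mult norm_divide norm_power norm_fact power_Suc fact_Suc of_nat_mult norm_of_nat) (simp add: divide_simps)
    finally show "norm (x ^ Suc n * rGamma (\<nu> + of_nat (Suc n) + 1) / fact (Suc n))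
       \<le> 1/2 * norm (x ^ n * rGamma (\<nu> + of_nat n + 1) / fact n)"
      by (simp add: norm_mult norm_divide norm_power)
  qed simp
qed

text \<open>Reflection with the sign taken out of the sine. At a pole of one Gamma factor it turns
  the value of the other factor into the \<open>rGamma\<close> coefficient of a Bessel
  series.\<close>

lemma Gamma_minus_nat:
  fixes z :: complex
  assumes "z \<notin> \<int>"
  shows "Gamma (z - of_nat k) = (-1) ^ k * of_real pi / sin (of_real pi * z) * rGamma (1 - z + of_nat k)"
proof -
  have s: "sin (of_real pi * (z - of_nat k)) = (-1) ^ k * sin (of_real pi * z)"
  proof -
    have "cos (of_real (real k * pi)) = ((-1) ^ k :: complex)"
      by (subst cos_of_real) (simp add: cos_npi)
    moreover have "sin (of_real (real k * pi)) = (0 :: complex)"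
      by (subst sin_of_real) (simp add: sin_npi)
    ultimately show ?thesis
      using sin_diff[of "of_real pi * z" "of_real (real k * pi)"] by (simp add: algebra_simps)
  qed
  have nz: "sin (of_real pi * z) \<noteq> 0"
    using assms sin_eq_0[of "of_real pi * z"] by (auto simp: Ints_def)
  have "1 - z + of_nat k \<notin> \<int>\<^sub>\<le>\<^sub>0"
  proof
    assume "1 - z + of_nat k \<in> \<int>\<^sub>\<le>\<^sub>0"
    hence "1 - z + of_nat k \<in> \<int>" by (rule nonpos_Ints_subset_Ints[THEN subsetD])
    hence "1 + of_nat k - (1 - z + of_nat k) \<in> \<int>" by (intro Ints_diff Ints_add) auto
    thus False using assms by simp
  qed
  hence "rGamma (1 - z + of_nat k) * Gamma (1 - z + of_nat k) = 1"
    by (simp add: rGamma_inverse_Gamma Gamma_eq_zero_iff)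
  moreover have "Gamma (z - of_nat k) * Gamma (1 - z + of_nat k) = of_real pi / ((-1) ^ k * sin (of_real pi * z))"
  proof -
    have "1 - (z - of_nat k) = 1 - z + of_nat k" by simp
    with Gamma_reflection_complex[of "z - of_nat k"] show ?thesis by (simp only: s)
  qed
  ultimately have "Gamma (z - of_nat k) = of_real pi / ((-1) ^ k * sin (of_real pi * z)) * rGamma (1 - z + of_nat k)"
    by (metis mult.assoc mult.commute mult.right_neutral)
  also have "of_real pi / ((-1) ^ k * sin (of_real pi * z)) = (-1) ^ k * of_real pi / sin (of_real pi * z)"
    using nz by (simp add: field_simps flip: power_mult_distrib)
  finally show ?thesis by simp
qed

lemma sum_image_nat_shift:
  fixes f :: "complex \<Rightarrow> 'a::comm_monoid_add"
  shows "sum f ((\<lambda>k. \<theta> - of_nat k) ` {..n}) = (\<Sum>k\<le>n. f (\<theta> - of_nat k))"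
  by (subst sum.reindex) (auto simp: inj_on_def)

lemma open_vertical_strip: "open {z. a < Re z \<and> Re z < b}"
proof -
  have "{z. a < Re z \<and> Re z < b} = {z. a < Re z} \<inter> {z. Re z < b}" by auto
  thus ?thesis by (auto intro!: open_Int open_halfspace_Re_gt open_halfspace_Re_lt)
qed

text \<open>The poles at -s/2 - k and s/2 - k produce the series of I of order s and of order -s.
  They are simple because s is not an integer. With L twice the logarithm of z/2,
  \<open>exp (- w * L)\<close> stands for (z/2)^(-2w); |Im L| \<le> pi/2 confines z to the sector
  where the decay of the Gamma pair wins.\<close>

theorem bessel_K_generic_Mellin_Barnes:
  fixes b :: real and s L z :: complex
  assumes b: "b \<ge> 1/2" and s: "\<bar>Re s\<bar> < 1" "s \<notin> \<int>" and L: "\<bar>Im L\<bar> \<le> pi / 2" "L = 2 * Ln (z / 2)" and z: "z \<noteq> 0"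
  shows "(\<integral>t. Gamma (Complex b t + s/2) * Gamma (Complex b t - s/2) * exp (- Complex b t * L) \<partial>lborel)
     = 4 * of_real pi * bessel_K_generic s z"
proof -
  define \<mu> where "\<mu> = s / 2"
  define F where "F = (\<lambda>w. Gamma (w + \<mu>) * Gamma (w - \<mu>) * exp (- w * L))"
  define P where "P = (\<lambda>n. (\<lambda>k. - \<mu> - of_nat k) ` {..n} \<union> (\<lambda>k. \<mu> - of_nat k) ` {..n})"
  have \<mu>: "\<bar>Re \<mu>\<bar> < 1/2" using s by (simp add: \<mu>_def)
  \<comment> \<open>The largest margin for which w + \<mu> and w - \<mu> keep real part above -(n +
    1) throughout \<open>S n\<close>, so that \<open>P n\<close> lists every pole there.\<close>
  define \<epsilon> where "\<epsilon> = 1/2 - \<bar>Re \<mu>\<bar>"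
  have \<epsilon>: "\<epsilon> > 0" using \<mu> by (simp add: \<epsilon>_def)
  define S where "S = (\<lambda>n. {z. 1/2 - real (Suc n) - \<epsilon> < Re z \<and> Re z < b + 1})"
  have nonpos: "w + \<mu> \<notin> \<int>\<^sub>\<le>\<^sub>0" "w - \<mu> \<notin> \<int>\<^sub>\<le>\<^sub>0" if "w \<in> S n - P n" for w n
  proof -
    show "w + \<mu> \<notin> \<int>\<^sub>\<le>\<^sub>0"
    proof
      assume "w + \<mu> \<in> \<int>\<^sub>\<le>\<^sub>0"
      moreover have "Re (w + \<mu>) > - real (Suc n)" using that abs_ge_self[of "Re \<mu>"] abs_ge_minus_self[of "Re \<mu>"] by (simp add: S_def \<epsilon>_def)
      ultimately show False
        by (rule nonpos_Ints_add_cases) (use that in \<open>auto simp: P_def\<close>)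
    qed
    show "w - \<mu> \<notin> \<int>\<^sub>\<le>\<^sub>0"
    proof
      assume "w - \<mu> \<in> \<int>\<^sub>\<le>\<^sub>0"
      hence "w + (- \<mu>) \<in> \<int>\<^sub>\<le>\<^sub>0" by simp
      moreover have "Re (w + (- \<mu>)) > - real (Suc n)" using that abs_ge_self[of "Re \<mu>"] abs_ge_minus_self[of "Re \<mu>"] by (simp add: S_def \<epsilon>_def)
      ultimately show False
        by (rule nonpos_Ints_add_cases) (use that in \<open>auto simp: P_def\<close>)
    qed
  qed
  have holo: "F holomorphic_on S n - P n" for n
    unfolding F_def using nonpos by (intro holomorphic_intros) auto
  obtain C0 where C0: "C0 > 0" "\<And>n t.
    norm (Gamma (Complex (1/2 - real (Suc n)) t + \<mu>) * Gamma (Complex (1/2 - real (Suc n)) t - \<mu>))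
      \<le> C0 / fact n * exp (- (3 * pi / 4) * \<bar>t\<bar>)"
    using Gamma_pair_left_line[of \<mu> "1/2"] \<mu> by auto
  \<comment> \<open>The rate 3*pi/4 of the Gamma pair minus at most pi/2 from the argument of
    z.\<close>
  have e: "exp (- (3 * pi / 4) * x) * exp (\<bar>Im L\<bar> * x) \<le> exp (- (pi / 4) * x)" if "x \<ge> 0" for x
  proof -
    have "\<bar>Im L\<bar> * x \<le> pi / 2 * x" using L that by (intro mult_right_mono) auto
    thus ?thesis by (simp flip: exp_add)
  qed
  have main: "integrable lborel (\<lambda>t. F (Complex b t)) \<and>
    (\<lambda>n. \<Sum>p\<in>P n. residue F p) \<longlonglongrightarrow> (\<integral>t. F (Complex b t) \<partial>lborel) / (2 * of_real pi)"
  proof (rule line_integral_residue_series[where P = P and b' = "b + 1" and a = "\<lambda>n. 1/2 - real (Suc n)" and a' = "\<lambda>n. 1/2 - real (Suc n) - \<epsilon>" and Y = "1 + \<bar>Im \<mu>\<bar>" and d = "pi / 4"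
       and K = "\<lambda>n. C0 * exp (\<bar>Re L\<bar>) ^ Suc n / fact n"])
    fix n
    show "F holomorphic_on {z. 1/2 - real (Suc n) - \<epsilon> < Re z \<and> Re z < b + 1} - P n"
      using holo[of n] by (simp add: S_def)
    show "1/2 - real (Suc n) < Re p \<and> Re p < b" if "p \<in> P n" for p
      using that \<mu> b by (auto simp: P_def abs_if split: if_splits)
    show "\<exists>C. \<forall>z. 1/2 - real (Suc n) \<le> Re z \<longrightarrow> Re z \<le> b \<longrightarrow> \<bar>Im z\<bar> \<ge> 1 + \<bar>Im \<mu>\<bar> \<longrightarrow> norm (F z) \<le> C * exp (- (pi / 4) * \<bar>Im z\<bar>)"
    proof -
      obtain C where C: "C > 0" "\<And>w. 1/2 - real (Suc n) \<le> Re w \<Longrightarrow> Re w \<le> b \<Longrightarrow> \<bar>Im w\<bar> \<ge> 1 + \<bar>Im \<mu>\<bar> \<Longrightarrow>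
        norm (Gamma (w + \<mu>) * Gamma (w - \<mu>)) \<le> C * exp (- (3 * pi / 4) * \<bar>Im w\<bar>)"
        using Gamma_pair_exp_bound_strip[of "1/2 - real (Suc n)" b \<mu>] by metis
      define R where "R = exp ((real (Suc n) + b) * \<bar>Re L\<bar>)"
      have "norm (F z) \<le> C * R * exp (- (pi / 4) * \<bar>Im z\<bar>)"
        if "1/2 - real (Suc n) \<le> Re z" "Re z \<le> b" "\<bar>Im z\<bar> \<ge> 1 + \<bar>Im \<mu>\<bar>" for z
      proof -
        have "norm (exp (- z * L)) \<le> R * exp (\<bar>Im L\<bar> * \<bar>Im z\<bar>)"
          unfolding R_def using that b by (intro norm_exp_neg_mult_le) auto
        hence "norm (F z) \<le> (C * exp (- (3 * pi / 4) * \<bar>Im z\<bar>)) * (R * exp (\<bar>Im L\<bar> * \<bar>Im z\<bar>))"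
          unfolding F_def norm_mult[of "Gamma _ * Gamma _"] using C that by (intro mult_mono) auto
        also have "\<dots> = C * R * (exp (- (3 * pi / 4) * \<bar>Im z\<bar>) * exp (\<bar>Im L\<bar> * \<bar>Im z\<bar>))" by simp
        also have "\<dots> \<le> C * R * exp (- (pi / 4) * \<bar>Im z\<bar>)"
          using C by (intro mult_left_mono e) (auto simp: R_def)
        finally show ?thesis .
      qed
      thus ?thesis by blast
    qed
    fix t
    let ?w = "Complex (1/2 - real (Suc n)) t"
    have "norm (exp (- ?w * L)) \<le> exp (real (Suc n) * \<bar>Re L\<bar>) * exp (\<bar>Im L\<bar> * \<bar>Im ?w\<bar>)"
      by (rule norm_exp_neg_mult_le) simp
    hence "norm (F ?w) \<le> (C0 / fact n * exp (- (3 * pi / 4) * \<bar>t\<bar>)) * (exp (real (Suc n) * \<bar>Re L\<bar>) * exp (\<bar>Im L\<bar> * \<bar>t\<bar>))"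
      unfolding F_def norm_mult[of "Gamma _ * Gamma _"] using C0(1) C0(2)[of n t] by (intro mult_mono) auto
    also have "\<dots> = C0 / fact n * exp (real (Suc n) * \<bar>Re L\<bar>) * (exp (- (3 * pi / 4) * \<bar>t\<bar>) * exp (\<bar>Im L\<bar> * \<bar>t\<bar>))" by simp
    also have "\<dots> \<le> C0 / fact n * exp (real (Suc n) * \<bar>Re L\<bar>) * exp (- (pi / 4) * \<bar>t\<bar>)"
      using C0(1) by (intro mult_left_mono e) auto
    also have "exp (real (Suc n) * \<bar>Re L\<bar>) = exp (\<bar>Re L\<bar>) ^ Suc n" by (rule exp_of_nat_mult)
    finally show "norm (F ?w) \<le> C0 * exp (\<bar>Re L\<bar>) ^ Suc n / fact n * exp (- (pi / 4) * \<bar>t\<bar>)" by simp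
  next
    show "(\<lambda>n. C0 * exp \<bar>Re L\<bar> ^ Suc n / fact n) \<longlonglongrightarrow> 0" by (rule power_div_fact_tendsto_0)
  qed (use b \<epsilon> in \<open>auto simp: P_def\<close>)
  have notint: "s \<notin> \<int>" "- s \<notin> \<int>" using s(2) by (auto simp: minus_in_Ints_iff)
  \<comment> \<open>With m equal to \<mu> or -\<mu>, one computation covers both families of
    poles.\<close>
  have res: "residue F (- m - of_nat k) = of_real pi / sin (of_real pi * (- 2 * m)) * (exp L ^ k * rGamma (2 * m + of_nat k + 1) / fact k) * exp (m * L)"
    if m: "m = \<mu> \<or> m = - \<mu>" for m k
  proof -
    have "- 2 * m = - s \<or> - 2 * m = s" using m by (auto simp: \<mu>_def)
    hence m2: "- 2 * m \<notin> \<int>" using notint by auto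
    have "- 2 * m - of_nat k \<notin> \<int>\<^sub>\<le>\<^sub>0"
    proof
      assume "- 2 * m - of_nat k \<in> \<int>\<^sub>\<le>\<^sub>0"
      hence "- 2 * m - of_nat k \<in> \<int>" by (rule nonpos_Ints_subset_Ints[THEN subsetD])
      hence "- 2 * m - of_nat k + of_nat k \<in> \<int>" by (intro Ints_add) auto
      thus False using m2 by simp
    qed
    hence lim: "((\<lambda>w. Gamma (w + m) * (w - (- m - of_nat k)) * (Gamma (w - m) * exp (- w * L))) \<longlongrightarrow>
      (-1) ^ k / fact k * (Gamma (- m - of_nat k - m) * exp (- (- m - of_nat k) * L))) (at (- m - of_nat k))"
      by (intro tendsto_mult[OF Gamma_pole_limit] tendsto_intros) auto
    have "residue F (- m - of_nat k) = (-1) ^ k / fact k * (Gamma (- m - of_nat k - m) * exp (- (- m - of_nat k) * L))"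
    proof (rule residue_of_limit[OF _ _ holo[of k]])
      show "open (S k)" unfolding S_def by (rule open_vertical_strip)
      show "- m - of_nat k \<in> S k" using m \<mu> b \<epsilon> by (auto simp: S_def \<epsilon>_def abs_if split: if_splits)
      show "((\<lambda>w. F w * (w - (- m - of_nat k))) \<longlongrightarrow> (-1) ^ k / fact k * (Gamma (- m - of_nat k - m) * exp (- (- m - of_nat k) * L))) (at (- m - of_nat k))"
        using lim m by (auto simp: F_def mult_ac)
    qed (auto simp: P_def)
    also have "exp (- (- m - of_nat k) * L) = exp (m * L) * exp L ^ k"
      by (simp add: exp_of_nat_mult[symmetric] algebra_simps flip: exp_add)
    also have "Gamma (- m - of_nat k - m) = Gamma (- 2 * m - of_nat k)"
      by (rule arg_cong[where f = Gamma]) (simp add: algebra_simps)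
    also have "\<dots> = (-1) ^ k * of_real pi / sin (of_real pi * (- 2 * m)) * rGamma (1 - (- 2 * m) + of_nat k)"
      by (rule Gamma_minus_nat[OF m2])
    also have "1 - (- 2 * m) + of_nat k = 2 * m + of_nat k + 1" by simp
    finally show ?thesis by (simp add: mult_ac flip: power_mult_distrib)
  qed
  have disj: "(\<lambda>k. - \<mu> - of_nat k) ` {..n} \<inter> (\<lambda>k. \<mu> - of_nat k) ` {..n} = {}" for n
  proof -
    have False if "- \<mu> - of_nat k = \<mu> - of_nat j" for j k
    proof -
      have "of_nat j - of_nat k = \<mu> + \<mu> + ((- \<mu> - of_nat k) - (\<mu> - of_nat j))" by (simp add: algebra_simps)
      hence "of_nat j - of_nat k = \<mu> + \<mu>" by (simp only: that diff_self add_0_right)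
      hence "s = of_nat j - of_nat k" by (simp add: \<mu>_def)
      thus False using s(2) by auto
    qed
    thus ?thesis by blast
  qed
  define A where "A = (\<lambda>m. of_real pi / sin (of_real pi * (- 2 * m)) * (\<Sum>k. exp L ^ k * rGamma (2 * m + of_nat k + 1) / fact k) * exp (m * L))"
  have Alim: "(\<lambda>n. \<Sum>k\<le>n. residue F (- m - of_nat k)) \<longlonglongrightarrow> A m" if "m = \<mu> \<or> m = - \<mu>" for m
  proof -
    have "(\<lambda>k. of_real pi / sin (of_real pi * (- 2 * m)) * (exp L ^ k * rGamma (2 * m + of_nat k + 1) / fact k) * exp (m * L)) sums A m"
      unfolding A_def by (intro sums_mult sums_mult2 summable_sums summable_bessel)
    thus ?thesis unfolding res[OF that] sums_def_le .
  qed
  have "(\<Sum>p\<in>P n. residue F p) = (\<Sum>k\<le>n. residue F (- \<mu> - of_nat k)) + (\<Sum>k\<le>n. residue F (- (- \<mu>) - of_nat k))" for n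
    unfolding P_def using disj by (subst sum.union_disjoint) (auto simp: sum_image_nat_shift)
  with main have "(\<lambda>n. (\<Sum>k\<le>n. residue F (- \<mu> - of_nat k)) + (\<Sum>k\<le>n. residue F (- (- \<mu>) - of_nat k)))
     \<longlonglongrightarrow> (\<integral>t. F (Complex b t) \<partial>lborel) / (2 * of_real pi)" by simp
  moreover have "(\<lambda>n. (\<Sum>k\<le>n. residue F (- \<mu> - of_nat k)) + (\<Sum>k\<le>n. residue F (- (- \<mu>) - of_nat k))) \<longlonglongrightarrow> A \<mu> + A (- \<mu>)"
    by (intro tendsto_add Alim) auto
  ultimately have "(\<integral>t. F (Complex b t) \<partial>lborel) / (2 * of_real pi) = A \<mu> + A (- \<mu>)"
    by (rule LIMSEQ_unique)
  also have "A \<mu> + A (- \<mu>) = 2 * bessel_K_generic s z"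
  proof -
    have eL: "exp L = z\<^sup>2 / 4"
    proof -
      have "exp L = exp (Ln (z / 2)) ^ 2" unfolding L(2) by (simp add: exp_double)
      also have "\<dots> = z\<^sup>2 / 4" using z by (simp add: power_divide)
      finally show ?thesis .
    qed
    have ep: "exp (m * L) = (z / 2) powr (2 * m)" for m
      using z by (simp add: powr_def L(2) mult_ac)
    have "A m = of_real pi / sin (of_real pi * (- 2 * m)) * bessel_I (2 * m) z" for m
      unfolding A_def bessel_I_def eL ep by simp
    thus ?thesis by (simp add: \<mu>_def bessel_K_generic_def diff_divide_distrib algebra_simps)
  qed
  finally show ?thesis by (simp add: F_def \<mu>_def field_simps)
qed

subsection \<open>The Lommel function\<close>

lemma norm_cos_ge_cos_Re: "\<bar>cos (Re z)\<bar> \<le> norm (cos z)"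
proof -
  have "1 \<le> cosh (Im z)" by (rule cosh_real_ge_1)
  hence "\<bar>cos (Re z)\<bar> * 1 \<le> \<bar>cos (Re z)\<bar> * cosh (Im z)" by (intro mult_left_mono) auto
  also have "\<dots> = \<bar>Re (cos z)\<bar>" by (simp add: Re_cos cosh_def abs_mult)
  also have "\<dots> \<le> norm (cos z)" by (rule abs_Re_le_cmod)
  finally show ?thesis by simp
qed

lemma norm_cos_ge_1:
  assumes "\<bar>Im z\<bar> \<ge> 2"
  shows "norm (cos z) \<ge> 1"
proof -
  have n: "norm (exp (\<i> * z)) = exp (- Im z)" "norm (exp (- (\<i> * z))) = exp (Im z)" by simp_all
  have "\<bar>exp (Im z) - exp (- Im z)\<bar> \<le> norm (exp (\<i> * z) + exp (- (\<i> * z)))"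
    using norm_triangle_ineq3[of "exp (\<i> * z)" "- exp (- (\<i> * z))"] by (simp add: n abs_minus_commute)
  also have "\<dots> = 2 * norm (cos z)" by (simp add: cos_exp_eq norm_divide)
  finally have 1: "\<bar>exp (Im z) - exp (- Im z)\<bar> \<le> 2 * norm (cos z)" .
  have "exp \<bar>Im z\<bar> \<ge> 1 + \<bar>Im z\<bar>" by (rule exp_ge_add_one_self)
  moreover have "exp (- \<bar>Im z\<bar>) \<le> 1" by simp
  moreover have "\<bar>exp (Im z) - exp (- Im z)\<bar> = exp \<bar>Im z\<bar> - exp (- \<bar>Im z\<bar>)"
    by (cases "Im z \<ge> 0") auto
  ultimately show ?thesis using 1 assms by linarith
qed

lemma cos_complex_minus_nat_pi: "cos (of_real pi * (z - of_nat k) :: complex) = (-1) ^ k * cos (of_real pi * z)"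
proof -
  have "cos (of_real (real k * pi)) = ((-1) ^ k :: complex)"
    by (subst cos_of_real) (simp add: cos_npi)
  moreover have "sin (of_real (real k * pi)) = (0 :: complex)"
    by (subst sin_of_real) (simp add: sin_npi)
  ultimately show ?thesis
    using cos_diff[of "of_real pi * z" "of_real (real k * pi)"] by (simp add: algebra_simps)
qed

lemma cos_pi_gt_zero:
  fixes r :: real
  assumes "\<bar>r\<bar> < 1/2"
  shows "cos (pi * r) > 0"
proof (rule cos_gt_zero_pi)
  have r: "- (1/2) < r" "r < 1/2" using assms by (auto simp: abs_if split: if_splits)
  show "- (pi / 2) < pi * r" using mult_strict_left_mono[OF r(1) pi_gt_zero] by simp
  show "pi * r < pi / 2" using mult_strict_left_mono[OF r(2) pi_gt_zero] by simp
qed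

lemma cos_pi_nonzero:
  assumes "\<bar>Re z\<bar> < 1/2"
  shows "cos (of_real pi * z) \<noteq> (0 :: complex)"
proof -
  have "cos (pi * Re z) > 0" using assms by (rule cos_pi_gt_zero)
  with norm_cos_ge_cos_Re[of "of_real pi * z"] show ?thesis by auto
qed

text \<open>As a Gamma product the secant has its poles treated by the pole limit of
  \<open>Gamma\<close>, and the factor at u + 1/2 is ready for the duplication formula in the
  Laplace representation.\<close>

lemma cos_pi_as_Gamma: "1 / cos (of_real pi * u :: complex) = Gamma (u + 1/2) * Gamma (1/2 - u) / of_real pi"
proof -
  have "sin (of_real pi * (u + 1/2)) = cos (of_real pi * u)"
    using sin_add[of "of_real pi * u" "of_real (pi/2)"] sin_of_real[of "pi/2", where 'a = complex] cos_of_real[of "pi/2", where 'a = complex]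
    by (simp add: algebra_simps)
  with Gamma_reflection_complex[of "u + 1/2"] show ?thesis by (simp add: field_simps)
qed

lemma rGamma_plus_nat: "rGamma (z + of_nat k) * pochhammer z k = rGamma (z :: complex)"
  using pochhammer_rGamma[of z k] by simp

text \<open>For |Re \<nu>| < 1/2 the line Re w = 1/4 has all poles of the two Gamma factors on its
  left and separates the poles of the secant at -\<nu>/2 - 1/2 and -\<nu>/2 + 1/2. The exponential
  is (x/2)^(-2w).\<close>

definition lommel_MB_integrand :: "complex \<Rightarrow> real \<Rightarrow> real \<Rightarrow> complex" where
  "lommel_MB_integrand \<nu> x t = (let w = Complex (1/4) t in
     Gamma (w + \<nu>/2) * Gamma (w - \<nu>/2) / cos (of_real pi * (w + \<nu>/2)) * exp (- w * of_real (2 * ln (x/2))))"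

text \<open>Closing the line to the left collects three progressions of simple poles. Those of the
  Gamma factors sum to multiples of the Bessel functions of order \<nu> and -\<nu>, those of the
  secant to the hypergeometric series of \<open>lommel_s\<close>. The Bessel terms in the definition
  of S have exactly the coefficients that make S the complete residue sum.\<close>

lemma lommel_S_generic_Mellin_Barnes:
  fixes \<nu> :: complex and x :: real
  assumes \<nu>: "\<bar>Re \<nu>\<bar> < 1/2" "\<nu> \<noteq> 0" and x: "x > 0"
  shows "lommel_S \<nu> \<nu> (of_real x) = 2 powr (\<nu> - 1) * of_real (sqrt pi) * rGamma (1/2 - \<nu>) / (2 * of_real pi) *
     (\<integral>t. lommel_MB_integrand \<nu> x t \<partial>lborel)"
proof -
  define \<mu> where "\<mu> = \<nu> / 2"
  define L :: complex where "L = of_real (2 * ln (x/2))"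
  define F where "F = (\<lambda>w. Gamma (w + \<mu>) * Gamma (w - \<mu>) * (1 / cos (of_real pi * (w + \<mu>))) * exp (- w * L))"
  define PA where "PA = (\<lambda>m n. (\<lambda>k. - m - of_nat k :: complex) ` {..n::nat})"
  define P where "P = (\<lambda>n. PA \<mu> n \<union> PA (- \<mu>) n \<union> PA (\<mu> + 1/2) n)"
  have \<mu>: "\<bar>Re \<mu>\<bar> < 1/4" using \<nu> by (simp add: \<mu>_def)
  have \<nu>int: "\<nu> \<notin> \<int>"
  proof
    assume "\<nu> \<in> \<int>"
    then obtain j where j: "\<nu> = of_int j" by (auto elim: Ints_cases)
    hence "\<bar>real_of_int j\<bar> < 1/2" using \<nu> by simp
    hence "j = 0" by linarith
    thus False using j \<nu> by simp
  qed
  note absmu = abs_ge_self[of "Re \<mu>"] abs_ge_minus_self[of "Re \<mu>"]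
  \<comment> \<open>On the left this margin admits only the poles listed in \<open>P n\<close>; on
    the right it keeps Re (w + \<mu>) below 1/2, short of the first pole of the secant on that
    side.\<close>
  define \<epsilon> where "\<epsilon> = 1/4 - \<bar>Re \<mu>\<bar>"
  have \<epsilon>: "\<epsilon> > 0" using \<mu> by (simp add: \<epsilon>_def)
  define S where "S = (\<lambda>n. {z. 1/4 - real (Suc n) - \<epsilon> < Re z \<and> Re z < 1/4 + \<epsilon>})"
  have nonpos: "w + \<mu> \<notin> \<int>\<^sub>\<le>\<^sub>0" "w - \<mu> \<notin> \<int>\<^sub>\<le>\<^sub>0" "cos (of_real pi * (w + \<mu>)) \<noteq> 0" if "w \<in> S n - P n" for w n
  proof -
    show "w + \<mu> \<notin> \<int>\<^sub>\<le>\<^sub>0"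
    proof
      assume "w + \<mu> \<in> \<int>\<^sub>\<le>\<^sub>0"
      moreover have "Re (w + \<mu>) > - real (Suc n)" using that absmu by (simp add: S_def \<epsilon>_def)
      ultimately show False
        by (rule nonpos_Ints_add_cases) (use that in \<open>auto simp: P_def PA_def\<close>)
    qed
    show "w - \<mu> \<notin> \<int>\<^sub>\<le>\<^sub>0"
    proof
      assume "w - \<mu> \<in> \<int>\<^sub>\<le>\<^sub>0"
      hence "w + (- \<mu>) \<in> \<int>\<^sub>\<le>\<^sub>0" by simp
      moreover have "Re (w + (- \<mu>)) > - real (Suc n)" using that absmu by (simp add: S_def \<epsilon>_def)
      ultimately show False
        by (rule nonpos_Ints_add_cases) (use that in \<open>auto simp: P_def PA_def\<close>)
    qed
    show "cos (of_real pi * (w + \<mu>)) \<noteq> 0"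
    proof
      assume "cos (of_real pi * (w + \<mu>)) = 0"
      hence "Gamma (w + \<mu> + 1/2) * Gamma (1/2 - (w + \<mu>)) = 0"
        using cos_pi_as_Gamma[of "w + \<mu>"] by simp
      moreover have "1/2 - (w + \<mu>) \<notin> \<int>\<^sub>\<le>\<^sub>0"
        using that absmu by (intro nonpos_Ints_Re) (simp add: S_def \<epsilon>_def)
      ultimately have "w + (\<mu> + 1/2) \<in> \<int>\<^sub>\<le>\<^sub>0" by (simp add: Gamma_eq_zero_iff add_ac)
      moreover have "Re (w + (\<mu> + 1/2)) > - real (Suc n)" using that absmu by (simp add: S_def \<epsilon>_def)
      ultimately show False
        by (rule nonpos_Ints_add_cases) (use that in \<open>auto simp: P_def PA_def\<close>)
    qed
  qed
  have holo: "F holomorphic_on S n - P n" for n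
    unfolding F_def using nonpos by (intro holomorphic_intros) auto
  obtain C0 where C0: "C0 > 0" "\<And>n t.
    norm (Gamma (Complex (1/4 - real (Suc n)) t + \<mu>) * Gamma (Complex (1/4 - real (Suc n)) t - \<mu>))
      \<le> C0 / fact n * exp (- (3 * pi / 4) * \<bar>t\<bar>)"
    using Gamma_pair_left_line[of \<mu> "1/4"] \<mu> by auto
  have ImL: "Im L = 0" by (simp add: L_def)
  \<comment> \<open>Lower bound for the cosine on every left line at once: the lines differ by
    integers, which changes the real angle by multiples of pi.\<close>
  define \<kappa> where "\<kappa> = \<bar>cos (pi * (1/4 + Re \<mu>))\<bar>"
  have \<kappa>: "\<kappa> > 0"
  proof -
    have "cos (pi * (1/4 + Re \<mu>)) > 0"
      using \<mu> by (intro cos_pi_gt_zero) (auto simp: abs_if split: if_splits)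
    thus ?thesis by (simp add: \<kappa>_def)
  qed
  have main: "integrable lborel (\<lambda>t. F (Complex (1/4) t)) \<and>
    (\<lambda>n. \<Sum>p\<in>P n. residue F p) \<longlonglongrightarrow> (\<integral>t. F (Complex (1/4) t) \<partial>lborel) / (2 * of_real pi)"
  proof (rule line_integral_residue_series[where P = P and b' = "1/4 + \<epsilon>" and a = "\<lambda>n. 1/4 - real (Suc n)" and a' = "\<lambda>n. 1/4 - real (Suc n) - \<epsilon>" and Y = "1 + \<bar>Im \<mu>\<bar>" and d = "3 * pi / 4"
       and K = "\<lambda>n. C0 / \<kappa> * exp (\<bar>Re L\<bar>) ^ Suc n / fact n"])
    fix n
    show "F holomorphic_on {z. 1/4 - real (Suc n) - \<epsilon> < Re z \<and> Re z < 1/4 + \<epsilon>} - P n"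
      using holo[of n] by (simp add: S_def)
    show "1/4 - real (Suc n) < Re p \<and> Re p < 1/4" if "p \<in> P n" for p
      using that \<mu> by (auto simp: P_def PA_def abs_if split: if_splits)
    show "\<exists>C. \<forall>z. 1/4 - real (Suc n) \<le> Re z \<longrightarrow> Re z \<le> 1/4 \<longrightarrow> \<bar>Im z\<bar> \<ge> 1 + \<bar>Im \<mu>\<bar> \<longrightarrow> norm (F z) \<le> C * exp (- (3 * pi / 4) * \<bar>Im z\<bar>)"
    proof -
      obtain C where C: "C > 0" "\<And>w. 1/4 - real (Suc n) \<le> Re w \<Longrightarrow> Re w \<le> 1/4 \<Longrightarrow> \<bar>Im w\<bar> \<ge> 1 + \<bar>Im \<mu>\<bar> \<Longrightarrow>
        norm (Gamma (w + \<mu>) * Gamma (w - \<mu>)) \<le> C * exp (- (3 * pi / 4) * \<bar>Im w\<bar>)"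
        using Gamma_pair_exp_bound_strip[of "1/4 - real (Suc n)" "1/4" \<mu>] by metis
      define R where "R = exp (real (Suc n) * \<bar>Re L\<bar>)"
      have "norm (F z) \<le> C * R * exp (- (3 * pi / 4) * \<bar>Im z\<bar>)"
        if "1/4 - real (Suc n) \<le> Re z" "Re z \<le> 1/4" "\<bar>Im z\<bar> \<ge> 1 + \<bar>Im \<mu>\<bar>" for z
      proof -
        have "norm (exp (- z * L)) \<le> R * exp (\<bar>Im L\<bar> * \<bar>Im z\<bar>)"
          unfolding R_def using that by (intro norm_exp_neg_mult_le) auto
        hence e: "norm (exp (- z * L)) \<le> R" by (simp add: ImL)
        have "pi * 1 \<le> pi * \<bar>Im (z + \<mu>)\<bar>" using that by (intro mult_left_mono) auto
        hence "2 \<le> pi * \<bar>Im (z + \<mu>)\<bar>" using pi_ge_two by linarith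
        hence "\<bar>Im (of_real pi * (z + \<mu>))\<bar> \<ge> 2" by (simp add: abs_mult)
        from norm_cos_ge_1[OF this] have "norm (1 / cos (of_real pi * (z + \<mu>))) \<le> 1"
          by (simp add: norm_divide divide_simps)
        hence "norm (F z) \<le> (C * exp (- (3 * pi / 4) * \<bar>Im z\<bar>)) * 1 * R"
          unfolding F_def norm_mult[of "_ * (1 / _)"] norm_mult[of "Gamma _ * Gamma _"] using C e that
          by (intro mult_mono) auto
        thus ?thesis by (simp add: mult_ac)
      qed
      thus ?thesis by blast
    qed
    fix t
    let ?w = "Complex (1/4 - real (Suc n)) t"
    have "norm (exp (- ?w * L)) \<le> exp (real (Suc n) * \<bar>Re L\<bar>) * exp (\<bar>Im L\<bar> * \<bar>Im ?w\<bar>)"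
      by (rule norm_exp_neg_mult_le) simp
    hence e: "norm (exp (- ?w * L)) \<le> exp (real (Suc n) * \<bar>Re L\<bar>)" by (simp add: ImL)
    have "\<kappa> = \<bar>cos (Re (of_real pi * (?w + \<mu>)))\<bar>"
    proof -
      have "Re (of_real pi * (?w + \<mu>)) = pi * (1/4 + Re \<mu>) - of_nat (Suc n) * pi" by (simp add: algebra_simps)
      moreover have "\<bar>cos (a - of_nat k * pi)\<bar> = \<bar>cos a\<bar>" for a :: real and k :: nat
        by (simp add: cos_diff cos_npi sin_npi abs_mult power_abs)
      ultimately show ?thesis unfolding \<kappa>_def by presburger
    qed
    also have "\<dots> \<le> norm (cos (of_real pi * (?w + \<mu>)))" by (rule norm_cos_ge_cos_Re)
    finally have "norm (1 / cos (of_real pi * (?w + \<mu>))) \<le> 1 / \<kappa>"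
      using \<kappa> by (simp only: norm_divide norm_one) (intro divide_left_mono mult_pos_pos, auto)
    hence "norm (F ?w) \<le> (C0 / fact n * exp (- (3 * pi / 4) * \<bar>t\<bar>)) * (1 / \<kappa>) * exp (real (Suc n) * \<bar>Re L\<bar>)"
      unfolding F_def norm_mult[of "_ * (1 / _)"] norm_mult[of "Gamma _ * Gamma _"]
      using C0(1) C0(2)[of n t] e \<kappa> by (intro mult_mono) auto
    also have "exp (real (Suc n) * \<bar>Re L\<bar>) = exp (\<bar>Re L\<bar>) ^ Suc n" by (rule exp_of_nat_mult)
    finally show "norm (F ?w) \<le> C0 / \<kappa> * exp (\<bar>Re L\<bar>) ^ Suc n / fact n * exp (- (3 * pi / 4) * \<bar>t\<bar>)" by (simp add: mult_ac)
  next
    show "(\<lambda>n. C0 / \<kappa> * exp \<bar>Re L\<bar> ^ Suc n / fact n) \<longlonglongrightarrow> 0" by (rule power_div_fact_tendsto_0)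
  qed (use \<epsilon> in \<open>auto simp: P_def PA_def\<close>)
  have eL: "exp L = of_real x ^ 2 / 4"
  proof -
    have "exp L = of_real (exp (ln (x/2)) ^ 2)" unfolding L_def exp_of_real by (simp only: exp_double)
    also have "\<dots> = of_real x ^ 2 / 4" using x by (simp add: power_divide)
    finally show ?thesis .
  qed
  have ep: "exp (m * L) = (of_real x / 2) powr (2 * m)" for m
  proof -
    have "Ln (of_real x / 2) = complex_of_real (ln (x / 2))" using Ln_of_real[of "x/2"] x by simp
    thus ?thesis using x by (simp add: L_def powr_def mult_ac)
  qed
  have cos\<nu>: "cos (of_real pi * \<nu>) \<noteq> 0" by (rule cos_pi_nonzero) (rule \<nu>)
  \<comment> \<open>Up to the sign (-1)^k this is the cosine at the pole -m - k: 1 for m = \<mu> and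
    cos (pi \<nu>) for m = -\<mu>. The sign is what turns a series of type I into one of type
    J.\<close>
  define \<gamma> where "\<gamma> = (\<lambda>m. cos (of_real pi * (\<mu> - m)))"
  have \<gamma>: "\<gamma> m \<noteq> 0" if "m = \<mu> \<or> m = - \<mu>" for m using that cos\<nu> by (auto simp: \<gamma>_def \<mu>_def)
  have inS: "p \<in> S k" if "p \<in> {- \<mu> - of_nat k, \<mu> - of_nat k, - (\<mu> + 1/2) - of_nat k}" for p k
    using that \<mu> \<epsilon> by (auto simp: S_def \<epsilon>_def abs_if split: if_splits)
  have finP: "finite (P n)" for n by (simp add: P_def PA_def)
  have res: "residue F (- m - of_nat k) = of_real pi / sin (of_real pi * (- 2 * m)) / \<gamma> m * ((- exp L) ^ k * rGamma (2 * m + of_nat k + 1) / fact k) * exp (m * L)"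
    if m: "m = \<mu> \<or> m = - \<mu>" for m k
  proof -
    have "- 2 * m = - \<nu> \<or> - 2 * m = \<nu>" using m by (auto simp: \<mu>_def)
    hence m2: "- 2 * m \<notin> \<int>" using \<nu>int by (auto simp: minus_in_Ints_iff)
    have "- 2 * m - of_nat k \<notin> \<int>\<^sub>\<le>\<^sub>0"
    proof
      assume "- 2 * m - of_nat k \<in> \<int>\<^sub>\<le>\<^sub>0"
      hence "- 2 * m - of_nat k \<in> \<int>" by (rule nonpos_Ints_subset_Ints[THEN subsetD])
      hence "- 2 * m - of_nat k + of_nat k \<in> \<int>" by (intro Ints_add) auto
      thus False using m2 by simp
    qed
    moreover have c: "cos (of_real pi * (- m - of_nat k + \<mu>)) = (-1) ^ k * \<gamma> m"
      using cos_complex_minus_nat_pi[of "\<mu> - m" k] by (simp add: \<gamma>_def algebra_simps)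
    ultimately have lim: "((\<lambda>w. Gamma (w + m) * (w - (- m - of_nat k)) * (Gamma (w - m) * (1 / cos (of_real pi * (w + \<mu>))) * exp (- w * L))) \<longlongrightarrow>
      (-1) ^ k / fact k * (Gamma (- m - of_nat k - m) * (1 / cos (of_real pi * (- m - of_nat k + \<mu>))) * exp (- (- m - of_nat k) * L))) (at (- m - of_nat k))"
      using \<gamma>[OF m] by (intro tendsto_mult[OF Gamma_pole_limit] tendsto_intros) auto
    have "residue F (- m - of_nat k) = (-1) ^ k / fact k * (Gamma (- m - of_nat k - m) * (1 / cos (of_real pi * (- m - of_nat k + \<mu>))) * exp (- (- m - of_nat k) * L))"
    proof (rule residue_of_limit[OF _ _ holo[of k] finP])
      show "open (S k)" unfolding S_def by (rule open_vertical_strip)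
      show "- m - of_nat k \<in> S k" using m by (intro inS) auto
      show "((\<lambda>w. F w * (w - (- m - of_nat k))) \<longlongrightarrow> (-1) ^ k / fact k * (Gamma (- m - of_nat k - m) * (1 / cos (of_real pi * (- m - of_nat k + \<mu>))) * exp (- (- m - of_nat k) * L))) (at (- m - of_nat k))"
        using lim m by (auto simp: F_def mult_ac)
    qed
    also have "exp (- (- m - of_nat k) * L) = exp (m * L) * exp L ^ k"
      by (simp add: exp_of_nat_mult[symmetric] algebra_simps flip: exp_add)
    also have "Gamma (- m - of_nat k - m) = Gamma (- 2 * m - of_nat k)"
      by (rule arg_cong[where f = Gamma]) (simp add: algebra_simps)
    also have "\<dots> = (-1) ^ k * of_real pi / sin (of_real pi * (- 2 * m)) * rGamma (1 - (- 2 * m) + of_nat k)"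
      by (rule Gamma_minus_nat[OF m2])
    also have "1 - (- 2 * m) + of_nat k = 2 * m + of_nat k + 1" by simp
    also note c
    finally show ?thesis by (cases "even k") (simp_all add: mult_ac)
  qed
  \<comment> \<open>At a pole of the secant the two Gamma factors of the integrand are regular;
    reflection brings both into \<open>rGamma\<close> form, and the second half of the secant
    contributes k!.\<close>
  have resB: "residue F (- (\<mu> + 1/2) - of_nat k) = of_real pi / cos (of_real pi * \<nu>) * rGamma (3/2 + of_nat k) *
       rGamma (\<nu> + 3/2 + of_nat k) * (- exp L) ^ k * exp ((\<mu> + 1/2) * L)" for k
  proof -
    let ?p = "- (\<mu> + 1/2) - of_nat k :: complex"
    have half: "(1/2 :: complex) \<notin> \<int>"
      using fraction_not_in_Ints[where 'a = complex, of 2 1] by simp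
    have half\<nu>: "1/2 - \<nu> \<notin> \<int>"
    proof
      assume "1/2 - \<nu> \<in> \<int>"
      then obtain j where "1/2 - \<nu> = of_int j" by (auto elim: Ints_cases)
      hence "Re (1/2 - \<nu>) = real_of_int j" by simp
      hence "0 < real_of_int j" "real_of_int j < 1" using \<nu>(1) by (auto simp: abs_if split: if_splits)
      thus False by simp
    qed
    have G1: "Gamma (?p + \<mu>) = (-1) ^ Suc k * of_real pi * rGamma (3/2 + of_nat k)"
    proof -
      have "?p + \<mu> = 1/2 - of_nat (Suc k)" "1 - 1/2 + of_nat (Suc k) = (3/2 + of_nat k :: complex)" by (simp_all add: field_simps)
      moreover have "sin (of_real pi * (1/2)) = (1 :: complex)"
        using sin_of_real[of "pi / 2", where 'a = complex] by simp
      ultimately show ?thesis using Gamma_minus_nat[OF half, of "Suc k"] by simp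
    qed
    have G2: "Gamma (?p - \<mu>) = (-1) ^ Suc k * of_real pi / cos (of_real pi * \<nu>) * rGamma (\<nu> + 3/2 + of_nat k)"
    proof -
      have "?p - \<mu> = 1/2 - \<nu> - of_nat (Suc k)" "1 - (1/2 - \<nu>) + of_nat (Suc k) = (\<nu> + 3/2 + of_nat k :: complex)"
        by (simp_all add: field_simps \<mu>_def)
      moreover have "sin (of_real pi * (1/2 - \<nu>)) = cos (of_real pi * \<nu>)"
        using sin_diff[of "of_real (pi/2)" "of_real pi * \<nu>"] sin_of_real[of "pi / 2", where 'a = complex] cos_of_real[of "pi / 2", where 'a = complex]
        by (simp add: algebra_simps)
      ultimately show ?thesis using Gamma_minus_nat[OF half\<nu>, of "Suc k"] by (simp only:)
    qed
    have n1: "?p + \<mu> \<notin> \<int>\<^sub>\<le>\<^sub>0" "?p - \<mu> \<notin> \<int>\<^sub>\<le>\<^sub>0"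
    proof -
      have *: "z - of_nat (Suc k) \<notin> \<int>\<^sub>\<le>\<^sub>0" if "z \<notin> \<int>" for z :: complex
      proof
        assume "z - of_nat (Suc k) \<in> \<int>\<^sub>\<le>\<^sub>0"
        hence "z - of_nat (Suc k) \<in> \<int>" by (rule nonpos_Ints_subset_Ints[THEN subsetD])
        hence "z - of_nat (Suc k) + of_nat (Suc k) \<in> \<int>" by (intro Ints_add) auto
        thus False using that by simp
      qed
      have "?p + \<mu> = 1/2 - of_nat (Suc k)" "?p - \<mu> = 1/2 - \<nu> - of_nat (Suc k)" by (simp_all add: field_simps \<mu>_def)
      thus "?p + \<mu> \<notin> \<int>\<^sub>\<le>\<^sub>0" "?p - \<mu> \<notin> \<int>\<^sub>\<le>\<^sub>0" using *[OF half] *[OF half\<nu>] by (simp_all only: not_False_eq_True)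
    qed
    have G3: "Gamma (1/2 - (?p + \<mu>)) = fact k"
      using Gamma_fact[of k, where 'a = complex] by (simp add: add_ac)
    have n3: "1/2 - (?p + \<mu>) \<notin> \<int>\<^sub>\<le>\<^sub>0" by (rule nonpos_Ints_Re) simp
    have lim: "((\<lambda>w. Gamma (w + (\<mu> + 1/2)) * (w - ?p) * (Gamma (1/2 - (w + \<mu>)) / of_real pi * (Gamma (w + \<mu>) * Gamma (w - \<mu>)) * exp (- w * L))) \<longlongrightarrow>
      (-1) ^ k / fact k * (Gamma (1/2 - (?p + \<mu>)) / of_real pi * (Gamma (?p + \<mu>) * Gamma (?p - \<mu>)) * exp (- ?p * L))) (at ?p)"
      using n1 n3 by (intro tendsto_mult[OF Gamma_pole_limit] tendsto_intros) auto
    have "residue F ?p = (-1) ^ k / fact k * (Gamma (1/2 - (?p + \<mu>)) / of_real pi * (Gamma (?p + \<mu>) * Gamma (?p - \<mu>)) * exp (- ?p * L))"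
    proof (rule residue_of_limit[OF _ _ holo[of k] finP])
      show "open (S k)" unfolding S_def by (rule open_vertical_strip)
      show "?p \<in> S k" by (intro inS) auto
      have "F w = Gamma (w + (\<mu> + 1/2)) * (Gamma (1/2 - (w + \<mu>)) / of_real pi * (Gamma (w + \<mu>) * Gamma (w - \<mu>)) * exp (- w * L))" for w
        unfolding F_def cos_pi_as_Gamma by (simp add: mult_ac add_ac)
      thus "((\<lambda>w. F w * (w - ?p)) \<longlongrightarrow> (-1) ^ k / fact k * (Gamma (1/2 - (?p + \<mu>)) / of_real pi * (Gamma (?p + \<mu>) * Gamma (?p - \<mu>)) * exp (- ?p * L))) (at ?p)"
        using lim by (simp add: mult_ac)
    qed
    also have "exp (- ?p * L) = exp ((\<mu> + 1/2) * L) * exp L ^ k"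
      by (simp add: exp_of_nat_mult[symmetric] algebra_simps flip: exp_add)
    finally show ?thesis unfolding G1 G2 G3
      by (cases "even k") (simp_all add: mult_ac)
  qed
  \<comment> \<open>Equality of the first two families would make \<nu> an integer; the first and
    third differ by a half-integer; the second and third meet only if \<nu> is an integer minus 1/2,
    which |Re \<nu>| < 1/2 excludes.\<close>
  have disj: "PA \<mu> n \<inter> PA (- \<mu>) n = {}" "(PA \<mu> n \<union> PA (- \<mu>) n) \<inter> PA (\<mu> + 1/2) n = {}" for n
  proof -
    have False if "- \<mu> - of_nat k = - (- \<mu>) - of_nat j" for j k
    proof -
      have "of_nat j - of_nat k = \<mu> + \<mu> + ((- \<mu> - of_nat k) - (- (- \<mu>) - of_nat j))" by (simp add: algebra_simps)
      hence "of_nat j - of_nat k = \<mu> + \<mu>" by (simp only: that diff_self add_0_right)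
      hence "\<nu> = of_nat j - of_nat k" by (simp add: \<mu>_def)
      thus False using \<nu>int by auto
    qed
    moreover have False if "- \<mu> - of_nat k = - (\<mu> + 1/2) - of_nat j" for j k
    proof -
      have "Re (- \<mu> - of_nat k) = Re (- (\<mu> + 1/2) - of_nat j)" using that by (simp only:)
      hence "2 * (real k - real j) = 1" by (simp add: field_simps)
      hence "real_of_int (2 * (int k - int j)) = real_of_int 1" by simp
      hence "2 * (int k - int j) = 1" by (simp only: of_int_eq_iff)
      thus False by presburger
    qed
    moreover have False if "- (- \<mu>) - of_nat k = - (\<mu> + 1/2) - of_nat j" for j k
    proof -
      have "Re (- (- \<mu>) - of_nat k) = Re (- (\<mu> + 1/2) - of_nat j)" using that by (simp only:)
      hence "2 * Re \<mu> = real_of_int (int k - int j) - 1/2" by (simp add: field_simps)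
      hence "\<bar>real_of_int (int k - int j) - 1/2\<bar> < 1/2" using \<mu> by linarith
      hence "real_of_int (int k - int j) < 1" "0 < real_of_int (int k - int j)" by linarith+
      thus False by simp
    qed
    ultimately show "PA \<mu> n \<inter> PA (- \<mu>) n = {}" "(PA \<mu> n \<union> PA (- \<mu>) n) \<inter> PA (\<mu> + 1/2) n = {}"
      unfolding PA_def by blast+
  qed
  define A where "A = (\<lambda>m. of_real pi / sin (of_real pi * (- 2 * m)) / \<gamma> m * (\<Sum>k. (- exp L) ^ k * rGamma (2 * m + of_nat k + 1) / fact k) * exp (m * L))"
  have Alim: "(\<lambda>n. \<Sum>k\<le>n. residue F (- m - of_nat k)) \<longlonglongrightarrow> A m" if "m = \<mu> \<or> m = - \<mu>" for m
  proof -
    have "(\<lambda>k. of_real pi / sin (of_real pi * (- 2 * m)) / \<gamma> m * ((- exp L) ^ k * rGamma (2 * m + of_nat k + 1) / fact k) * exp (m * L)) sums A m"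
      unfolding A_def by (intro sums_mult sums_mult2 summable_sums summable_bessel)
    thus ?thesis unfolding res[OF that] sums_def_le .
  qed
  define I where "I = (\<integral>t. F (Complex (1/4) t) \<partial>lborel) / (2 * of_real pi)"
  have "(\<Sum>p\<in>P n. residue F p) = (\<Sum>k\<le>n. residue F (- \<mu> - of_nat k)) + (\<Sum>k\<le>n. residue F (- (- \<mu>) - of_nat k)) +
     (\<Sum>k\<le>n. residue F (- (\<mu> + 1/2) - of_nat k))" for n
  proof -
    have "sum (residue F) (P n) = sum (residue F) (PA \<mu> n \<union> PA (- \<mu>) n) + sum (residue F) (PA (\<mu> + 1/2) n)"
      unfolding P_def by (rule sum.union_disjoint) (use disj in \<open>auto simp: PA_def\<close>)
    also have "sum (residue F) (PA \<mu> n \<union> PA (- \<mu>) n) = sum (residue F) (PA \<mu> n) + sum (residue F) (PA (- \<mu>) n)"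
      by (rule sum.union_disjoint) (use disj in \<open>auto simp: PA_def\<close>)
    finally show ?thesis unfolding PA_def sum_image_nat_shift .
  qed
  with main have "(\<lambda>n. (\<Sum>k\<le>n. residue F (- \<mu> - of_nat k)) + (\<Sum>k\<le>n. residue F (- (- \<mu>) - of_nat k)) +
     (\<Sum>k\<le>n. residue F (- (\<mu> + 1/2) - of_nat k))) \<longlonglongrightarrow> I" by (simp only: I_def)
  \<comment> \<open>The secant family converges because the total and the two Bessel families do;
    its sum need not be estimated directly.\<close>
  from tendsto_diff[OF this tendsto_add[OF Alim[of \<mu>] Alim[of "- \<mu>"]]]
  have B: "(\<lambda>k. residue F (- (\<mu> + 1/2) - of_nat k)) sums (I - (A \<mu> + A (- \<mu>)))"
    unfolding sums_def_le by simp
  \<comment> \<open>\<open>pref\<close> normalises the residue sum to S, and \<open>c1\<close> is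
    the prefactor of \<open>lommel_s\<close> at equal indices.\<close>
  define pref where "pref = 2 powr (\<nu> - 1) * of_real (sqrt pi) * rGamma (1/2 - \<nu>)"
  define c1 where "c1 = of_real x powr (\<nu> + 1) / (2 * \<nu> + 1)"
  have rG: "rGamma (1/2 - \<nu>) * rGamma (1/2 + \<nu>) = cos (of_real pi * \<nu>) / of_real pi"
  proof -
    have "sin (of_real pi * (1/2 - \<nu>)) = cos (of_real pi * \<nu>)"
      using sin_diff[of "of_real (pi/2)" "of_real pi * \<nu>"] sin_of_real[of "pi / 2", where 'a = complex] cos_of_real[of "pi / 2", where 'a = complex]
      by (simp add: algebra_simps)
    thus ?thesis using rGamma_reflection_complex[of "1/2 - \<nu>"] by simp
  qed
  have \<nu>1: "2 * \<nu> + 1 \<noteq> 0"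
  proof
    assume "2 * \<nu> + 1 = 0"
    hence "Re (2 * \<nu> + 1) = 0" by simp
    thus False using \<nu>(1) by simp
  qed
  have npoch: "pochhammer (3/2 :: complex) k \<noteq> 0" "pochhammer (\<nu> + 3/2) k \<noteq> 0" for k
  proof -
    have "pochhammer z k \<noteq> 0" if "Re z > 0" for z :: complex
      using nonpos_Ints_Re[OF that] by (auto simp: pochhammer_eq_0_iff)
    thus "pochhammer (3/2 :: complex) k \<noteq> 0" "pochhammer (\<nu> + 3/2) k \<noteq> 0" using \<nu>(1) by auto
  qed
  have summand: "pref * residue F (- (\<mu> + 1/2) - of_nat k) =
     c1 * (pochhammer 1 k / (pochhammer (3/2) k * pochhammer (\<nu> + 3/2) k) * ((- (of_real x ^ 2 / 4)) ^ k / fact k))" for k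
  proof -
    have g1: "rGamma (3/2 + of_nat k) = (2 :: complex) / of_real (sqrt pi) / pochhammer (3/2) k"
    proof -
      have "rGamma (3/2 + of_nat k) = rGamma (3/2 :: complex) / pochhammer (3/2) k"
        using rGamma_plus_nat[of "3/2" k] npoch(1)[of k] by (simp add: field_simps)
      moreover have "rGamma (3/2 :: complex) = 2 / of_real (sqrt pi)"
      proof -
        have "rGamma (1/2 :: complex) = 1 / of_real (sqrt pi)"
          by (simp add: rGamma_inverse_Gamma Gamma_one_half_complex inverse_eq_divide)
        moreover have "1/2 * rGamma (3/2 :: complex) = rGamma (1/2)"
          using rGamma_plus1[of "1/2 :: complex"] by simp
        ultimately show ?thesis by simp
      qed
      ultimately show ?thesis by simp
    qed
    have g2: "rGamma (\<nu> + 3/2 + of_nat k) = 2 * rGamma (1/2 + \<nu>) / (2 * \<nu> + 1) / pochhammer (\<nu> + 3/2) k"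
    proof -
      have "rGamma (\<nu> + 3/2 + of_nat k) = rGamma (\<nu> + 3/2) / pochhammer (\<nu> + 3/2) k"
        using rGamma_plus_nat[of "\<nu> + 3/2" k] npoch(2)[of k] by (simp add: field_simps)
      moreover have "(1/2 + \<nu>) * rGamma (\<nu> + 3/2) = rGamma (1/2 + \<nu>)"
        using rGamma_plus1[of "1/2 + \<nu>"] by (simp add: add_ac)
      hence "rGamma (\<nu> + 3/2) = 2 * rGamma (1/2 + \<nu>) / (2 * \<nu> + 1)"
        using \<nu>1 by (simp add: field_simps)
      ultimately show ?thesis by simp
    qed
    have g3: "2 powr (\<nu> - 1) * exp ((\<mu> + 1/2) * L) = of_real x powr (\<nu> + 1) / 4"
    proof -
      have "exp ((\<mu> + 1/2) * L) = (of_real x / 2) powr (\<nu> + 1)"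
        using ep[of "\<mu> + 1/2"] by (simp add: \<mu>_def ring_distribs)
      also have "\<dots> = of_real x powr (\<nu> + 1) / 2 powr (\<nu> + 1)"
      proof -
        have "Ln (of_real x / 2) = complex_of_real (ln (x / 2))" using Ln_of_real[of "x/2"] x by simp
        moreover have "Ln 2 = complex_of_real (ln 2)" using Ln_of_real[of 2] by simp
        ultimately show ?thesis using x
          by (simp add: powr_def Ln_of_real ln_div right_diff_distrib exp_diff)
      qed
      also have "2 powr (\<nu> - 1) * \<dots> = of_real x powr (\<nu> + 1) / 4"
      proof -
        have "(2 :: complex) powr (\<nu> + 1) = 2 powr (\<nu> - 1) * 2 powr 2"
          unfolding powr_add[symmetric] by (rule arg_cong[where f = "(powr) 2"]) simp
        also have "(2 :: complex) powr 2 = 4" by (simp add: powr_numeral)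
        finally show ?thesis by simp
      qed
      finally show ?thesis by simp
    qed
    have "pref * residue F (- (\<mu> + 1/2) - of_nat k) =
      (2 powr (\<nu> - 1) * exp ((\<mu> + 1/2) * L)) * (rGamma (1/2 - \<nu>) * rGamma (1/2 + \<nu>)) * (of_real (sqrt pi) / of_real (sqrt pi)) *
      of_real pi / cos (of_real pi * \<nu>) * 4 / (2 * \<nu> + 1) / (pochhammer (3/2) k * pochhammer (\<nu> + 3/2) k) * (- exp L) ^ k"
      unfolding pref_def resB g1 g2 by (simp add: mult_ac)
    also have "\<dots> = c1 / (pochhammer (3/2) k * pochhammer (\<nu> + 3/2) k) * (- exp L) ^ k"
      unfolding g3 rG c1_def using cos\<nu> by simp
    finally show ?thesis by (simp add: eL flip: pochhammer_fact)
  qed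
  have "c1 \<noteq> 0" using x \<nu>1 by (simp add: c1_def)
  from sums_divide[OF sums_mult[OF B, of pref], of c1] have "(\<lambda>k. pochhammer 1 k / (pochhammer (3/2) k * pochhammer (\<nu> + 3/2) k) * ((- (of_real x ^ 2 / 4)) ^ k / fact k))
     sums (pref * (I - (A \<mu> + A (- \<mu>))) / c1)"
    by (simp only: summand nonzero_mult_div_cancel_left[OF \<open>c1 \<noteq> 0\<close>])
  hence hyp: "hyp_1F2 1 (3/2) (\<nu> + 3/2) (- (of_real x ^ 2 / 4)) = pref * (I - (A \<mu> + A (- \<mu>))) / c1"
    unfolding hyp_1F2_def by (rule sums_unique[symmetric])
  have args: "(\<nu> - \<nu> + 3) / 2 = 3/2" "(\<nu> + \<nu> + 3) / 2 = \<nu> + 3/2" "(\<nu> - \<nu> + 1) * (\<nu> + \<nu> + 1) = 2 * \<nu> + 1"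
    by (simp_all add: field_simps)
  have "lommel_s \<nu> \<nu> (of_real x) = c1 * (pref * (I - (A \<mu> + A (- \<mu>))) / c1)"
    unfolding hyp[symmetric] by (simp only: lommel_s_def args c1_def)
  also have "\<dots> = pref * (I - (A \<mu> + A (- \<mu>)))" using \<open>c1 \<noteq> 0\<close> by simp
  finally have ls: "lommel_s \<nu> \<nu> (of_real x) = pref * I - pref * A \<mu> - pref * A (- \<mu>)"
    by (simp add: algebra_simps)
  have J: "bessel_J (2 * m) (of_real x) = exp (m * L) * (\<Sum>k. (- exp L) ^ k * rGamma (2 * m + of_nat k + 1) / fact k)" for m
    unfolding bessel_J_def ep eL by (simp add: power_minus[of "_ / 4"])
  \<comment> \<open>Reflection trades \<open>rGamma (1/2 - \<nu>)\<close> for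
    \<open>Gamma (\<nu> + 1/2)\<close>, the form in which the definition of S carries its Bessel
    coefficients.\<close>
  have pG: "pref * of_real pi / cos (of_real pi * \<nu>) = 2 powr (\<nu> - 1) * Gamma (1/2) * Gamma (\<nu> + 1/2)"
  proof -
    have "\<nu> + 1/2 \<notin> \<int>\<^sub>\<le>\<^sub>0" using \<nu>(1) by (intro nonpos_Ints_Re) auto
    hence g: "rGamma (1/2 + \<nu>) * Gamma (\<nu> + 1/2) = 1"
      by (simp add: rGamma_inverse_Gamma Gamma_eq_zero_iff add.commute)
    have "rGamma (1/2 - \<nu>) = rGamma (1/2 - \<nu>) * (rGamma (1/2 + \<nu>) * Gamma (\<nu> + 1/2))" by (simp only: g mult_1_right)
    also have "\<dots> = cos (of_real pi * \<nu>) / of_real pi * Gamma (\<nu> + 1/2)" by (simp only: rG mult.assoc[symmetric])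
    finally show ?thesis unfolding pref_def using cos\<nu> by (simp add: Gamma_one_half_complex)
  qed
  have sn: "sin (of_real pi * \<nu>) \<noteq> 0" using \<nu>int by (auto simp: sin_eq_0 Ints_def)
  have AJ: "A m = of_real pi / sin (of_real pi * (- 2 * m)) / \<gamma> m * bessel_J (2 * m) (of_real x)" for m
    unfolding A_def J by (simp add: mult_ac)
  have \<mu>2: "2 * \<mu> = \<nu>" "2 * (- \<mu>) = - \<nu>" "- 2 * \<mu> = - \<nu>" "- 2 * (- \<mu>) = \<nu>" "\<gamma> \<mu> = 1" "\<gamma> (- \<mu>) = cos (of_real pi * \<nu>)"
    by (simp_all add: \<mu>_def \<gamma>_def)
  have A1: "pref * A \<mu> = - (2 powr (\<nu> - 1) * Gamma (1/2) * Gamma (\<nu> + 1/2)) / sin (\<nu> * of_real pi) * cos (\<nu> * of_real pi) * bessel_J \<nu> (of_real x)"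
    unfolding AJ \<mu>2 pG[symmetric] mult.commute[of \<nu> "of_real pi"] using cos\<nu> by (simp add: mult_ac)
  have A2: "pref * A (- \<mu>) = 2 powr (\<nu> - 1) * Gamma (1/2) * Gamma (\<nu> + 1/2) / sin (\<nu> * of_real pi) * bessel_J (- \<nu>) (of_real x)"
    unfolding AJ \<mu>2 pG[symmetric] mult.commute[of \<nu> "of_real pi"] by (simp add: mult_ac)
  have args': "(\<nu> + \<nu> + 1) / 2 = \<nu> + 1/2" "(\<nu> - \<nu> + 1) / 2 = 1/2" "cos ((\<nu> - \<nu>) * of_real pi / 2) = 1"
    "(\<nu> + \<nu>) * of_real pi / 2 = \<nu> * of_real pi" by (simp_all add: field_simps)
  have "lommel_S \<nu> \<nu> (of_real x) = lommel_s \<nu> \<nu> (of_real x) + pref * A (- \<mu>) + pref * A \<mu>"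
    unfolding lommel_S_def A1 A2 args' if_not_P[OF \<nu>int] by (simp add: right_diff_distrib diff_divide_distrib mult_ac)
  also have "\<dots> = pref * I" by (simp add: ls)
  finally show ?thesis by (simp add: I_def pref_def F_def lommel_MB_integrand_def Let_def \<mu>_def L_def)
qed

section \<open>Gamma and Beta integrals on the positive half-line\<close>

lemma lborel_set_integral_scale:
  fixes f :: "real \<Rightarrow> complex" and a :: real
  assumes a: "a > 0"
  shows "(LINT x:{0<..}|lborel. f (a * x)) = (LINT x:{0<..}|lborel. f x) / of_real a"
    and "set_integrable lborel {0<..} f \<Longrightarrow> set_integrable lborel {0<..} (\<lambda>x. f (a * x))"
proof -
  have ind: "indicator {0<..} (a * x) = (indicator {0<..} x :: real)" for x
    using a by (auto simp: indicator_def zero_less_mult_iff)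
  show "(LINT x:{0<..}|lborel. f (a * x)) = (LINT x:{0<..}|lborel. f x) / of_real a"
    using lborel_integral_real_affine[of a "\<lambda>x. indicator {0<..} x *\<^sub>R f x" 0] a
    by (simp add: set_lebesgue_integral_def ind scaleR_conv_of_real)
  show "set_integrable lborel {0<..} f \<Longrightarrow> set_integrable lborel {0<..} (\<lambda>x. f (a * x))"
    using lborel_integrable_real_affine[of "\<lambda>x. indicator {0<..} x *\<^sub>R f x" a 0] a
    by (simp add: set_integrable_def ind)
qed

lemma norm_of_real_powr: "t > 0 \<Longrightarrow> norm (complex_of_real t powr z) = t powr Re z"
  by (simp add: norm_powr_real_powr)

lemma of_real_mult_powr:
  assumes "a > 0" "b > 0"
  shows "complex_of_real (a * b) powr z = of_real a powr z * of_real b powr z"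
proof -
  have "a * b \<noteq> 0" using assms by simp
  thus ?thesis using assms
    by (simp add: powr_def Ln_of_real ln_mult algebra_simps flip: exp_add of_real_mult)
qed

lemma Gamma_set_integral:
  fixes z :: complex and a :: real
  assumes z: "Re z > 0" and a: "a > 0"
  shows "set_integrable lborel {0<..} (\<lambda>x. of_real x powr (z - 1) * of_real (exp (- (a * x))))"
    and "(LINT x:{0<..}|lborel. of_real x powr (z - 1) * of_real (exp (- (a * x)))) = Gamma z * of_real a powr (- z)"
proof -
  have m: "(\<lambda>t. indicator {0<..} t *\<^sub>R (complex_of_real t powr (z - 1) / of_real (exp (a * t)))) \<in> borel_measurable lborel" for a :: real
    by measurable
  have i: "set_integrable lborel {0<..} (\<lambda>t. complex_of_real t powr (z - 1) / of_real (exp (a * t)))" if "a > 0" for a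
    using absolutely_integrable_Gamma_integral[OF z that] integrable_completion[OF m]
    unfolding set_integrable_def by blast
  thus "set_integrable lborel {0<..} (\<lambda>x. of_real x powr (z - 1) * of_real (exp (- (a * x))))"
    using i[OF a] by (simp add: exp_minus field_simps)
  have g1: "(LINT x:{0<..}|lborel. of_real x powr (z - 1) / of_real (exp x)) = Gamma z"
    using set_borel_integral_eq_integral(2)[of "{0<..}" "\<lambda>t. complex_of_real t powr (z - 1) / of_real (exp t)"]
      i[of 1] integral_unique[OF Gamma_integral_complex'[OF z]] by simp
  have "(LINT x:{0<..}|lborel. of_real x powr (z - 1) * of_real (exp (- (a * x)))) =
     (LINT x:{0<..}|lborel. of_real a powr (1 - z) * (of_real (a * x) powr (z - 1) / of_real (exp (a * x))))"
  proof (intro set_lebesgue_integral_cong allI impI)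
    fix x :: real assume "x \<in> {0<..}"
    hence "of_real (a * x) powr (z - 1) = of_real a powr (z - 1) * complex_of_real x powr (z - 1)"
      using a by (intro of_real_mult_powr) auto
    moreover have "of_real a powr (1 - z) * of_real a powr (z - 1) = (1 :: complex)"
      using a by (simp flip: powr_add)
    ultimately show "of_real x powr (z - 1) * of_real (exp (- (a * x))) =
        of_real a powr (1 - z) * (of_real (a * x) powr (z - 1) / complex_of_real (exp (a * x)))"
      by (simp add: exp_minus field_simps)
  qed auto
  also have "\<dots> = of_real a powr (1 - z) * (LINT x:{0<..}|lborel. of_real (a * x) powr (z - 1) / of_real (exp (a * x)))"
    by (rule set_integral_mult_right)
  also have "\<dots> = of_real a powr (1 - z) * (Gamma z / of_real a)"
    using lborel_set_integral_scale(1)[OF a, of "\<lambda>x. of_real x powr (z - 1) / of_real (exp x)"] by (simp only: g1)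
  also have "of_real a powr (1 - z) = of_real a * complex_of_real a powr (- z)"
    using a powr_add[of "complex_of_real a" 1 "- z"] by simp
  finally show "(LINT x:{0<..}|lborel. of_real x powr (z - 1) * of_real (exp (- (a * x)))) = Gamma z * of_real a powr (- z)"
    using a by simp
qed

text \<open>The modulus of a complex power of a positive base depends only on the real part of the
  exponent, so the norm integral is again a Gamma integral. Exact values make the hypotheses of
  Fubini immediate.\<close>

lemma Gamma_set_integral_norm:
  fixes z :: complex and a :: real
  assumes z: "Re z > 0" and a: "a > 0"
  shows "(LINT x:{0<..}|lborel. norm (of_real x powr (z - 1) * of_real (exp (- (a * x))) :: complex)) = Gamma (Re z) * a powr (- Re z)"
proof -
  have "complex_of_real (LINT x:{0<..}|lborel. norm (of_real x powr (z - 1) * of_real (exp (- (a * x))) :: complex)) =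
    (LINT x:{0<..}|lborel. of_real (norm (of_real x powr (z - 1) * of_real (exp (- (a * x))) :: complex)))"
    by (rule set_integral_complex_of_real[symmetric])
  also have "\<dots> = (LINT x:{0<..}|lborel. of_real x powr (of_real (Re z) - 1) * of_real (exp (- (a * x))))"
  proof (intro set_lebesgue_integral_cong allI impI)
    fix x :: real assume x: "x \<in> {0<..}"
    hence "complex_of_real (x powr (Re z - 1)) = of_real x powr of_real (Re z - 1)"
      using powr_of_real[of x "Re z - 1"] by simp
    thus "of_real (norm (of_real x powr (z - 1) * of_real (exp (- (a * x))) :: complex)) = of_real x powr (of_real (Re z) - 1) * complex_of_real (exp (- (a * x)))"
      using x by (simp add: norm_mult norm_of_real_powr)
  qed auto
  also have "\<dots> = Gamma (of_real (Re z)) * of_real a powr (- of_real (Re z))"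
    using Gamma_set_integral(2)[of "of_real (Re z)" a] z a by simp
  also have "\<dots> = of_real (Gamma (Re z) * a powr (- Re z))"
    using a powr_of_real[of a "- Re z"] by (simp add: Gamma_complex_of_real)
  finally show ?thesis by (simp only: of_real_eq_iff)
qed

text \<open>The product of y^(A+B-1) exp (-y) and v^(A-1) exp (-y v), integrated in both orders:
  first over v it separates into Gamma A and Gamma B, first over y it leaves the Beta integrand
  times Gamma (A + B).\<close>

lemma Beta_set_integral:
  fixes A B :: complex
  assumes A: "Re A > 0" and B: "Re B > 0"
  shows "set_integrable lborel {0<..} (\<lambda>v. of_real v powr (A - 1) * of_real (1 + v) powr (- (A + B)))"
    and "(LINT v:{0<..}|lborel. of_real v powr (A - 1) * of_real (1 + v) powr (- (A + B))) = Gamma A * Gamma B / Gamma (A + B)"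
proof -
  define f :: "real \<Rightarrow> real \<Rightarrow> complex" where
    "f = (\<lambda>y v. (of_real y powr (A + B - 1) * of_real (exp (- y))) * (of_real v powr (A - 1) * of_real (exp (- (y * v)))))"
  have AB: "Re (A + B) > 0" using A B by simp
  have m: "case_prod f \<in> borel_measurable (lborel \<Otimes>\<^sub>M lborel)"
    unfolding f_def case_prod_beta' by measurable
  have inner: "(LINT v:{0<..}|lborel. f y v) = Gamma A * (of_real y powr (B - 1) * of_real (exp (- (1 * y))))"
    "set_integrable lborel {0<..} (f y)"
    "(LINT v:{0<..}|lborel. norm (f y v)) = Gamma (Re A) * norm (of_real y powr (B - 1) * of_real (exp (- (1 * y))) :: complex)"
    if y: "y \<in> {0<..}" for y
  proof -
    have y': "y > 0" using y by simp
    show "set_integrable lborel {0<..} (f y)"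
      unfolding f_def using Gamma_set_integral(1)[OF A y'] by (intro set_integrable_mult_right) auto
    have "(LINT v:{0<..}|lborel. f y v) = (of_real y powr (A + B - 1) * of_real (exp (- y))) * (Gamma A * of_real y powr (- A))"
      unfolding f_def using Gamma_set_integral(2)[OF A y'] by simp
    also have "of_real y powr (B - 1) = complex_of_real y powr (A + B - 1) * of_real y powr (- A)"
      by (simp flip: powr_add)
    ultimately show "(LINT v:{0<..}|lborel. f y v) = Gamma A * (of_real y powr (B - 1) * of_real (exp (- (1 * y))))"
      by simp
    have "(LINT v:{0<..}|lborel. norm (f y v)) = norm (of_real y powr (A + B - 1) * of_real (exp (- y)) :: complex) * (Gamma (Re A) * y powr (- Re A))"
      unfolding f_def norm_mult[of "_ * of_real (exp (- y))"] using Gamma_set_integral_norm[OF A y'] by simp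
    also have "\<dots> = Gamma (Re A) * (y powr (Re (A + B - 1)) * y powr (- Re A)) * exp (- y)"
      using y' by (simp add: norm_mult norm_of_real_powr)
    also have "y powr (Re (A + B - 1)) * y powr (- Re A) = y powr (Re (B - 1))" by (simp flip: powr_add)
    finally show "(LINT v:{0<..}|lborel. norm (f y v)) = Gamma (Re A) * norm (of_real y powr (B - 1) * of_real (exp (- (1 * y))) :: complex)"
      using y' by (simp add: norm_mult norm_of_real_powr)
  qed
  have i2: "set_integrable lborel {0<..} (\<lambda>y. LINT v:{0<..}|lborel. norm (f y v))"
  proof -
    have "set_integrable lborel {0<..} (\<lambda>y. Gamma (Re A) * norm (of_real y powr (B - 1) * of_real (exp (- (1 * y))) :: complex))"
      using set_integrable_norm[OF Gamma_set_integral(1)[OF B, of 1]] by (intro set_integrable_mult_right) auto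
    thus ?thesis by (rule set_integrable_cong[THEN iffD1, rotated -1]) (use inner(3) in auto)
  qed
  note swap = set_integrals_swap[OF m _ _ inner(2) i2, simplified]
  have outer: "(LINT y:{0<..}|lborel. f y v) = Gamma (A + B) * (of_real v powr (A - 1) * of_real (1 + v) powr (- (A + B)))"
    if v: "v \<in> {0<..}" for v
  proof -
    have v': "1 + v > 0" using v by simp
    have "f y v = of_real v powr (A - 1) * (of_real y powr (A + B - 1) * of_real (exp (- ((1 + v) * y))))" for y
      by (simp add: f_def algebra_simps exp_add[symmetric] flip: of_real_mult)
    thus ?thesis using Gamma_set_integral(2)[OF AB v'] by simp
  qed
  have g: "Gamma (A + B) \<noteq> 0" using nonpos_Ints_Re[OF AB] by (simp add: Gamma_eq_zero_iff)
  have "set_integrable lborel {0<..} (\<lambda>v. Gamma (A + B) * (of_real v powr (A - 1) * of_real (1 + v) powr (- (A + B))))"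
    using swap(2) by (rule set_integrable_cong[THEN iffD1, rotated -1]) (use outer in auto)
  thus "set_integrable lborel {0<..} (\<lambda>v. of_real v powr (A - 1) * of_real (1 + v) powr (- (A + B)))"
    using g by simp
  have "(LINT y:{0<..}|lborel. LINT v:{0<..}|lborel. f y v) = (LINT y:{0<..}|lborel. Gamma A * (of_real y powr (B - 1) * of_real (exp (- (1 * y)))))"
    by (intro set_lebesgue_integral_cong) (use inner(1) in auto)
  also have "\<dots> = Gamma A * Gamma B" using Gamma_set_integral(2)[OF B, of 1] by simp
  finally have "Gamma A * Gamma B = (LINT v:{0<..}|lborel. LINT y:{0<..}|lborel. f y v)" using swap(3) by simp
  also have "\<dots> = (LINT v:{0<..}|lborel. Gamma (A + B) * (of_real v powr (A - 1) * of_real (1 + v) powr (- (A + B))))"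
    by (intro set_lebesgue_integral_cong) (use outer in auto)
  also have "\<dots> = Gamma (A + B) * (LINT v:{0<..}|lborel. of_real v powr (A - 1) * of_real (1 + v) powr (- (A + B)))"
    by simp
  finally show "(LINT v:{0<..}|lborel. of_real v powr (A - 1) * of_real (1 + v) powr (- (A + B))) = Gamma A * Gamma B / Gamma (A + B)"
    using g by (simp add: field_simps)
qed

section \<open>Order 0 of the Lommel function as a limit\<close>

lemma lommel_MB_integrand_bound:
  assumes "r < 1/2" "0 \<le> r" "0 \<le> M"
  obtains C where "C > 0" "\<And>\<nu> t. \<bar>Re \<nu>\<bar> \<le> r \<Longrightarrow> \<bar>Im \<nu>\<bar> \<le> M \<Longrightarrow>
     norm (lommel_MB_integrand \<nu> x t) \<le> C * exp (- (3 * pi / 4) * \<bar>t\<bar>)"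
proof -
  from assms have r: "r < 1/2" "0 \<le> r" "0 \<le> M / 2" by auto
  have r': "r / 2 < 1/4" using r by simp
  obtain C where C: "C > 0" "\<And>\<mu> t. \<bar>Re \<mu>\<bar> \<le> r/2 \<Longrightarrow> \<bar>Im \<mu>\<bar> \<le> M/2 \<Longrightarrow>
    norm (Gamma (Complex (1/4) t + \<mu>) * Gamma (Complex (1/4) t - \<mu>)) \<le> C * exp (- (3 * pi / 4) * \<bar>t\<bar>)"
    using Gamma_pair_exp_bound_line[OF r' r(3)] by metis
  define \<kappa> where "\<kappa> = cos (pi * (1/4 + r/2))"
  have \<kappa>: "\<kappa> > 0" unfolding \<kappa>_def using r by (intro cos_pi_gt_zero) auto
  define E where "E = exp (1/4 * \<bar>2 * ln (x/2)\<bar>)"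
  show ?thesis
  proof (rule that[of "C / \<kappa> * E"])
    show "C / \<kappa> * E > 0" using C \<kappa> by (simp add: E_def)
    fix \<nu> t assume \<nu>: "\<bar>Re \<nu>\<bar> \<le> r" "\<bar>Im \<nu>\<bar> \<le> M"
    let ?w = "Complex (1/4) t"
    have "\<kappa> \<le> cos (pi * \<bar>1/4 + Re \<nu> / 2\<bar>)"
      unfolding \<kappa>_def using \<nu> r by (intro cos_monotone_0_pi_le mult_left_mono mult_left_le) (auto simp: abs_le_iff)
    also have "\<dots> = cos (Re (of_real pi * (?w + \<nu>/2)))"
    proof -
      have "1/4 + Re \<nu> / 2 > 0" using \<nu>(1) r by (simp add: abs_le_iff)
      thus ?thesis by (simp add: abs_of_pos)
    qed
    also have "\<dots> \<le> norm (cos (of_real pi * (?w + \<nu>/2)))"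
      using norm_cos_ge_cos_Re[of "of_real pi * (?w + \<nu>/2)"] by linarith
    finally have c: "norm (1 / cos (of_real pi * (?w + \<nu>/2))) \<le> 1 / \<kappa>"
      using \<kappa> by (simp only: norm_divide norm_one) (intro divide_left_mono mult_pos_pos, auto)
    have e: "norm (exp (- ?w * of_real (2 * ln (x/2)))) \<le> E"
      using norm_exp_neg_mult_le[of ?w "1/4" "of_real (2 * ln (x/2))"] by (simp add: E_def)
    have "lommel_MB_integrand \<nu> x t = Gamma (?w + \<nu>/2) * Gamma (?w - \<nu>/2) * (1 / cos (of_real pi * (?w + \<nu>/2))) * exp (- ?w * of_real (2 * ln (x/2)))"
      by (simp add: lommel_MB_integrand_def Let_def)
    also have "norm \<dots> \<le> (C * exp (- (3 * pi / 4) * \<bar>t\<bar>)) * (1 / \<kappa>) * E"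
      unfolding norm_mult[of "_ * (1 / _)"] norm_mult[of "Gamma _ * Gamma _"]
      using C(1) C(2)[of "\<nu>/2" t] \<nu> c e \<kappa> by (intro mult_mono) auto
    finally show "norm (lommel_MB_integrand \<nu> x t) \<le> C / \<kappa> * E * exp (- (3 * pi / 4) * \<bar>t\<bar>)" by (simp add: mult_ac)
  qed
qed

lemma continuous_lommel_MB_integrand:
  assumes "\<bar>Re \<nu>\<bar> < 1/2"
  shows "continuous_on UNIV (lommel_MB_integrand \<nu> x)"
proof -
  have 1: "cos (of_real pi * (Complex (1/4) t + \<nu>/2)) \<noteq> 0" for t
  proof (rule cos_pi_nonzero)
    show "\<bar>Re (Complex (1/4) t + \<nu>/2)\<bar> < 1/2" using assms by auto
  qed
  have 2: "Complex (1/4) t + \<nu>/2 \<notin> \<int>\<^sub>\<le>\<^sub>0" "Complex (1/4) t - \<nu>/2 \<notin> \<int>\<^sub>\<le>\<^sub>0" for t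
    using assms by (auto intro!: nonpos_Ints_Re)
  show ?thesis
    using 1 2 unfolding lommel_MB_integrand_def Let_def Complex_eq
    by (intro continuous_at_imp_continuous_on ballI continuous_intros) auto
qed

lemma tendsto_lommel_MB_integral:
  assumes x: "x > 0"
  shows "((\<lambda>\<nu>. \<integral>t. lommel_MB_integrand \<nu> x t \<partial>lborel) \<longlongrightarrow> (\<integral>t. lommel_MB_integrand 0 x t \<partial>lborel)) (at 0)"
proof -
  obtain C where C: "C > 0" "\<And>\<nu> t. \<bar>Re \<nu>\<bar> \<le> 1/4 \<Longrightarrow> \<bar>Im \<nu>\<bar> \<le> 1/4 \<Longrightarrow>
     norm (lommel_MB_integrand \<nu> x t) \<le> C * exp (- (3 * pi / 4) * \<bar>t\<bar>)"
    by (rule lommel_MB_integrand_bound[of "1/4" "1/4" x]) auto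
  have "((\<lambda>\<nu>. \<integral>t. lommel_MB_integrand \<nu> x t \<partial>lborel) \<longlongrightarrow> (\<integral>t. lommel_MB_integrand 0 x t \<partial>lborel)) (at 0 within ball 0 (1/4))"
    unfolding tendsto_at_iff_sequentially o_def
  proof (intro allI impI)
    fix X :: "nat \<Rightarrow> complex"
    assume X: "\<forall>i. X i \<in> ball 0 (1/4) - {0}" "X \<longlonglongrightarrow> 0"
    have X': "\<bar>Re (X i)\<bar> \<le> 1/4" "\<bar>Im (X i)\<bar> \<le> 1/4" for i
    proof -
      have "norm (X i) < 1/4" using X(1) by simp
      thus "\<bar>Re (X i)\<bar> \<le> 1/4" "\<bar>Im (X i)\<bar> \<le> 1/4"
        using abs_Re_le_cmod[of "X i"] abs_Im_le_cmod[of "X i"] by linarith+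
    qed
    have X2: "\<bar>Re (X i)\<bar> < 1/2" for i using X'(1)[of i] by linarith
    show "(\<lambda>i. \<integral>t. lommel_MB_integrand (X i) x t \<partial>lborel) \<longlonglongrightarrow> (\<integral>t. lommel_MB_integrand 0 x t \<partial>lborel)"
    proof (rule integral_dominated_convergence[where w = "\<lambda>t. C * exp (- (3 * pi / 4) * \<bar>t\<bar>)"])
      show "lommel_MB_integrand 0 x \<in> borel_measurable lborel"
        using borel_measurable_continuous_onI[OF continuous_lommel_MB_integrand[of 0 x]] by simp
      show "lommel_MB_integrand (X i) x \<in> borel_measurable lborel" for i
        using borel_measurable_continuous_onI[OF continuous_lommel_MB_integrand[where x = x, OF X2]] by simp
      show "integrable lborel (\<lambda>t. C * exp (- (3 * pi / 4) * \<bar>t\<bar>))"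
        by (intro integrable_mult_right integrable_exp_abs) auto
      show "AE t in lborel. norm (lommel_MB_integrand (X i) x t) \<le> C * exp (- (3 * pi / 4) * \<bar>t\<bar>)" for i
        using C(2) X' by auto
      show "AE t in lborel. (\<lambda>i. lommel_MB_integrand (X i) x t) \<longlonglongrightarrow> lommel_MB_integrand 0 x t"
      proof (intro AE_I2)
        fix t
        have "cos (of_real pi * (Complex (1/4) t + 0/2)) \<noteq> 0"
          by (rule cos_pi_nonzero) auto
        moreover have "Complex (1/4) t + 0/2 \<notin> \<int>\<^sub>\<le>\<^sub>0" "Complex (1/4) t - 0/2 \<notin> \<int>\<^sub>\<le>\<^sub>0"
          by (auto intro!: nonpos_Ints_Re)
        ultimately show "(\<lambda>i. lommel_MB_integrand (X i) x t) \<longlonglongrightarrow> lommel_MB_integrand 0 x t"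
          unfolding lommel_MB_integrand_def Let_def by (intro tendsto_intros X(2)) auto
      qed
    qed
  qed
  moreover have "at 0 within ball 0 (1/4) = (at 0 :: complex filter)" by (rule at_within_open) auto
  ultimately show ?thesis by (simp only:)
qed

text \<open>Near order 0 the moduli of the factors satisfy |pochhammer 1| \<le> |pochhammer (3/2)|
  and 1 \<le> |pochhammer (\<nu> + 3/2)|, so the exponential series of |y| is a uniform majorant and
  the sum is continuous in \<nu>.\<close>

lemma tendsto_hyp_1F2:
  "((\<lambda>\<nu>. hyp_1F2 1 (3/2) (\<nu> + 3/2) y) \<longlongrightarrow> hyp_1F2 1 (3/2) (0 + 3/2) y) (at 0)"
proof -
  define f :: "nat \<Rightarrow> complex \<Rightarrow> complex" where "f = (\<lambda>k \<nu>. pochhammer 1 k / (pochhammer (3/2) k * pochhammer (\<nu> + 3/2) k) * (y ^ k / fact k))"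
  have ge1: "1 \<le> norm (pochhammer (\<nu> + 3/2) k)" if "\<nu> \<in> ball 0 (1/4)" for \<nu> :: complex and k
  proof -
    have "\<bar>Re \<nu>\<bar> < 1/4" using that abs_Re_le_cmod[of \<nu>] by simp
    hence "1 \<le> norm (\<nu> + 3/2 + of_nat i)" for i
      using complex_Re_le_cmod[of "\<nu> + 3/2 + of_nat i"] by (simp add: abs_if split: if_splits)
    thus ?thesis unfolding pochhammer_prod prod_norm[symmetric] by (intro prod_ge_1) auto
  qed
  have le: "norm (pochhammer 1 k :: complex) \<le> norm (pochhammer (3/2) k :: complex)" for k
    unfolding pochhammer_prod prod_norm[symmetric]
  proof (intro prod_mono conjI)
    fix i
    have "norm (1 + of_nat i :: complex) = 1 + real i" using norm_of_nat[of "Suc i", where 'a = complex] by simp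
    also have "\<dots> \<le> Re (3/2 + of_nat i)" by simp
    also have "\<dots> \<le> norm (3/2 + of_nat i :: complex)" by (rule complex_Re_le_cmod)
    finally show "norm (1 + of_nat i :: complex) \<le> norm (3/2 + of_nat i :: complex)" .
  qed auto
  have "uniform_limit (ball 0 (1/4)) (\<lambda>n \<nu>. \<Sum>k<n. f k \<nu>) (\<lambda>\<nu>. \<Sum>k. f k \<nu>) sequentially"
  proof (rule Weierstrass_m_test)
    fix k and \<nu> :: complex assume \<nu>: "\<nu> \<in> ball 0 (1/4)"
    have p: "norm (pochhammer (3/2) k :: complex) > 0"
      using ge1[of 0 k] by auto
    have "norm (f k \<nu>) = norm (pochhammer 1 k :: complex) / norm (pochhammer (3/2) k :: complex) / norm (pochhammer (\<nu> + 3/2) k) * (norm y ^ k / fact k)"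
      by (simp add: f_def norm_mult norm_divide norm_power)
    also have "\<dots> \<le> 1 / 1 * (norm y ^ k / fact k)"
      using le[of k] ge1[OF \<nu>, of k] p by (intro mult_right_mono frac_le) auto
    finally show "norm (f k \<nu>) \<le> norm y ^ k / fact k" by simp
  next
    show "summable (\<lambda>k. norm y ^ k / fact k)" using summable_exp[of "norm y"] by (simp add: field_simps)
  qed
  moreover have "continuous_on (ball 0 (1/4)) (\<lambda>\<nu>. \<Sum>k<n. f k \<nu>)" for n
  proof (intro continuous_on_sum)
    fix k assume "k \<in> {..<n}"
    have "pochhammer (\<nu> + 3/2) k \<noteq> 0" if "\<nu> \<in> ball 0 (1/4 :: real)" for \<nu> :: complex using ge1[OF that, of k] by auto
    moreover have "pochhammer (3/2 :: complex) k \<noteq> 0" using ge1[of 0 k] by auto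
    ultimately show "continuous_on (ball 0 (1/4)) (f k)"
      unfolding f_def pochhammer_prod by (intro continuous_intros) (auto simp del: prod_zero_iff)
  qed
  ultimately have "continuous_on (ball 0 (1/4)) (\<lambda>\<nu>. \<Sum>k. f k \<nu>)"
    by (intro uniform_limit_theorem[where F = sequentially]) auto
  hence "isCont (\<lambda>\<nu>. \<Sum>k. f k \<nu>) 0"
    by (simp add: continuous_on_eq_continuous_at)
  thus ?thesis by (simp add: isCont_def hyp_1F2_def f_def)
qed

text \<open>At order 0 the definition of S has its own formula with Y, and Y is a \<open>Lim\<close>
  that has a meaning only if the limit exists. For generic order the bracket at equal indices is
  -sin (\<nu> pi) Y, so the generic identity is solved for Y; every other term in it has a limit at
  0, which both proves that Y of order 0 exists and gives its value.\<close>

theorem lommel_S_Mellin_Barnes: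
  fixes \<nu> :: complex and x :: real
  assumes \<nu>: "\<bar>Re \<nu>\<bar> < 1/2" and x: "x > 0"
  shows "lommel_S \<nu> \<nu> (of_real x) = 2 powr (\<nu> - 1) * of_real (sqrt pi) * rGamma (1/2 - \<nu>) / (2 * of_real pi) *
     (\<integral>t. lommel_MB_integrand \<nu> x t \<partial>lborel)"
proof (cases "\<nu> = 0")
  case False
  thus ?thesis by (rule lommel_S_generic_Mellin_Barnes[OF \<nu> _ x])
next
  case True
  define D where "D = (\<lambda>\<nu>. 2 powr (\<nu> - 1) * of_real (sqrt pi) * rGamma (1/2 - \<nu>) / (2 * of_real pi) *
     (\<integral>t. lommel_MB_integrand \<nu> x t \<partial>lborel))"
  define c where "c = (\<lambda>\<nu>. 2 powr (\<nu> - 1) * Gamma (1/2) * Gamma (\<nu> + 1/2) :: complex)"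
  have args: "(\<nu> - \<nu> + 3) / 2 = 3/2" "(\<nu> + \<nu> + 3) / 2 = \<nu> + 3/2" "(\<nu> - \<nu> + 1) / 2 = 1/2" "(\<nu> + \<nu> + 1) / 2 = \<nu> + 1/2"
    "(\<nu> - \<nu>) * of_real pi / 2 = 0" "(\<nu> + \<nu>) * of_real pi / 2 = \<nu> * of_real pi" for \<nu> :: complex
    by (simp_all add: field_simps)
  have half: "(1/2 :: complex) \<notin> \<int>\<^sub>\<le>\<^sub>0" "0 + (1/2 :: complex) \<notin> \<int>\<^sub>\<le>\<^sub>0" by (auto intro!: nonpos_Ints_Re)
  have c0: "c 0 \<noteq> 0" using half by (simp add: c_def Gamma_eq_zero_iff)
  have "((\<lambda>\<nu>. (lommel_s \<nu> \<nu> (of_real x) - D \<nu>) / c \<nu>) \<longlongrightarrow> (lommel_s 0 0 (of_real x) - D 0) / c 0) (at 0)"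
  proof (intro tendsto_divide tendsto_diff c0)
    show "((\<lambda>\<nu>. lommel_s \<nu> \<nu> (of_real x)) \<longlongrightarrow> lommel_s 0 0 (of_real x)) (at 0)"
      unfolding lommel_s_def args using x
      by (intro tendsto_mult tendsto_hyp_1F2 tendsto_divide tendsto_powr_complex tendsto_intros) auto
    show "(D \<longlongrightarrow> D 0) (at 0)"
    proof -
      have "((\<lambda>\<nu>. rGamma (1/2 - \<nu>)) \<longlongrightarrow> rGamma (1/2 - 0 :: complex)) (at 0)"
        by (intro isContD continuous_intros)
      thus ?thesis unfolding D_def by (intro tendsto_lommel_MB_integral x tendsto_intros) auto
    qed
    show "(c \<longlongrightarrow> c 0) (at 0)" unfolding c_def using half by (intro tendsto_intros) auto
  qed
  moreover have "eventually (\<lambda>\<nu>. (lommel_s \<nu> \<nu> (of_real x) - D \<nu>) / c \<nu> = bessel_Y_generic \<nu> (of_real x)) (at 0)"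
  proof -
    have "eventually (\<lambda>\<nu>::complex. \<nu> \<in> ball 0 (1/2) \<and> \<nu> \<noteq> 0) (at 0)"
      using eventually_at_ball[of "1/2" "0::complex" UNIV] by (auto simp: eventually_at_filter elim: eventually_mono)
    thus ?thesis
    proof eventually_elim
      case (elim \<nu>)
      hence \<nu>: "\<bar>Re \<nu>\<bar> < 1/2" using abs_Re_le_cmod[of \<nu>] by simp
      have int: "\<nu> \<notin> \<int>"
      proof
        assume "\<nu> \<in> \<int>"
        then obtain j where j: "\<nu> = of_int j" by (auto elim: Ints_cases)
        hence "\<bar>real_of_int j\<bar> < 1/2" using \<nu> by simp
        hence "j = 0" by linarith
        thus False using j elim by simp
      qed
      have "\<nu> + 1/2 \<notin> \<int>\<^sub>\<le>\<^sub>0" using \<nu> by (intro nonpos_Ints_Re) auto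
      hence c: "c \<nu> \<noteq> 0" using half by (simp add: c_def Gamma_eq_zero_iff)
      have "D \<nu> = lommel_S \<nu> \<nu> (of_real x)"
        using lommel_S_generic_Mellin_Barnes[OF \<nu> _ x] elim by (simp add: D_def)
      also have "\<dots> = lommel_s \<nu> \<nu> (of_real x) - c \<nu> * bessel_Y_generic \<nu> (of_real x)"
        unfolding lommel_S_def args if_not_P[OF int] c_def bessel_Y_generic_def
        by (simp add: right_diff_distrib diff_divide_distrib mult_ac)
      finally show ?case using c by simp
    qed
  qed
  ultimately have "((\<lambda>\<nu>. bessel_Y_generic \<nu> (of_real x)) \<longlongrightarrow> (lommel_s 0 0 (of_real x) - D 0) / c 0) (at 0)"
    by (rule Lim_transform_eventually)
  hence "bessel_Y 0 (of_real x) = (lommel_s 0 0 (of_real x) - D 0) / c 0"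
    unfolding bessel_Y_def by (simp add: tendsto_Lim)
  hence "lommel_S 0 0 (of_real x) = D 0"
    using c0 unfolding lommel_S_def args by (simp add: c_def)
  thus ?thesis using True by (simp add: D_def)
qed

section \<open>Laplace integral and Mellin transform of the Lommel function\<close>

lemma of_real_sqrt_powr:
  assumes "v > 0"
  shows "complex_of_real (sqrt v) powr z = of_real v powr (z / 2)"
  using assms by (simp add: powr_def Ln_of_real ln_sqrt)

lemma powr_Complex_split:
  assumes "v > 0"
  shows "complex_of_real (sqrt v) powr (- z) * of_real v powr (- 1/2) = of_real v powr (1/2 - z/2 - 1)"
proof -
  have "complex_of_real (sqrt v) powr (- z) * of_real v powr (- 1/2) = of_real v powr (- z / 2 + (- 1/2))"
    using assms by (simp only: of_real_sqrt_powr powr_add)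
  also have "- z / 2 + (- 1/2) = 1/2 - z/2 - 1" by (simp add: field_simps)
  finally show ?thesis .
qed

text \<open>Duplication together with the Gamma form of the secant replaces Gamma (w + \<nu>/2) /
  cos by Gamma (2w + \<nu>) Gamma (1/2 - w - \<nu>/2). The latter factor and Gamma (w - \<nu>/2)
  form a Beta integral over v, and Gamma (2w + \<nu>) is a Cahen-Mellin integrand, which the
  integral over t turns into exp (-x sqrt v).\<close>

theorem lommel_S_Laplace:
  fixes \<nu> :: complex and x :: real
  assumes \<nu>: "\<bar>Re \<nu>\<bar> < 1/2" and x: "x > 0"
  shows "lommel_S \<nu> \<nu> (of_real x) = of_real x powr \<nu> / 2 *
     (LINT v:{0<..}|lborel. of_real v powr (- 1/2) * of_real (1 + v) powr (\<nu> - 1/2) * of_real (exp (- (x * sqrt v))))"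
proof -
  define w where "w = (\<lambda>t. Complex (1/4) t)"
  define b where "b = 1/2 + Re \<nu>"
  have b: "b > 0" using \<nu> by (simp add: b_def abs_less_iff)
  have w2: "2 * w t + \<nu> = Complex b (Im \<nu> + 2 * t)" for t by (simp add: w_def b_def complex_eq_iff)
  define h where "h = (\<lambda>v. complex_of_real v powr (- 1/2) * of_real (1 + v) powr (\<nu> - 1/2))"
  define f where "f = (\<lambda>t v. Gamma (2 * w t + \<nu>) * of_real (x * sqrt v) powr (- (2 * w t + \<nu>)) * h v)"
  \<comment> \<open>The Beta parameters. Their sum 1/2 - \<nu> does not involve t, which makes the
    power of 1 + v a constant of the line integral and lets the norm integral factor.\<close>
  define A where "A = (\<lambda>t. 1/2 - (2 * w t + \<nu>) / 2)"
  define B where "B = (\<lambda>t. w t - \<nu>/2)"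
  have AB: "Re (A t) > 0" "Re (B t) > 0" "- (A t + B t) = \<nu> - 1/2" for t
  proof -
    show "Re (A t) > 0" "Re (B t) > 0" using \<nu> by (auto simp: A_def B_def w_def abs_less_iff)
    show "- (A t + B t) = \<nu> - 1/2" by (simp add: A_def B_def field_simps)
  qed
  have nAB: "Re (A t) = Re (A 0)" for t by (simp add: A_def w_def)
  define g where "g = (\<lambda>t v. complex_of_real v powr (A t - 1) * of_real (1 + v) powr (- (A t + B t)))"
  have fg: "f t v = Gamma (2 * w t + \<nu>) * of_real x powr (- (2 * w t + \<nu>)) * g t v" if "v \<in> {0<..}" for t v
  proof -
    have v: "v > 0" using that by simp
    have 1: "of_real (x * sqrt v) powr (- (2 * w t + \<nu>)) = complex_of_real x powr (- (2 * w t + \<nu>)) * of_real (sqrt v) powr (- (2 * w t + \<nu>))"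
      using v x by (intro of_real_mult_powr) auto
    have 2: "of_real (sqrt v) powr (- (2 * w t + \<nu>)) * of_real v powr (- 1/2) = complex_of_real v powr (A t - 1)"
      unfolding A_def by (rule powr_Complex_split[OF v])
    show ?thesis unfolding f_def h_def g_def AB(3) 1 2[symmetric] by (simp only: mult.assoc)
  qed
  have G1: "integrable lborel (\<lambda>t. Gamma (2 * w t + \<nu>))"
  proof -
    have "integrable lborel (\<lambda>t. Gamma (Complex b t))"
      using exp_Mellin_Barnes(1)[OF b, of 1] by simp
    from lborel_integrable_real_affine[OF this, of 2 "Im \<nu>"] show ?thesis unfolding w2 by simp
  qed
  have fm: "case_prod f \<in> borel_measurable (lborel \<Otimes>\<^sub>M lborel)"
  proof -
    have [measurable]: "(\<lambda>t. Gamma (2 * w t + \<nu>)) \<in> borel_measurable lborel" using G1 by (rule borel_measurable_integrable)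
    have [measurable]: "w \<in> borel_measurable lborel" unfolding w_def Complex_eq by measurable
    have [measurable]: "h \<in> borel_measurable lborel" unfolding h_def by measurable
    show ?thesis unfolding f_def case_prod_beta' by measurable
  qed
  have gi: "set_integrable lborel {0<..} (g t)" for t
    unfolding g_def by (rule Beta_set_integral(1)[OF AB(1,2)])
  have i1: "set_integrable lborel {0<..} (f t)" for t
  proof -
    have "set_integrable lborel {0<..} (\<lambda>v. Gamma (2 * w t + \<nu>) * of_real x powr (- (2 * w t + \<nu>)) * g t v)"
      using gi by (intro set_integrable_mult_right) auto
    thus ?thesis by (rule set_integrable_cong[THEN iffD1, rotated -1]) (use fg in auto)
  qed
  have ng: "norm (g t v) = norm (g 0 v)" if "v \<in> {0<..}" for t v
    using that nAB[of t] unfolding g_def AB(3) by (simp add: norm_mult norm_of_real_powr)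
  have n: "(LINT v:{0<..}|lborel. norm (f t v)) = norm (Gamma (2 * w t + \<nu>)) * (x powr (- b) * (LINT v:{0<..}|lborel. norm (g 0 v)))" for t
  proof -
    have "(LINT v:{0<..}|lborel. norm (f t v)) = (LINT v:{0<..}|lborel. norm (Gamma (2 * w t + \<nu>)) * x powr (- b) * norm (g 0 v))"
    proof (intro set_lebesgue_integral_cong allI impI)
      fix v :: real assume v: "v \<in> {0<..}"
      have "Re (- (2 * w t + \<nu>)) = - b" by (simp add: w2)
      thus "norm (f t v) = norm (Gamma (2 * w t + \<nu>)) * x powr (- b) * norm (g 0 v)"
        unfolding fg[OF v] norm_mult ng[OF v, of t] norm_of_real_powr[OF x] by simp
    qed auto
    thus ?thesis by simp
  qed
  have i2: "set_integrable lborel UNIV (\<lambda>t. LINT v:{0<..}|lborel. norm (f t v))"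
    unfolding n integral_UNIV_as_set_integral using G1 by (intro integrable_mult_left integrable_norm)
  note swap = set_integrals_swap(3)[OF fm _ _ i1 i2, unfolded integral_UNIV_as_set_integral, simplified]
  have inner_v: "(LINT v:{0<..}|lborel. f t v) = Gamma (2 * w t + \<nu>) * of_real x powr (- (2 * w t + \<nu>)) * (Gamma (A t) * Gamma (B t) * rGamma (1/2 - \<nu>))" for t
  proof -
    have "(LINT v:{0<..}|lborel. f t v) = (LINT v:{0<..}|lborel. Gamma (2 * w t + \<nu>) * of_real x powr (- (2 * w t + \<nu>)) * g t v)"
      by (intro set_lebesgue_integral_cong) (use fg in auto)
    also have "\<dots> = Gamma (2 * w t + \<nu>) * of_real x powr (- (2 * w t + \<nu>)) * (LINT v:{0<..}|lborel. g t v)" by simp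
    also have "(LINT v:{0<..}|lborel. g t v) = Gamma (A t) * Gamma (B t) / Gamma (A t + B t)"
      unfolding g_def by (rule Beta_set_integral(2)[OF AB(1,2)])
    also have "A t + B t = 1/2 - \<nu>" by (simp add: A_def B_def field_simps)
    finally show ?thesis by (simp add: rGamma_inverse_Gamma field_simps)
  qed
  \<comment> \<open>The point 2w + \<nu> runs through its vertical line at double speed, which
    leaves pi in place of 2 pi.\<close>
  have inner_t: "(\<integral>t. f t v \<partial>lborel) = of_real pi * of_real (exp (- (x * sqrt v))) * h v" if v: "v \<in> {0<..}" for v
  proof -
    have y: "x * sqrt v > 0" using x v by simp
    have "2 * of_real pi * exp (- complex_of_real (x * sqrt v)) =
        2 * (\<integral>t. Gamma (Complex b (Im \<nu> + 2 * t)) * of_real (x * sqrt v) powr (- Complex b (Im \<nu> + 2 * t)) \<partial>lborel)"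
      using exp_Mellin_Barnes(2)[OF b y]
        lborel_integral_real_affine[of 2 "\<lambda>t. Gamma (Complex b t) * of_real (x * sqrt v) powr (- Complex b t)" "Im \<nu>"]
      by (simp add: scaleR_conv_of_real)
    hence "(\<integral>t. Gamma (2 * w t + \<nu>) * of_real (x * sqrt v) powr (- (2 * w t + \<nu>)) \<partial>lborel) = of_real pi * exp (- complex_of_real (x * sqrt v))"
      unfolding w2 by simp
    thus ?thesis unfolding f_def by (simp flip: exp_of_real)
  qed
  \<comment> \<open>All constants of duplication and reflection cancel against the normalisation of
    the Mellin-Barnes integral, leaving only x^\<nu>.\<close>
  have key: "2 powr (\<nu> - 1) * of_real (sqrt pi) * rGamma (1/2 - \<nu>) * lommel_MB_integrand \<nu> x t = of_real x powr \<nu> * (LINT v:{0<..}|lborel. f t v)" for t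
  proof -
    define u where "u = w t + \<nu>/2"
    have u0: "Re u > 0" using \<nu> by (simp add: u_def w_def abs_less_iff)
    have dup: "Gamma u * Gamma (u + 1/2) = exp ((1 - 2 * u) * of_real (ln 2)) * of_real (sqrt pi) * Gamma (2 * u)"
      using u0 by (intro Gamma_legendre_duplication nonpos_Ints_Re) auto
    have "lommel_MB_integrand \<nu> x t = (Gamma u * Gamma (u + 1/2)) * Gamma (1/2 - u) / of_real pi * Gamma (B t) * exp (- w t * of_real (2 * ln (x/2)))"
    proof -
      have "lommel_MB_integrand \<nu> x t = Gamma u * Gamma (B t) * (1 / cos (of_real pi * u)) * exp (- w t * of_real (2 * ln (x/2)))"
        by (simp add: lommel_MB_integrand_def Let_def u_def w_def B_def)
      thus ?thesis unfolding cos_pi_as_Gamma by (simp add: mult_ac)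
    qed
    also have "\<dots> = Gamma (2 * u) * Gamma (1/2 - u) * Gamma (B t) * (of_real (sqrt pi) / of_real pi) * (exp ((1 - 2 * u) * of_real (ln 2)) * exp (- w t * of_real (2 * ln (x/2))))"
      unfolding dup by (simp add: mult_ac)
    finally have e1: "2 powr (\<nu> - 1) * of_real (sqrt pi) * rGamma (1/2 - \<nu>) * lommel_MB_integrand \<nu> x t =
       Gamma (2 * u) * Gamma (1/2 - u) * Gamma (B t) * rGamma (1/2 - \<nu>) * (of_real (sqrt pi) * of_real (sqrt pi) / of_real pi) *
       (2 powr (\<nu> - 1) * (exp ((1 - 2 * u) * of_real (ln 2)) * exp (- w t * of_real (2 * ln (x/2)))))"
      by (simp only: times_divide_eq_left times_divide_eq_right mult_ac)
    have e2: "of_real (sqrt pi) * of_real (sqrt pi) / of_real pi = (1 :: complex)"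
      by (simp flip: of_real_mult)
    have e3: "2 powr (\<nu> - 1) * (exp ((1 - 2 * u) * of_real (ln 2)) * exp (- w t * of_real (2 * ln (x/2)))) = of_real x powr \<nu> * of_real x powr (- (2 * w t + \<nu>))"
    proof -
      have "Ln 2 = complex_of_real (ln 2)" using Ln_of_real[of 2] by simp
      hence "2 powr (\<nu> - 1) = exp ((\<nu> - 1) * of_real (ln 2))" by (simp add: powr_def)
      hence "2 powr (\<nu> - 1) * (exp ((1 - 2 * u) * of_real (ln 2)) * exp (- w t * of_real (2 * ln (x/2)))) =
         exp ((\<nu> - 1) * of_real (ln 2) + ((1 - 2 * u) * of_real (ln 2) + - w t * of_real (2 * ln (x/2))))"
        by (simp only: exp_add)
      also have "(\<nu> - 1) * of_real (ln 2) + ((1 - 2 * u) * of_real (ln 2) + - w t * of_real (2 * ln (x/2))) =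
         \<nu> * of_real (ln x) + (- (2 * w t + \<nu>)) * of_real (ln x)"
        using x by (simp add: u_def ln_div algebra_simps)
      finally show ?thesis using x by (simp only: exp_add powr_def) (simp add: Ln_of_real)
    qed
    have "2 * u = 2 * w t + \<nu>" "1/2 - u = A t" by (simp_all add: u_def A_def field_simps)
    thus ?thesis unfolding e1 e2 e3 inner_v by (simp add: mult_ac)
  qed
  have "lommel_S \<nu> \<nu> (of_real x) = (\<integral>t. 2 powr (\<nu> - 1) * of_real (sqrt pi) * rGamma (1/2 - \<nu>) * lommel_MB_integrand \<nu> x t \<partial>lborel) / (2 * of_real pi)"
    unfolding lommel_S_Mellin_Barnes[OF \<nu> x] by simp
  also have "\<dots> = of_real x powr \<nu> * (\<integral>t. (LINT v:{0<..}|lborel. f t v) \<partial>lborel) / (2 * of_real pi)"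
    unfolding key by simp
  also have "(\<integral>t. (LINT v:{0<..}|lborel. f t v) \<partial>lborel) = (LINT v:{0<..}|lborel. (\<integral>t. f t v \<partial>lborel))"
    by (rule swap)
  also have "\<dots> = (LINT v:{0<..}|lborel. of_real pi * (h v * of_real (exp (- (x * sqrt v)))))"
    by (intro set_lebesgue_integral_cong) (use inner_t in \<open>auto simp: mult_ac\<close>)
  also have "\<dots> = of_real pi * (LINT v:{0<..}|lborel. h v * of_real (exp (- (x * sqrt v))))" by simp
  finally show ?thesis by (simp add: h_def)
qed

text \<open>Under the Laplace integral the integration over x is a Gamma integral with scale sqrt v,
  and the remaining one over v is a Beta integral. On Re z = 1/2 both Beta parameters have real part
  1/4 - Re \<nu> / 2 > 0, so everything converges absolutely.\<close>

theorem lommel_S_Mellin: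
  fixes \<nu> z :: complex
  assumes \<nu>: "\<bar>Re \<nu>\<bar> < 1/2" and z: "Re z = 1/2"
  shows "set_integrable lborel {0<..} (\<lambda>x. lommel_S \<nu> \<nu> (of_real x) * of_real x powr (z - 1))"
    and "(LINT x:{0<..}|lborel. lommel_S \<nu> \<nu> (of_real x) * of_real x powr (z - 1)) =
      Gamma (z + \<nu>) * Gamma ((1 - z - \<nu>) / 2) * Gamma ((z - \<nu>) / 2) * rGamma (1/2 - \<nu>) / 2"
proof -
  define h where "h = (\<lambda>v. complex_of_real v powr (- 1/2) * of_real (1 + v) powr (\<nu> - 1/2))"
  define f where "f = (\<lambda>v x. h v * (complex_of_real x powr ((z + \<nu>) - 1) * of_real (exp (- (sqrt v * x)))))"
  have zn: "Re (z + \<nu>) > 0" using \<nu> z by (simp add: abs_less_iff)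
  define A B where "A = 1/2 - (z + \<nu>) / 2" and "B = (z - \<nu>) / 2"
  have AB: "Re A > 0" "Re B > 0" "- (A + B) = \<nu> - 1/2"
  proof -
    show "Re A > 0" "Re B > 0" using \<nu> z by (auto simp: A_def B_def abs_less_iff)
    show "- (A + B) = \<nu> - 1/2" by (simp add: A_def B_def field_simps)
  qed
  define g where "g = (\<lambda>v. complex_of_real v powr (A - 1) * of_real (1 + v) powr (- (A + B)))"
  have hg: "h v * of_real (sqrt v) powr (- (z + \<nu>)) = g v" if "v \<in> {0<..}" for v
  proof -
    have v: "v > 0" using that by simp
    have "of_real (sqrt v) powr (- (z + \<nu>)) * of_real v powr (- 1/2) = complex_of_real v powr (A - 1)"
      unfolding A_def by (rule powr_Complex_split[OF v])
    thus ?thesis unfolding h_def g_def AB(3) by (metis mult.assoc mult.commute)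
  qed
  have gi: "set_integrable lborel {0<..} g"
    unfolding g_def by (rule Beta_set_integral(1)[OF AB(1,2)])
  have fm: "case_prod f \<in> borel_measurable (lborel \<Otimes>\<^sub>M lborel)"
    unfolding f_def h_def case_prod_beta' by measurable
  have i1: "set_integrable lborel {0<..} (f v)" if "v \<in> {0<..}" for v
    unfolding f_def using Gamma_set_integral(1)[OF zn, of "sqrt v"] that by (intro set_integrable_mult_right) auto
  have inner: "(LINT x:{0<..}|lborel. f v x) = Gamma (z + \<nu>) * g v" if v: "v \<in> {0<..}" for v
  proof -
    have "sqrt v > 0" using v by simp
    from Gamma_set_integral(2)[OF zn this]
    have "(LINT x:{0<..}|lborel. f v x) = Gamma (z + \<nu>) * (h v * of_real (sqrt v) powr (- (z + \<nu>)))"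
      unfolding f_def by simp
    thus ?thesis by (simp only: hg[OF v])
  qed
  have innern: "(LINT x:{0<..}|lborel. norm (f v x)) = Gamma (Re (z + \<nu>)) * norm (g v)" if v: "v \<in> {0<..}" for v
  proof -
    have s: "sqrt v > 0" using v by simp
    from Gamma_set_integral_norm[OF zn this]
    have "(LINT x:{0<..}|lborel. norm (f v x)) = Gamma (Re (z + \<nu>)) * (norm (h v) * sqrt v powr (- Re (z + \<nu>)))"
      unfolding f_def norm_mult[of "h v"] by simp
    also have "sqrt v powr (- Re (z + \<nu>)) = norm (complex_of_real (sqrt v) powr (- (z + \<nu>)))"
      using norm_of_real_powr[OF s, of "- (z + \<nu>)"] by simp
    finally show ?thesis by (simp only: norm_mult[symmetric] hg[OF v])
  qed
  have i2: "set_integrable lborel {0<..} (\<lambda>v. LINT x:{0<..}|lborel. norm (f v x))"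
  proof -
    have "set_integrable lborel {0<..} (\<lambda>v. Gamma (Re (z + \<nu>)) * norm (g v))"
      using set_integrable_norm[OF gi] by (intro set_integrable_mult_right) auto
    thus ?thesis by (rule set_integrable_cong[THEN iffD1, rotated -1]) (use innern in auto)
  qed
  note swap = set_integrals_swap[OF fm _ _ i1 i2, simplified]
  have outer: "lommel_S \<nu> \<nu> (of_real x) * of_real x powr (z - 1) = (LINT v:{0<..}|lborel. f v x) / 2" if "x \<in> {0<..}" for x
  proof -
    have x: "x > 0" using that by simp
    have "(LINT v:{0<..}|lborel. f v x) = (LINT v:{0<..}|lborel. of_real x powr (z + \<nu> - 1) * (h v * of_real (exp (- (x * sqrt v)))))"
      unfolding f_def by (simp only: mult_ac)
    also have "\<dots> = of_real x powr (z + \<nu> - 1) * (LINT v:{0<..}|lborel. h v * of_real (exp (- (x * sqrt v))))" by simp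
    also have "of_real x powr (z + \<nu> - 1) = of_real x powr \<nu> * complex_of_real x powr (z - 1)"
      by (simp flip: powr_add add: algebra_simps)
    finally show ?thesis unfolding lommel_S_Laplace[OF \<nu> x] h_def by simp
  qed
  have "set_integrable lborel {0<..} (\<lambda>x. (LINT v:{0<..}|lborel. f v x) / 2)"
    using swap(2) by simp
  thus "set_integrable lborel {0<..} (\<lambda>x. lommel_S \<nu> \<nu> (of_real x) * of_real x powr (z - 1))"
    by (rule set_integrable_cong[THEN iffD1, rotated -1]) (use outer in auto)
  have "(LINT x:{0<..}|lborel. lommel_S \<nu> \<nu> (of_real x) * of_real x powr (z - 1)) = (LINT x:{0<..}|lborel. (LINT v:{0<..}|lborel. f v x) / 2)"
    by (intro set_lebesgue_integral_cong) (use outer in auto)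
  also have "\<dots> = (LINT x:{0<..}|lborel. (LINT v:{0<..}|lborel. f v x)) / 2" by simp
  also have "(LINT x:{0<..}|lborel. (LINT v:{0<..}|lborel. f v x)) = (LINT v:{0<..}|lborel. (LINT x:{0<..}|lborel. f v x))"
    using swap(3) by simp
  also have "\<dots> = (LINT v:{0<..}|lborel. Gamma (z + \<nu>) * g v)"
    by (intro set_lebesgue_integral_cong) (use inner in auto)
  also have "\<dots> = Gamma (z + \<nu>) * (Gamma A * Gamma B / Gamma (A + B))"
    unfolding g_def using Beta_set_integral(2)[OF AB(1,2)] by simp
  finally have fin: "(LINT x:{0<..}|lborel. lommel_S \<nu> \<nu> (of_real x) * of_real x powr (z - 1)) =
      Gamma (z + \<nu>) * (Gamma A * Gamma B / Gamma (A + B)) / 2" .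
  have eqs: "A + B = 1/2 - \<nu>" "A = (1 - z - \<nu>) / 2" "B = (z - \<nu>) / 2"
    by (simp_all add: A_def B_def field_simps)
  show "(LINT x:{0<..}|lborel. lommel_S \<nu> \<nu> (of_real x) * of_real x powr (z - 1)) =
      Gamma (z + \<nu>) * Gamma ((1 - z - \<nu>) / 2) * Gamma ((z - \<nu>) / 2) * rGamma (1/2 - \<nu>) / 2"
    using fin unfolding eqs(1) unfolding eqs(2,3)
    by (simp only: rGamma_inverse_Gamma divide_inverse mult_ac)
qed

subsection \<open>The zeta function and its functional equation\<close>

text \<open>\<open>zeta_num z\<close> is \<open>(z - 1) \<zeta>(z)\<close> on the right half-plane, by Euler-Maclaurin summation.\<close>

definition zeta_term :: "nat \<Rightarrow> complex \<Rightarrow> complex" where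
  "zeta_term n z = (z - 1) * of_real (real n + 2) powr (- z) + of_real (real n + 2) powr (1 - z) - of_real (real n + 1) powr (1 - z)"

definition zeta_num :: "complex \<Rightarrow> complex" where
  "zeta_num z = z + (\<Sum>n. zeta_term n z)"

text \<open>Up to sign the term is the first order Taylor remainder of u^(1-z), expanded at n + 2
  and evaluated at n + 1. The second derivative therefore gives an extra power of n, which makes the
  series converge for Re z > 0.\<close>

lemma norm_zeta_term_le:
  assumes z: "Re z > 0"
  shows "norm (zeta_term n z) \<le> norm z * norm (z - 1) * (real n + 1) powr (- Re z - 1)"
proof -
  define f where "f = (\<lambda>i x::complex. if i = 0 then x powr (1 - z) else if i = Suc 0 then (1 - z) * x powr (1 - z - 1) else (1 - z) * ((1 - z - 1) * x powr (1 - z - 1 - 1)))"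
  define S where "S = closed_segment (complex_of_real (real n + 1)) (of_real (real n + 2))"
  have S: "\<exists>u. x = of_real u \<and> real n + 1 \<le> u" if "x \<in> S" for x
  proof -
    have "Im x = 0 \<and> Re x \<in> closed_segment (real n + 1) (real n + 2)"
      using that unfolding S_def by (subst (asm) closed_segment_same_Im) auto
    hence "x = of_real (Re x)" "real n + 1 \<le> Re x"
      by (auto simp: complex_eq_iff closed_segment_eq_real_ivl split: if_splits)
    thus ?thesis by blast
  qed
  let ?B = "norm z * norm (z - 1) * (real n + 1) powr (- Re z - 1)"
  have "norm (f 0 (of_real (real n + 1)) - (\<Sum>i\<le>1. f i (of_real (real n + 2)) * (of_real (real n + 1) - of_real (real n + 2)) ^ i / fact i))
     \<le> ?B * norm (complex_of_real (real n + 1) - of_real (real n + 2)) ^ Suc 1 / fact 1"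
  proof (rule complex_Taylor[of S])
    show "convex S" unfolding S_def by (rule convex_closed_segment)
    show "of_real (real n + 1) \<in> S" "of_real (real n + 2) \<in> S" unfolding S_def by auto
    fix i :: nat and x assume x: "x \<in> S"
    then obtain u where u: "x = of_real u" "real n + 1 \<le> u" using S by blast
    hence nx: "x \<notin> \<real>\<^sub>\<le>\<^sub>0" by auto
    show "(f i has_field_derivative f (Suc i) x) (at x within S)" if "i \<le> 1"
    proof (cases "i = 0")
      case True
      thus ?thesis unfolding f_def using has_field_derivative_powr[OF nx, of "1 - z"]
        by (auto intro: has_field_derivative_at_within)
    next
      case False
      hence "i = 1" using that by simp
      thus ?thesis unfolding f_def using DERIV_cmult[OF has_field_derivative_powr[OF nx, of "1 - z - 1"], of "1 - z"]
        by (auto intro: has_field_derivative_at_within)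
    qed
    have "norm (f (Suc 1) x) = norm (z - 1) * (norm z * u powr (- Re z - 1))"
      using u by (simp add: f_def norm_mult norm_of_real_powr norm_minus_commute)
    also have "\<dots> \<le> norm (z - 1) * (norm z * (real n + 1) powr (- Re z - 1))"
      using u z by (intro mult_left_mono powr_mono2') auto
    finally show "norm (f (Suc 1) x) \<le> ?B" by (simp add: mult_ac)
  qed
  also have "f 0 (of_real (real n + 1)) - (\<Sum>i\<le>1. f i (of_real (real n + 2)) * (of_real (real n + 1) - of_real (real n + 2)) ^ i / fact i) = - zeta_term n z"
    by (simp add: f_def zeta_term_def algebra_simps)
  finally show ?thesis by simp
qed

lemma summable_Suc_powr: "s < -1 \<Longrightarrow> summable (\<lambda>n. (real n + 1) powr s)"
  using summable_real_powr_iff[of s] summable_Suc_iff[of "\<lambda>n. real n powr s"] by (simp add: add.commute)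

lemma summable_zeta_term: "Re z > 0 \<Longrightarrow> summable (\<lambda>n. zeta_term n z)"
  by (rule summable_comparison_test'[where N = 0 and g = "\<lambda>n. norm z * norm (z - 1) * (real n + 1) powr (- Re z - 1)"])
     (auto intro!: summable_mult summable_Suc_powr norm_zeta_term_le)

lemma holomorphic_zeta_num: "zeta_num holomorphic_on {z. Re z > 0}"
proof -
  have "(\<lambda>z. \<Sum>n. zeta_term n z) holomorphic_on {z. Re z > 0}"
  proof (rule holomorphic_uniform_sequence)
    show "open {z. Re z > 0}" by (rule open_halfspace_Re_gt)
    show "(\<lambda>z. \<Sum>k<n. zeta_term k z) holomorphic_on {z. Re z > 0}" for n
      unfolding zeta_term_def by (intro holomorphic_intros)
    fix x :: complex assume x: "x \<in> {z. Re z > 0}"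
    \<comment> \<open>On this disc the real part is at least Re x / 2, which fixes a summable
      exponent for the majorant.\<close>
    define d where "d = Re x / 2"
    have sub: "Re x / 2 \<le> Re z" "norm z \<le> norm x + d" if "z \<in> cball x d" for z
    proof -
      have n: "norm (x - z) \<le> d" using that by (simp add: dist_norm)
      have "Re (x - z) \<le> d" using complex_Re_le_cmod[of "x - z"] n by linarith
      thus "Re x / 2 \<le> Re z" by (simp add: d_def)
      show "norm z \<le> norm x + d" using norm_triangle_ineq2[of z x] n by (simp add: norm_minus_commute)
    qed
    have "uniform_limit (cball x d) (\<lambda>n z. \<Sum>k<n. zeta_term k z) (\<lambda>z. \<Sum>n. zeta_term n z) sequentially"
    proof (rule Weierstrass_m_test)
      fix n z assume z: "z \<in> cball x d"
      have "Re z > 0" using sub(1)[OF z] x by simp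
      hence "norm (zeta_term n z) \<le> norm z * norm (z - 1) * (real n + 1) powr (- Re z - 1)" by (rule norm_zeta_term_le)
      also have "\<dots> \<le> (norm x + d) * (norm x + d + 1) * (real n + 1) powr (- (Re x / 2) - 1)"
      proof (intro mult_mono powr_mono)
        show "norm (z - 1) \<le> norm x + d + 1" using norm_triangle_ineq4[of z 1] sub(2)[OF z] by simp
      qed (use sub[OF z] x in \<open>auto simp: d_def intro!: mult_nonneg_nonneg add_nonneg_nonneg\<close>)
      finally show "norm (zeta_term n z) \<le> (norm x + d) * (norm x + d + 1) * (real n + 1) powr (- (Re x / 2) - 1)" .
    next
      show "summable (\<lambda>n. (norm x + d) * (norm x + d + 1) * (real n + 1) powr (- (Re x / 2) - 1))"
        using x by (intro summable_mult summable_Suc_powr) auto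
    qed
    moreover have "cball x d \<subseteq> {z. Re z > 0}" using sub(1) x by force
    ultimately show "\<exists>d. 0 < d \<and> cball x d \<subseteq> {z. Re z > 0} \<and>
        uniform_limit (cball x d) (\<lambda>n z. \<Sum>k<n. zeta_term k z) (\<lambda>z. \<Sum>n. zeta_term n z) sequentially"
      using x by (intro exI[of _ d]) (auto simp: d_def)
  qed
  thus ?thesis unfolding zeta_num_def[abs_def] by (intro holomorphic_intros)
qed

lemma zeta_num_1: "zeta_num 1 = 1"
proof -
  have "zeta_term n 1 = 0" for n
  proof -
    have "complex_of_real (real n + 2) \<noteq> 0" "complex_of_real (real n + 1) \<noteq> 0"
      by (simp_all only: of_real_eq_0_iff)
    thus ?thesis unfolding zeta_term_def
      by (simp only: diff_self mult_zero_left powr_zero_eq_one if_False add_0_left)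
  qed
  thus ?thesis by (simp add: zeta_num_def)
qed

lemma norm_zeta_num_le:
  assumes \<sigma>: "\<sigma> > 0"
  obtains C where "C > 0" "\<And>z. Re z \<ge> \<sigma> \<Longrightarrow> norm (zeta_num z) \<le> C * (1 + norm z) ^ 2"
proof -
  define D where "D = (\<Sum>n. (real n + 1) powr (- \<sigma> - 1))"
  have sm: "summable (\<lambda>n. (real n + 1) powr (- \<sigma> - 1))" using \<sigma> by (intro summable_Suc_powr) auto
  have D: "D \<ge> 0" unfolding D_def by (intro suminf_nonneg sm) auto
  show ?thesis
  proof (rule that[of "1 + D"])
    fix z assume z: "Re z \<ge> \<sigma>"
    have b: "norm (zeta_term n z) \<le> norm z * norm (z - 1) * (real n + 1) powr (- \<sigma> - 1)" for n
    proof -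
      have "norm (zeta_term n z) \<le> norm z * norm (z - 1) * (real n + 1) powr (- Re z - 1)"
        using z \<sigma> by (intro norm_zeta_term_le) auto
      also have "\<dots> \<le> norm z * norm (z - 1) * (real n + 1) powr (- \<sigma> - 1)"
        using z by (intro mult_left_mono powr_mono) auto
      finally show ?thesis .
    qed
    have "norm (\<Sum>n. zeta_term n z) \<le> (\<Sum>n. norm z * norm (z - 1) * (real n + 1) powr (- \<sigma> - 1))"
      using b by (intro norm_suminf_le summable_mult sm) auto
    also have "\<dots> = norm z * norm (z - 1) * D" unfolding D_def by (rule suminf_mult[OF sm])
    also have "\<dots> \<le> norm z * (1 + norm z) * D"
      using D norm_triangle_ineq4[of z 1] by (intro mult_right_mono mult_left_mono) auto
    also have "\<dots> \<le> (1 + norm z) * (1 + norm z) * D" using D by (intro mult_right_mono) auto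
    finally have "norm (\<Sum>n. zeta_term n z) \<le> (1 + norm z) ^ 2 * D" by (simp add: power2_eq_square)
    hence "norm (zeta_num z) \<le> norm z + (1 + norm z) ^ 2 * D"
      unfolding zeta_num_def using norm_triangle_ineq[of z "\<Sum>n. zeta_term n z"] by linarith
    moreover have "norm z \<le> (1 + norm z) ^ 2" by (simp add: power2_eq_square algebra_simps)
    moreover have "(1 + D) * Y = Y + Y * D" for Y by (simp add: algebra_simps)
    ultimately show "norm (zeta_num z) \<le> (1 + D) * (1 + norm z) ^ 2" by (metis add_mono_thms_linordered_semiring(3) order_trans)
  qed (use D in auto)
qed

text \<open>The terms telescope. In the strip 0 < Re z < 1, where the partial sums diverge, this
  says that the sum minus the integral of u^(-z) over [0, N] tends to \<zeta>(z).\<close>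

lemma zeta_partial_sums:
  assumes z: "Re z > 0" "z \<noteq> 1"
  shows "(\<lambda>N. (\<Sum>n<N. of_real (real n + 1) powr (- z)) - of_real (real N) powr (1 - z) / (1 - z))
    \<longlonglongrightarrow> zeta_num z / (z - 1)"
proof (rule LIMSEQ_imp_Suc)
  have "(\<Sum>n<N. zeta_term n z) = (z - 1) * ((\<Sum>n<Suc N. of_real (real n + 1) powr (- z)) - 1) + of_real (real N + 1) powr (1 - z) - 1" for N
  proof (induction N)
    case (Suc N)
    have "complex_of_real (real (Suc N) + 1) = of_real (real N + 2)" "complex_of_real (real (Suc N) + 1) = of_real (real N + 2)" by simp_all
    thus ?case using Suc.IH by (simp add: zeta_term_def algebra_simps)
  qed (use z in simp)
  note eq = this
  have eq': "(\<Sum>n<Suc N. of_real (real n + 1) powr (- z)) - of_real (real (Suc N)) powr (1 - z) / (1 - z) =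
     ((\<Sum>n<N. zeta_term n z) + z) / (z - 1)" for N
  proof -
    have nz: "z - 1 \<noteq> 0" using z by simp
    have gen: "((z - 1) * (a - 1) + X - 1 + z) / (z - 1) = a - X / (1 - z)" for a X :: complex
    proof -
      have e1: "(z - 1) * (a - 1) + X - 1 + z = (z - 1) * a + X" by (simp add: algebra_simps)
      have e2: "X / (1 - z) = - (X / (z - 1))" by (metis minus_diff_eq divide_minus_right)
      have "((z - 1) * a + X) / (z - 1) = a + X / (z - 1)" using nz by (simp add: add_divide_distrib)
      thus ?thesis unfolding e1 e2 by simp
    qed
    show ?thesis unfolding eq gen by (simp add: add.commute)
  qed
  have "(\<lambda>N. ((\<Sum>n<N. zeta_term n z) + z) / (z - 1)) \<longlonglongrightarrow> ((\<Sum>n. zeta_term n z) + z) / (z - 1)"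
    using z by (intro tendsto_intros summable_LIMSEQ summable_zeta_term) auto
  thus "(\<lambda>N. (\<Sum>n<Suc N. of_real (real n + 1) powr (- z)) - of_real (real (Suc N)) powr (1 - z) / (1 - z))
    \<longlonglongrightarrow> zeta_num z / (z - 1)"
    unfolding eq' zeta_num_def by (simp add: add.commute)
qed

lemma zeta_num_sums:
  assumes z: "Re z > 1"
  shows "(\<lambda>n. of_nat (Suc n) powr (- z)) sums (zeta_num z / (z - 1))"
proof -
  have "((\<lambda>x. x powr (1 - Re z)) \<longlongrightarrow> 0) at_top" using z by (intro tendsto_neg_powr filterlim_ident) auto
  hence "(\<lambda>N. real N powr (1 - Re z)) \<longlonglongrightarrow> 0" by (rule filterlim_compose[OF _ filterlim_real_sequentially])
  hence "(\<lambda>N. complex_of_real (real N) powr (1 - z)) \<longlonglongrightarrow> 0"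
  proof (rule Lim_null_comparison[rotated])
    show "\<forall>\<^sub>F N in sequentially. norm (complex_of_real (real N) powr (1 - z)) \<le> real N powr (1 - Re z)"
      using eventually_gt_at_top[of 0] by eventually_elim (simp only: norm_of_real_powr of_nat_0_less_iff, simp)
  qed
  moreover have "z \<noteq> 1" "Re z > 0" using z by auto
  ultimately have "(\<lambda>N. (\<Sum>n<N. of_real (real n + 1) powr (- z)) - of_real (real N) powr (1 - z) / (1 - z) +
     of_real (real N) powr (1 - z) / (1 - z)) \<longlonglongrightarrow> zeta_num z / (z - 1) + 0 / (1 - z)"
    by (intro tendsto_intros zeta_partial_sums) auto
  thus ?thesis unfolding sums_def by (simp add: add.commute)
qed

text \<open>The power minus its step function with right end points, which is the sum written as an
  integral. In the strip 0 < Re z < 1 its integral over the positive half-line is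
  -\<zeta>(z).\<close>

definition ceil_diff :: "complex \<Rightarrow> real \<Rightarrow> complex" where
  "ceil_diff z u = of_real u powr (- z) - of_real (of_int \<lceil>u\<rceil>) powr (- z)"

lemma ceil_powr_le: "u > 0 \<Longrightarrow> \<sigma> > 0 \<Longrightarrow> of_int \<lceil>u\<rceil> powr (- \<sigma>) \<le> (u::real) powr (- \<sigma>)"
  by (rule powr_mono2') (auto simp: le_of_int_ceiling)

lemma borel_measurable_of_int_ceiling [measurable]: "(\<lambda>u::real. real_of_int \<lceil>u\<rceil>) \<in> borel_measurable borel"
  by measurable

text \<open>Two majorants: the power itself on (0, 1], integrable because \<sigma> < 1, and beyond 1
  the bound \<sigma> u^(-\<sigma>-1) from the mean value theorem on an interval of length 1.\<close>

lemma ceil_diff_integrable: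
  assumes \<sigma>: "0 < \<sigma>" "\<sigma> < 1"
  shows "set_integrable lborel {0<..} (\<lambda>u::real. u powr (- \<sigma>) - of_int \<lceil>u\<rceil> powr (- \<sigma>))"
proof -
  have i1: "set_integrable lborel {0<..1} (\<lambda>u::real. u powr (- \<sigma>))"
  proof -
    have "(\<lambda>u::real. u powr (- \<sigma>)) absolutely_integrable_on {0..1}"
      using has_integral_powr_from_0[of "- \<sigma>" 1] \<sigma> by (intro nonnegative_absolutely_integrable_1) (auto simp: has_integral_integrable)
    hence "(\<lambda>u::real. u powr (- \<sigma>)) absolutely_integrable_on {0<..1}"
      by (rule set_integrable_subset) auto
    thus ?thesis unfolding set_integrable_def by (subst (asm) integrable_completion) auto
  qed
  have i2: "set_integrable lborel {1<..} (\<lambda>u::real. \<sigma> * u powr (- \<sigma> - 1))"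
  proof -
    have "(\<lambda>u::real. u powr (- \<sigma> - 1)) absolutely_integrable_on {1..}"
      using has_integral_powr_to_inf[of "- \<sigma> - 1" 1] \<sigma> by (intro nonnegative_absolutely_integrable_1) (auto simp: has_integral_integrable)
    hence "(\<lambda>u::real. u powr (- \<sigma> - 1)) absolutely_integrable_on {1<..}"
      by (rule set_integrable_subset) auto
    hence "set_integrable lborel {1<..} (\<lambda>u::real. u powr (- \<sigma> - 1))"
      unfolding set_integrable_def by (subst (asm) integrable_completion) auto
    thus ?thesis by (intro set_integrable_mult_right)
  qed
  have "integrable lborel (\<lambda>u. indicator {0<..1} u *\<^sub>R u powr (- \<sigma>) + indicator {1<..} u *\<^sub>R (\<sigma> * u powr (- \<sigma> - 1)))"
    using i1 i2 unfolding set_integrable_def by (rule Bochner_Integration.integrable_add)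
  thus ?thesis unfolding set_integrable_def
  proof (rule Bochner_Integration.integrable_bound)
    show "(\<lambda>u. indicator {0<..} u *\<^sub>R (u powr (- \<sigma>) - of_int \<lceil>u\<rceil> powr (- \<sigma>))) \<in> borel_measurable lborel" by measurable
    have "u powr (- \<sigma>) - of_int \<lceil>u\<rceil> powr (- \<sigma>) \<le> \<sigma> * u powr (- \<sigma> - 1)" if u: "u > 1" for u :: real
    proof -
      have "\<exists>v. u < v \<and> v < u + 1 \<and> (u + 1) powr (- \<sigma>) - u powr (- \<sigma>) = (u + 1 - u) * (- \<sigma> * v powr (- \<sigma> - 1))"
        using u by (intro MVT2) (auto intro!: derivative_eq_intros simp: powr_diff)
      then obtain v where v: "u < v" "u powr (- \<sigma>) - (u + 1) powr (- \<sigma>) = \<sigma> * v powr (- \<sigma> - 1)"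
        by (auto simp: algebra_simps)
      have "(u + 1) powr (- \<sigma>) \<le> of_int \<lceil>u\<rceil> powr (- \<sigma>)"
        by (rule powr_mono2') (use u \<sigma> in linarith)+
      moreover have "\<sigma> * v powr (- \<sigma> - 1) \<le> \<sigma> * u powr (- \<sigma> - 1)"
        using v u \<sigma> by (intro mult_left_mono powr_mono2') auto
      ultimately show ?thesis using v by linarith
    qed
    moreover have "u powr (- \<sigma>) - of_int \<lceil>u\<rceil> powr (- \<sigma>) \<le> u powr (- \<sigma>)" for u :: real by simp
    ultimately show "AE u in lborel. norm (indicator {0<..} u *\<^sub>R (u powr (- \<sigma>) - of_int \<lceil>u\<rceil> powr (- \<sigma>)))
      \<le> norm (indicator {0<..1} u *\<^sub>R u powr (- \<sigma>) + indicator {1<..} u *\<^sub>R (\<sigma> * u powr (- \<sigma> - 1)))"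
      using ceil_powr_le[OF _ \<sigma>(1)] \<sigma> by (intro AE_I2) (auto simp: indicator_def not_le)
  qed
qed

lemma ceil_diff_has_integral:
  assumes z: "0 < Re z" "Re z < 1"
  shows "(ceil_diff z has_integral (of_real (real N) powr (1 - z) / (1 - z) - (\<Sum>n<N. of_real (real n + 1) powr (- z)))) {0..real N}"
proof -
  have z1: "1 - z \<noteq> 0" using z by auto
  have p: "((\<lambda>u. complex_of_real u powr (- z)) has_integral (of_real (real N) powr (1 - z) / (1 - z) - of_real 0 powr (1 - z) / (1 - z))) {0..real N}"
  proof (rule fundamental_theorem_of_calculus_interior)
    show "continuous_on {0..real N} (\<lambda>u. complex_of_real u powr (1 - z) / (1 - z))"
    proof (intro continuous_on_divide continuous_on_const)
      have "((\<lambda>u. complex_of_real u powr (1 - z)) \<longlongrightarrow> of_real u powr (1 - z)) (at u within {0..real N})" if "u \<in> {0..real N}" for u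
      proof (cases "u = 0")
        case False
        thus ?thesis using that by (intro tendsto_powr_complex tendsto_intros) auto
      next
        case True
        \<comment> \<open>The limit rule for complex powers needs a base off the cut, so continuity
          at 0 comes from the real power with exponent 1 - Re z > 0.\<close>
        have lim: "((\<lambda>u. u powr (1 - Re z)) \<longlongrightarrow> 0 powr (1 - Re z)) (at 0 within {0..real N})"
          by (rule tendsto_powr'[OF tendsto_ident_at tendsto_const]) (use z in \<open>auto simp: eventually_at_filter\<close>)
        have "((\<lambda>u. complex_of_real u powr (1 - z)) \<longlongrightarrow> 0) (at 0 within {0..real N})"
        proof (rule Lim_null_comparison)
          show "\<forall>\<^sub>F u in at 0 within {0..real N}. norm (complex_of_real u powr (1 - z)) \<le> u powr (1 - Re z)"
            by (auto simp: eventually_at_filter norm_of_real_powr intro!: always_eventually)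
        qed (use lim z in simp)
        thus ?thesis using True by simp
      qed
      thus "continuous_on {0..real N} (\<lambda>u. complex_of_real u powr (1 - z))" by (simp add: continuous_on_def)
    qed (use z1 in auto)
    fix u assume u: "u \<in> {0<..<real N}"
    hence "((\<lambda>w. w powr (1 - z)) has_field_derivative (1 - z) * of_real u powr (1 - z - 1)) (at (complex_of_real u))"
      by (intro has_field_derivative_powr) auto
    hence "((\<lambda>w. w powr (1 - z) / (1 - z)) has_field_derivative (1 - z) * of_real u powr (1 - z - 1) / (1 - z)) (at (complex_of_real u))"
      by (rule DERIV_cdivide)
    thus "((\<lambda>u. of_real u powr (1 - z) / (1 - z)) has_vector_derivative complex_of_real u powr (- z)) (at u)"
      using z1 by (auto dest: has_vector_derivative_real_field)
  qed auto
  have c: "((\<lambda>u. complex_of_real (of_int \<lceil>u\<rceil>) powr (- z)) has_integral (\<Sum>n<N. of_real (real n + 1) powr (- z))) {0..real N}"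
  proof (induction N)
    case (Suc N)
    have "((\<lambda>u. complex_of_real (of_int \<lceil>u\<rceil>) powr (- z)) has_integral of_real (real N + 1) powr (- z)) {real N..real (Suc N)}"
    \<comment> \<open>On (N, N + 1] the ceiling is N + 1; only the left end point differs.\<close>
    proof (rule has_integral_spike_finite[of "{real N}"])
      show "((\<lambda>u. of_real (real N + 1) powr (- z)) has_integral of_real (real N + 1) powr (- z)) {real N..real (Suc N)}"
        using has_integral_const_real[of "complex_of_real (real N + 1) powr (- z)" "real N" "real (Suc N)"] by simp
      fix u assume "u \<in> {real N..real (Suc N)} - {real N}"
      hence "\<lceil>u\<rceil> = int N + 1" by (intro ceiling_unique) auto
      thus "complex_of_real (of_int \<lceil>u\<rceil>) powr (- z) = of_real (real N + 1) powr (- z)" by simp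
    qed auto
    from has_integral_combine[OF _ _ Suc.IH this] show ?case by simp
  qed (simp add: has_integral_refl)
  show ?thesis unfolding ceil_diff_def[abs_def] using has_integral_diff[OF p c] by simp
qed

text \<open>Exhaustion by (0, N] and the partial sum formula. The integrability assumption is
  discharged later as a by-product of Fubini.\<close>

lemma ceil_diff_integral:
  assumes z: "0 < Re z" "Re z < 1" and i: "set_integrable lborel {0<..} (ceil_diff z)"
  shows "(LINT u:{0<..}|lborel. ceil_diff z u) = - (zeta_num z / (z - 1))"
proof -
  have "(\<lambda>N. LINT u:{0<..real N}|lborel. ceil_diff z u) \<longlonglongrightarrow> (LINT u:(\<Union>N. {0<..real N})|lborel. ceil_diff z u)"
  proof (rule set_integral_cont_up)
    show "incseq (\<lambda>N. {0<..real N})" by (auto simp: incseq_def)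
    have u: "(\<Union>N. {0<..real N}) = {0<..}" using real_arch_simple by auto
    show "set_integrable lborel (\<Union>N. {0<..real N}) (ceil_diff z)" unfolding u by (rule i)
  qed auto
  moreover have "(\<Union>N. {0<..real N}) = {0<..}" using real_arch_simple by auto
  moreover have "(LINT u:{0<..real N}|lborel. ceil_diff z u) = of_real (real N) powr (1 - z) / (1 - z) - (\<Sum>n<N. of_real (real n + 1) powr (- z))" for N
  proof -
    have "set_integrable lborel {0<..real N} (ceil_diff z)" by (rule set_integrable_subset[OF i]) auto
    from set_borel_integral_eq_integral(2)[OF this]
    have "(LINT u:{0<..real N}|lborel. ceil_diff z u) = integral {0<..real N} (ceil_diff z)" .
    also have "\<dots> = integral {0..real N} (ceil_diff z)"
      by (rule integral_subset_negligible) (auto intro!: negligible_subset[of "{0}"])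
    finally show ?thesis using ceil_diff_has_integral[OF z, of N] by (simp add: integral_unique)
  qed
  ultimately have "(\<lambda>N. of_real (real N) powr (1 - z) / (1 - z) - (\<Sum>n<N. of_real (real n + 1) powr (- z))) \<longlonglongrightarrow> (LINT u:{0<..}|lborel. ceil_diff z u)"
    by simp
  moreover have "z \<noteq> 1" using z by auto
  with zeta_partial_sums[of z] z have "(\<lambda>N. - ((\<Sum>n<N. of_real (real n + 1) powr (- z)) - of_real (real N) powr (1 - z) / (1 - z))) \<longlonglongrightarrow> - (zeta_num z / (z - 1))"
    by (intro tendsto_minus) auto
  hence "(\<lambda>N. of_real (real N) powr (1 - z) / (1 - z) - (\<Sum>n<N. of_real (real n + 1) powr (- z))) \<longlonglongrightarrow> - (zeta_num z / (z - 1))"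
    by simp
  ultimately show ?thesis by (rule LIMSEQ_unique)
qed

text \<open>A sum over n becomes the integral of a step function, so that the integral and the sum
  of a kernel can be subtracted under one integral sign.\<close>

lemma integral_of_ceiling:
  fixes h :: "nat \<Rightarrow> real"
  assumes h: "\<And>n. h n \<ge> 0" "h sums S"
  shows "set_integrable lborel {0<..} (\<lambda>u::real. h (nat \<lceil>u\<rceil> - 1))"
    and "(LINT u:{0::real<..}|lborel. h (nat \<lceil>u\<rceil> - 1)) = S"
proof -
  define f where "f = (\<lambda>n u. indicator {real n<..real n + 1} u *\<^sub>R h n)"
  have i: "integrable lborel (f n)" for n
    unfolding f_def by (intro integrable_scaleR_left integrable_real_indicator) auto
  have If: "(\<integral>u. f n u \<partial>lborel) = h n" for n unfolding f_def by simp
  have Ifn: "(\<integral>u. norm (f n u) \<partial>lborel) = h n" for n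
  proof -
    have "(\<lambda>u. norm (f n u)) = f n" using h(1) by (auto simp: f_def fun_eq_iff)
    thus ?thesis using If[of n] by simp
  qed
  have eq: "(\<lambda>n. f n u) sums (indicator {0<..} u *\<^sub>R h (nat \<lceil>u\<rceil> - 1))" for u
  proof (cases "u > 0")
    case True
    define m where "m = nat \<lceil>u\<rceil> - 1"
    have c: "\<lceil>u\<rceil> \<ge> 1" using True by linarith
    have "indicator {real n<..real n + 1} u = (if n = m then 1 else 0 :: real)" for n
    proof -
      have "u \<in> {real n<..real n + 1} \<longleftrightarrow> \<lceil>u\<rceil> = int n + 1"
        by (auto simp: ceiling_eq_iff)
      also have "\<dots> \<longleftrightarrow> n = m"
      proof -
        have "1 \<le> nat \<lceil>u\<rceil>" using c by linarith
        hence "int m = \<lceil>u\<rceil> - 1" using c by (simp add: m_def of_nat_diff)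
        thus ?thesis by linarith
      qed
      finally show ?thesis by (simp add: indicator_def)
    qed
    hence "(\<lambda>n. f n u) = (\<lambda>n. if n = m then h n else 0)" by (auto simp: f_def fun_eq_iff)
    thus ?thesis using sums_single[of m h] True by (simp add: m_def)
  next
    case False
    hence "(\<lambda>n. f n u) = (\<lambda>n. 0)" by (auto simp: f_def fun_eq_iff)
    thus ?thesis using False by simp
  qed
  have nf: "norm (f n u) = f n u" for n u using h(1) by (auto simp: f_def)
  have AE: "AE u in lborel. summable (\<lambda>n. norm (f n u))" unfolding nf using eq by (auto dest: sums_summable)
  have sm: "summable (\<lambda>n. \<integral>u. norm (f n u) \<partial>lborel)" unfolding Ifn using h(2) by (rule sums_summable)
  have su: "(\<Sum>n. f n u) = indicator {0<..} u *\<^sub>R h (nat \<lceil>u\<rceil> - 1)" for u using eq by (rule sums_unique[symmetric])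
  show "set_integrable lborel {0<..} (\<lambda>u::real. h (nat \<lceil>u\<rceil> - 1))"
    using integrable_suminf[OF i AE sm] unfolding su set_integrable_def .
  show "(LINT u:{0::real<..}|lborel. h (nat \<lceil>u\<rceil> - 1)) = S"
    using integral_suminf[OF i AE sm] unfolding su If set_lebesgue_integral_def using sums_unique[OF h(2)] by simp
qed

text \<open>Logarithmic differentiation of Gamma z Gamma (1 - z) = pi / sin (pi z) expresses pi cot
  (pi z) through two Digamma series. At z = i x the cotangent becomes a hyperbolic one, rewritten
  with exp (2 pi x) - 1 to match the geometric sum of the other kernel.\<close>

theorem coth_partial_fractions:
  fixes x :: real
  assumes x: "x > 0"
  shows "(\<lambda>n. 1 / (x\<^sup>2 + (real n + 1)\<^sup>2)) sums (pi / x * (1/2 + 1 / (exp (2 * pi * x) - 1) - 1 / (2 * pi * x)))"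
proof -
  define z where "z = \<i> * of_real x"
  have Imz: "Im z = x" by (simp add: z_def)
  have nz: "z \<notin> \<int>\<^sub>\<le>\<^sub>0" "1 - z \<notin> \<int>\<^sub>\<le>\<^sub>0" "z \<noteq> 0" "1 - z \<noteq> 0"
    using x by (auto intro!: nonpos_Ints_Im simp: z_def complex_eq_iff)
  have nI: "z \<notin> \<int>"
  proof
    assume "z \<in> \<int>"
    then obtain j where "z = of_int j" by (auto elim: Ints_cases)
    thus False using x Imz by simp
  qed
  have sn: "sin (of_real pi * z) \<noteq> 0" using nI by (auto simp: sin_eq_0 Ints_def)
  define c where "c = cos (of_real pi * z) / sin (of_real pi * z)"
  have dig: "Digamma z - Digamma (1 - z) = - of_real pi * c"
  proof -
    have "((\<lambda>z. Gamma z * Gamma (1 - z)) has_field_derivative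
       (Gamma z * Digamma z * Gamma (1 - z) + Gamma z * (Gamma (1 - z) * Digamma (1 - z) * (- 1)))) (at z)"
      using nz by (auto intro!: derivative_eq_intros simp: algebra_simps)
    moreover have "((\<lambda>z. Gamma z * Gamma (1 - z)) has_field_derivative
       (- (of_real pi * (cos (of_real pi * z) * of_real pi)) / (sin (of_real pi * z) * sin (of_real pi * z)))) (at z)"
      unfolding Gamma_reflection_complex using sn by (auto intro!: derivative_eq_intros)
    ultimately have "Gamma z * Digamma z * Gamma (1 - z) + Gamma z * (Gamma (1 - z) * Digamma (1 - z) * (- 1)) =
       - (of_real pi * (cos (of_real pi * z) * of_real pi)) / (sin (of_real pi * z) * sin (of_real pi * z))"
      by (rule DERIV_unique)
    also have "Gamma z * Digamma z * Gamma (1 - z) + Gamma z * (Gamma (1 - z) * Digamma (1 - z) * (- 1)) =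
       (Gamma z * Gamma (1 - z)) * (Digamma z - Digamma (1 - z))" by (simp add: algebra_simps)
    also have "- (of_real pi * (cos (of_real pi * z) * of_real pi)) / (sin (of_real pi * z) * sin (of_real pi * z)) =
       (of_real pi / sin (of_real pi * z)) * (- of_real pi * c)" by (simp add: c_def)
    also have "of_real pi / sin (of_real pi * z) = Gamma z * Gamma (1 - z)" by (rule Gamma_reflection_complex[symmetric])
    finally have "(Gamma z * Gamma (1 - z)) * (Digamma z - Digamma (1 - z)) = (Gamma z * Gamma (1 - z)) * (- of_real pi * c)" .
    moreover have "Gamma z * Gamma (1 - z) \<noteq> 0" using nz by (simp add: Gamma_eq_zero_iff)
    ultimately show ?thesis by (simp only: mult_cancel_left) simp
  qed
  have "(\<lambda>k. (inverse (of_nat (Suc k)) - inverse (z + of_nat k)) - (inverse (of_nat (Suc k)) - inverse (1 - z + of_nat k)))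
      sums ((Digamma z + euler_mascheroni) - (Digamma (1 - z) + euler_mascheroni))"
    using summable_sums[OF summable_Digamma[OF nz(3)]] summable_sums[OF summable_Digamma[OF nz(4)]]
    by (intro sums_diff) (simp_all add: Digamma_def)
  hence "(\<lambda>k. inverse (1 - z + of_nat k) - inverse (z + of_nat k)) sums (- of_real pi * c)"
    by (simp add: dig)
  \<comment> \<open>Adding this telescoping series moves z + k to z + k + 1, so that the two
    denominators multiply to (k + 1)^2 + x^2; it costs the term 1 / z.\<close>
  moreover have "(\<lambda>k. inverse (z + of_nat k) - inverse (z + of_nat (Suc k))) sums (inverse (z + of_nat 0) - 0)"
    by (intro telescope_sums' filterlim_compose[OF tendsto_inverse_0]
              tendsto_add_filterlim_at_infinity[OF tendsto_const] tendsto_of_nat)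
  ultimately have "(\<lambda>k. (inverse (1 - z + of_nat k) - inverse (z + of_nat k)) + (inverse (z + of_nat k) - inverse (z + of_nat (Suc k))))
      sums (- of_real pi * c + (inverse (z + of_nat 0) - 0))"
    by (rule sums_add)
  also have "(\<lambda>k. (inverse (1 - z + of_nat k) - inverse (z + of_nat k)) + (inverse (z + of_nat k) - inverse (z + of_nat (Suc k))))
      = (\<lambda>k. \<i> * of_real (2 * x / (x\<^sup>2 + (real k + 1)\<^sup>2)))"
  proof
    fix k :: nat
    have n: "1 - z + of_nat k \<noteq> 0" "z + of_nat (Suc k) \<noteq> 0" using x by (auto simp: z_def complex_eq_iff)
    have "inverse (1 - z + of_nat k) - inverse (z + of_nat (Suc k)) = 2 * z / ((1 - z + of_nat k) * (z + of_nat (Suc k)))"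
      using n by (simp add: field_simps)
    also have "(1 - z + of_nat k) * (z + of_nat (Suc k)) = of_real (x\<^sup>2 + (real k + 1)\<^sup>2)"
      by (simp add: z_def power2_eq_square algebra_simps)
    finally show "(inverse (1 - z + of_nat k) - inverse (z + of_nat k)) + (inverse (z + of_nat k) - inverse (z + of_nat (Suc k)))
       = \<i> * of_real (2 * x / (x\<^sup>2 + (real k + 1)\<^sup>2))" by (simp add: z_def)
  qed
  finally have s1: "(\<lambda>k. \<i> * of_real (2 * x / (x\<^sup>2 + (real k + 1)\<^sup>2))) sums (- of_real pi * c + inverse z)" by simp
  have "- of_real pi * c + inverse z = \<i> * of_real (pi * (1 + 2 / (exp (2 * pi * x) - 1)) - 1 / x)"
  proof -
    define E where "E = exp (pi * x)"
    have E: "E > 1" using x by (simp add: E_def)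
    have e: "exp (\<i> * (of_real pi * z)) = of_real (inverse E)" "exp (- (\<i> * (of_real pi * z))) = of_real E"
    proof -
      have "\<i> * (of_real pi * z) = of_real (- (pi * x))" by (simp add: z_def complex_eq_iff)
      thus "exp (\<i> * (of_real pi * z)) = of_real (inverse E)" "exp (- (\<i> * (of_real pi * z))) = of_real E"
        unfolding E_def by (simp_all only: exp_of_real of_real_minus[symmetric] minus_minus exp_minus)
    qed
    have "cos (of_real pi * z) = of_real ((inverse E + E) / 2)" by (simp add: cos_exp_eq e)
    moreover have "sin (of_real pi * z) = of_real (inverse E - E) / (2 * \<i>)" by (simp add: sin_exp_eq e)
    moreover have "complex_of_real (a / 2) / (of_real b / (2 * \<i>)) = \<i> * of_real (a / b)" for a b
      by (cases "b = 0") (simp_all add: field_simps)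
    ultimately have "c = \<i> * of_real ((inverse E + E) / (inverse E - E))" by (simp only: c_def)
    also have "(inverse E + E) / (inverse E - E) = - (1 + 2 / (E * E - 1))"
    proof -
      have "E * E > 1" using E by (simp add: less_1_mult)
      hence "E * E - 1 \<noteq> 0" "1 - E * E \<noteq> 0" "E \<noteq> 0" by auto
      thus ?thesis by (simp add: divide_simps) (simp add: algebra_simps)
    qed
    also have "E * E = exp (2 * pi * x)" by (simp add: E_def flip: exp_add)
    finally have c: "c = \<i> * of_real (- (1 + 2 / (exp (2 * pi * x) - 1)))" .
    have "inverse z = \<i> * of_real (- (1 / x))" using x by (simp add: z_def field_simps)
    thus ?thesis unfolding c by (simp add: algebra_simps)
  qed
  with s1 have "(\<lambda>k. \<i> * of_real (2 * x / (x\<^sup>2 + (real k + 1)\<^sup>2))) sums (\<i> * of_real (pi * (1 + 2 / (exp (2 * pi * x) - 1)) - 1 / x))"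
    by simp
  from sums_Im[OF this] have "(\<lambda>k. 2 * x / (x\<^sup>2 + (real k + 1)\<^sup>2)) sums (pi * (1 + 2 / (exp (2 * pi * x) - 1)) - 1 / x)"
    by simp
  from sums_mult[OF this, of "1 / (2 * x)"]
  have "(\<lambda>n. 1 / (2 * x) * (2 * x / (x\<^sup>2 + (real n + 1)\<^sup>2))) sums (1 / (2 * x) * (pi * (1 + 2 / (exp (2 * pi * x) - 1)) - 1 / x))" .
  moreover have "1 / (2 * x) * (2 * x / a) = 1 / a" for a using x by simp
  moreover have "1 / (2 * x) * (pi * (1 + 2 / e) - 1 / x) = pi / x * (1/2 + 1 / e - 1 / (2 * pi * x))" for e
    using x by (cases "e = 0") (simp_all add: field_simps)
  ultimately show ?thesis by (simp only:)
qed

section \<open>Mellin integrals of the two kernels and the functional equation\<close>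

lemma sqrt_substitution:
  fixes f :: "real \<Rightarrow> complex"
  assumes cont: "continuous_on {0<..} f" and i: "set_integrable lborel {0<..} (\<lambda>v. (1 / (2 * sqrt v)) *\<^sub>R f (sqrt v))"
  shows "set_integrable lborel {0<..} f"
    and "(LINT x:{0<..}|lborel. f x) = (LINT v:{0<..}|lborel. (1 / (2 * sqrt v)) *\<^sub>R f (sqrt v))"
proof -
  have ei: "einterval 0 \<infinity> = {0<..}" by (auto simp: einterval_def)
  have cf: "isCont f x" if "x > 0" for x
    using cont that by (simp add: continuous_on_eq_continuous_at)
  have d: "DERIV sqrt x :> 1 / (2 * sqrt x)" if "0 < ereal x" for x
    using DERIV_real_sqrt[of x] that by (simp add: inverse_eq_divide mult.commute)
  have A: "((ereal \<circ> sqrt \<circ> real_of_ereal) \<longlongrightarrow> 0) (at_right 0)"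
  proof -
    have "(sqrt \<longlongrightarrow> sqrt 0) (at_right 0)" by (intro tendsto_intros)
    hence "((ereal \<circ> sqrt) \<longlongrightarrow> ereal 0) (at_right 0)" by (simp add: o_def)
    thus ?thesis unfolding zero_ereal_def ereal_tendsto_simps .
  qed
  have B: "((ereal \<circ> sqrt \<circ> real_of_ereal) \<longlongrightarrow> \<infinity>) (at_left \<infinity>)"
  proof -
    show ?thesis unfolding ereal_tendsto_simps using sqrt_at_top by (simp add: o_def)
  qed
  have c1: "isCont (\<lambda>x. 1 / (2 * sqrt x)) x" if "0 < ereal x" for x
    using that by (intro continuous_intros) auto
  have "set_integrable lborel {0<..} (\<lambda>v. norm ((1 / (2 * sqrt v)) *\<^sub>R f (sqrt v)))"
    using i by (rule set_integrable_norm)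
  hence in': "set_integrable lborel (einterval 0 \<infinity>) (\<lambda>v. norm (f (sqrt v)) * (1 / (2 * sqrt v)))"
    unfolding ei by (rule set_integrable_cong[THEN iffD1, rotated -1]) auto
  have "set_integrable lborel (einterval 0 \<infinity>) (\<lambda>x. norm (f x))"
    by (rule interval_integral_substitution_nonneg(1)[OF _ d _ c1 _ _ A B in'])
       (auto intro!: continuous_norm cf)
  hence n: "set_integrable lborel {0<..} (\<lambda>x. norm (f x))" by (simp add: ei)
  have "(\<lambda>x. indicator {0<..} x *\<^sub>R f x) \<in> borel_measurable borel"
    by (rule borel_measurable_continuous_on_indicator[OF _ cont]) auto
  hence "set_borel_measurable lborel {0<..} f" by (simp add: set_borel_measurable_def)
  thus i3: "set_integrable lborel {0<..} f"
    using n unfolding set_integrable_def set_borel_measurable_def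
    by (subst integrable_norm_iff[symmetric]) auto
  have "(LBINT x=0..\<infinity>. f x) = (LBINT v=0..\<infinity>. (1 / (2 * sqrt v)) *\<^sub>R f (sqrt v))"
    by (rule interval_integral_substitution_integrable[OF _ d _ c1 _ A B])
       (use cf i i3 in \<open>auto simp: ei\<close>)
  thus "(LINT x:{0<..}|lborel. f x) = (LINT v:{0<..}|lborel. (1 / (2 * sqrt v)) *\<^sub>R f (sqrt v))"
    by (simp add: interval_lebesgue_integral_0_infty)
qed

text \<open>For u = 1 the substitution x = sqrt v gives a Beta integral with A + B = 1, which
  reflection evaluates as a cosine; scaling supplies the power of u.\<close>

lemma power_over_quadratic_integral:
  fixes z :: complex and u :: real
  assumes z: "\<bar>Re z\<bar> < 1" and u: "u > 0"
  shows "set_integrable lborel {0<..} (\<lambda>x. of_real x powr z * of_real (1 / (x\<^sup>2 + u\<^sup>2)))"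
    and "(LINT x:{0<..}|lborel. of_real x powr z * of_real (1 / (x\<^sup>2 + u\<^sup>2))) =
      of_real pi / (2 * cos (of_real pi * z / 2)) * of_real u powr (z - 1)"
proof -
  define A B where "A = (1 + z) / 2" and "B = (1 - z) / 2"
  have AB: "Re A > 0" "Re B > 0" "A + B = 1" using z by (auto simp: A_def B_def abs_less_iff field_simps)
  define f where "f = (\<lambda>x. complex_of_real x powr z * of_real (1 / (x\<^sup>2 + 1)))"
  have eq: "(1 / (2 * sqrt v)) *\<^sub>R f (sqrt v) = 1/2 * (of_real v powr (A - 1) * of_real (1 + v) powr (- (A + B)))"
    if v: "v \<in> {0<..}" for v
  proof -
    have v': "v > 0" "1 + v > 0" using v by auto
    have "of_real (1 / sqrt v) = complex_of_real v powr (- 1/2)"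
    proof -
      have "v powr (- 1/2) = 1 / sqrt v" using v' powr_minus_divide[of v "1/2"] by (simp add: powr_half_sqrt)
      thus ?thesis using v' powr_of_real[of v "- 1/2"] by simp
    qed
    moreover have "complex_of_real (sqrt v) powr z = of_real v powr (z / 2)" by (rule of_real_sqrt_powr[OF v'(1)])
    moreover have "complex_of_real v powr (- 1/2) * of_real v powr (z / 2) = of_real v powr (A - 1)"
      unfolding powr_add[symmetric] by (rule arg_cong[where f = "(powr) _"]) (simp add: A_def field_simps)
    moreover have "complex_of_real (1 + v) powr (- (A + B)) = of_real (1 / (1 + v))"
      using v' powr_of_real[of "1 + v" "- 1"] unfolding AB(3) by (simp add: powr_minus_divide)
    moreover have "(1 / (2 * sqrt v)) *\<^sub>R f (sqrt v) = 1/2 * (of_real (1 / sqrt v) * (complex_of_real (sqrt v) powr z) * of_real (1 / (1 + v)))"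
    proof -
      have "(complex_of_real (sqrt v))\<^sup>2 = of_real ((sqrt v)\<^sup>2)" by (rule of_real_power[symmetric])
      hence "(complex_of_real (sqrt v))\<^sup>2 = of_real v" using v' by simp
      thus ?thesis using v' by (simp add: f_def scaleR_conv_of_real add.commute)
    qed
    ultimately show ?thesis by simp
  qed
  have i: "set_integrable lborel {0<..} (\<lambda>v. (1 / (2 * sqrt v)) *\<^sub>R f (sqrt v))"
    using set_integrable_mult_right[of "1/2 :: complex", OF Beta_set_integral(1)[OF AB(1,2)]]
    by (rule set_integrable_cong[THEN iffD1, rotated -1]) (use eq in auto)
  have cont: "continuous_on {0<..} f"
  proof -
    have "x\<^sup>2 + 1 \<noteq> 0" for x :: real by (smt (verit) zero_le_power2)
    thus ?thesis unfolding f_def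
      by (intro continuous_intros) (auto simp flip: of_real_power of_real_add)
  qed
  note sub = sqrt_substitution[OF cont i]
  have val: "(LINT x:{0<..}|lborel. f x) = of_real pi / (2 * cos (of_real pi * z / 2))"
  proof -
    have "(LINT x:{0<..}|lborel. f x) = (LINT v:{0<..}|lborel. 1/2 * (of_real v powr (A - 1) * of_real (1 + v) powr (- (A + B))))"
      unfolding sub(2) by (intro set_lebesgue_integral_cong) (use eq in auto)
    also have "\<dots> = 1/2 * (Gamma A * Gamma B / Gamma (A + B))"
      using Beta_set_integral(2)[OF AB(1,2)] by simp
    also have "\<dots> = 1/2 * (Gamma A * Gamma (1 - A))"
    proof -
      have "B = 1 - A" using AB(3) by (simp add: eq_diff_eq add.commute)
      thus ?thesis by simp
    qed
    also have "Gamma A * Gamma (1 - A) = of_real pi / sin (of_real pi * A)" by (rule Gamma_reflection_complex)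
    also have "sin (of_real pi * A) = cos (of_real pi * z / 2)"
      using sin_add[of "of_real (pi/2)" "of_real pi * z / 2"] sin_of_real[of "pi/2", where 'a = complex] cos_of_real[of "pi/2", where 'a = complex]
      by (simp add: A_def field_simps)
    finally show ?thesis by simp
  qed
  have sc: "of_real x powr z * of_real (1 / (x\<^sup>2 + u\<^sup>2)) = of_real u powr (z - 2) * f (1 / u * x)" if x: "x \<in> {0<..}" for x
  proof -
    have "of_real x powr z = of_real (u * (1 / u * x)) powr z" using u by simp
    also have "\<dots> = of_real u powr z * of_real (1 / u * x) powr z"
      using u x by (intro of_real_mult_powr) auto
    moreover have "1 / (x\<^sup>2 + u\<^sup>2) = 1 / u ^ 2 * (1 / ((1 / u * x)\<^sup>2 + 1))"
      using u by (simp add: field_simps power2_eq_square)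
    moreover have "of_real u powr (z - 2) = complex_of_real u powr z * of_real (1 / u ^ 2)"
      using u by (simp add: powr_diff)
    ultimately show ?thesis unfolding f_def by (simp only: of_real_mult mult_ac)
  qed
  have u1: "1 / u > 0" using u by simp
  have "set_integrable lborel {0<..} (\<lambda>x. of_real u powr (z - 2) * f (1 / u * x))"
    using lborel_set_integral_scale(2)[OF u1 sub(1)] by (rule set_integrable_mult_right)
  thus "set_integrable lborel {0<..} (\<lambda>x. of_real x powr z * of_real (1 / (x\<^sup>2 + u\<^sup>2)))"
    by (rule set_integrable_cong[THEN iffD1, rotated -1]) (use sc in auto)
  have "(LINT x:{0<..}|lborel. of_real x powr z * of_real (1 / (x\<^sup>2 + u\<^sup>2))) = (LINT x:{0<..}|lborel. of_real u powr (z - 2) * f (1 / u * x))"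
    by (intro set_lebesgue_integral_cong) (use sc in auto)
  also have "\<dots> = of_real u powr (z - 2) * (LINT x:{0<..}|lborel. f (1 / u * x))" by (rule set_integral_mult_right)
  also have "(LINT x:{0<..}|lborel. f (1 / u * x)) = (LINT x:{0<..}|lborel. f x) / of_real (1 / u)"
    by (rule lborel_set_integral_scale(1)[OF u1])
  also have "of_real u powr (z - 2) * ((LINT x:{0<..}|lborel. f x) / of_real (1 / u)) = (LINT x:{0<..}|lborel. f x) * (of_real u powr (z - 2) * of_real u powr 1)"
    using u by simp
  also have "of_real u powr (z - 2) * of_real u powr 1 = complex_of_real u powr (z - 1)"
    by (simp flip: powr_add del: powr_to_1)
  finally show "(LINT x:{0<..}|lborel. of_real x powr z * of_real (1 / (x\<^sup>2 + u\<^sup>2))) =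
      of_real pi / (2 * cos (of_real pi * z / 2)) * of_real u powr (z - 1)" by (simp add: val)
qed

lemma power_over_quadratic_integral_norm:
  fixes z :: complex and u :: real
  assumes z: "\<bar>Re z\<bar> < 1" and u: "u > 0"
  shows "(LINT x:{0<..}|lborel. norm (of_real x powr z * of_real (1 / (x\<^sup>2 + u\<^sup>2)) :: complex)) =
      pi / (2 * cos (pi * Re z / 2)) * u powr (Re z - 1)"
proof -
  have "complex_of_real (LINT x:{0<..}|lborel. norm (of_real x powr z * of_real (1 / (x\<^sup>2 + u\<^sup>2)) :: complex)) =
    (LINT x:{0<..}|lborel. of_real (norm (of_real x powr z * of_real (1 / (x\<^sup>2 + u\<^sup>2)) :: complex)))"
    by (rule set_integral_complex_of_real[symmetric])
  also have "\<dots> = (LINT x:{0<..}|lborel. of_real x powr (of_real (Re z)) * of_real (1 / (x\<^sup>2 + u\<^sup>2)))"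
  proof (intro set_lebesgue_integral_cong allI impI)
    fix x :: real assume x: "x \<in> {0<..}"
    have "norm (of_real x powr z * of_real (1 / (x\<^sup>2 + u\<^sup>2)) :: complex) = x powr Re z * (1 / (x\<^sup>2 + u\<^sup>2))"
      using x by (simp only: norm_mult norm_of_real_powr norm_of_real greaterThan_iff) simp
    thus "of_real (norm (of_real x powr z * of_real (1 / (x\<^sup>2 + u\<^sup>2)) :: complex)) = of_real x powr of_real (Re z) * complex_of_real (1 / (x\<^sup>2 + u\<^sup>2))"
      using x powr_of_real[of x "Re z"] by simp
  qed auto
  also have "\<dots> = of_real pi / (2 * cos (of_real pi * of_real (Re z) / 2)) * of_real u powr (of_real (Re z) - 1)"
    by (rule power_over_quadratic_integral(2)) (use z u in auto)
  also have "\<dots> = of_real (pi / (2 * cos (pi * Re z / 2)) * u powr (Re z - 1))"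
    using u powr_of_real[of u "Re z - 1"] cos_of_real[of "pi * Re z / 2", where 'a = complex] by simp
  finally show ?thesis by (simp only: of_real_eq_iff)
qed

text \<open>Comparing the integral of a decreasing kernel with the sum over its right endpoints; integrating
  the difference against a power of \<open>x\<close> in either order brings in the value of \<open>\<zeta>\<close> in the strip.\<close>

lemma kernel_minus_sum_integral:
  fixes k :: "real \<Rightarrow> real \<Rightarrow> real" and w z c :: complex
  assumes [measurable]: "case_prod k \<in> borel_measurable (lborel \<Otimes>\<^sub>M lborel)"
    and z: "0 < Re z" "Re z < 1" and c: "c \<noteq> 0"
    and k0: "\<And>u x. u > 0 \<Longrightarrow> x > 0 \<Longrightarrow> 0 \<le> k u x" and kmono: "\<And>u v x. 0 < u \<Longrightarrow> u \<le> v \<Longrightarrow> x > 0 \<Longrightarrow> k v x \<le> k u x"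
    and ix: "\<And>u. u > 0 \<Longrightarrow> set_integrable lborel {0<..} (\<lambda>x. of_real x powr w * of_real (k u x))"
    and Ix: "\<And>u. u > 0 \<Longrightarrow> (LINT x:{0<..}|lborel. of_real x powr w * of_real (k u x)) = c * of_real u powr (- z)"
    and Nx: "\<And>u. u > 0 \<Longrightarrow> (LINT x:{0<..}|lborel. norm (of_real x powr w * of_real (k u x) :: complex)) = c' * u powr (- Re z)"
    and iu: "\<And>x. x > 0 \<Longrightarrow> set_integrable lborel {0<..} (\<lambda>u. k u x)"
    and Iu: "\<And>x. x > 0 \<Longrightarrow> (LINT u:{0<..}|lborel. k u x) = D x"
    and su: "\<And>x. x > 0 \<Longrightarrow> (\<lambda>n. k (real n + 1) x) sums E x"
  shows "(LINT x:{0<..}|lborel. of_real x powr w * of_real (D x - E x)) = - c * (zeta_num z / (z - 1))"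
proof -
  define f where "f = (\<lambda>u x. complex_of_real x powr w * of_real (k u x - k (of_int \<lceil>u\<rceil>) x))"
  have [measurable]: "(\<lambda>p. k (fst p) (snd p)) \<in> borel_measurable (lborel \<Otimes>\<^sub>M lborel)"
    using assms(1) by (simp add: case_prod_beta')
  have km2: "(\<lambda>p. k (of_int \<lceil>fst p\<rceil>) (snd p)) \<in> borel_measurable ((lborel :: real measure) \<Otimes>\<^sub>M lborel)"
  proof -
    have "(\<lambda>p. real_of_int \<lceil>fst p\<rceil>) \<in> ((lborel :: real measure) \<Otimes>\<^sub>M (lborel :: real measure)) \<rightarrow>\<^sub>M lborel"
      using measurable_compose[OF measurable_fst[of lborel "lborel :: real measure"], of "\<lambda>u::real. real_of_int \<lceil>u\<rceil>" lborel] borel_measurable_of_int_ceiling by simp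
    hence "(\<lambda>p. (real_of_int \<lceil>fst p\<rceil>, snd p)) \<in> ((lborel :: real measure) \<Otimes>\<^sub>M lborel) \<rightarrow>\<^sub>M (lborel \<Otimes>\<^sub>M (lborel :: real measure))"
      by (rule measurable_Pair[OF _ measurable_snd])
    from measurable_compose[OF this assms(1)] show ?thesis by (simp only: prod.case)
  qed
  have fm: "case_prod f \<in> borel_measurable (lborel \<Otimes>\<^sub>M lborel)"
    unfolding f_def case_prod_beta' using km2 by measurable
  have cu: "real_of_int \<lceil>u\<rceil> > 0" "u \<le> real_of_int \<lceil>u\<rceil>" if "u \<in> {0<..}" for u using that by (auto simp: le_of_int_ceiling)
  have fd: "f u x = of_real x powr w * of_real (k u x) - of_real x powr w * of_real (k (of_int \<lceil>u\<rceil>) x)" for u x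
    by (simp add: f_def algebra_simps)
  have i1: "set_integrable lborel {0<..} (f u)" if u: "u \<in> {0<..}" for u
    unfolding fd[abs_def] using u cu[OF u] by (intro set_integral_diff ix) auto
  have inner: "(LINT x:{0<..}|lborel. f u x) = c * ceil_diff z u" if u: "u \<in> {0<..}" for u
  proof -
    have "(LINT x:{0<..}|lborel. f u x) = c * of_real u powr (- z) - c * of_real (of_int \<lceil>u\<rceil>) powr (- z)"
      unfolding fd using u cu[OF u] by (subst set_integral_diff(2)) (auto simp: ix Ix)
    thus ?thesis by (simp add: ceil_diff_def algebra_simps)
  qed
  \<comment> \<open>Monotonicity in u makes the kernel difference nonnegative, so its norm is a
    difference of norms and \<open>Nx\<close> evaluates the integral exactly.\<close>
  have innern: "(LINT x:{0<..}|lborel. norm (f u x)) = c' * (u powr (- Re z) - of_int \<lceil>u\<rceil> powr (- Re z))" if u: "u \<in> {0<..}" for u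
  proof -
    have "(LINT x:{0<..}|lborel. norm (f u x)) = (LINT x:{0<..}|lborel. norm (of_real x powr w * of_real (k u x) :: complex) - norm (of_real x powr w * of_real (k (of_int \<lceil>u\<rceil>) x) :: complex))"
    proof (intro set_lebesgue_integral_cong allI impI)
      fix x :: real assume x: "x \<in> {0<..}"
      have "0 \<le> k u x - k (of_int \<lceil>u\<rceil>) x" "0 \<le> k u x" "0 \<le> k (of_int \<lceil>u\<rceil>) x"
        using kmono[of u "of_int \<lceil>u\<rceil>" x] k0[of u x] k0[of "of_int \<lceil>u\<rceil>" x] cu[OF u] u x by auto
      thus "norm (f u x) = norm (of_real x powr w * of_real (k u x) :: complex) - norm (of_real x powr w * of_real (k (of_int \<lceil>u\<rceil>) x) :: complex)"
        unfolding f_def norm_mult norm_of_real by (simp add: algebra_simps)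
    qed auto
    also have "\<dots> = c' * u powr (- Re z) - c' * of_int \<lceil>u\<rceil> powr (- Re z)"
      using u cu[OF u] by (subst set_integral_diff(2)) (auto simp: Nx intro!: set_integrable_norm ix)
    finally show ?thesis by (simp add: algebra_simps)
  qed
  have i2: "set_integrable lborel {0<..} (\<lambda>u. LINT x:{0<..}|lborel. norm (f u x))"
    using set_integrable_mult_right[OF ceil_diff_integrable[OF z], of c']
    by (rule set_integrable_cong[THEN iffD1, rotated -1]) (use innern in auto)
  note swap = set_integrals_swap[OF fm _ _ i1 i2, simplified]
  have "set_integrable lborel {0<..} (\<lambda>u. c * ceil_diff z u)"
    using swap(1) by (rule set_integrable_cong[THEN iffD1, rotated -1]) (use inner in auto)
  hence ci: "set_integrable lborel {0<..} (ceil_diff z)" using c by simp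
  have outer: "(LINT u:{0<..}|lborel. f u x) = of_real x powr w * of_real (D x - E x)" if x: "x \<in> {0<..}" for x
  proof -
    have x': "x > 0" using x by simp
    have ceq: "k (real (nat \<lceil>u\<rceil> - 1) + 1) x = k (of_int \<lceil>u\<rceil>) x" if "u \<in> {0<..}" for u :: real
    proof -
      have "1 \<le> nat \<lceil>u\<rceil>" using that by (simp add: Suc_le_eq)
      hence "real (nat \<lceil>u\<rceil> - 1) + 1 = real (nat \<lceil>u\<rceil>)" by (simp add: of_nat_diff)
      also have "\<dots> = of_int \<lceil>u\<rceil>" using that by simp
      finally show ?thesis by (simp only:)
    qed
    have nn: "k (real n + 1) x \<ge> 0" for n using k0 x' by auto
    note ic = integral_of_ceiling[of "\<lambda>n. k (real n + 1) x", OF nn su[OF x']]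
    have ic1: "set_integrable lborel {0<..} (\<lambda>u::real. k (of_int \<lceil>u\<rceil>) x)"
      using ic(1) by (rule set_integrable_cong[THEN iffD1, rotated -1]) (use ceq in auto)
    have "(LINT u:{0::real<..}|lborel. k (real (nat \<lceil>u\<rceil> - 1) + 1) x) = (LINT u:{0::real<..}|lborel. k (of_int \<lceil>u\<rceil>) x)"
      by (intro set_lebesgue_integral_cong) (use ceq in auto)
    hence ic2: "(LINT u:{0::real<..}|lborel. k (of_int \<lceil>u\<rceil>) x) = E x" using ic(2) by simp
    have "(LINT u:{0<..}|lborel. k u x - k (of_int \<lceil>u\<rceil>) x) = D x - E x"
      using set_integral_diff(2)[OF iu[OF x'] ic1] Iu[OF x'] ic2 by simp
    hence "(LINT u:{0<..}|lborel. complex_of_real (k u x - k (of_int \<lceil>u\<rceil>) x)) = of_real (D x - E x)"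
      by (simp only: set_integral_complex_of_real)
    thus ?thesis unfolding f_def by (simp only: set_integral_mult_right)
  qed
  have "(LINT x:{0<..}|lborel. of_real x powr w * of_real (D x - E x)) = (LINT x:{0<..}|lborel. LINT u:{0<..}|lborel. f u x)"
    by (intro set_lebesgue_integral_cong) (use outer in auto)
  also have "\<dots> = (LINT u:{0<..}|lborel. LINT x:{0<..}|lborel. f u x)" using swap(3) by simp
  also have "\<dots> = (LINT u:{0<..}|lborel. c * ceil_diff z u)"
    by (intro set_lebesgue_integral_cong) (use inner in auto)
  also have "\<dots> = c * - (zeta_num z / (z - 1))" using ceil_diff_integral[OF z ci] by simp
  finally show ?thesis by simp
qed

text \<open>The exponential kernel with weight x^(z-1) has defect 1/(2 pi x) - 1/(exp (2 pi x) - 1)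
  and produces \<zeta>(z) with a Gamma factor. The quadratic kernel with weight x^z has, by the
  partial fractions of coth, pi / x times the same defect and produces \<zeta>(1 - z) with a cosine
  factor. Equating the two values is the functional equation.\<close>

theorem zeta_functional_equation_strip:
  assumes z: "0 < Re z" "Re z < 1"
  shows "zeta_num (1 - z) / (1 - z - 1) = 2 * of_real (2 * pi) powr (- z) * Gamma z * cos (of_real pi * z / 2) * (zeta_num z / (z - 1))"
proof -
  define I where "I = (LINT x:{0<..}|lborel. of_real x powr (z - 1) * complex_of_real (1 / (2 * pi * x) - 1 / (exp (2 * pi * x) - 1)))"
  have Gz: "Gamma z \<noteq> 0" using nonpos_Ints_Re[OF z(1)] by (simp add: Gamma_eq_zero_iff)
  have I1: "I = - (Gamma z * of_real (2 * pi) powr (- z)) * (zeta_num z / (z - 1))"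
    unfolding I_def
  proof (rule kernel_minus_sum_integral[where k = "\<lambda>u x. exp (- (2 * pi * u * x))" and c' = "Gamma (Re z) * (2 * pi) powr (- Re z)"])
    show "(\<lambda>(u, x). exp (- (2 * pi * u * x))) \<in> borel_measurable (lborel \<Otimes>\<^sub>M lborel)" by measurable
    show "Gamma z * of_real (2 * pi) powr (- z) \<noteq> 0" using Gz by simp
    fix u :: real assume u: "u > 0"
    hence u2: "2 * pi * u > 0" by simp
    show "set_integrable lborel {0<..} (\<lambda>x. of_real x powr (z - 1) * complex_of_real (exp (- (2 * pi * u * x))))"
      by (rule Gamma_set_integral(1)[OF z(1) u2])
    have "(LINT x:{0<..}|lborel. of_real x powr (z - 1) * complex_of_real (exp (- (2 * pi * u * x)))) = Gamma z * of_real (2 * pi * u) powr (- z)"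
      by (rule Gamma_set_integral(2)[OF z(1) u2])
    also have "complex_of_real (2 * pi * u) powr (- z) = of_real (2 * pi) powr (- z) * of_real u powr (- z)"
      using u by (intro of_real_mult_powr) auto
    finally show "(LINT x:{0<..}|lborel. of_real x powr (z - 1) * complex_of_real (exp (- (2 * pi * u * x)))) =
       Gamma z * of_real (2 * pi) powr (- z) * of_real u powr (- z)" by simp
    have "(LINT x:{0<..}|lborel. norm (of_real x powr (z - 1) * complex_of_real (exp (- (2 * pi * u * x))))) = Gamma (Re z) * (2 * pi * u) powr (- Re z)"
      by (rule Gamma_set_integral_norm[OF z(1) u2])
    thus "(LINT x:{0<..}|lborel. norm (of_real x powr (z - 1) * complex_of_real (exp (- (2 * pi * u * x))))) =
       Gamma (Re z) * (2 * pi) powr (- Re z) * u powr (- Re z)" using u by (simp add: powr_mult)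
  next
    fix x :: real assume x: "x > 0"
    hence x2: "2 * pi * x > 0" by simp
    have c: "set_integrable lborel {0<..} (\<lambda>u. complex_of_real (exp (- (2 * pi * u * x))))"
      by (rule set_integrable_cong[THEN iffD1, rotated -1, OF Gamma_set_integral(1)[of 1 "2 * pi * x"]]) (use x in \<open>auto simp: mult_ac\<close>)
    show "set_integrable lborel {0<..} (\<lambda>u. exp (- (2 * pi * u * x)))"
      using set_integrable_norm[OF c] by simp
    have "(LINT u:{0<..}|lborel. complex_of_real (exp (- (2 * pi * u * x)))) = (LINT u:{0<..}|lborel. of_real u powr (1 - 1) * of_real (exp (- (2 * pi * x * u))))"
      by (intro set_lebesgue_integral_cong) (auto simp: mult_ac)
    also have "\<dots> = Gamma 1 * of_real (2 * pi * x) powr (- 1)"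
      by (rule Gamma_set_integral(2)) (use x in auto)
    also have "\<dots> = of_real (1 / (2 * pi * x))" by (simp add: powr_minus_divide)
    finally show "(LINT u:{0<..}|lborel. exp (- (2 * pi * u * x))) = 1 / (2 * pi * x)"
      by (simp only: set_integral_complex_of_real of_real_eq_iff)
    have "(\<lambda>n. exp (- (2 * pi * x)) * exp (- (2 * pi * x)) ^ n) sums (exp (- (2 * pi * x)) * (1 / (1 - exp (- (2 * pi * x)))))"
      using x by (intro sums_mult geometric_sums) auto
    also have "(\<lambda>n. exp (- (2 * pi * x)) * exp (- (2 * pi * x)) ^ n) = (\<lambda>n. exp (- (2 * pi * (real n + 1) * x)))"
      by (auto simp: fun_eq_iff algebra_simps simp flip: exp_of_nat_mult exp_add)
    also have "exp (- (2 * pi * x)) * (1 / (1 - exp (- (2 * pi * x)))) = 1 / (exp (2 * pi * x) - 1)"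
    proof -
      have "exp (2 * pi * x) > 1" using x by simp
      thus ?thesis by (simp add: exp_minus field_simps)
    qed
    finally show "(\<lambda>n. exp (- (2 * pi * (real n + 1) * x))) sums (1 / (exp (2 * pi * x) - 1))" .
  qed (use z in auto)
  have cz: "cos (of_real pi * z / 2) \<noteq> 0"
    using cos_pi_nonzero[of "z/2"] z by (simp add: abs_if)
  have I2: "(LINT x:{0<..}|lborel. of_real x powr z * complex_of_real (pi / (2 * x) - pi / x * (1/2 + 1 / (exp (2 * pi * x) - 1) - 1 / (2 * pi * x))))
     = - (of_real pi / (2 * cos (of_real pi * z / 2))) * (zeta_num (1 - z) / (1 - z - 1))"
  proof (rule kernel_minus_sum_integral[where k = "\<lambda>u x. 1 / (x\<^sup>2 + u\<^sup>2)" and c' = "pi / (2 * cos (pi * Re z / 2))"])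
    show "(\<lambda>(u, x). 1 / (x\<^sup>2 + u\<^sup>2)) \<in> borel_measurable (lborel \<Otimes>\<^sub>M (lborel :: real measure))" by measurable
    show "of_real pi / (2 * cos (of_real pi * z / 2)) \<noteq> 0" using cz by simp
    fix u :: real assume u: "u > 0"
    show "set_integrable lborel {0<..} (\<lambda>x. of_real x powr z * complex_of_real (1 / (x\<^sup>2 + u\<^sup>2)))"
      using z u by (intro power_over_quadratic_integral) auto
    show "(LINT x:{0<..}|lborel. of_real x powr z * complex_of_real (1 / (x\<^sup>2 + u\<^sup>2))) = of_real pi / (2 * cos (of_real pi * z / 2)) * of_real u powr (- (1 - z))"
      using power_over_quadratic_integral(2)[of z u] z u by simp
    show "(LINT x:{0<..}|lborel. norm (of_real x powr z * complex_of_real (1 / (x\<^sup>2 + u\<^sup>2)))) = pi / (2 * cos (pi * Re z / 2)) * u powr (- Re (1 - z))"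
      using power_over_quadratic_integral_norm[of z u] z u by simp
  next
    fix u v x :: real assume "0 < u" "u \<le> v" "x > 0"
    thus "1 / (x\<^sup>2 + v\<^sup>2) \<le> 1 / (x\<^sup>2 + u\<^sup>2)"
      by (intro divide_left_mono add_left_mono power_mono mult_pos_pos add_pos_pos) auto
  next
    fix x :: real assume x: "x > 0"
    have c: "set_integrable lborel {0<..} (\<lambda>u. complex_of_real (1 / (x\<^sup>2 + u\<^sup>2)))"
      by (rule set_integrable_cong[THEN iffD1, rotated -1, OF power_over_quadratic_integral(1)[of 0 x]]) (use x in \<open>auto simp: add.commute\<close>)
    thus "set_integrable lborel {0<..} (\<lambda>u. 1 / (x\<^sup>2 + u\<^sup>2))"
      using set_integrable_norm[OF c] by (simp del: of_real_divide)
    have "(LINT u:{0<..}|lborel. complex_of_real (1 / (x\<^sup>2 + u\<^sup>2))) = (LINT u:{0<..}|lborel. of_real u powr 0 * complex_of_real (1 / (u\<^sup>2 + x\<^sup>2)))"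
      by (intro set_lebesgue_integral_cong) (auto simp: add.commute)
    also have "\<dots> = of_real pi / (2 * cos (of_real pi * 0 / 2)) * of_real x powr (0 - 1)"
      by (rule power_over_quadratic_integral(2)) (use x in auto)
    also have "\<dots> = of_real (pi / (2 * x))" by (simp add: powr_minus_divide)
    finally show "(LINT u:{0<..}|lborel. 1 / (x\<^sup>2 + u\<^sup>2)) = pi / (2 * x)"
      by (simp only: set_integral_complex_of_real of_real_eq_iff)
    show "(\<lambda>n. 1 / (x\<^sup>2 + (real n + 1)\<^sup>2)) sums (pi / x * (1/2 + 1 / (exp (2 * pi * x) - 1) - 1 / (2 * pi * x)))"
      by (rule coth_partial_fractions[OF x])
  qed (use z in auto)
  \<comment> \<open>The constant 1/2 in the coth expansion cancels against pi / (2 x), and the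
    factor pi / x lowers the exponent from z to z - 1.\<close>
  have "(LINT x:{0<..}|lborel. of_real x powr z * complex_of_real (pi / (2 * x) - pi / x * (1/2 + 1 / (exp (2 * pi * x) - 1) - 1 / (2 * pi * x))))
     = (LINT x:{0<..}|lborel. of_real pi * (of_real x powr (z - 1) * complex_of_real (1 / (2 * pi * x) - 1 / (exp (2 * pi * x) - 1))))"
  proof (intro set_lebesgue_integral_cong allI impI)
    fix x :: real assume "x \<in> {0<..}"
    hence x: "x > 0" by simp
    have "pi / (2 * x) - pi / x * (1/2 + 1 / (exp (2 * pi * x) - 1) - 1 / (2 * pi * x)) = pi / x * (1 / (2 * pi * x) - 1 / (exp (2 * pi * x) - 1))"
      by (simp add: algebra_simps)
    moreover have "of_real x powr (z - 1) = complex_of_real x powr z / of_real x" using x by (simp add: powr_diff)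
    ultimately show "of_real x powr z * complex_of_real (pi / (2 * x) - pi / x * (1/2 + 1 / (exp (2 * pi * x) - 1) - 1 / (2 * pi * x)))
       = of_real pi * (of_real x powr (z - 1) * complex_of_real (1 / (2 * pi * x) - 1 / (exp (2 * pi * x) - 1)))"
      by (simp only: of_real_mult of_real_divide) simp
  qed auto
  also have "\<dots> = of_real pi * I" unfolding I_def by (rule set_integral_mult_right)
  finally have "of_real pi * I = - (of_real pi / (2 * cos (of_real pi * z / 2))) * (zeta_num (1 - z) / (1 - z - 1))"
    using I2 by simp
  moreover have "Y = - 2 * C * I" if "of_real pi * I = - (of_real pi / (2 * C)) * Y" "C \<noteq> 0" for Y C :: complex
  proof -
    have "2 * C * (of_real pi * I) = - (of_real pi * Y)" unfolding that(1) using that(2) by simp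
    hence "of_real pi * (Y + 2 * C * I) = 0" by (simp add: algebra_simps)
    thus ?thesis by (simp add: eq_neg_iff_add_eq_0)
  qed
  ultimately have "zeta_num (1 - z) / (1 - z - 1) = - 2 * cos (of_real pi * z / 2) * I"
    using cz by blast
  thus ?thesis unfolding I1 by (simp add: mult_ac)
qed

text \<open>By the functional equation, \<open>zeta_left_num z\<close> is \<open>z \<zeta>(z)\<close> for \<open>Re z < 1\<close>.\<close>

definition zeta_left_num :: "complex \<Rightarrow> complex" where
  "zeta_left_num z = - 2 * of_real (2 * pi) powr (z - 1) * Gamma (1 - z) * sin (of_real pi * z / 2) * zeta_num (1 - z)"

lemma zeta_left_num_0: "zeta_left_num 0 = 0"
  by (simp add: zeta_left_num_def)

lemma holomorphic_zeta_left_num: "zeta_left_num holomorphic_on {z. Re z < 1}"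
proof -
  have "(zeta_num \<circ> (\<lambda>z. 1 - z)) holomorphic_on {z. Re z < 1}"
    by (rule holomorphic_on_compose_gen[OF _ holomorphic_zeta_num]) (auto intro!: holomorphic_intros)
  hence z: "(\<lambda>z. zeta_num (1 - z)) holomorphic_on {z. Re z < 1}" by (simp add: o_def)
  have "1 - z \<notin> \<int>\<^sub>\<le>\<^sub>0" if "z \<in> {z. Re z < 1}" for z using that by (intro nonpos_Ints_Re) auto
  thus ?thesis unfolding zeta_left_num_def[abs_def]
    by (intro holomorphic_on_mult z holomorphic_Gamma' holomorphic_intros) auto
qed

lemma zeta_left_num_strip:
  assumes z: "0 < Re z" "Re z < 1"
  shows "zeta_left_num z / z = zeta_num z / (z - 1)"
proof -
  have "sin (of_real pi * z / 2) = cos (of_real pi * (1 - z) / 2)"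
    using cos_diff[of "of_real (pi/2)" "of_real pi * z / 2"] sin_of_real[of "pi/2", where 'a = complex] cos_of_real[of "pi/2", where 'a = complex]
    by (simp add: algebra_simps diff_divide_distrib)
  hence "zeta_left_num z / z = 2 * of_real (2 * pi) powr (- (1 - z)) * Gamma (1 - z) * cos (of_real pi * (1 - z) / 2) * (zeta_num (1 - z) / (1 - z - 1))"
    by (simp add: zeta_left_num_def)
  also have "\<dots> = zeta_num (1 - (1 - z)) / (1 - (1 - z) - 1)"
    using zeta_functional_equation_strip[of "1 - z"] z by simp
  finally show ?thesis by simp
qed

text \<open>At 0 the quotient \<open>zeta_left_num z / z\<close> has a removable singularity, since
  the numerator vanishes there; the derivative is its limit.\<close>

definition zeta_cont :: "complex \<Rightarrow> complex" where
  "zeta_cont z = (if Re z > 0 then zeta_num z / (z - 1) else if z = 0 then deriv zeta_left_num 0 else zeta_left_num z / z)"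

text \<open>Two open sets cover the punctured plane, and on their overlap, the strip, the two
  formulas agree by the functional equation.\<close>

lemma holomorphic_zeta_cont: "zeta_cont holomorphic_on (- {1})"
proof -
  have o1: "open ({z. Re z > 0} - {1})" by (intro open_Diff open_halfspace_Re_gt) auto
  have o2: "open {z. Re z < 1}" by (rule open_halfspace_Re_lt)
  have "zeta_cont holomorphic_on ({z. Re z > 0} - {1})"
  proof (rule holomorphic_transform)
    show "(\<lambda>z. zeta_num z / (z - 1)) holomorphic_on ({z. Re z > 0} - {1})"
      by (intro holomorphic_intros holomorphic_on_subset[OF holomorphic_zeta_num]) auto
  qed (auto simp: zeta_cont_def)
  moreover have "zeta_cont holomorphic_on {z. Re z < 1}"
  proof (rule holomorphic_transform)
    show "(\<lambda>z. if z = 0 then deriv zeta_left_num 0 else (zeta_left_num z - zeta_left_num 0) / (z - 0)) holomorphic_on {z. Re z < 1}"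
      by (rule pole_lemma_open[OF holomorphic_zeta_left_num o2])
    show "(if z = 0 then deriv zeta_left_num 0 else (zeta_left_num z - zeta_left_num 0) / (z - 0)) = zeta_cont z"
      if "z \<in> {z. Re z < 1}" for z
      using that zeta_left_num_strip[of z] by (auto simp: zeta_cont_def zeta_left_num_0)
  qed
  ultimately have "zeta_cont holomorphic_on ({z. Re z > 0} - {1}) \<union> {z. Re z < 1}"
    using o1 o2 by (rule holomorphic_on_Un)
  moreover have "- {1} \<subseteq> ({z. Re z > 0} - {1}) \<union> {z. Re z < 1}" by auto
  ultimately show ?thesis by (rule holomorphic_on_subset)
qed

text \<open>\<open>riemann_zeta\<close> is a Hilbert choice, so its properties need the existence of the continuation.\<close>

lemma riemann_zeta_spec:
  "riemann_zeta holomorphic_on (- {1})"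
  "Re s > 1 \<Longrightarrow> (\<lambda>n. of_nat (Suc n) powr (- s)) sums riemann_zeta s"
proof -
  define Q where "Q = (\<lambda>f. f holomorphic_on (- {1}) \<and> (\<forall>s. Re s > 1 \<longrightarrow> (\<lambda>n. of_nat (Suc n) powr (- s)) sums f s))"
  have "Q zeta_cont"
    unfolding Q_def using holomorphic_zeta_cont zeta_num_sums by (auto simp: zeta_cont_def)
  hence "Q (SOME f. Q f)" using someI[of Q zeta_cont] by blast
  hence "Q riemann_zeta" by (simp add: Q_def riemann_zeta_def)
  thus "riemann_zeta holomorphic_on (- {1})"
    "Re s > 1 \<Longrightarrow> (\<lambda>n. of_nat (Suc n) powr (- s)) sums riemann_zeta s"
    by (auto simp: Q_def)
qed

lemma riemann_zeta_eq_zeta_cont: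
  assumes "z \<noteq> 1"
  shows "riemann_zeta z = zeta_cont z"
proof -
  have "connected (- {1 :: complex})"
    using connected_punctured_universe[of "1 :: complex"] by simp
  have "riemann_zeta z - zeta_cont z = 0"
  proof (rule analytic_continuation_open[where f = "\<lambda>z. riemann_zeta z - zeta_cont z" and g = "\<lambda>_. 0" and s = "{z. Re z > 1}" and s' = "- {1}"])
    show "open {z. Re z > 1}" by (rule open_halfspace_Re_gt)
    show "{z. Re z > 1} \<noteq> {}" by (auto intro: exI[of _ 2])
    show "(\<lambda>z. riemann_zeta z - zeta_cont z) holomorphic_on - {1}"
      by (intro holomorphic_intros riemann_zeta_spec(1) holomorphic_zeta_cont)
    fix w :: complex assume "w \<in> {z. Re z > 1}"
    hence w: "Re w > 1" by simp
    have "riemann_zeta w = zeta_num w / (w - 1)"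
      using riemann_zeta_spec(2)[OF w] zeta_num_sums[OF w] by (rule sums_unique2)
    thus "riemann_zeta w - zeta_cont w = 0" using w by (simp add: zeta_cont_def)
  qed (use assms \<open>connected (- {1 :: complex})\<close> in auto)
  thus ?thesis by simp
qed

lemma riemann_zeta_right: "Re z > 0 \<Longrightarrow> z \<noteq> 1 \<Longrightarrow> riemann_zeta z = zeta_num z / (z - 1)"
  by (simp add: riemann_zeta_eq_zeta_cont zeta_cont_def)

text \<open>Inside the strip this is the equation already proved; for Re q \<ge> 1 it holds by the
  construction of the continuation. The latter range matters because the divisor series lives on Re
  w = 2, where Re (w - s/2) > 1.\<close>

theorem riemann_zeta_functional_equation:
  assumes q: "Re q > 0" "q \<noteq> 1"
  shows "riemann_zeta (1 - q) = 2 * of_real (2 * pi) powr (- q) * Gamma q * cos (of_real pi * q / 2) * riemann_zeta q"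
proof -
  have nz: "1 - q \<noteq> 0" "1 - q \<noteq> 1" using q by auto
  have "riemann_zeta (1 - q) = zeta_left_num (1 - q) / (1 - q)"
    using nz zeta_left_num_strip[of "1 - q"] q by (simp add: riemann_zeta_eq_zeta_cont zeta_cont_def)
  moreover have "sin (of_real pi * (1 - q) / 2) = cos (of_real pi * q / 2)"
    using sin_diff[of "of_real (pi/2)" "of_real pi * q / 2"] sin_of_real[of "pi/2", where 'a = complex] cos_of_real[of "pi/2", where 'a = complex]
    by (simp add: algebra_simps diff_divide_distrib)
  moreover have "- X / (1 - q) = X / (q - 1)" for X by (metis minus_diff_eq minus_divide_divide minus_minus)
  ultimately show ?thesis
    by (simp add: zeta_left_num_def riemann_zeta_right[OF q] mult_ac)
qed

text \<open>The growth is polynomial; stating it with an arbitrarily small exponential rate \<eta>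
  lets it be charged directly against the decay of the Gamma factors.\<close>

lemma norm_riemann_zeta_le:
  assumes \<sigma>: "\<sigma> > 0" and \<eta>: "\<eta> > 0"
  obtains C where "C > 0" "\<And>z. \<sigma> \<le> Re z \<Longrightarrow> Re z \<le> b \<Longrightarrow> 1 \<le> \<bar>Im z\<bar> \<Longrightarrow> norm (riemann_zeta z) \<le> C * exp (\<eta> * \<bar>Im z\<bar>)"
proof -
  obtain C where C: "C > 0" "\<And>z. Re z \<ge> \<sigma> \<Longrightarrow> norm (zeta_num z) \<le> C * (1 + norm z) ^ 2"
    using norm_zeta_num_le[OF \<sigma>] by blast
  define R where "R = exp (\<eta> * (1 + \<bar>b\<bar>)) * 2 / \<eta> ^ 2"
  show ?thesis
  proof (rule that[of "C * R"])
    show "C * R > 0" using C \<eta> by (simp add: R_def)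
    fix z assume z: "\<sigma> \<le> Re z" "Re z \<le> b" "1 \<le> \<bar>Im z\<bar>"
    have ne: "z \<noteq> 1" using z by auto
    have "1 \<le> \<bar>Im (z - 1)\<bar>" using z by simp
    also have "\<dots> \<le> norm (z - 1)" by (rule abs_Im_le_cmod)
    finally have ge: "1 \<le> norm (z - 1)" .
    have "riemann_zeta z = zeta_num z / (z - 1)" using z \<sigma> ne by (intro riemann_zeta_right) auto
    hence "norm (riemann_zeta z) \<le> norm (zeta_num z) / 1"
      using ge by (simp only: norm_divide) (intro divide_left_mono mult_pos_pos, auto)
    also have "\<dots> \<le> C * (1 + norm z) ^ 2" using C(2) z by simp
    also have "(1 + norm z) ^ 2 \<le> R * exp (\<eta> * \<bar>Im z\<bar>)"
    proof -
      have "norm z \<le> \<bar>Re z\<bar> + \<bar>Im z\<bar>" by (rule cmod_le)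
      also have "\<bar>Re z\<bar> \<le> \<bar>b\<bar>" using z \<sigma> by auto
      finally have n: "1 + norm z \<le> 1 + \<bar>b\<bar> + \<bar>Im z\<bar>" by simp
      have "(\<eta> * (1 + norm z)) ^ 2 / fact 2 \<le> exp (\<eta> * (1 + norm z))"
        using \<eta> by (intro power_div_fact_le_exp) auto
      also have "\<dots> \<le> exp (\<eta> * (1 + \<bar>b\<bar> + \<bar>Im z\<bar>))" using n \<eta> by simp
      finally have a: "(\<eta> * (1 + norm z)) ^ 2 / fact 2 \<le> exp (\<eta> * (1 + \<bar>b\<bar> + \<bar>Im z\<bar>))" .
      have "\<eta> ^ 2 * (1 + norm z) ^ 2 / 2 \<le> exp (\<eta> * (1 + \<bar>b\<bar>)) * exp (\<eta> * \<bar>Im z\<bar>)"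
      proof -
        have "exp (\<eta> * (1 + \<bar>b\<bar> + \<bar>Im z\<bar>)) = exp (\<eta> * (1 + \<bar>b\<bar>)) * exp (\<eta> * \<bar>Im z\<bar>)"
          by (simp add: ring_distribs exp_add)
        moreover have "(fact 2 :: real) = 2" by (simp add: fact_numeral)
        ultimately show ?thesis using a by (simp only: power_mult_distrib)
      qed
      thus ?thesis using \<eta> by (simp add: R_def field_simps)
    qed
    finally show "norm (riemann_zeta z) \<le> C * R * exp (\<eta> * \<bar>Im z\<bar>)" using C(1) by (simp add: mult_ac)
  qed
qed

lemma riemann_zeta_residue_1: "((\<lambda>z. (z - 1) * riemann_zeta z) \<longlongrightarrow> 1) (at 1)"
proof -
  have "isCont zeta_num 1"
    using holomorphic_on_imp_continuous_on[OF holomorphic_zeta_num] continuous_on_eq_continuous_at[OF open_halfspace_Re_gt, of 0 zeta_num]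
    by auto
  hence "(zeta_num \<longlongrightarrow> 1) (at 1)" by (simp add: isCont_def zeta_num_1)
  moreover have "eventually (\<lambda>z. zeta_num z = (z - 1) * riemann_zeta z) (at 1)"
  proof -
    have "eventually (\<lambda>z. z \<in> {z. Re z > 0}) (at (1 :: complex))"
      by (intro eventually_at_in_open' open_halfspace_Re_gt) auto
    thus ?thesis using eventually_neq_at_within[of 1]
      by eventually_elim (auto simp: riemann_zeta_right)
  qed
  ultimately show ?thesis by (rule Lim_transform_eventually)
qed

subsection \<open>Mellin-Barnes integral for \<open>\<phi>\<close>\<close>

text \<open>With n = d m the summand d^(-s) n^(s/2) n^(-w) factors as d^(-(w + s/2)) m^(-(w - s/2)).
  Both Dirichlet series converge absolutely, so their product may be summed over pairs and regrouped
  by n.\<close>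

lemma has_sum_divisor_convolution:
  fixes s w :: complex
  assumes p: "Re (w + s/2) > 1" and q: "Re (w - s/2) > 1"
  defines "a \<equiv> \<lambda>n. divisor_sigma (- s) n * of_nat n powr (s/2) * of_nat n powr (- w)"
  shows "(\<lambda>n. a (Suc n)) sums (riemann_zeta (w + s/2) * riemann_zeta (w - s/2))"
    and "summable (\<lambda>n. norm (a (Suc n)))"
proof -
  define f where "f = (\<lambda>z n. complex_of_nat n powr (- z))"
  have abs: "(\<lambda>n. norm (f z n)) summable_on {1..}" "(f z has_sum riemann_zeta z) {1..}" if "Re z > 1" for z
  proof -
    have s: "summable (\<lambda>n. norm (of_nat (Suc n) powr (- z)))"
    proof -
      have "norm (complex_of_nat (Suc n) powr (- z)) = (real n + 1) powr (- Re z)" for n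
        using norm_of_real_powr[of "real (Suc n)" "- z"] by (simp add: add.commute)
      thus ?thesis using that by (simp only:) (intro summable_Suc_powr, simp)
    qed
    hence 1: "(\<lambda>n. norm (f z (Suc n))) summable_on UNIV"
      by (subst summable_on_UNIV_nonneg_real_iff) (auto simp: f_def)
    have 2: "((\<lambda>n. f z (Suc n)) has_sum riemann_zeta z) UNIV"
      unfolding f_def by (rule norm_summable_imp_has_sum[OF s riemann_zeta_spec(2)[OF that]])
    have bij: "bij_betw Suc UNIV {1..}"
      by (auto simp: bij_betw_def image_iff Suc_le_eq gr0_conv_Suc)
    show "(\<lambda>n. norm (f z n)) summable_on {1..}" "(f z has_sum riemann_zeta z) {1..}"
      using 1 2 summable_on_reindex_bij_betw[OF bij, of "\<lambda>n. norm (f z n)"] has_sum_reindex_bij_betw[OF bij, of "f z"]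
      by simp_all
  qed
  define P where "P = ({1..} :: nat set) \<times> ({1..} :: nat set)"
  define F where "F = (\<lambda>(d, m). f (w + s/2) d * f (w - s/2) m)"
  have Fabs: "(\<lambda>x. norm (F x)) summable_on P"
    unfolding P_def
  proof (rule Infinite_Sum.abs_summable_on_Sigma_iff[THEN iffD2], intro conjI ballI)
    show "(\<lambda>y. norm (F (x, y))) summable_on {1..}" for x
      unfolding F_def using abs(1)[OF q] by (simp add: norm_mult summable_on_cmult_right)
    have "infsum (\<lambda>y. norm (F (x, y))) {1..} = norm (f (w + s/2) x) * infsum (\<lambda>y. norm (f (w - s/2) y)) {1..}" for x
      unfolding F_def using abs(1)[OF q] by (simp add: norm_mult infsum_cmult_right)
    moreover have "infsum (\<lambda>y. norm (f (w - s/2) y)) {1..} \<ge> 0" by (intro infsum_nonneg) auto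
    ultimately have "norm (infsum (\<lambda>y. norm (F (x, y))) {1..}) = norm (f (w + s/2) x) * infsum (\<lambda>y. norm (f (w - s/2) y)) {1..}" for x
      by (simp only: real_norm_def abs_mult abs_of_nonneg norm_ge_zero)
    thus "(\<lambda>x. norm (infsum (\<lambda>y. norm (F (x, y))) {1..})) summable_on {1..}"
      by (simp only: summable_on_cmult_left[OF abs(1)[OF p]])
  qed
  have FS: "(F has_sum (riemann_zeta (w + s/2) * riemann_zeta (w - s/2))) P"
  proof -
    have "F summable_on P" using Fabs by (rule abs_summable_summable)
    then obtain T where S: "(F has_sum T) P" by (auto simp: summable_on_def)
    have "((\<lambda>d. f (w + s/2) d * riemann_zeta (w - s/2)) has_sum T) {1..}"
    proof (rule has_sum_SigmaD[OF S[unfolded P_def]])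
      show "((\<lambda>m. F (d, m)) has_sum (f (w + s/2) d * riemann_zeta (w - s/2))) {1..}" for d
        unfolding F_def using has_sum_cmult_right[OF abs(2)[OF q], of "f (w + s/2) d"] by simp
    qed
    moreover have "((\<lambda>d. f (w + s/2) d * riemann_zeta (w - s/2)) has_sum (riemann_zeta (w + s/2) * riemann_zeta (w - s/2))) {1..}"
      by (rule has_sum_cmult_left[OF abs(2)[OF p]])
    ultimately have "T = riemann_zeta (w + s/2) * riemann_zeta (w - s/2)" by (rule has_sum_unique)
    with S show ?thesis by simp
  qed
  define D where "D = Sigma ({1..} :: nat set) (\<lambda>n. {d. d dvd n})"
  \<comment> \<open>Pairs of a number and one of its divisors correspond to pairs of complementary
    factors; all indices start at 1, which makes the inverse well defined.\<close>
  have bij: "bij_betw (\<lambda>(n, d). (d, n div d)) D P"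
  proof (rule bij_betw_byWitness[where f' = "\<lambda>(d, m). (d * m, d)"])
    show "\<forall>x\<in>D. (case (case x of (n, d) \<Rightarrow> (d, n div d)) of (d, m) \<Rightarrow> (d * m, d)) = x"
      by (auto simp: D_def)
    show "\<forall>x\<in>P. (case (case x of (d, m) \<Rightarrow> (d * m, d)) of (n, d) \<Rightarrow> (d, n div d)) = x"
      by (auto simp: P_def)
    show "(\<lambda>(n, d). (d, n div d)) ` D \<subseteq> P"
      by (auto simp: D_def P_def Suc_le_eq elim!: dvdE)
    show "(\<lambda>(d, m). (d * m, d)) ` P \<subseteq> D" by (auto simp: D_def P_def Suc_le_eq)
  qed
  define G where "G = (\<lambda>(n, d). F (d, n div d))"
  have Geq: "G x = F ((\<lambda>(n, d). (d, n div d)) x)" for x by (simp add: G_def split: prod.splits)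
  have GS: "(G has_sum (riemann_zeta (w + s/2) * riemann_zeta (w - s/2))) D"
    using has_sum_reindex_bij_betw[OF bij, of F] FS by (simp add: Geq[abs_def])
  have GA: "(\<lambda>x. norm (G x)) summable_on D"
    using summable_on_reindex_bij_betw[OF bij, of "\<lambda>x. norm (F x)"] Fabs by (simp add: Geq[abs_def])
  have inner: "(\<Sum>d | d dvd n. G (n, d)) = a n" if n: "n \<ge> 1" for n
  proof -
    have "G (n, d) = of_nat d powr (- s) * (of_nat n powr (s/2) * of_nat n powr (- w))" if d: "d dvd n" for d
    proof -
      obtain m where m: "n = d * m" using d by blast
      have pos: "d > 0" "m > 0" using n m by (auto intro: Nat.gr0I)
      have e: "complex_of_nat n powr z = of_nat d powr z * of_nat m powr z" for z
        using of_real_mult_powr[of "real d" "real m" z] pos m by simp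
      have "of_nat d powr (- s) * (of_nat n powr (s/2) * of_nat n powr (- w)) =
        (of_nat d powr (- s) * of_nat d powr (s/2) * of_nat d powr (- w)) * (of_nat m powr (s/2) * complex_of_nat m powr (- w))"
        unfolding e by (simp add: mult_ac)
      also have "of_nat d powr (- s) * of_nat d powr (s/2) * of_nat d powr (- w) = complex_of_nat d powr (- (w + s/2))"
        unfolding powr_add[symmetric] by (rule arg_cong[where f = "(powr) _"]) (simp add: field_simps)
      also have "of_nat m powr (s/2) * complex_of_nat m powr (- w) = of_nat m powr (- (w - s/2))"
        unfolding powr_add[symmetric] by (rule arg_cong[where f = "(powr) _"]) (simp add: field_simps)
      finally show ?thesis using m pos by (simp add: G_def F_def f_def)
    qed
    hence "(\<Sum>d | d dvd n. G (n, d)) = (\<Sum>d | d dvd n. of_nat d powr (- s) * (of_nat n powr (s/2) * of_nat n powr (- w)))"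
      by (intro sum.cong) auto
    thus ?thesis by (simp add: a_def divisor_sigma_def sum_distrib_right mult.assoc)
  qed
  have fin: "finite {d. d dvd n}" if "n \<ge> 1" for n :: nat using that by (intro finite_divisors_nat) auto
  have aS: "(a has_sum (riemann_zeta (w + s/2) * riemann_zeta (w - s/2))) {1..}"
  proof (rule has_sum_SigmaD[OF GS[unfolded D_def]])
    fix n :: nat assume "n \<in> {1..}"
    thus "((\<lambda>d. G (n, d)) has_sum a n) {d. d dvd n}"
      using inner[of n] fin[of n] by (metis atLeast_iff has_sum_finite)
  qed
  have an: "(\<lambda>n. norm (a n)) summable_on {1..}"
  proof -
    have "(\<lambda>n. infsum (\<lambda>d. norm (G (n, d))) {d. d dvd n}) summable_on {1..}"
    proof -
      have "(\<lambda>n. norm (infsum (\<lambda>d. norm (G (n, d))) {d. d dvd n})) summable_on {1..}"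
        using GA unfolding D_def by (subst (asm) Infinite_Sum.abs_summable_on_Sigma_iff) blast
      thus ?thesis by (simp add: infsum_nonneg)
    qed
    thus ?thesis
    proof (rule summable_on_comparison_test)
      fix n :: nat assume n: "n \<in> {1..}"
      hence "infsum (\<lambda>d. norm (G (n, d))) {d. d dvd n} = (\<Sum>d | d dvd n. norm (G (n, d)))"
        using fin[of n] by (intro infsum_finite) auto
      thus "norm (a n) \<le> infsum (\<lambda>d. norm (G (n, d))) {d. d dvd n}"
        using inner[of n] n norm_sum[of "\<lambda>d. G (n, d)" "{d. d dvd n}"] by simp
    qed auto
  qed
  have bij: "bij_betw Suc UNIV {1..}"
    by (auto simp: bij_betw_def image_iff Suc_le_eq gr0_conv_Suc)
  show "(\<lambda>n. a (Suc n)) sums (riemann_zeta (w + s/2) * riemann_zeta (w - s/2))"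
    using has_sum_reindex_bij_betw[OF bij, of a] aS by (intro has_sum_imp_sums) auto
  show "summable (\<lambda>n. norm (a (Suc n)))"
    using summable_on_reindex_bij_betw[OF bij, of "\<lambda>n. norm (a n)"] an
    by (intro summable_on_imp_summable) auto
qed

lemma Gamma_pair_exp_integrand_bound:
  assumes b: "\<delta> < b" and \<mu>: "\<bar>Re \<mu>\<bar> \<le> \<delta>" "\<bar>Im \<mu>\<bar> \<le> M" and L: "\<bar>Im L\<bar> \<le> pi / 2"
    and C: "\<And>\<mu> t. \<bar>Re \<mu>\<bar> \<le> \<delta> \<Longrightarrow> \<bar>Im \<mu>\<bar> \<le> M \<Longrightarrow>
      norm (Gamma (Complex b t + \<mu>) * Gamma (Complex b t - \<mu>)) \<le> C * exp (- (3 * pi / 4) * \<bar>t\<bar>)" "C > 0"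
  shows "norm (Gamma (Complex b t + \<mu>) * Gamma (Complex b t - \<mu>) * exp (- Complex b t * L)) \<le>
    C * exp (\<bar>b\<bar> * \<bar>Re L\<bar>) * exp (- (pi / 4) * \<bar>t\<bar>)"
proof -
  have "norm (exp (- Complex b t * L)) \<le> exp (\<bar>b\<bar> * \<bar>Re L\<bar>) * exp (\<bar>Im L\<bar> * \<bar>t\<bar>)"
    using norm_exp_neg_mult_le[of "Complex b t" "\<bar>b\<bar>" L] by simp
  also have "\<dots> \<le> exp (\<bar>b\<bar> * \<bar>Re L\<bar>) * exp (pi / 2 * \<bar>t\<bar>)"
    using mult_right_mono[OF L abs_ge_zero[of t]] by simp
  finally have "norm (Gamma (Complex b t + \<mu>) * Gamma (Complex b t - \<mu>) * exp (- Complex b t * L)) \<le>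
     (C * exp (- (3 * pi / 4) * \<bar>t\<bar>)) * (exp (\<bar>b\<bar> * \<bar>Re L\<bar>) * exp (pi / 2 * \<bar>t\<bar>))"
    unfolding norm_mult[of "Gamma _ * Gamma _"] using C(1)[OF \<mu>, of t] C(2) by (intro mult_mono) auto
  also have "\<dots> = C * exp (\<bar>b\<bar> * \<bar>Re L\<bar>) * (exp (- (3 * pi / 4) * \<bar>t\<bar>) * exp (pi / 2 * \<bar>t\<bar>))" by simp
  also have "exp (- (3 * pi / 4) * \<bar>t\<bar>) * exp (pi / 2 * \<bar>t\<bar>) = exp (- (pi / 4) * \<bar>t\<bar>)"
    by (simp flip: exp_add)
  finally show ?thesis .
qed

lemma continuous_Gamma_pair_integrand:
  assumes "\<bar>Re \<mu>\<bar> < b"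
  shows "continuous_on UNIV (\<lambda>t. Gamma (Complex b t + \<mu>) * Gamma (Complex b t - \<mu>) * exp (- Complex b t * L))"
proof -
  have "Complex b t + \<mu> \<notin> \<int>\<^sub>\<le>\<^sub>0" "Complex b t - \<mu> \<notin> \<int>\<^sub>\<le>\<^sub>0" for t
    using assms by (auto intro!: nonpos_Ints_Re)
  thus ?thesis unfolding Complex_eq
    by (intro continuous_at_imp_continuous_on ballI continuous_intros) auto
qed

text \<open>The only integer order with |Re s| < 1 is 0, where \<open>K\<close> is a
  \<open>Lim\<close>. Dominated convergence in the generic integral, by the bound uniform in the
  order, shows that the limit exists and identifies it.\<close>

theorem bessel_K_Mellin_Barnes:
  fixes b :: real and s L z :: complex
  assumes b: "b \<ge> 1/2" and s: "\<bar>Re s\<bar> < 1" and L: "\<bar>Im L\<bar> \<le> pi / 2" "L = 2 * Ln (z / 2)" and z: "z \<noteq> 0"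
  shows "(\<integral>t. Gamma (Complex b t + s/2) * Gamma (Complex b t - s/2) * exp (- Complex b t * L) \<partial>lborel)
     = 4 * of_real pi * bessel_K s z"
proof (cases "s \<in> \<int>")
  case False
  thus ?thesis using bessel_K_generic_Mellin_Barnes[OF b s False L z] by (simp add: bessel_K_def)
next
  case True
  then obtain j where j: "s = of_int j" by (auto elim: Ints_cases)
  hence "\<bar>real_of_int j\<bar> < 1" using s by simp
  hence s0: "s = 0" using j by simp
  define I where "I = (\<lambda>s. \<integral>t. Gamma (Complex b t + s/2) * Gamma (Complex b t - s/2) * exp (- Complex b t * L) \<partial>lborel)"
  have b': "1/4 < b" using b by simp
  obtain C where C: "C > 0" "\<And>\<mu> t. \<bar>Re \<mu>\<bar> \<le> 1/4 \<Longrightarrow> \<bar>Im \<mu>\<bar> \<le> 1/4 \<Longrightarrow>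
      norm (Gamma (Complex b t + \<mu>) * Gamma (Complex b t - \<mu>)) \<le> C * exp (- (3 * pi / 4) * \<bar>t\<bar>)"
    by (rule Gamma_pair_exp_bound_line[OF b', of "1/4"]) auto
  have "(I \<longlongrightarrow> I 0) (at 0 within ball 0 (1/2))"
    unfolding tendsto_at_iff_sequentially o_def
  proof (intro allI impI)
    fix X :: "nat \<Rightarrow> complex"
    assume X: "\<forall>i. X i \<in> ball 0 (1/2) - {0}" "X \<longlonglongrightarrow> 0"
    have X': "\<bar>Re (X i / 2)\<bar> \<le> 1/4" "\<bar>Im (X i / 2)\<bar> \<le> 1/4" for i
    proof -
      have "norm (X i) < 1/2" using X(1) by simp
      thus "\<bar>Re (X i / 2)\<bar> \<le> 1/4" "\<bar>Im (X i / 2)\<bar> \<le> 1/4"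
        using abs_Re_le_cmod[of "X i"] abs_Im_le_cmod[of "X i"] by simp_all
    qed
    show "(\<lambda>i. I (X i)) \<longlonglongrightarrow> I 0"
      unfolding I_def
    proof (rule integral_dominated_convergence[where w = "\<lambda>t. C * exp (\<bar>b\<bar> * \<bar>Re L\<bar>) * exp (- (pi / 4) * \<bar>t\<bar>)"])
      show "(\<lambda>t. Gamma (Complex b t + 0/2) * Gamma (Complex b t - 0/2) * exp (- Complex b t * L)) \<in> borel_measurable lborel"
        using borel_measurable_continuous_onI[OF continuous_Gamma_pair_integrand[of "0/2" b L]] b by simp
      show "(\<lambda>t. Gamma (Complex b t + X i/2) * Gamma (Complex b t - X i/2) * exp (- Complex b t * L)) \<in> borel_measurable lborel" for i
      proof -
        have "\<bar>Re (X i / 2)\<bar> < b" using X'(1)[of i] b by linarith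
        from borel_measurable_continuous_onI[OF continuous_Gamma_pair_integrand[OF this, of L]] show ?thesis by simp
      qed
      show "integrable lborel (\<lambda>t. C * exp (\<bar>b\<bar> * \<bar>Re L\<bar>) * exp (- (pi / 4) * \<bar>t\<bar>))"
        by (intro integrable_mult_right integrable_exp_abs) auto
      show "AE t in lborel. norm (Gamma (Complex b t + X i/2) * Gamma (Complex b t - X i/2) * exp (- Complex b t * L)) \<le> C * exp (\<bar>b\<bar> * \<bar>Re L\<bar>) * exp (- (pi / 4) * \<bar>t\<bar>)" for i
        by (intro AE_I2 Gamma_pair_exp_integrand_bound[OF b' X' L(1) C(2,1)])
      show "AE t in lborel. (\<lambda>i. Gamma (Complex b t + X i/2) * Gamma (Complex b t - X i/2) * exp (- Complex b t * L)) \<longlonglongrightarrow>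
        Gamma (Complex b t + 0/2) * Gamma (Complex b t - 0/2) * exp (- Complex b t * L)"
      proof (intro AE_I2)
        fix t
        have "Complex b t + 0/2 \<notin> \<int>\<^sub>\<le>\<^sub>0" "Complex b t - 0/2 \<notin> \<int>\<^sub>\<le>\<^sub>0"
          using b by (auto intro!: nonpos_Ints_Re)
        thus "(\<lambda>i. Gamma (Complex b t + X i/2) * Gamma (Complex b t - X i/2) * exp (- Complex b t * L)) \<longlonglongrightarrow>
        Gamma (Complex b t + 0/2) * Gamma (Complex b t - 0/2) * exp (- Complex b t * L)"
          by (intro tendsto_intros X(2)) auto
      qed
    qed
  qed
  moreover have w: "at 0 within ball 0 (1/2) = (at 0 :: complex filter)" by (rule at_within_open) auto
  ultimately have "(I \<longlongrightarrow> I 0) (at 0)" by (simp only:)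
  hence "((\<lambda>s. I s / (4 * of_real pi)) \<longlongrightarrow> I 0 / (4 * of_real pi)) (at 0)" by (intro tendsto_intros) auto
  moreover have "eventually (\<lambda>s. I s / (4 * of_real pi) = bessel_K_generic s z) (at 0)"
  proof -
    have "eventually (\<lambda>s::complex. s \<in> ball 0 1 \<and> s \<noteq> 0) (at 0)"
      using eventually_at_ball[of 1 "0::complex" UNIV] by (auto simp: eventually_at_filter elim: eventually_mono)
    thus ?thesis
    proof eventually_elim
      case (elim s)
      hence s: "\<bar>Re s\<bar> < 1" using abs_Re_le_cmod[of s] by simp
      have int: "s \<notin> \<int>"
      proof
        assume "s \<in> \<int>"
        then obtain j where j: "s = of_int j" by (auto elim: Ints_cases)
        hence "\<bar>real_of_int j\<bar> < 1" using s by simp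
        hence "j = 0" by linarith
        thus False using j elim by simp
      qed
      show ?case using bessel_K_generic_Mellin_Barnes[OF b s int L z] by (simp add: I_def)
    qed
  qed
  ultimately have "((\<lambda>s. bessel_K_generic s z) \<longlongrightarrow> I 0 / (4 * of_real pi)) (at 0)"
    by (rule Lim_transform_eventually)
  hence "bessel_K 0 z = I 0 / (4 * of_real pi)"
    unfolding bessel_K_def by (simp add: tendsto_Lim)
  thus ?thesis unfolding s0 by (simp add: I_def)
qed

lemma norm_cos_le_exp: "norm (cos z) \<le> exp \<bar>Im z\<bar>"
proof -
  have "norm (cos z) \<le> (norm (exp (\<i> * z)) + norm (exp (- (\<i> * z)))) / 2"
    using norm_triangle_ineq[of "exp (\<i> * z)" "exp (- (\<i> * z))"] by (simp add: cos_exp_eq norm_divide)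
  also have "\<dots> = (exp (- Im z) + exp (Im z)) / 2" by simp
  also have "\<dots> \<le> exp \<bar>Im z\<bar>" by (cases "Im z \<ge> 0") auto
  finally show ?thesis .
qed

text \<open>The two Bessel terms combined: on the rays of angle pi/4 and -pi/4 the integrands carry
  the phases exp of -i pi w / 2 and i pi w / 2, and together with the prefactors exp of i pi s / 4
  and -i pi s / 4 they add up to the cosine.\<close>

definition phi_kernel :: "complex \<Rightarrow> complex \<Rightarrow> complex" where
  "phi_kernel s w = 2 * of_real (2 * pi) powr (- 2 * w) * (Gamma (w + s/2) * Gamma (w - s/2)) * cos (of_real pi * (w - s/2) / 2)"

text \<open>The functional equation turns the summed kernel \<open>phi_kernel s w \<zeta>(w + s/2) \<zeta>(w - s/2)\<close> into this form, in
  which the pole of \<open>\<zeta>(w - s/2)\<close> has disappeared and the line can be moved to the left.\<close>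

definition phi_Mellin :: "complex \<Rightarrow> complex \<Rightarrow> complex" where
  "phi_Mellin s w = of_real (2 * pi) powr (- (w + s/2)) * Gamma (w + s/2) * riemann_zeta (w + s/2) * riemann_zeta (1 - (w - s/2))"

lemma phi_Mellin_eq_kernel:
  assumes "Re (w - s/2) > 0" "w - s/2 \<noteq> 1"
  shows "phi_Mellin s w = phi_kernel s w * (riemann_zeta (w + s/2) * riemann_zeta (w - s/2))"
proof -
  have "of_real (2 * pi) powr (- (w + s/2)) * of_real (2 * pi) powr (- (w - s/2)) = complex_of_real (2 * pi) powr (- 2 * w)"
    unfolding powr_add[symmetric] by (rule arg_cong[where f = "(powr) _"]) (simp add: field_simps)
  thus ?thesis
    unfolding phi_Mellin_def phi_kernel_def riemann_zeta_functional_equation[OF assms] by (simp add: mult_ac)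
qed

lemma phi_kernel_bound_line:
  assumes s: "\<bar>Re s\<bar> < 1"
  obtains C where "C > 0" "\<And>t. norm (phi_kernel s (Complex 2 t)) \<le> C * exp (- (pi / 4) * \<bar>t\<bar>)"
proof -
  have "\<bar>Re (s/2)\<bar> < 2" using s by simp
  then obtain C where C: "C > 0" "\<And>t. norm (Gamma (Complex 2 t + s/2) * Gamma (Complex 2 t - s/2)) \<le> C * exp (- (3 * pi / 4) * \<bar>t\<bar>)"
    using Gamma_pair_exp_bound_line[OF _ abs_ge_zero[of "Im (s/2)"], of "\<bar>Re (s/2)\<bar>" 2] by (metis order_refl)
  define D where "D = exp (pi / 4 * \<bar>Im s\<bar>)"
  define E where "E = (2 * pi) powr (- 4)"
  show ?thesis
  proof (rule that[of "2 * E * C * D"])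
    show "2 * E * C * D > 0" using C by (simp add: D_def E_def)
    fix t
    have "\<bar>Im (of_real pi * (Complex 2 t - s/2) / 2)\<bar> = pi / 2 * \<bar>t - Im s / 2\<bar>" by (simp add: abs_mult)
    also have "\<dots> \<le> pi / 2 * (\<bar>t\<bar> + \<bar>Im s\<bar> / 2)" by (intro mult_left_mono) auto
    finally have "norm (cos (of_real pi * (Complex 2 t - s/2) / 2)) \<le> exp (pi / 2 * (\<bar>t\<bar> + \<bar>Im s\<bar> / 2))"
      using norm_cos_le_exp[of "of_real pi * (Complex 2 t - s/2) / 2"] by (meson exp_le_cancel_iff order_trans)
    also have "\<dots> = D * exp (pi / 2 * \<bar>t\<bar>)" unfolding D_def exp_add[symmetric] by (simp add: ring_distribs)
    finally have c: "norm (cos (of_real pi * (Complex 2 t - s/2) / 2)) \<le> D * exp (pi / 2 * \<bar>t\<bar>)" .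
    have "norm (complex_of_real (2 * pi) powr (- 2 * Complex 2 t)) = E"
      using norm_of_real_powr[of "2 * pi" "- 2 * Complex 2 t"] by (simp add: E_def)
    hence "norm (phi_kernel s (Complex 2 t)) \<le> 2 * E * (C * exp (- (3 * pi / 4) * \<bar>t\<bar>)) * (D * exp (pi / 2 * \<bar>t\<bar>))"
      unfolding phi_kernel_def norm_mult[of "_ * (Gamma _ * Gamma _)"] norm_mult[of _ "Gamma _ * Gamma _"] norm_mult[of 2]
      using C(1) C(2)[of t] c by (intro mult_mono) (auto simp: D_def E_def)
    also have "\<dots> = 2 * E * C * D * (exp (- (3 * pi / 4) * \<bar>t\<bar>) * exp (pi / 2 * \<bar>t\<bar>))" by simp
    also have "exp (- (3 * pi / 4) * \<bar>t\<bar>) * exp (pi / 2 * \<bar>t\<bar>) = exp (- (pi / 4) * \<bar>t\<bar>)" by (simp flip: exp_add)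
    finally show "norm (phi_kernel s (Complex 2 t)) \<le> 2 * E * C * D * exp (- (pi / 4) * \<bar>t\<bar>)" .
  qed
qed

lemma phi_kernel_integrable:
  assumes s: "\<bar>Re s\<bar> < 1"
  shows "integrable lborel (\<lambda>t. phi_kernel s (Complex 2 t))"
proof -
  obtain C where C: "C > 0" "\<And>t. norm (phi_kernel s (Complex 2 t)) \<le> C * exp (- (pi / 4) * \<bar>t\<bar>)"
    using phi_kernel_bound_line[OF s] by blast
  have "Complex 2 t + s/2 \<notin> \<int>\<^sub>\<le>\<^sub>0" "Complex 2 t - s/2 \<notin> \<int>\<^sub>\<le>\<^sub>0" for t
    using s by (auto intro!: nonpos_Ints_Re)
  hence "continuous_on UNIV (\<lambda>t. phi_kernel s (Complex 2 t))"
    unfolding phi_kernel_def Complex_eq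
    by (intro continuous_at_imp_continuous_on ballI continuous_intros) auto
  thus ?thesis
    by (rule integrable_of_exp_bound[where d = "pi / 4" and C = C and Y = 0]) (use C(2) in auto)
qed

lemma phi_term_Mellin:
  fixes x :: real and s :: complex
  assumes s: "\<bar>Re s\<bar> < 1" and x: "x > 0" and n: "n > 0"
  shows "2 * phi_term x s n = (\<integral>t. divisor_sigma (- s) n * of_nat n powr (s/2) * of_nat n powr (- Complex 2 t) *
      (phi_kernel s (Complex 2 t) * of_real x powr (- Complex 2 t)) \<partial>lborel) / (2 * of_real pi)"
proof -
  \<comment> \<open>The Boolean selects one of the two conjugate rays, so that both Bessel terms are
    handled by the same definitions.\<close>
  define \<epsilon> where "\<epsilon> = (\<lambda>b::bool. if b then 1 else - 1 :: real)"
  \<comment> \<open>The real part of the logarithm of z/2. The imaginary part is pi/4 up to sign, so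
    the principal logarithm is additive here and Im L attains the extreme value pi/2 that the Bessel
    integral allows.\<close>
  define l where "l = ln (2 * pi * sqrt (real n * x))"
  define L where "L = (\<lambda>b. of_real (2 * l) + \<i> * of_real (\<epsilon> b * (pi / 2)))"
  define z where "z = (\<lambda>b. 4 * of_real pi * exp (of_real (\<epsilon> b) * (of_real pi * \<i> / 4)) * of_real (sqrt (real n * x)))"
  have nx: "real n * x > 0" using n x by simp
  have z2: "z b / 2 = exp (of_real l + \<i> * of_real (\<epsilon> b * (pi / 4)))" for b
  proof -
    have "exp (complex_of_real l) = of_real (2 * pi * sqrt (real n * x))"
      using nx unfolding exp_of_real l_def by (subst exp_ln) auto
    thus ?thesis unfolding exp_add z_def by (simp add: mult_ac)
  qed
  have z0: "z b \<noteq> 0" for b using z2[of b] by auto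
  have LnL: "L b = 2 * Ln (z b / 2)" for b
  proof -
    have "Ln (z b / 2) = of_real l + \<i> * of_real (\<epsilon> b * (pi / 4))"
      unfolding z2 by (rule Ln_exp) (auto simp: \<epsilon>_def)
    thus ?thesis by (simp add: L_def algebra_simps)
  qed
  have ImL: "\<bar>Im (L b)\<bar> \<le> pi / 2" for b by (simp add: L_def \<epsilon>_def)
  define g where "g = (\<lambda>b t. Gamma (Complex 2 t + s/2) * Gamma (Complex 2 t - s/2) * exp (- Complex 2 t * L b))"
  have K: "bessel_K s (z b) = (\<integral>t. g b t \<partial>lborel) / (4 * of_real pi)" for b
    using bessel_K_Mellin_Barnes[OF _ s ImL LnL z0, of 2 b] by (simp add: g_def)
  have gi: "integrable lborel (g b)" for b
  proof -
    have s2: "\<bar>Re (s/2)\<bar> < 2" using s by simp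
    obtain C where C: "C > 0" "\<And>\<mu> t. \<bar>Re \<mu>\<bar> \<le> \<bar>Re (s/2)\<bar> \<Longrightarrow> \<bar>Im \<mu>\<bar> \<le> \<bar>Im (s/2)\<bar> \<Longrightarrow>
        norm (Gamma (Complex 2 t + \<mu>) * Gamma (Complex 2 t - \<mu>)) \<le> C * exp (- (3 * pi / 4) * \<bar>t\<bar>)"
      using Gamma_pair_exp_bound_line[OF s2 abs_ge_zero[of "Im (s/2)"]] by metis
    show ?thesis unfolding g_def
      using Gamma_pair_exp_integrand_bound[OF s2 order_refl order_refl ImL C(2,1)]
      by (intro integrable_of_exp_bound[OF continuous_Gamma_pair_integrand[OF s2], where d = "pi / 4" and Y = 0 and C = "C * exp (\<bar>2\<bar> * \<bar>Re (L b)\<bar>)"]) auto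
  qed
  define e where "e = (\<lambda>b. exp (of_real (\<epsilon> b) * (of_real pi * \<i> * s / 4)))"
  have "phi_term x s n = divisor_sigma (- s) n * of_nat n powr (s/2) * (e True * bessel_K s (z True) + e False * bessel_K s (z False))"
    by (simp add: phi_term_def e_def z_def \<epsilon>_def)
  also have "e True * bessel_K s (z True) + e False * bessel_K s (z False) = (\<integral>t. e True * g True t + e False * g False t \<partial>lborel) / (4 * of_real pi)"
    unfolding K using gi by (simp add: add_divide_distrib)
  also have "(\<lambda>t. e True * g True t + e False * g False t) = (\<lambda>t. of_nat n powr (- Complex 2 t) * (phi_kernel s (Complex 2 t) * of_real x powr (- Complex 2 t)))"
  proof
    fix t
    define w where "w = Complex 2 t"
    have E: "exp (- w * of_real (2 * l)) = of_real (2 * pi) powr (- 2 * w) * (of_nat n powr (- w) * of_real x powr (- w))"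
    proof -
      have "2 * l = 2 * ln (2 * pi) + (ln (real n) + ln x)"
        using nx n x by (simp add: l_def ln_mult ln_sqrt algebra_simps)
      hence "- w * of_real (2 * l) = - 2 * w * of_real (ln (2 * pi)) + (- w * of_real (ln (real n)) + - w * of_real (ln x))"
        by (simp add: algebra_simps)
      moreover have "Ln (of_nat n) = complex_of_real (ln (real n))" using Ln_of_real[of "real n"] n by simp
      moreover have "Ln (complex_of_real (2 * pi)) = complex_of_real (ln (2 * pi))" by (rule Ln_of_real) simp
      moreover have "Ln (of_real x) = complex_of_real (ln x)" using x by (rule Ln_of_real)
      moreover have "complex_of_real (2 * pi) \<noteq> 0" "complex_of_nat n \<noteq> 0" "complex_of_real x \<noteq> 0" using n x by auto
      ultimately show ?thesis by (simp only: powr_def if_False exp_add)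
    qed
    have "e b * exp (- w * L b) = exp (- w * of_real (2 * l)) * exp (of_real (- \<epsilon> b) * (\<i> * (of_real pi * (w - s/2) / 2)))" for b
      unfolding e_def L_def exp_add[symmetric] by (rule arg_cong[where f = exp]) (simp add: algebra_simps)
    hence "e True * exp (- w * L True) + e False * exp (- w * L False) =
       exp (- w * of_real (2 * l)) * (exp (- (\<i> * (of_real pi * (w - s/2) / 2))) + exp (\<i> * (of_real pi * (w - s/2) / 2)))"
      by (simp add: \<epsilon>_def distrib_left)
    also have "exp (- (\<i> * (of_real pi * (w - s/2) / 2))) + exp (\<i> * (of_real pi * (w - s/2) / 2)) = 2 * cos (of_real pi * (w - s/2) / 2)"
      by (simp add: cos_exp_eq add.commute)
    finally have "e True * exp (- w * L True) + e False * exp (- w * L False) = exp (- w * of_real (2 * l)) * (2 * cos (of_real pi * (w - s/2) / 2))" .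
    moreover have "e True * g True t + e False * g False t = (Gamma (w + s/2) * Gamma (w - s/2)) * (e True * exp (- w * L True) + e False * exp (- w * L False))"
      unfolding g_def w_def[symmetric] by (simp add: algebra_simps)
    ultimately show "e True * g True t + e False * g False t = of_nat n powr (- Complex 2 t) * (phi_kernel s (Complex 2 t) * of_real x powr (- Complex 2 t))"
      unfolding w_def[symmetric] phi_kernel_def E by (simp only: mult_ac)
  qed
  finally have phi: "phi_term x s n = divisor_sigma (- s) n * of_nat n powr (s/2) *
     ((\<integral>t. of_nat n powr (- Complex 2 t) * (phi_kernel s (Complex 2 t) * of_real x powr (- Complex 2 t)) \<partial>lborel) / (4 * of_real pi))" .
  have "(\<integral>t. divisor_sigma (- s) n * of_nat n powr (s/2) * of_nat n powr (- Complex 2 t) * (phi_kernel s (Complex 2 t) * of_real x powr (- Complex 2 t)) \<partial>lborel)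
     = divisor_sigma (- s) n * of_nat n powr (s/2) * (\<integral>t. of_nat n powr (- Complex 2 t) * (phi_kernel s (Complex 2 t) * of_real x powr (- Complex 2 t)) \<partial>lborel)"
    unfolding mult.assoc[of "divisor_sigma (- s) n * of_nat n powr (s/2)"] by (rule integral_mult_right_zero)
  thus ?thesis unfolding phi by simp
qed

text \<open>On Re w = 2 both w + s/2 and w - s/2 have real part above 1, so the divisor series
  converges absolutely.\<close>

theorem phi_Mellin_line_2:
  fixes x :: real and s :: complex
  assumes s: "\<bar>Re s\<bar> < 1" and x: "x > 0"
  shows "phi x s = (\<integral>t. phi_Mellin s (Complex 2 t) * of_real x powr (- Complex 2 t) \<partial>lborel) / (2 * of_real pi)"
proof -
  define a where "a = (\<lambda>w n. divisor_sigma (- s) n * of_nat n powr (s/2) * of_nat n powr (- w))"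
  define k where "k = (\<lambda>t. phi_kernel s (Complex 2 t) * of_real x powr (- Complex 2 t))"
  define f where "f = (\<lambda>n t. a (Complex 2 t) (Suc n) * k t)"
  have pq: "Re (Complex 2 t + s/2) > 1" "Re (Complex 2 t - s/2) > 1" for t using s by auto
  \<comment> \<open>The modulus of each coefficient is constant along the line, so the norm
    integrals are a fixed summable sequence times one number; this is all that termwise integration
    requires.\<close>
  have na: "norm (a (Complex 2 t) (Suc n)) = norm (a (Complex 2 0) (Suc n))" for t n
    using norm_of_real_powr[of "real (Suc n)" "- Complex 2 t"] norm_of_real_powr[of "real (Suc n)" "- Complex 2 0"]
    unfolding a_def norm_mult by simp
  have nf: "norm (f n t) = norm (a (Complex 2 0) (Suc n)) * norm (k t)" for n t
    unfolding f_def norm_mult na[of t n] ..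
  have meas [measurable]: "Complex 2 \<in> borel_measurable lborel" unfolding Complex_eq by measurable
  have ki: "integrable lborel k"
  proof (rule Bochner_Integration.integrable_bound[OF integrable_mult_right[OF integrable_norm[OF phi_kernel_integrable[OF s]], of "x powr (- 2)"]])
    have [measurable]: "(\<lambda>t. phi_kernel s (Complex 2 t)) \<in> borel_measurable lborel"
      using phi_kernel_integrable[OF s] by (rule borel_measurable_integrable)
    show "k \<in> borel_measurable lborel" unfolding k_def by measurable
    have "norm (complex_of_real x powr (- Complex 2 t)) = x powr (- 2)" for t
      using norm_of_real_powr[OF x, of "- Complex 2 t"] by simp
    hence "norm (k t) = x powr (- 2) * norm (phi_kernel s (Complex 2 t))" for t
      unfolding k_def norm_mult by (simp only: mult.commute)
    thus "AE t in lborel. norm (k t) \<le> norm (x powr (- 2) * norm (phi_kernel s (Complex 2 t)))"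
      by (intro AE_I2) simp
  qed
  have fi: "integrable lborel (f n)" for n
  proof (rule Bochner_Integration.integrable_bound[OF integrable_mult_right[OF integrable_norm[OF ki], of "norm (a (Complex 2 0) (Suc n))"]])
    have [measurable]: "k \<in> borel_measurable lborel" using ki by (rule borel_measurable_integrable)
    have "(\<lambda>t. complex_of_real (real (Suc n)) powr (- Complex 2 t)) \<in> borel_measurable lborel" by measurable
    hence [measurable]: "(\<lambda>t. of_nat (Suc n) powr (- Complex 2 t)) \<in> borel_measurable lborel" by (simp only: of_real_of_nat_eq)
    show "f n \<in> borel_measurable lborel" unfolding f_def a_def by measurable
    show "AE t in lborel. norm (f n t) \<le> norm (norm (a (Complex 2 0) (Suc n)) * norm (k t))"
      unfolding nf by (intro AE_I2) simp
  qed
  have AE: "AE t in lborel. summable (\<lambda>n. norm (f n t))"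
  proof (intro AE_I2)
    fix t
    show "summable (\<lambda>n. norm (f n t))"
      unfolding f_def norm_mult unfolding a_def by (rule summable_mult2[OF has_sum_divisor_convolution(2)[OF pq]])
  qed
  have If: "(\<integral>t. norm (f n t) \<partial>lborel) = norm (a (Complex 2 0) (Suc n)) * (\<integral>t. norm (k t) \<partial>lborel)" for n
    unfolding nf by (rule integral_mult_right_zero)
  have sm: "summable (\<lambda>n. \<integral>t. norm (f n t) \<partial>lborel)"
    unfolding If unfolding a_def by (rule summable_mult2[OF has_sum_divisor_convolution(2)[OF pq]])
  have sf: "(\<Sum>n. f n t) = phi_Mellin s (Complex 2 t) * of_real x powr (- Complex 2 t)" for t
  proof -
    have "(\<lambda>n. f n t) sums (riemann_zeta (Complex 2 t + s/2) * riemann_zeta (Complex 2 t - s/2) * k t)"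
      unfolding f_def a_def by (intro sums_mult2 has_sum_divisor_convolution(1) pq)
    moreover have "phi_Mellin s (Complex 2 t) = phi_kernel s (Complex 2 t) * (riemann_zeta (Complex 2 t + s/2) * riemann_zeta (Complex 2 t - s/2))"
    proof (rule phi_Mellin_eq_kernel)
      show "Re (Complex 2 t - s/2) > 0" using pq(2)[of t] by linarith
      show "Complex 2 t - s/2 \<noteq> 1"
      proof
        assume "Complex 2 t - s/2 = 1"
        hence "Re (Complex 2 t - s/2) = 1" by (simp only: one_complex.sel)
        thus False using pq(2)[of t] by linarith
      qed
    qed
    ultimately show ?thesis by (simp add: sums_iff k_def mult_ac)
  qed
  have "(\<lambda>n. \<integral>t. f n t \<partial>lborel) sums (\<integral>t. phi_Mellin s (Complex 2 t) * of_real x powr (- Complex 2 t) \<partial>lborel)"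
    using sums_integral[OF fi AE sm] by (simp only: sf)
  from sums_divide[OF this, of "2 * of_real pi"]
  have "(\<lambda>n. 2 * phi_term x s (Suc n)) sums ((\<integral>t. phi_Mellin s (Complex 2 t) * of_real x powr (- Complex 2 t) \<partial>lborel) / (2 * of_real pi))"
    unfolding f_def k_def a_def using phi_term_Mellin[OF s x, of "Suc _"] by simp
  moreover from sums_mult[OF this, of "1/2"] have "summable (\<lambda>n. phi_term x s (Suc n))" by (simp add: sums_iff)
  ultimately show ?thesis unfolding phi_def by (simp add: sums_iff suminf_mult)
qed

text \<open>The balance of rates is 3*pi/4 from the Gamma pair, less pi/2 for the cosine and pi/16
  for each of the two zeta factors, which leaves pi/8.\<close>

lemma phi_Mellin_bound:
  assumes s: "\<bar>Re s\<bar> < 1"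
  obtains C where "C > 0" "\<And>w. 1/2 \<le> Re w \<Longrightarrow> Re w \<le> 2 \<Longrightarrow> \<bar>Im w\<bar> \<ge> 1 + \<bar>Im s\<bar> \<Longrightarrow>
    norm (phi_Mellin s w) \<le> C * exp (- (pi / 8) * \<bar>Im w\<bar>)"
proof -
  obtain C1 where C1: "C1 > 0" "\<And>w. 1/2 \<le> Re w \<Longrightarrow> Re w \<le> 2 \<Longrightarrow> \<bar>Im w\<bar> \<ge> 1 + \<bar>Im (s/2)\<bar> \<Longrightarrow>
    norm (Gamma (w + s/2) * Gamma (w - s/2)) \<le> C1 * exp (- (3 * pi / 4) * \<bar>Im w\<bar>)"
    using Gamma_pair_exp_bound_strip[of "1/2" 2 "s/2"] by metis
  \<comment> \<open>The least real part that w + s/2 and w - s/2 can have when Re w \<ge>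
    1/2.\<close>
  define \<sigma> where "\<sigma> = (1 - \<bar>Re s\<bar>) / 2"
  have \<sigma>: "\<sigma> > 0" using s by (simp add: \<sigma>_def)
  obtain C2 where C2: "C2 > 0" "\<And>z. \<sigma> \<le> Re z \<Longrightarrow> Re z \<le> 3 \<Longrightarrow> 1 \<le> \<bar>Im z\<bar> \<Longrightarrow> norm (riemann_zeta z) \<le> C2 * exp (pi / 16 * \<bar>Im z\<bar>)"
    using norm_riemann_zeta_le[OF \<sigma>, of "pi / 16" 3] by auto
  define h where "h = \<bar>Im s\<bar> / 2"
  define C where "C = 2 * 1 * C1 * exp (pi / 2 * h) * ((C2 * exp (pi / 16 * h)) * (C2 * exp (pi / 16 * h)))"
  show ?thesis
  proof (rule that[of C])
    show "C > 0" using C1 C2 by (simp add: C_def)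
    fix w assume w: "1/2 \<le> Re w" "Re w \<le> 2" "\<bar>Im w\<bar> \<ge> 1 + \<bar>Im s\<bar>"
    have im: "1 \<le> \<bar>Im (w + s/2)\<bar>" "1 \<le> \<bar>Im (w - s/2)\<bar>" "\<bar>Im (w + s/2)\<bar> \<le> \<bar>Im w\<bar> + h" "\<bar>Im (w - s/2)\<bar> \<le> \<bar>Im w\<bar> + h"
      using w by (auto simp: h_def)
    have re: "\<sigma> \<le> Re (w + s/2)" "\<sigma> \<le> Re (w - s/2)" "Re (w + s/2) \<le> 3" "Re (w - s/2) \<le> 3"
      using w s by (auto simp: \<sigma>_def field_simps)
    have ze: "norm (riemann_zeta z) \<le> (C2 * exp (pi / 16 * h)) * exp (pi / 16 * \<bar>Im w\<bar>)"
      if "z = w + s/2 \<or> z = w - s/2" for z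
    proof -
      have "norm (riemann_zeta z) \<le> C2 * exp (pi / 16 * \<bar>Im z\<bar>)" using that re im by (intro C2(2)) auto
      also have "\<dots> \<le> C2 * exp (pi / 16 * (\<bar>Im w\<bar> + h))" using that im C2(1) by auto
      also have "exp (pi / 16 * (\<bar>Im w\<bar> + h)) = exp (pi / 16 * h) * exp (pi / 16 * \<bar>Im w\<bar>)"
        unfolding exp_add[symmetric] by (rule arg_cong[where f = exp]) (simp add: field_simps)
      finally show ?thesis by (simp only: mult.assoc)
    qed
    have c: "norm (cos (of_real pi * (w - s/2) / 2)) \<le> exp (pi / 2 * h) * exp (pi / 2 * \<bar>Im w\<bar>)"
    proof -
      have "norm (cos (of_real pi * (w - s/2) / 2)) \<le> exp \<bar>Im (of_real pi * (w - s/2) / 2)\<bar>" by (rule norm_cos_le_exp)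
      also have "\<bar>Im (of_real pi * (w - s/2) / 2)\<bar> = pi / 2 * \<bar>Im (w - s/2)\<bar>" by (simp add: abs_mult)
      also have "exp (pi / 2 * \<bar>Im (w - s/2)\<bar>) \<le> exp (pi / 2 * (\<bar>Im w\<bar> + h))" using im by simp
      also have "exp (pi / 2 * (\<bar>Im w\<bar> + h)) = exp (pi / 2 * h) * exp (pi / 2 * \<bar>Im w\<bar>)"
        unfolding exp_add[symmetric] by (rule arg_cong[where f = exp]) (simp add: field_simps)
      finally show ?thesis .
    qed
    have p: "norm (complex_of_real (2 * pi) powr (- 2 * w)) \<le> 1"
    proof -
      have "norm (complex_of_real (2 * pi) powr (- 2 * w)) = (2 * pi) powr Re (- 2 * w)" by (rule norm_of_real_powr) simp
      also have "\<dots> \<le> (2 * pi) powr 0" using w pi_ge_two by (intro powr_mono) auto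
      finally show ?thesis by simp
    qed
    have g: "norm (Gamma (w + s/2) * Gamma (w - s/2)) \<le> C1 * exp (- (3 * pi / 4) * \<bar>Im w\<bar>)"
      using w by (intro C1(2)) auto
    have k: "norm (phi_kernel s w) \<le> 2 * 1 * (C1 * exp (- (3 * pi / 4) * \<bar>Im w\<bar>)) * (exp (pi / 2 * h) * exp (pi / 2 * \<bar>Im w\<bar>))"
      unfolding phi_kernel_def norm_mult[of "_ * (Gamma _ * Gamma _)"] norm_mult[of _ "Gamma _ * Gamma _"] norm_mult[of 2]
      using C1(1) p c g by (intro mult_mono) auto
    have "phi_Mellin s w = phi_kernel s w * (riemann_zeta (w + s/2) * riemann_zeta (w - s/2))"
    proof (rule phi_Mellin_eq_kernel)
      show "Re (w - s/2) > 0" using re(2) \<sigma> by linarith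
      show "w - s/2 \<noteq> 1"
      proof
        assume "w - s/2 = 1"
        hence "\<bar>Im (w - s/2)\<bar> = 0" by (simp only: one_complex.sel abs_zero)
        thus False using im(2) by linarith
      qed
    qed
    also have "norm \<dots> \<le> (2 * 1 * (C1 * exp (- (3 * pi / 4) * \<bar>Im w\<bar>)) * (exp (pi / 2 * h) * exp (pi / 2 * \<bar>Im w\<bar>))) *
       (((C2 * exp (pi / 16 * h)) * exp (pi / 16 * \<bar>Im w\<bar>)) * ((C2 * exp (pi / 16 * h)) * exp (pi / 16 * \<bar>Im w\<bar>)))"
      unfolding norm_mult[of "phi_kernel s w"] norm_mult[of "riemann_zeta _"] using k ze C1(1) C2(1) by (intro mult_mono) auto
    also have "\<dots> = C * (exp (- (3 * pi / 4) * \<bar>Im w\<bar>) * exp (pi / 2 * \<bar>Im w\<bar>) * (exp (pi / 16 * \<bar>Im w\<bar>) * exp (pi / 16 * \<bar>Im w\<bar>)))"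
      by (simp add: C_def mult_ac)
    also have "exp (- (3 * pi / 4) * \<bar>Im w\<bar>) * exp (pi / 2 * \<bar>Im w\<bar>) * (exp (pi / 16 * \<bar>Im w\<bar>) * exp (pi / 16 * \<bar>Im w\<bar>)) = exp (- (pi / 8) * \<bar>Im w\<bar>)"
      unfolding exp_add[symmetric] by (rule arg_cong[where f = exp]) (simp add: field_simps)
    finally show "norm (phi_Mellin s w) \<le> C * exp (- (pi / 8) * \<bar>Im w\<bar>)" .
  qed
qed

text \<open>At w = 1 - s/2 the factor \<zeta>(w + s/2) has its pole while the other zeta factor
  takes the value \<zeta>(s), which gives the subtracted term with coefficient 1 / (2 pi).\<close>

theorem phi_minus_pole_Mellin:
  fixes x :: real and s :: complex
  assumes s: "\<bar>Re s\<bar> < 1" and x: "x > 0"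
  shows "integrable lborel (\<lambda>t. phi_Mellin s (Complex (1/2) t) * of_real x powr (- Complex (1/2) t))"
    and "phi x s - riemann_zeta s / (2 * of_real pi) * of_real x powr (s/2 - 1) =
      (\<integral>t. phi_Mellin s (Complex (1/2) t) * of_real x powr (- Complex (1/2) t) \<partial>lborel) / (2 * of_real pi)"
proof -
  define F where "F = (\<lambda>w. phi_Mellin s w * of_real x powr (- w))"
  define p where "p = 1 - s/2"
  \<comment> \<open>The left edge lies at |Re s| / 2 < 1/2: the Gamma poles and the pole of
    \<zeta>(1 - (w - s/2)) at w = s/2 are all at or beyond it, so p is the only singularity
    inside.\<close>
  define S where "S = {z. \<bar>Re s\<bar> / 2 < Re z \<and> Re z < 3}"
  have x0: "complex_of_real x \<noteq> 0" using x by simp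
  obtain C where C: "C > 0" "\<And>w. 1/2 \<le> Re w \<Longrightarrow> Re w \<le> 2 \<Longrightarrow> \<bar>Im w\<bar> \<ge> 1 + \<bar>Im s\<bar> \<Longrightarrow>
    norm (phi_Mellin s w) \<le> C * exp (- (pi / 8) * \<bar>Im w\<bar>)"
    using phi_Mellin_bound[OF s] by blast
  have holo: "F holomorphic_on S - {p}"
  proof -
    have z1: "(\<lambda>w. riemann_zeta (w + s/2)) holomorphic_on S - {p}"
    proof -
      have "(riemann_zeta \<circ> (\<lambda>w. w + s/2)) holomorphic_on S - {p}"
        by (rule holomorphic_on_compose_gen[OF _ riemann_zeta_spec(1)]) (auto intro!: holomorphic_intros simp: p_def algebra_simps)
      thus ?thesis by (simp add: o_def)
    qed
    have z2: "(\<lambda>w. riemann_zeta (1 - (w - s/2))) holomorphic_on S - {p}"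
    proof -
      have "(riemann_zeta \<circ> (\<lambda>w. 1 - (w - s/2))) holomorphic_on S - {p}"
        by (rule holomorphic_on_compose_gen[OF _ riemann_zeta_spec(1)]) (auto intro!: holomorphic_intros simp: S_def)
      thus ?thesis by (simp add: o_def)
    qed
    have "w + s/2 \<notin> \<int>\<^sub>\<le>\<^sub>0" if "w \<in> S - {p}" for w using that by (intro nonpos_Ints_Re) (auto simp: S_def)
    thus ?thesis unfolding F_def phi_Mellin_def
      using x0 by (intro holomorphic_on_mult z1 z2 holomorphic_Gamma' holomorphic_intros) auto
  qed
  have ps: "1/2 < Re p" "Re p < 2" using s by (auto simp: p_def)
  have bound: "norm (F w) \<le> (C * exp (2 * \<bar>ln x\<bar>)) * exp (- (pi / 8) * \<bar>Im w\<bar>)"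
    if w: "1/2 \<le> Re w" "Re w \<le> 2" "\<bar>Im w\<bar> \<ge> 1 + \<bar>Im s\<bar>" for w
  proof -
    have "complex_of_real x powr (- w) = exp (- w * of_real (ln x))" using x by (simp add: powr_def Ln_of_real)
    also have "norm \<dots> \<le> exp (2 * \<bar>Re (complex_of_real (ln x))\<bar>) * exp (\<bar>Im (complex_of_real (ln x))\<bar> * \<bar>Im w\<bar>)"
      using w by (intro norm_exp_neg_mult_le) auto
    finally have "norm (complex_of_real x powr (- w)) \<le> exp (2 * \<bar>ln x\<bar>)" by simp
    hence "norm (F w) \<le> (C * exp (- (pi / 8) * \<bar>Im w\<bar>)) * exp (2 * \<bar>ln x\<bar>)"
      unfolding F_def norm_mult using C(1) C(2)[OF w] by (intro mult_mono) auto
    thus ?thesis by (simp add: mult_ac)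
  qed
  have shift: "integrable lborel (\<lambda>t. F (Complex (1/2) t))"
    "(\<integral>t. F (Complex 2 t) \<partial>lborel) - (\<integral>t. F (Complex (1/2) t) \<partial>lborel) = 2 * of_real pi * (\<Sum>p\<in>{p}. residue F p)"
    using vertical_line_shift[of "\<bar>Re s\<bar> / 2" "1/2" 2 3 "{p}" F "pi / 8" "1 + \<bar>Im s\<bar>" "C * exp (2 * \<bar>ln x\<bar>)"] s holo ps bound
    by (auto simp: S_def)
  have "residue F p = of_real (2 * pi) powr (- 1) * Gamma 1 * 1 * riemann_zeta s * of_real x powr (- p)"
  proof (rule residue_of_limit[OF _ _ holo])
    show "open S" unfolding S_def by (rule open_vertical_strip)
    show "p \<in> S" using ps s by (auto simp: S_def)
    have f1: "filterlim (\<lambda>w. w + s/2) (at 1) (at p)"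
    proof (rule filterlim_atI)
      have "eventually (\<lambda>w. w \<noteq> p) (at p)" by (simp add: eventually_at_filter)
      thus "eventually (\<lambda>w. w + s/2 \<noteq> 1) (at p)" by eventually_elim (auto simp: p_def algebra_simps)
    qed (auto intro!: tendsto_eq_intros simp: p_def)
    have "((\<lambda>w. (w + s/2 - 1) * riemann_zeta (w + s/2)) \<longlongrightarrow> 1) (at p)"
      using filterlim_compose[OF riemann_zeta_residue_1 f1] .
    hence l1: "((\<lambda>w. (w - p) * riemann_zeta (w + s/2)) \<longlongrightarrow> 1) (at p)" by (simp add: p_def algebra_simps)
    have "isCont riemann_zeta s"
    proof -
      have "s \<noteq> 1" using s by auto
      moreover have "open (- {1 :: complex})" by auto
      ultimately show ?thesis
        using holomorphic_on_imp_continuous_on[OF riemann_zeta_spec(1)] continuous_on_eq_continuous_at by blast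
    qed
    hence l2: "((\<lambda>w. riemann_zeta (1 - (w - s/2))) \<longlongrightarrow> riemann_zeta s) (at p)"
      by (rule isCont_tendsto_compose) (auto intro!: tendsto_eq_intros simp: p_def)
    have "2 * complex_of_real pi \<notin> \<real>\<^sub>\<le>\<^sub>0"
      using nonpos_Reals_of_real_iff[of "2 * pi", where 'a = complex] pi_gt_zero by simp
    hence "((\<lambda>w. of_real (2 * pi) powr (- (w + s/2)) * Gamma (w + s/2) * ((w - p) * riemann_zeta (w + s/2)) * riemann_zeta (1 - (w - s/2)) * of_real x powr (- w))
       \<longlongrightarrow> of_real (2 * pi) powr (- (p + s/2)) * Gamma (p + s/2) * 1 * riemann_zeta s * of_real x powr (- p)) (at p)"
      using x by (intro tendsto_mult l1 l2 tendsto_powr_complex tendsto_Gamma tendsto_intros) (auto simp: p_def)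
    moreover have "p + s/2 = 1" by (simp add: p_def)
    ultimately show "((\<lambda>w. F w * (w - p)) \<longlongrightarrow> of_real (2 * pi) powr (- 1) * Gamma 1 * 1 * riemann_zeta s * of_real x powr (- p)) (at p)"
      by (simp add: F_def phi_Mellin_def mult_ac)
  qed simp
  also have "\<dots> = riemann_zeta s / (2 * of_real pi) * of_real x powr (s/2 - 1)"
    by (simp add: p_def powr_minus_divide)
  finally have res: "residue F p = riemann_zeta s / (2 * of_real pi) * of_real x powr (s/2 - 1)" .
  show "integrable lborel (\<lambda>t. phi_Mellin s (Complex (1/2) t) * of_real x powr (- Complex (1/2) t))"
    using shift(1) by (simp add: F_def)
  have "phi x s = (\<integral>t. F (Complex 2 t) \<partial>lborel) / (2 * of_real pi)"
    using phi_Mellin_line_2[OF s x] by (simp add: F_def)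
  moreover have "(\<integral>t. F (Complex 2 t) \<partial>lborel) = (\<integral>t. F (Complex (1/2) t) \<partial>lborel) + 2 * of_real pi * residue F p"
    using shift(2) by (simp add: algebra_simps)
  ultimately have fin: "phi x s - residue F p = (\<integral>t. F (Complex (1/2) t) \<partial>lborel) / (2 * of_real pi)"
    by (simp add: add_divide_distrib)
  show "phi x s - riemann_zeta s / (2 * of_real pi) * of_real x powr (s/2 - 1) =
      (\<integral>t. phi_Mellin s (Complex (1/2) t) * of_real x powr (- Complex (1/2) t) \<partial>lborel) / (2 * of_real pi)"
    using fin unfolding res unfolding F_def .
qed

subsection \<open>The integral identity\<close>

text \<open>Duplication and reflection at z/2 turn the asymmetric functional equation into the
  symmetric one. The strip is the natural range, since \<open>riemann_xi\<close> does not fill its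
  removable singularities.\<close>

lemma riemann_xi_symmetric:
  assumes z: "0 < Re z" "Re z < 1"
  shows "riemann_xi (1 - z) = riemann_xi z"
proof -
  have z1: "z \<noteq> 1" using z by auto
  define \<pi> where "\<pi> = complex_of_real pi"
  have \<pi>0: "\<pi> \<noteq> 0" by (simp add: \<pi>_def)
  have dup: "Gamma (z/2) * Gamma (z/2 + 1/2) = exp ((1 - 2 * (z/2)) * of_real (ln 2)) * of_real (sqrt pi) * Gamma (2 * (z/2))"
    using z by (intro Gamma_legendre_duplication nonpos_Ints_Re) auto
  have refl': "1 / cos (of_real pi * (z/2)) = Gamma (z/2 + 1/2) * Gamma (1/2 - z/2) / of_real pi" by (rule cos_pi_as_Gamma)
  have c0: "cos (\<pi> * z / 2) \<noteq> 0"
    using cos_pi_nonzero[of "z/2"] z by (simp add: abs_if \<pi>_def)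
  have e2: "exp ((1 - 2 * (z/2)) * of_real (ln 2)) = (2 :: complex) powr (1 - z)"
    using Ln_of_real[of 2] by (simp add: powr_def)
  have sq: "of_real (sqrt pi) = \<pi> powr (1/2)"
    unfolding \<pi>_def using powr_of_real[of pi "1/2"] by (simp add: powr_half_sqrt)
  have twopi: "of_real (2 * pi) powr u = 2 powr u * \<pi> powr u" for u
    unfolding \<pi>_def using of_real_mult_powr[of 2 pi u] by simp
  have scal: "\<pi> powr (- (1 - z) / 2) * (2 * (2 powr (- z) * \<pi> powr (- z))) * \<pi> = \<pi> powr (- z / 2) * (2 powr (1 - z) * \<pi> powr (1/2))"
  proof -
    have "(2 :: complex) * 2 powr (- z) = 2 powr 1 * 2 powr (- z)" by simp
    also have "\<dots> = 2 powr (1 - z)" unfolding powr_add[symmetric] by simp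
    finally have 2: "(2 :: complex) * 2 powr (- z) = 2 powr (1 - z)" .
    have "\<pi> powr (- (1 - z) / 2) * \<pi> powr (- z) * \<pi> = \<pi> powr (- (1 - z) / 2) * \<pi> powr (- z) * \<pi> powr 1"
      using \<pi>0 by simp
    also have "\<dots> = \<pi> powr (- z / 2 + 1/2)"
      unfolding powr_add[symmetric] by (rule arg_cong[where f = "(powr) \<pi>"]) (simp add: field_simps)
    also have "\<dots> = \<pi> powr (- z / 2) * \<pi> powr (1/2)" by (rule powr_add)
    finally have 3: "\<pi> powr (- (1 - z) / 2) * \<pi> powr (- z) * \<pi> = \<pi> powr (- z / 2) * \<pi> powr (1/2)" .
    have "\<pi> powr (- (1 - z) / 2) * (2 * (2 powr (- z) * \<pi> powr (- z))) * \<pi> = (2 * 2 powr (- z)) * (\<pi> powr (- (1 - z) / 2) * \<pi> powr (- z) * \<pi>)"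
      by (simp only: mult_ac)
    also have "\<dots> = \<pi> powr (- z / 2) * (2 powr (1 - z) * \<pi> powr (1/2))" unfolding 2 3 by (simp only: mult_ac)
    finally show ?thesis .
  qed
  have G: "2 powr (1 - z) * \<pi> powr (1/2) * Gamma z * Gamma ((1 - z) / 2) * cos (\<pi> * z / 2) = \<pi> * Gamma (z/2)"
  proof -
    have "Gamma (z/2 + 1/2) * Gamma (1/2 - z/2) * cos (\<pi> * z / 2) = \<pi>"
      using refl' c0 \<pi>0 unfolding \<pi>_def by (simp add: field_simps)
    moreover have "2 powr (1 - z) * \<pi> powr (1/2) * Gamma z = Gamma (z/2) * Gamma (z/2 + 1/2)"
      using dup unfolding e2 sq by simp
    moreover have "(1 - z) / 2 = 1/2 - z/2" by (simp add: field_simps)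
    ultimately show ?thesis by (simp only: mult.assoc) (simp only: mult_ac)
  qed
  have "\<pi> * (\<pi> powr (- (1 - z) / 2) * Gamma ((1 - z) / 2) * riemann_zeta (1 - z)) =
     (\<pi> powr (- (1 - z) / 2) * (2 * (2 powr (- z) * \<pi> powr (- z))) * \<pi>) * (Gamma z * Gamma ((1 - z) / 2) * cos (\<pi> * z / 2)) * riemann_zeta z"
    unfolding riemann_zeta_functional_equation[OF z(1) z1] twopi unfolding \<pi>_def[symmetric] by (simp only: mult_ac)
  also have "\<dots> = \<pi> powr (- z / 2) * (2 powr (1 - z) * \<pi> powr (1/2) * Gamma z * Gamma ((1 - z) / 2) * cos (\<pi> * z / 2)) * riemann_zeta z"
    unfolding scal by (simp only: mult_ac)
  also have "\<dots> = \<pi> * (\<pi> powr (- z / 2) * Gamma (z/2) * riemann_zeta z)" unfolding G by (simp only: mult_ac)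
  finally have "\<pi> powr (- (1 - z) / 2) * Gamma ((1 - z) / 2) * riemann_zeta (1 - z) = \<pi> powr (- z / 2) * Gamma (z/2) * riemann_zeta z"
    using \<pi>0 by (metis mult_left_cancel)
  moreover have "riemann_xi (1 - z) = 1/2 * z * (z - 1) * (\<pi> powr (- (1 - z) / 2) * Gamma ((1 - z) / 2) * riemann_zeta (1 - z))"
    unfolding riemann_xi_def \<pi>_def by (simp add: algebra_simps)
  moreover have "riemann_xi z = 1/2 * z * (z - 1) * (\<pi> powr (- z / 2) * Gamma (z/2) * riemann_zeta z)"
    unfolding riemann_xi_def \<pi>_def by (simp only: mult_ac)
  ultimately show ?thesis by (simp only:)
qed

text \<open>The part of the integrand that is independent of \<alpha>; all dependence on \<alpha> is
  then carried by an exponential on the whole line or a cosine on the half-line.\<close>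

definition Xi_weight :: "complex \<Rightarrow> real \<Rightarrow> complex" where
  "Xi_weight s t = Gamma ((s - 1 + \<i> * of_real t) / 4) * Gamma ((s - 1 - \<i> * of_real t) / 4) *
     Gamma ((- s + 1 + \<i> * of_real t) / 4) * Gamma ((- s + 1 - \<i> * of_real t) / 4) *
     riemann_Xi ((of_real t - \<i> * s) / 2) * riemann_Xi ((of_real t + \<i> * s) / 2) / ((of_real t)\<^sup>2 + (s + 1)\<^sup>2)"

lemma Xi_integrand_eq: "Xi_integrand s \<alpha> t = Xi_weight s t * of_real (cos (1/2 * t * ln \<alpha>))"
  by (simp add: Xi_integrand_def Xi_weight_def)

text \<open>Changing the sign of t exchanges the Gamma factors in pairs and exchanges the two \<Xi>
  arguments up to sign; |Re s| < 1 keeps those arguments in the strip |Im u| < 1/2 where \<Xi> is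
  even.\<close>

lemma Xi_weight_minus:
  assumes s: "\<bar>Re s\<bar> < 1"
  shows "Xi_weight s (- t) = Xi_weight s t"
proof -
  have sym: "riemann_Xi (- u) = riemann_Xi u" if "\<bar>Im u\<bar> < 1/2" for u
  proof -
    have "riemann_xi (1 - (1/2 + \<i> * u)) = riemann_xi (1/2 + \<i> * u)"
      using that by (intro riemann_xi_symmetric) auto
    moreover have "1 - (1/2 + \<i> * u) = 1/2 + \<i> * (- u)" by simp
    ultimately show ?thesis unfolding riemann_Xi_def by (simp only:)
  qed
  have e: "(of_real (- t) - \<i> * s) / 2 = - ((of_real t + \<i> * s) / 2)" "(of_real (- t) + \<i> * s) / 2 = - ((of_real t - \<i> * s) / 2)"
    by (simp_all add: field_simps)
  have X: "riemann_Xi ((of_real (- t) - \<i> * s) / 2) = riemann_Xi ((of_real t + \<i> * s) / 2)"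
    "riemann_Xi ((of_real (- t) + \<i> * s) / 2) = riemann_Xi ((of_real t - \<i> * s) / 2)"
    unfolding e using s by (auto intro!: sym)
  show ?thesis unfolding Xi_weight_def X by (simp add: mult_ac)
qed

definition Xi_const :: "complex \<Rightarrow> complex" where
  "Xi_const s = 2 powr (s / 2 - 2) * of_real pi powr (- 5 / 2) / Gamma ((1 - s) / 2)"

text \<open>The bracket is the Mellin transform of S at 1 - w with order s/2, and (2 pi)^(w-1) comes
  from the scale of its argument. In the variables p and q, with t = 2 \<tau>, the \<Xi> factors are
  \<xi>(p) and \<xi>(q), and the denominator t^2 + (s + 1)^2 is 4 p (1 - q).\<close>

lemma Mellin_product_eq_Xi_weight:
  fixes \<tau> :: real and s :: complex
  assumes s: "\<bar>Re s\<bar> < 1"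
  defines "w \<equiv> Complex (1/2) \<tau>"
  shows "phi_Mellin s w * of_real (2 * pi) powr (w - 1) *
      (Gamma (1 - w + s/2) * Gamma ((1 - (1 - w) - s/2) / 2) * Gamma ((1 - w - s/2) / 2) * rGamma (1/2 - s/2) / 2) =
    2 * of_real pi * Xi_const s * Xi_weight s (2 * \<tau>)"
proof -
  define p q where "p = w + s/2" and "q = w - s/2"
  define \<pi> where "\<pi> = complex_of_real pi"
  have \<pi>0: "\<pi> \<noteq> 0" by (simp add: \<pi>_def)
  have p: "0 < Re p" "Re p < 1" and q: "0 < Re q" "Re q < 1" using s by (auto simp: p_def q_def w_def)
  have nz: "p \<noteq> 0" "q \<noteq> 0" "1 - q \<noteq> 0" "q \<noteq> 1" "p - 1 \<noteq> 0" using p q by auto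
  have w: "w = 1/2 + \<i> * of_real \<tau>" by (simp add: w_def Complex_eq)
  have sinq: "sin (\<pi> * q / 2) \<noteq> 0"
  proof -
    have "cos (of_real pi * ((1 - q) / 2)) \<noteq> 0" using q by (intro cos_pi_nonzero) (auto simp: abs_if)
    moreover have "cos (of_real pi * ((1 - q) / 2)) = sin (\<pi> * q / 2)"
      using cos_diff[of "of_real (pi/2)" "\<pi> * q / 2"] sin_of_real[of "pi/2", where 'a = complex] cos_of_real[of "pi/2", where 'a = complex]
      by (simp add: \<pi>_def algebra_simps diff_divide_distrib)
    ultimately show ?thesis by simp
  qed
  have cosq: "cos (\<pi> * q / 2) \<noteq> 0" using cos_pi_nonzero[of "q/2"] q by (simp add: abs_if \<pi>_def)
  \<comment> \<open>The cosine left by the functional equation cancels half of the double angle sine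
    in the reflection formula, so a Gamma product at q becomes one at q/2.\<close>
  have R: "Gamma q * Gamma (1 - q) * cos (\<pi> * q / 2) = 1/2 * (Gamma (q/2) * Gamma (1 - q/2))"
  proof -
    have "sin (\<pi> * q) = 2 * sin (\<pi> * q / 2) * cos (\<pi> * q / 2)" using sin_double[of "\<pi> * q / 2"] by simp
    hence "Gamma q * Gamma (1 - q) = \<pi> / (2 * sin (\<pi> * q / 2) * cos (\<pi> * q / 2))"
      using Gamma_reflection_complex[of q] by (simp add: \<pi>_def)
    moreover have "Gamma (q/2) * Gamma (1 - q/2) = \<pi> / sin (\<pi> * q / 2)"
      using Gamma_reflection_complex[of "q/2"] by (simp add: \<pi>_def)
    ultimately show ?thesis using cosq by simp
  qed
  have dup: "Gamma (p/2) * Gamma ((p + 1) / 2) = 2 powr (1 - p) * of_real (sqrt pi) * Gamma p"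
  proof -
    have "Gamma (p/2) * Gamma (p/2 + 1/2) = exp ((1 - 2 * (p/2)) * of_real (ln 2)) * of_real (sqrt pi) * Gamma (2 * (p/2))"
      using p by (intro Gamma_legendre_duplication nonpos_Ints_Re) auto
    moreover have "exp ((1 - 2 * (p/2)) * of_real (ln 2)) = (2 :: complex) powr (1 - p)"
      using Ln_of_real[of 2] by (simp add: powr_def)
    moreover have "p/2 + 1/2 = (p + 1) / 2" by (simp add: field_simps)
    ultimately show ?thesis by simp
  qed
  \<comment> \<open>The factors p - 1 of \<xi>(p) and q of \<xi>(q) move the two Gamma arguments
    with negative real part to the right by 1; the remaining factors p and q - 1 cancel against the
    denominator up to sign.\<close>
  have g1: "(p - 1) * Gamma ((p - 1) / 2) = 2 * Gamma ((p + 1) / 2)"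
  proof -
    have "(p - 1) / 2 \<notin> \<int>\<^sub>\<le>\<^sub>0"
    proof
      assume "(p - 1) / 2 \<in> \<int>\<^sub>\<le>\<^sub>0"
      then obtain k where "(p - 1) / 2 = of_int k" by (auto elim: nonpos_Ints_cases)
      hence "Re ((p - 1) / 2) = real_of_int k" by simp
      hence "real_of_int (- 1) < real_of_int k" "real_of_int k < real_of_int 0" using p by auto
      thus False unfolding of_int_less_iff by linarith
    qed
    from Gamma_plus1[OF this] have "Gamma ((p - 1) / 2 + 1) = (p - 1) / 2 * Gamma ((p - 1) / 2)" .
    moreover have "(p - 1) / 2 + 1 = (p + 1) / 2" by (simp add: field_simps)
    ultimately have "Gamma ((p + 1) / 2) = (p - 1) / 2 * Gamma ((p - 1) / 2)" by (simp only:)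
    thus ?thesis by (simp add: mult.commute)
  qed
  have g2: "q * Gamma (- (q/2)) = - 2 * Gamma (1 - q/2)"
  proof -
    have "- (q/2) \<notin> \<int>\<^sub>\<le>\<^sub>0"
    proof
      assume "- (q/2) \<in> \<int>\<^sub>\<le>\<^sub>0"
      then obtain k where "- (q/2) = of_int k" by (auto elim: nonpos_Ints_cases)
      hence "Re (- (q/2)) = real_of_int k" by simp
      hence "real_of_int (- 1) < real_of_int k" "real_of_int k < real_of_int 0" using q by auto
      thus False unfolding of_int_less_iff by linarith
    qed
    from Gamma_plus1[OF this] have "Gamma (- (q/2) + 1) = - (q/2) * Gamma (- (q/2))" .
    moreover have "- (q/2) + 1 = 1 - q/2" by simp
    ultimately show ?thesis by simp
  qed
  have twopi: "of_real (2 * pi) powr u = 2 powr u * \<pi> powr u" for u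
    unfolding \<pi>_def using of_real_mult_powr[of 2 pi u] by simp
  have sc1: "of_real (2 * pi) powr (- p) * of_real (2 * pi) powr (- q) * of_real (2 * pi) powr (w - 1) = 1/2 * (2 powr (- w) * \<pi> powr (- w - 1))"
  proof -
    have "of_real (2 * pi) powr (- p) * of_real (2 * pi) powr (- q) * of_real (2 * pi) powr (w - 1) = complex_of_real (2 * pi) powr (- w - 1)"
      unfolding powr_add[symmetric] by (rule arg_cong[where f = "(powr) _"]) (simp add: p_def q_def)
    also have "\<dots> = 2 powr (- w - 1) * \<pi> powr (- w - 1)" by (rule twopi)
    also have "(2 :: complex) powr (- w - 1) = 1/2 * 2 powr (- w)" by (simp add: powr_diff)
    finally show ?thesis by simp
  qed
  have sc2: "2 * \<pi> * (2 powr (s/2 - 2) * \<pi> powr (- 5/2)) * (2 powr (1 - p) * of_real (sqrt pi)) * (\<pi> powr (- p/2) * \<pi> powr (- q/2)) =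
      2 powr (- w) * \<pi> powr (- w - 1)"
  proof -
    have sq: "of_real (sqrt pi) = \<pi> powr (1/2)"
      unfolding \<pi>_def using powr_of_real[of pi "1/2"] by (simp add: powr_half_sqrt)
    have "(2 :: complex) * 2 powr (s/2 - 2) * 2 powr (1 - p) = 2 powr 1 * 2 powr (s/2 - 2) * 2 powr (1 - p)" by simp
    also have "\<dots> = 2 powr (- w)"
      unfolding powr_add[symmetric] by (rule arg_cong[where f = "(powr) _"]) (simp add: p_def)
    finally have 2: "(2 :: complex) * 2 powr (s/2 - 2) * 2 powr (1 - p) = 2 powr (- w)" .
    have "\<pi> * \<pi> powr (- 5/2) * \<pi> powr (1/2) * \<pi> powr (- p/2) * \<pi> powr (- q/2) = \<pi> powr 1 * \<pi> powr (- 5/2) * \<pi> powr (1/2) * \<pi> powr (- p/2) * \<pi> powr (- q/2)"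
      using \<pi>0 by simp
    also have "\<dots> = \<pi> powr (- w - 1)"
      unfolding powr_add[symmetric] by (rule arg_cong[where f = "(powr) _"]) (simp add: p_def q_def field_simps)
    finally have 3: "\<pi> * \<pi> powr (- 5/2) * \<pi> powr (1/2) * \<pi> powr (- p/2) * \<pi> powr (- q/2) = \<pi> powr (- w - 1)" .
    have "2 * \<pi> * (2 powr (s/2 - 2) * \<pi> powr (- 5/2)) * (2 powr (1 - p) * of_real (sqrt pi)) * (\<pi> powr (- p/2) * \<pi> powr (- q/2)) =
      (2 * 2 powr (s/2 - 2) * 2 powr (1 - p)) * (\<pi> * \<pi> powr (- 5/2) * \<pi> powr (1/2) * \<pi> powr (- p/2) * \<pi> powr (- q/2))"
      unfolding sq by (simp only: mult_ac)
    thus ?thesis unfolding 2 3 .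
  qed
  \<comment> \<open>The common core: each side is this product times powers of 2 and pi, which
    \<open>sc1\<close> and \<open>sc2\<close> show to agree.\<close>
  define T where "T = Gamma p * Gamma (q/2) * Gamma (q/2) * Gamma (1 - q/2) * Gamma ((1 - p) / 2) * riemann_zeta p * riemann_zeta q * rGamma ((1 - s) / 2)"
  have L: "phi_Mellin s w * of_real (2 * pi) powr (w - 1) *
      (Gamma (1 - w + s/2) * Gamma ((1 - (1 - w) - s/2) / 2) * Gamma ((1 - w - s/2) / 2) * rGamma (1/2 - s/2) / 2) =
      1/4 * (2 powr (- w) * \<pi> powr (- w - 1)) * T"
  proof -
    have args: "1 - w + s/2 = 1 - q" "(1 - (1 - w) - s/2) / 2 = q/2" "(1 - w - s/2) / 2 = (1 - p) / 2" "1/2 - s/2 = (1 - s) / 2"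
      by (simp_all add: p_def q_def field_simps)
    have "phi_Mellin s w = of_real (2 * pi) powr (- p) * Gamma p * riemann_zeta p * (2 * of_real (2 * pi) powr (- q) * Gamma q * cos (\<pi> * q / 2) * riemann_zeta q)"
      unfolding phi_Mellin_def p_def[symmetric] q_def[symmetric] riemann_zeta_functional_equation[OF q(1) nz(4)] \<pi>_def ..
    hence "phi_Mellin s w * of_real (2 * pi) powr (w - 1) *
      (Gamma (1 - q) * Gamma (q/2) * Gamma ((1 - p) / 2) * rGamma ((1 - s) / 2) / 2) =
      (of_real (2 * pi) powr (- p) * of_real (2 * pi) powr (- q) * of_real (2 * pi) powr (w - 1)) * (Gamma q * Gamma (1 - q) * cos (\<pi> * q / 2)) *
      (Gamma p * Gamma (q/2) * Gamma ((1 - p) / 2) * riemann_zeta p * riemann_zeta q * rGamma ((1 - s) / 2))"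
      by (simp add: mult_ac)
    also have "\<dots> = 1/4 * (2 powr (- w) * \<pi> powr (- w - 1)) * T" unfolding sc1 R T_def by (simp add: mult_ac)
    finally show ?thesis unfolding args .
  qed
  have X: "Xi_weight s (2 * \<tau>) = 1/4 * (2 powr (1 - p) * of_real (sqrt pi)) * (\<pi> powr (- p/2) * \<pi> powr (- q/2)) *
     (Gamma p * Gamma (q/2) * Gamma (q/2) * Gamma (1 - q/2) * Gamma ((1 - p) / 2) * riemann_zeta p * riemann_zeta q)"
  proof -
    have args: "(s - 1 + \<i> * of_real (2 * \<tau>)) / 4 = (p - 1) / 2" "(s - 1 - \<i> * of_real (2 * \<tau>)) / 4 = - (q/2)"
      "(- s + 1 + \<i> * of_real (2 * \<tau>)) / 4 = q/2" "(- s + 1 - \<i> * of_real (2 * \<tau>)) / 4 = (1 - p) / 2"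
      "1/2 + \<i> * ((of_real (2 * \<tau>) - \<i> * s) / 2) = p" "1/2 + \<i> * ((of_real (2 * \<tau>) + \<i> * s) / 2) = q"
      by (simp_all add: p_def q_def w field_simps)
    have den: "(of_real (2 * \<tau>))\<^sup>2 + (s + 1)\<^sup>2 = 4 * (p * (1 - q))"
    proof -
      have "4 * (p * (1 - q)) = (2 * p) * (2 * (1 - q))" by simp
      also have "2 * p = (s + 1) + \<i> * of_real (2 * \<tau>)" by (simp add: p_def w algebra_simps)
      also have "2 * (1 - q) = (s + 1) - \<i> * of_real (2 * \<tau>)" by (simp add: q_def w algebra_simps)
      also have "((s + 1) + \<i> * of_real (2 * \<tau>)) * ((s + 1) - \<i> * of_real (2 * \<tau>)) = (of_real (2 * \<tau>))\<^sup>2 + (s + 1)\<^sup>2"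
      proof -
        have "(a + \<i> * b) * (a - \<i> * b) = b\<^sup>2 + a\<^sup>2" for a b :: complex
          by (simp add: power2_eq_square algebra_simps)
        thus ?thesis .
      qed
      finally show ?thesis by simp
    qed
    have xi: "riemann_xi z = 1/2 * z * (z - 1) * \<pi> powr (- z/2) * Gamma (z/2) * riemann_zeta z" for z
      by (simp add: riemann_xi_def \<pi>_def)
    have "Xi_weight s (2 * \<tau>) = Gamma ((p - 1) / 2) * Gamma (- (q/2)) * Gamma (q/2) * Gamma ((1 - p) / 2) * riemann_xi p * riemann_xi q / (4 * (p * (1 - q)))"
      unfolding Xi_weight_def riemann_Xi_def args den ..
    also have "\<dots> = ((p - 1) * Gamma ((p - 1) / 2)) * (q * Gamma (- (q/2))) * (p / p) * ((q - 1) / (1 - q)) * (1/16) *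
       (Gamma (q/2) * Gamma ((1 - p) / 2) * (\<pi> powr (- p/2) * \<pi> powr (- q/2)) * Gamma (p/2) * Gamma (q/2) * riemann_zeta p * riemann_zeta q)"
      unfolding xi by (simp add: mult_ac)
    also have "p / p = 1" using nz by simp
    also have "(q - 1) / (1 - q) = - 1" using nz by (simp add: field_simps)
    finally have "Xi_weight s (2 * \<tau>) = 1/4 * (Gamma (p/2) * Gamma ((p + 1) / 2)) *
       (Gamma (1 - q/2) * Gamma (q/2) * Gamma ((1 - p) / 2) * (\<pi> powr (- p/2) * \<pi> powr (- q/2)) * Gamma (q/2) * riemann_zeta p * riemann_zeta q)"
      unfolding g1 g2 by (simp add: mult_ac)
    thus ?thesis unfolding dup by (simp only: mult_ac)
  qed
  have "2 * \<pi> * Xi_const s * Xi_weight s (2 * \<tau>) = 1/4 * (2 * \<pi> * (2 powr (s/2 - 2) * \<pi> powr (- 5/2)) * (2 powr (1 - p) * of_real (sqrt pi)) * (\<pi> powr (- p/2) * \<pi> powr (- q/2))) * T"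
    unfolding X Xi_const_def T_def \<pi>_def[symmetric] rGamma_inverse_Gamma divide_inverse by (simp only: mult_ac)
  also have "\<dots> = 1/4 * (2 powr (- w) * \<pi> powr (- w - 1)) * T" unfolding sc2 ..
  finally show ?thesis unfolding L by (simp add: \<pi>_def)
qed

lemma Xi_const_nonzero:
  assumes "\<bar>Re s\<bar> < 1"
  shows "Xi_const s \<noteq> 0"
proof -
  have "(1 - s) / 2 \<notin> \<int>\<^sub>\<le>\<^sub>0" using assms by (intro nonpos_Ints_Re) auto
  thus ?thesis by (simp add: Xi_const_def Gamma_eq_zero_iff)
qed

theorem lommel_integral_eq:
  fixes s :: complex and \<alpha> :: real
  assumes s: "\<bar>Re s\<bar> < 1" and \<alpha>: "\<alpha> > 0"
  shows "set_integrable lborel {0<..} (lommel_integrand s \<alpha>)"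
    and "integrable lborel (\<lambda>\<tau>. Xi_weight s (2 * \<tau>))"
    and "of_real (sqrt \<alpha>) * (LINT t:{0<..}|lborel. lommel_integrand s \<alpha> t) =
      Xi_const s * (\<integral>\<tau>. Xi_weight s (2 * \<tau>) * exp (\<i> * of_real (\<tau> * ln \<alpha>)) \<partial>lborel)"
proof -
  define \<nu> where "\<nu> = s / 2"
  have \<nu>: "\<bar>Re \<nu>\<bar> < 1/2" using s by (simp add: \<nu>_def)
  define c where "c = 2 * pi * \<alpha>"
  have c: "c > 0" using \<alpha> by (simp add: c_def)
  define w where "w = (\<lambda>\<tau>. Complex (1/2) \<tau>)"
  define M where "M = (\<lambda>\<tau>. phi_Mellin s (w \<tau>))"
  define S where "S = (\<lambda>t. lommel_S \<nu> \<nu> (of_real (c * t)))"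
  define m where "m = (\<lambda>\<tau>. Gamma (1 - w \<tau> + \<nu>) * Gamma ((1 - (1 - w \<tau>) - \<nu>) / 2) * Gamma ((1 - w \<tau> - \<nu>) / 2) * rGamma (1/2 - \<nu>) / 2)"
  have [measurable]: "w \<in> borel_measurable lborel" unfolding w_def Complex_eq by measurable
  have Mi: "integrable lborel M"
    using phi_minus_pole_Mellin(1)[OF s, of 1] by (simp add: M_def w_def)
  have mel: "set_integrable lborel {0<..} (\<lambda>t. S t * of_real t powr (- w \<tau>))"
    "(LINT t:{0<..}|lborel. S t * of_real t powr (- w \<tau>)) = of_real c powr (w \<tau> - 1) * m \<tau>" for \<tau>
  proof -
    have z: "Re (1 - w \<tau>) = 1/2" by (simp add: w_def)
    define g where "g = (\<lambda>x. lommel_S \<nu> \<nu> (of_real x) * of_real x powr ((1 - w \<tau>) - 1))"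
    note L = lommel_S_Mellin[OF \<nu> z, folded g_def]
    have eq: "S t * of_real t powr (- w \<tau>) = of_real c powr (w \<tau>) * g (c * t)" if "t \<in> {0<..}" for t
    proof -
      have "of_real (c * t) powr ((1 - w \<tau>) - 1) = complex_of_real c powr (- w \<tau>) * of_real t powr (- w \<tau>)"
        using of_real_mult_powr[of c t "- w \<tau>"] c that by simp
      moreover have "complex_of_real c powr (w \<tau>) * of_real c powr (- w \<tau>) = 1"
        using c by (simp flip: powr_add)
      ultimately show ?thesis unfolding g_def S_def by (simp add: mult_ac)
    qed
    have "set_integrable lborel {0<..} (\<lambda>t. of_real c powr (w \<tau>) * g (c * t))"
      using lborel_set_integral_scale(2)[OF c L(1)] by (rule set_integrable_mult_right)
    thus "set_integrable lborel {0<..} (\<lambda>t. S t * of_real t powr (- w \<tau>))"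
      by (rule set_integrable_cong[THEN iffD1, rotated -1]) (use eq in auto)
    have "(LINT t:{0<..}|lborel. S t * of_real t powr (- w \<tau>)) = (LINT t:{0<..}|lborel. of_real c powr (w \<tau>) * g (c * t))"
      by (intro set_lebesgue_integral_cong) (use eq in auto)
    also have "\<dots> = of_real c powr (w \<tau>) * (LINT t:{0<..}|lborel. g (c * t))" by (rule set_integral_mult_right)
    also have "(LINT t:{0<..}|lborel. g (c * t)) = (LINT x:{0<..}|lborel. g x) / of_real c"
      by (rule lborel_set_integral_scale(1)[OF c])
    also have "(LINT x:{0<..}|lborel. g x) = m \<tau>" unfolding L(2) m_def ..
    also have "of_real c powr (w \<tau>) * (m \<tau> / of_real c) = of_real c powr (w \<tau> - 1) * m \<tau>"
      using c by (simp add: powr_diff)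
    finally show "(LINT t:{0<..}|lborel. S t * of_real t powr (- w \<tau>)) = of_real c powr (w \<tau> - 1) * m \<tau>" .
  qed
  \<comment> \<open>Measurability of the Lommel function is taken from the integrability of its
    Mellin integrand at \<open>w 0\<close>; for that reason \<open>f\<close> is written relative to
    this point.\<close>
  define h where "h = (\<lambda>t. indicator {0<..} t *\<^sub>R (S t * of_real t powr (- w 0)))"
  have [measurable]: "h \<in> borel_measurable lborel"
    using mel(1)[of 0] unfolding h_def set_integrable_def by (rule borel_measurable_integrable)
  define f where "f = (\<lambda>\<tau> t. M \<tau> * (h t * of_real t powr (- (w \<tau> - w 0))))"
  have feq: "f \<tau> t = M \<tau> * (S t * of_real t powr (- w \<tau>))" if "t \<in> {0<..}" for \<tau> t
  proof -
    have "of_real t powr (- w 0) * of_real t powr (- (w \<tau> - w 0)) = complex_of_real t powr (- w \<tau>)"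
      by (simp flip: powr_add)
    thus ?thesis using that by (simp add: f_def h_def mult.assoc)
  qed
  have fm: "case_prod f \<in> borel_measurable (lborel \<Otimes>\<^sub>M lborel)"
  proof -
    have [measurable]: "M \<in> borel_measurable lborel" using Mi by (rule borel_measurable_integrable)
    show ?thesis unfolding f_def case_prod_beta' by measurable
  qed
  have i1: "set_integrable lborel {0<..} (f \<tau>)" for \<tau>
    using set_integrable_mult_right[OF mel(1)[of \<tau>], of "M \<tau>"]
    by (rule set_integrable_cong[THEN iffD1, rotated -1]) (use feq in auto)
  define K where "K = (LINT t:{0<..}|lborel. norm (S t * of_real t powr (- w 0)))"
  have n: "(LINT t:{0<..}|lborel. norm (f \<tau> t)) = norm (M \<tau>) * K" for \<tau>
  proof -
    have "(LINT t:{0<..}|lborel. norm (f \<tau> t)) = (LINT t:{0<..}|lborel. norm (M \<tau>) * norm (S t * of_real t powr (- w 0)))"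
    proof (intro set_lebesgue_integral_cong allI impI)
      fix t :: real assume t: "t \<in> {0<..}"
      have "norm (complex_of_real t powr (- w \<tau>)) = norm (complex_of_real t powr (- w 0))"
        using t norm_of_real_powr[of t "- w \<tau>"] norm_of_real_powr[of t "- w 0"] by (simp add: w_def)
      thus "norm (f \<tau> t) = norm (M \<tau>) * norm (S t * of_real t powr (- w 0))"
        unfolding feq[OF t] norm_mult by (simp only:)
    qed auto
    thus ?thesis by (simp add: K_def)
  qed
  have i2: "set_integrable lborel UNIV (\<lambda>\<tau>. LINT t:{0<..}|lborel. norm (f \<tau> t))"
    unfolding n integral_UNIV_as_set_integral using Mi by (intro integrable_mult_left integrable_norm)
  note swap = set_integrals_swap[OF fm _ _ i1 i2, unfolded integral_UNIV_as_set_integral, simplified]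
  have inner: "(LINT t:{0<..}|lborel. f \<tau> t) = 2 * of_real pi * Xi_const s * (of_real \<alpha> powr (w \<tau> - 1) * Xi_weight s (2 * \<tau>))" for \<tau>
  proof -
    have "(LINT t:{0<..}|lborel. f \<tau> t) = (LINT t:{0<..}|lborel. M \<tau> * (S t * of_real t powr (- w \<tau>)))"
      by (intro set_lebesgue_integral_cong) (use feq in auto)
    also have "\<dots> = M \<tau> * (of_real c powr (w \<tau> - 1) * m \<tau>)" unfolding set_integral_mult_right mel(2) ..
    also have "of_real c powr (w \<tau> - 1) = of_real (2 * pi) powr (w \<tau> - 1) * complex_of_real \<alpha> powr (w \<tau> - 1)"
      unfolding c_def using \<alpha> by (intro of_real_mult_powr) auto
    also have "M \<tau> * (of_real (2 * pi) powr (w \<tau> - 1) * complex_of_real \<alpha> powr (w \<tau> - 1) * m \<tau>) =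
      (M \<tau> * of_real (2 * pi) powr (w \<tau> - 1) * m \<tau>) * complex_of_real \<alpha> powr (w \<tau> - 1)" by (simp only: mult_ac)
    also have "M \<tau> * of_real (2 * pi) powr (w \<tau> - 1) * m \<tau> = 2 * of_real pi * Xi_const s * Xi_weight s (2 * \<tau>)"
      unfolding M_def m_def \<nu>_def w_def by (rule Mellin_product_eq_Xi_weight[OF s])
    finally show ?thesis by (simp only: mult_ac)
  qed
  have outer: "(\<integral>\<tau>. f \<tau> t \<partial>lborel) = 2 * of_real pi * lommel_integrand s \<alpha> t" if t: "t \<in> {0<..}" for t
  proof -
    have t': "t > 0" using t by simp
    have "(\<integral>\<tau>. f \<tau> t \<partial>lborel) = (\<integral>\<tau>. S t * (phi_Mellin s (Complex (1/2) \<tau>) * of_real t powr (- Complex (1/2) \<tau>)) \<partial>lborel)"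
      unfolding feq[OF t] M_def w_def by (simp only: mult_ac)
    also have "\<dots> = S t * (\<integral>\<tau>. phi_Mellin s (Complex (1/2) \<tau>) * of_real t powr (- Complex (1/2) \<tau>) \<partial>lborel)"
      by (rule integral_mult_right_zero)
    also have "(\<integral>\<tau>. phi_Mellin s (Complex (1/2) \<tau>) * of_real t powr (- Complex (1/2) \<tau>) \<partial>lborel) =
       2 * of_real pi * (phi t s - riemann_zeta s / (2 * of_real pi) * of_real t powr (s/2 - 1))"
      unfolding phi_minus_pole_Mellin(2)[OF s t'] by simp
    finally show ?thesis unfolding lommel_integrand_def S_def c_def \<nu>_def by (simp only: mult_ac)
  qed
  have "set_integrable lborel {0<..} (\<lambda>t. 2 * of_real pi * lommel_integrand s \<alpha> t)"
    using swap(2) by (rule set_integrable_cong[THEN iffD1, rotated -1]) (use outer in auto)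
  thus "set_integrable lborel {0<..} (lommel_integrand s \<alpha>)" by simp
  have np: "norm (complex_of_real \<alpha> powr (w \<tau> - 1)) = \<alpha> powr (- 1/2)" for \<tau>
    using norm_of_real_powr[OF \<alpha>, of "w \<tau> - 1"] by (simp add: w_def)
  have X1: "integrable lborel (\<lambda>\<tau>. of_real \<alpha> powr (w \<tau> - 1) * Xi_weight s (2 * \<tau>))"
    using integrable_mult_right[OF swap(1), of "inverse (2 * of_real pi * Xi_const s)"] Xi_const_nonzero[OF s]
    unfolding inner by (simp add: field_simps)
  \<comment> \<open>The power of \<alpha> has constant modulus on the line, so it can be divided out
    without losing integrability.\<close>
  have "integrable lborel (\<lambda>\<tau>. of_real \<alpha> powr (- (w \<tau> - 1)) * (of_real \<alpha> powr (w \<tau> - 1) * Xi_weight s (2 * \<tau>)))"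
  proof (rule Bochner_Integration.integrable_bound[OF integrable_mult_right[OF X1, of "of_real (\<alpha> powr (1/2))"]])
    have [measurable]: "(\<lambda>\<tau>. of_real \<alpha> powr (w \<tau> - 1) * Xi_weight s (2 * \<tau>)) \<in> borel_measurable lborel"
      using X1 by (rule borel_measurable_integrable)
    show "(\<lambda>\<tau>. of_real \<alpha> powr (- (w \<tau> - 1)) * (of_real \<alpha> powr (w \<tau> - 1) * Xi_weight s (2 * \<tau>))) \<in> borel_measurable lborel"
      by measurable
    have "norm (complex_of_real \<alpha> powr (- (w \<tau> - 1))) = \<alpha> powr (1/2)" for \<tau>
      using norm_of_real_powr[OF \<alpha>, of "- (w \<tau> - 1)"] by (simp add: w_def)
    thus "AE \<tau> in lborel. norm (of_real \<alpha> powr (- (w \<tau> - 1)) * (of_real \<alpha> powr (w \<tau> - 1) * Xi_weight s (2 * \<tau>)))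
       \<le> norm (complex_of_real (\<alpha> powr (1/2)) * (of_real \<alpha> powr (w \<tau> - 1) * Xi_weight s (2 * \<tau>)))"
      by (intro AE_I2) (simp only: norm_mult norm_of_real abs_of_nonneg powr_ge_zero order_refl)
  qed
  moreover have "of_real \<alpha> powr (- (w \<tau> - 1)) * (of_real \<alpha> powr (w \<tau> - 1) * X) = X" for \<tau> X
  proof -
    have "of_real \<alpha> powr (- (w \<tau> - 1)) * complex_of_real \<alpha> powr (w \<tau> - 1) = 1"
      using \<alpha> by (simp flip: powr_add)
    thus ?thesis by (simp only: mult.assoc[symmetric] mult_1_left)
  qed
  ultimately show "integrable lborel (\<lambda>\<tau>. Xi_weight s (2 * \<tau>))" by (simp only:)
  \<comment> \<open>The factor sqrt \<alpha> cancels the modulus \<alpha>^(-1/2) of the power and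
    leaves a pure phase.\<close>
  have pw: "of_real (sqrt \<alpha>) * of_real \<alpha> powr (w \<tau> - 1) = exp (\<i> * of_real (\<tau> * ln \<alpha>))" for \<tau>
  proof -
    have "of_real (sqrt \<alpha>) = complex_of_real \<alpha> powr (1/2)"
      using \<alpha> powr_of_real[of \<alpha> "1/2"] by (simp add: powr_half_sqrt)
    hence "of_real (sqrt \<alpha>) * of_real \<alpha> powr (w \<tau> - 1) = complex_of_real \<alpha> powr (1/2 + (w \<tau> - 1))" by (simp only: powr_add)
    also have "1/2 + (w \<tau> - 1) = \<i> * of_real \<tau>" by (simp add: w_def Complex_eq)
    finally show ?thesis using \<alpha> by (simp add: powr_def Ln_of_real mult.assoc)
  qed
  have "2 * of_real pi * (LINT t:{0<..}|lborel. lommel_integrand s \<alpha> t) = (LINT t:{0<..}|lborel. 2 * of_real pi * lommel_integrand s \<alpha> t)"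
    by (rule set_integral_mult_right[symmetric])
  also have "\<dots> = (LINT t:{0<..}|lborel. (\<integral>\<tau>. f \<tau> t \<partial>lborel))"
    by (intro set_lebesgue_integral_cong) (use outer in auto)
  also have "\<dots> = (\<integral>\<tau>. (LINT t:{0<..}|lborel. f \<tau> t) \<partial>lborel)" by (rule swap(3)[symmetric])
  also have "\<dots> = 2 * of_real pi * Xi_const s * (\<integral>\<tau>. of_real \<alpha> powr (w \<tau> - 1) * Xi_weight s (2 * \<tau>) \<partial>lborel)"
    unfolding inner by (rule integral_mult_right_zero)
  finally have "(LINT t:{0<..}|lborel. lommel_integrand s \<alpha> t) = Xi_const s * (\<integral>\<tau>. of_real \<alpha> powr (w \<tau> - 1) * Xi_weight s (2 * \<tau>) \<partial>lborel)"
    by simp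
  hence "of_real (sqrt \<alpha>) * (LINT t:{0<..}|lborel. lommel_integrand s \<alpha> t) =
     Xi_const s * (of_real (sqrt \<alpha>) * (\<integral>\<tau>. of_real \<alpha> powr (w \<tau> - 1) * Xi_weight s (2 * \<tau>) \<partial>lborel))"
    by (simp only: mult_ac)
  also have "of_real (sqrt \<alpha>) * (\<integral>\<tau>. of_real \<alpha> powr (w \<tau> - 1) * Xi_weight s (2 * \<tau>) \<partial>lborel) =
     (\<integral>\<tau>. of_real (sqrt \<alpha>) * (of_real \<alpha> powr (w \<tau> - 1) * Xi_weight s (2 * \<tau>)) \<partial>lborel)"
    by (rule integral_mult_right_zero[symmetric])
  also have "\<dots> = (\<integral>\<tau>. Xi_weight s (2 * \<tau>) * exp (\<i> * of_real (\<tau> * ln \<alpha>)) \<partial>lborel)"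
    unfolding mult.assoc[symmetric] pw by (simp only: mult.commute)
  finally show "of_real (sqrt \<alpha>) * (LINT t:{0<..}|lborel. lommel_integrand s \<alpha> t) =
      Xi_const s * (\<integral>\<tau>. Xi_weight s (2 * \<tau>) * exp (\<i> * of_real (\<tau> * ln \<alpha>)) \<partial>lborel)" .
qed

lemma integral_even:
  fixes h :: "real \<Rightarrow> complex"
  assumes i: "integrable lborel h" and even: "\<And>t. h (- t) = h t"
  shows "(\<integral>t. h t \<partial>lborel) = 2 * (LINT t:{0<..}|lborel. h t)" "set_integrable lborel {0<..} h"
proof -
  show s: "set_integrable lborel {0<..} h"
    unfolding set_integrable_def using i by (intro integrable_mult_indicator) auto
  have i1: "integrable lborel (\<lambda>t. indicator {0<..} t *\<^sub>R h t)" using s by (simp add: set_integrable_def)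
  have i2: "integrable lborel (\<lambda>t. indicator {0<..} (- t) *\<^sub>R h (- t))"
    using lborel_integrable_real_affine[OF i1, of "- 1" 0] by simp
  have [measurable]: "h \<in> borel_measurable lborel" using i by (rule borel_measurable_integrable)
  have "(\<integral>t. h t \<partial>lborel) = (\<integral>t. indicator {0<..} t *\<^sub>R h t + indicator {0<..} (- t) *\<^sub>R h (- t) \<partial>lborel)"
  proof (rule integral_cong_AE)
    have "AE t in lborel. t \<noteq> (0 :: real)" by (rule AE_lborel_singleton)
    thus "AE t in lborel. h t = indicator {0<..} t *\<^sub>R h t + indicator {0<..} (- t) *\<^sub>R h (- t)"
      by eventually_elim (auto simp: indicator_def even)
  qed (use i1 i2 in measurable)
  also have "\<dots> = (\<integral>t. indicator {0<..} t *\<^sub>R h t \<partial>lborel) + (\<integral>t. indicator {0<..} (- t) *\<^sub>R h (- t) \<partial>lborel)"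
    by (rule Bochner_Integration.integral_add[OF i1 i2])
  also have "(\<integral>t. indicator {0<..} (- t) *\<^sub>R h (- t) \<partial>lborel) = (\<integral>t. indicator {0<..} t *\<^sub>R h t \<partial>lborel)"
    using lborel_integral_real_affine[of "- 1" "\<lambda>t. indicator {0<..} t *\<^sub>R h t" 0] by simp
  finally show "(\<integral>t. h t \<partial>lborel) = 2 * (LINT t:{0<..}|lborel. h t)"
    by (simp add: set_lebesgue_integral_def)
qed

text \<open>The substitution t = 2 \<tau> contributes a factor 1/2 and folding the line at 0 a
  factor 2, so the integral over the whole line in \<tau> equals the one over the half-line in
  t.\<close>

lemma Xi_integrand_integral:
  assumes s: "\<bar>Re s\<bar> < 1"
  shows "Xi_integrand s \<alpha> integrable_on {0<..}"
    and "(\<integral>\<tau>. Xi_weight s (2 * \<tau>) * exp (\<i> * of_real (\<tau> * ln \<alpha>)) \<partial>lborel) = integral {0<..} (Xi_integrand s \<alpha>)"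
proof -
  define g where "g = (\<lambda>\<tau>. Xi_weight s (2 * \<tau>) * exp (\<i> * of_real (\<tau> * ln \<alpha>)))"
  have W: "integrable lborel (\<lambda>\<tau>. Xi_weight s (2 * \<tau>))" using lommel_integral_eq(2)[OF s, of 1] by simp
  have [measurable]: "(\<lambda>\<tau>. Xi_weight s (2 * \<tau>)) \<in> borel_measurable lborel" using W by (rule borel_measurable_integrable)
  have gi: "integrable lborel g"
    by (rule Bochner_Integration.integrable_bound[OF W]) (auto simp: g_def norm_mult)
  have gi': "integrable lborel (\<lambda>\<tau>. g (- \<tau>))"
    using lborel_integrable_real_affine[OF gi, of "- 1" 0] by simp
  have refl': "(\<integral>\<tau>. g (- \<tau>) \<partial>lborel) = (\<integral>\<tau>. g \<tau> \<partial>lborel)"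
    using lborel_integral_real_affine[of "- 1" g 0] by simp
  \<comment> \<open>Averaging over \<tau> and -\<tau> leaves the weight unchanged and turns the
    phase into a cosine.\<close>
  have sum: "g \<tau> + g (- \<tau>) = 2 * Xi_integrand s \<alpha> (0 + 2 * \<tau>)" for \<tau>
  proof -
    have "g \<tau> + g (- \<tau>) = Xi_weight s (2 * \<tau>) * (exp (\<i> * of_real (\<tau> * ln \<alpha>)) + exp (- (\<i> * of_real (\<tau> * ln \<alpha>))))"
      using Xi_weight_minus[OF s, of "2 * \<tau>"] by (simp add: g_def algebra_simps)
    also have "exp (\<i> * of_real (\<tau> * ln \<alpha>)) + exp (- (\<i> * of_real (\<tau> * ln \<alpha>))) = 2 * cos (complex_of_real (\<tau> * ln \<alpha>))"
      by (simp add: cos_exp_eq)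
    also have "cos (complex_of_real (\<tau> * ln \<alpha>)) = of_real (cos (\<tau> * ln \<alpha>))" by (rule cos_of_real)
    finally show ?thesis by (simp add: Xi_integrand_eq)
  qed
  have Xi2: "integrable lborel (\<lambda>\<tau>. Xi_integrand s \<alpha> (0 + 2 * \<tau>))"
    using integrable_mult_right[OF Bochner_Integration.integrable_add[OF gi gi'], of "1/2"] unfolding sum by simp
  hence Xi: "integrable lborel (Xi_integrand s \<alpha>)"
    using lborel_integrable_real_affine_iff[of 2 "Xi_integrand s \<alpha>" 0] by simp
  have even: "Xi_integrand s \<alpha> (- t) = Xi_integrand s \<alpha> t" for t
    using Xi_weight_minus[OF s, of t] by (simp add: Xi_integrand_eq)
  note ev = integral_even[OF Xi even]
  from set_borel_integral_eq_integral[OF ev(2)]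
  show "Xi_integrand s \<alpha> integrable_on {0<..}" by simp
  have "2 * (\<integral>\<tau>. g \<tau> \<partial>lborel) = (\<integral>\<tau>. g \<tau> + g (- \<tau>) \<partial>lborel)"
    using Bochner_Integration.integral_add[OF gi gi'] refl' by simp
  also have "\<dots> = 2 * (\<integral>\<tau>. Xi_integrand s \<alpha> (0 + 2 * \<tau>) \<partial>lborel)" unfolding sum by (rule integral_mult_right_zero)
  also have "\<dots> = (\<integral>t. Xi_integrand s \<alpha> t \<partial>lborel)"
    using lborel_integral_real_affine[of 2 "Xi_integrand s \<alpha>" 0] by (simp add: scaleR_conv_of_real)
  also have "\<dots> = 2 * integral {0<..} (Xi_integrand s \<alpha>)"
    using ev(1) set_borel_integral_eq_integral(2)[OF ev(2)] by simp
  finally show "(\<integral>\<tau>. Xi_weight s (2 * \<tau>) * exp (\<i> * of_real (\<tau> * ln \<alpha>)) \<partial>lborel) = integral {0<..} (Xi_integrand s \<alpha>)"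
    by (simp add: g_def)
qed

theorem theorem15p12:
  fixes \<alpha> \<beta> :: real and s :: complex
  assumes "\<alpha> > 0" and "\<beta> > 0" and "\<alpha> * \<beta> = 1"
    and "- 1 < Re s" and "Re s < 1"
  shows "lommel_integrand s \<alpha> integrable_on {0<..} \<and>
    lommel_integrand s \<beta> integrable_on {0<..} \<and>
    Xi_integrand s \<alpha> integrable_on {0<..} \<and>
    of_real (sqrt \<alpha>) * integral {0<..} (lommel_integrand s \<alpha>) =
      of_real (sqrt \<beta>) * integral {0<..} (lommel_integrand s \<beta>) \<and>
    of_real (sqrt \<beta>) * integral {0<..} (lommel_integrand s \<beta>) =
      2 powr (s / 2 - 2) * of_real pi powr (- 5 / 2) / Gamma ((1 - s) / 2) *
      integral {0<..} (Xi_integrand s \<alpha>)"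
proof -
  have s: "\<bar>Re s\<bar> < 1" using assms by auto
  have main: "lommel_integrand s a integrable_on {0<..}"
    "of_real (sqrt a) * integral {0<..} (lommel_integrand s a) = Xi_const s * integral {0<..} (Xi_integrand s a)"
    if "a > 0" for a
    using set_borel_integral_eq_integral[OF lommel_integral_eq(1)[OF s that]] lommel_integral_eq(3)[OF s that]
      Xi_integrand_integral(2)[OF s, of a] by simp_all
  have "\<beta> = inverse \<alpha>" using assms by (simp add: field_simps)
  hence "ln \<beta> = - ln \<alpha>" using assms by (simp add: ln_inverse)
  hence "Xi_integrand s \<beta> = Xi_integrand s \<alpha>" by (simp add: fun_eq_iff Xi_integrand_eq)
  thus ?thesis
    using main[OF assms(1)] main[OF assms(2)] Xi_integrand_integral(1)[OF s, of \<alpha>] by (simp add: Xi_const_def)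
qed

end
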